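(* Let $(R,\mathfrak m)$ be a $d$-dimensional analytically unramified Cohen-Macaulay (Noetherian) local ring of positive prime characteristic $p$. Then $R$ is $F$-rational if and only if $e_1^*(I)=0$ for some parameter ideal $I$ of $R$, i.e. for some ideal $I$ generated by a system of parameters.
   Context: $R^\circ$ is the set of elements of $R$ not contained in any minimal prime. For an ideal $I=(a_1,\dots,a_r)$ and $q=p^e$, $I^{[q]}=(a_1^q,\dots,a_r^q)$. The tight closure $I^*$ of $I$ consists of all $x\in R$ for which there is $c\in R^\circ$ with $cx^q\in I^{[q]}$ for all sufficiently large $q=p^e$. $R$ is $F$-rational if every ideal of the principal class (an ideal generated by as many elements as its height) is tightly closed, i.e. equals its tight closure. $(R,\mathfrak m)$ is analytically unramified if its $\mathfrak m$-adic completion is reduced. In that case, for every $\mathfrak m$-primary ideal $I$, the length $\ell(R/(I^n)^* )$ agrees for all large $n$ with a polynomial of degree $d$ in $n$, the tight Hilbert polynomial, written $$P_I^*(n)=e_0^*(I)\binom{n+d-1}{d}-e_1^*(I)\binom{n+d-2}{d-1}+\cdots+(-1)^d e_d^*(I),\qquad e_i^*(I)\in\mathbb Z,$$ with $e_0^*(I)=e(I)$ the multiplicity of $I$. (The coefficient $e_1^*(I)$ is defined for $d\ge 1$.) *)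

theory Defs
  imports
    "HOL-Algebra.Ring_Divisibility"
    "HOL-Algebra.Ideal_Product"
    "HOL-Algebra.Module"
    "HOL-Library.Extended_Nat"
    "HOL-Computational_Algebra.Primes"
begin

section \<open>Local rings, dimension, depth\<close>

locale local_ring = maximalideal \<mm> R + cring R for \<mm> and R (structure) +
  assumes unique_maximal: "maximalideal J R \<Longrightarrow> J = \<mm>"

text \<open>Same convention as \<open>CHAR('a)\<close> for type classes: characteristic 0 if no positive
  multiple of \<open>\<one>\<close> vanishes.\<close>

definition ring_char :: "('a, 'b) ring_scheme \<Rightarrow> nat" where
  "ring_char R = Gcd {n::nat. add_pow R n \<one>\<^bsub>R\<^esub> = \<zero>\<^bsub>R\<^esub>}"

definition prime_chain :: "('a, 'b) ring_scheme \<Rightarrow> nat \<Rightarrow> (nat \<Rightarrow> 'a set) \<Rightarrow> bool" where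
  "prime_chain R n P \<longleftrightarrow> (\<forall>i\<le>n. primeideal (P i) R) \<and> (\<forall>i<n. P i \<subset> P (Suc i))"

definition krull_dim :: "('a, 'b) ring_scheme \<Rightarrow> enat" where
  "krull_dim R = Sup {enat n | n. \<exists>P. prime_chain R n P}"

definition prime_height :: "('a, 'b) ring_scheme \<Rightarrow> 'a set \<Rightarrow> enat" where
  "prime_height R Q = Sup {enat n | n. \<exists>P. prime_chain R n P \<and> P n = Q}"

text \<open>The unit ideal, lying in no prime, has height \<open>\<infinity>\<close>.\<close>

definition height :: "('a, 'b) ring_scheme \<Rightarrow> 'a set \<Rightarrow> enat" where
  "height R I = Inf {prime_height R Q | Q. primeideal Q R \<and> I \<subseteq> Q}"

definition regular_sequence :: "('a, 'b) ring_scheme \<Rightarrow> 'a list \<Rightarrow> bool" where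
  "regular_sequence R xs \<longleftrightarrow>
     set xs \<subseteq> carrier R \<and> Idl\<^bsub>R\<^esub> (set xs) \<noteq> carrier R \<and>
     (\<forall>i<length xs. \<forall>y\<in>carrier R.
        xs ! i \<otimes>\<^bsub>R\<^esub> y \<in> Idl\<^bsub>R\<^esub> (set (take i xs)) \<longrightarrow> y \<in> Idl\<^bsub>R\<^esub> (set (take i xs)))"

definition depth :: "('a, 'b) ring_scheme \<Rightarrow> 'a set \<Rightarrow> enat" where
  "depth R \<mm> = Sup {enat (length xs) | xs. regular_sequence R xs \<and> set xs \<subseteq> \<mm>}"

definition cohen_macaulay_local :: "('a, 'b) ring_scheme \<Rightarrow> 'a set \<Rightarrow> bool" where
  "cohen_macaulay_local R \<mm> \<longleftrightarrow>
     local_ring \<mm> R \<and> noetherian_ring R \<and> depth R \<mm> = krull_dim R"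

definition radical :: "('a, 'b) ring_scheme \<Rightarrow> 'a set \<Rightarrow> 'a set" where
  "radical R I = {x \<in> carrier R. \<exists>n::nat. x [^]\<^bsub>R\<^esub> n \<in> I}"

definition system_of_parameters :: "('a, 'b) ring_scheme \<Rightarrow> 'a set \<Rightarrow> 'a list \<Rightarrow> bool" where
  "system_of_parameters R \<mm> xs \<longleftrightarrow>
     set xs \<subseteq> \<mm> \<and> enat (length xs) = krull_dim R \<and> radical R (Idl\<^bsub>R\<^esub> (set xs)) = \<mm>"

definition parameter_ideal :: "('a, 'b) ring_scheme \<Rightarrow> 'a set \<Rightarrow> 'a set \<Rightarrow> bool" where
  "parameter_ideal R \<mm> I \<longleftrightarrow> (\<exists>xs. system_of_parameters R \<mm> xs \<and> I = Idl\<^bsub>R\<^esub> (set xs))"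


section \<open>Completion\<close>

abbreviation ideal_pow :: "('a, 'b) ring_scheme \<Rightarrow> 'a set \<Rightarrow> nat \<Rightarrow> 'a set" where
  "ideal_pow R I n \<equiv> I [^]\<^bsub>ideals_set R\<^esub> n"

text \<open>The inverse limit of the rings \<open>R/I\<^sup>n\<close>. Elements of \<open>R/I\<^sup>n\<close> are cosets, and the
  transition map sends a coset of \<open>I\<^sup>n\<^sup>+\<^sup>1\<close> to the unique coset of \<open>I\<^sup>n\<close> containing it.\<close>

definition adic_completion :: "('a, 'b) ring_scheme \<Rightarrow> 'a set \<Rightarrow> (nat \<Rightarrow> 'a set) ring" where
  "adic_completion R I =
    \<lparr>carrier = {s. (\<forall>n. s n \<in> carrier (R Quot ideal_pow R I n)) \<and> (\<forall>n. s (Suc n) \<subseteq> s n)},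
     mult = (\<lambda>s t n. s n \<otimes>\<^bsub>R Quot ideal_pow R I n\<^esub> t n),
     one = (\<lambda>n. \<one>\<^bsub>R Quot ideal_pow R I n\<^esub>),
     zero = (\<lambda>n. \<zero>\<^bsub>R Quot ideal_pow R I n\<^esub>),
     add = (\<lambda>s t n. s n \<oplus>\<^bsub>R Quot ideal_pow R I n\<^esub> t n)\<rparr>"

definition reduced_ring :: "('a, 'b) ring_scheme \<Rightarrow> bool" where
  "reduced_ring R \<longleftrightarrow> (\<forall>x\<in>carrier R. \<forall>n::nat. x [^]\<^bsub>R\<^esub> n = \<zero>\<^bsub>R\<^esub> \<longrightarrow> x = \<zero>\<^bsub>R\<^esub>)"

definition analytically_unramified :: "('a, 'b) ring_scheme \<Rightarrow> 'a set \<Rightarrow> bool" where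
  "analytically_unramified R \<mm> \<longleftrightarrow> reduced_ring (adic_completion R \<mm>)"


section \<open>Tight closure and F-rationality\<close>

definition minimal_prime :: "('a, 'b) ring_scheme \<Rightarrow> 'a set \<Rightarrow> bool" where
  "minimal_prime R P \<longleftrightarrow> primeideal P R \<and> (\<forall>Q. primeideal Q R \<and> Q \<subseteq> P \<longrightarrow> Q = P)"

definition ring_circ :: "('a, 'b) ring_scheme \<Rightarrow> 'a set" where
  "ring_circ R = {c \<in> carrier R. \<forall>P. minimal_prime R P \<longrightarrow> c \<notin> P}"

text \<open>All elements of \<open>I\<close> are used as generators; by \<open>frobenius_power_genideal\<close> below the
  \<open>q\<close>-th powers of any generating set give the same ideal.\<close>

definition frobenius_power :: "('a, 'b) ring_scheme \<Rightarrow> 'a set \<Rightarrow> nat \<Rightarrow> 'a set" where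
  "frobenius_power R I q = Idl\<^bsub>R\<^esub> ((\<lambda>a. a [^]\<^bsub>R\<^esub> q) ` I)"

definition tight_closure :: "('a, 'b) ring_scheme \<Rightarrow> 'a set \<Rightarrow> 'a set" where
  "tight_closure R I =
    {x \<in> carrier R. \<exists>c\<in>ring_circ R.
       \<forall>\<^sub>F e in sequentially.
         c \<otimes>\<^bsub>R\<^esub> x [^]\<^bsub>R\<^esub> (ring_char R ^ e) \<in> frobenius_power R I (ring_char R ^ e)}"

definition principal_class :: "('a, 'b) ring_scheme \<Rightarrow> 'a set \<Rightarrow> bool" where
  "principal_class R I \<longleftrightarrow>
     (\<exists>xs. set xs \<subseteq> carrier R \<and> I = Idl\<^bsub>R\<^esub> (set xs) \<and> enat (length xs) = height R I)"

definition F_rational :: "('a, 'b) ring_scheme \<Rightarrow> bool" where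
  "F_rational R \<longleftrightarrow> (\<forall>I. principal_class R I \<longrightarrow> tight_closure R I = I)"


section \<open>Tight Hilbert polynomial\<close>

definition module_length :: "('a, 'b) ring_scheme \<Rightarrow> ('a, 'c, 'd) module_scheme \<Rightarrow> enat" where
  "module_length R M =
     Sup {enat n | n. \<exists>N. (\<forall>i\<le>n. submodule (N i) R M) \<and> (\<forall>i<n. N i \<subset> N (Suc i))}"

definition quotient_module :: "('a, 'b) ring_scheme \<Rightarrow> 'a set \<Rightarrow> ('a, 'a set) module" where
  "quotient_module R J =
    \<lparr>carrier = carrier (R Quot J), mult = mult (R Quot J), one = one (R Quot J),
     zero = zero (R Quot J), add = add (R Quot J),
     smult = (\<lambda>r X. (J +>\<^bsub>R\<^esub> r) \<otimes>\<^bsub>R Quot J\<^esub> X)\<rparr>"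

text \<open>\<open>tight_hilbert_coeffs R d I e\<close>: the tight Hilbert polynomial of \<open>I\<close> exists, has degree
  at most \<open>d\<close>, and its coefficient \<open>e\<^sub>i\<^sup>*(I)\<close> is \<open>e i\<close> for \<open>i \<le> d\<close>. The coefficients are unique, see
  \<open>tight_hilbert_coeffs_unique\<close>; the values of \<open>e\<close> beyond \<open>d\<close> are irrelevant. The subtractions
  do not truncate once \<open>n \<ge> 1\<close>.\<close>

definition tight_hilbert_coeffs ::
    "('a, 'b) ring_scheme \<Rightarrow> nat \<Rightarrow> 'a set \<Rightarrow> (nat \<Rightarrow> int) \<Rightarrow> bool" where
  "tight_hilbert_coeffs R d I e \<longleftrightarrow>
    (\<forall>\<^sub>F n in sequentially. \<exists>l::nat.
       module_length R (quotient_module R (tight_closure R (ideal_pow R I n))) = enat l \<and>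
       int l = (\<Sum>i\<le>d. (-1) ^ i * e i * int ((n + d - 1 - i) choose (d - i))))"


subsection \<open>Well-definedness\<close>

lemma binomial_coeffs_zero:
  fixes c :: "nat \<Rightarrow> int"
  assumes "\<And>n. n \<ge> N \<Longrightarrow> (\<Sum>k\<le>d. c k * int ((n + k - 1) choose k)) = 0" and "k \<le> d"
  shows "c k = 0"
  using assms
proof (induction d arbitrary: c N k)
  case 0
  then show ?case using "0.prems"(1)[of "N"] by simp
next
  case (Suc d)
  have step: "c (Suc k) = 0" if "k \<le> d" for k
  proof (rule Suc.IH[of "N + 2" "\<lambda>k. c (Suc k)"])
    fix n assume n: "n \<ge> N + 2"
    then obtain m where m: "n = Suc m" "m \<ge> N" "m \<ge> 1" by (cases n) auto
    have "0 = (\<Sum>k\<le>Suc d. c k * int ((Suc m + k - 1) choose k))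
            - (\<Sum>k\<le>Suc d. c k * int ((m + k - 1) choose k))"
      using Suc.prems(1)[of m] Suc.prems(1)[of "Suc m"] m by simp
    also have "\<dots> = (\<Sum>k\<le>d. c (Suc k) * (int ((m + Suc k) choose Suc k)
                                        - int ((m + k) choose Suc k)))"
      unfolding sum.atMost_Suc_shift by (simp add: sum_subtractf[symmetric] algebra_simps)
    also have "\<dots> = (\<Sum>k\<le>d. c (Suc k) * int ((n + k - 1) choose k))"
      using m by (intro sum.cong) auto
    finally show "(\<Sum>k\<le>d. c (Suc k) * int ((n + k - 1) choose k)) = 0" by simp
  qed (use that in auto)
  have "c 0 = 0"
    using Suc.prems(1)[of N] step unfolding sum.atMost_Suc_shift by simp
  with step Suc.prems(2) show ?case by (cases k) auto
qed

lemma tight_hilbert_coeffs_unique: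
  assumes "tight_hilbert_coeffs R d I e" "tight_hilbert_coeffs R d I e'" "i \<le> d"
  shows "e i = e' i"
proof -
  define c where "c k = (-1) ^ (d - k) * (e (d - k) - e' (d - k))" for k
  let ?P = "\<lambda>e n. \<Sum>i\<le>d. (-1) ^ i * e i * int ((n + d - 1 - i) choose (d - i))"
  have "\<forall>\<^sub>F n in sequentially. ?P e n = ?P e' n"
    using assms(1,2)[unfolded tight_hilbert_coeffs_def]
  proof eventually_elim
    case (elim n)
    then obtain l l' where l:
      "module_length R (quotient_module R (tight_closure R (ideal_pow R I n))) = enat l"
      "module_length R (quotient_module R (tight_closure R (ideal_pow R I n))) = enat l'"
      "int l = ?P e n" "int l' = ?P e' n" by blast
    from l(1,2) have "l = l'" by simp
    with l(3,4) show ?case by argo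
  qed
  then obtain N where N: "\<And>n. n \<ge> N \<Longrightarrow> ?P e n = ?P e' n"
    unfolding eventually_sequentially by blast
  have "c (d - i) = 0"
  proof (rule binomial_coeffs_zero)
    fix n assume n: "n \<ge> N"
    have "(\<Sum>k\<le>d. c k * int ((n + k - 1) choose k))
        = (\<Sum>i\<le>d. c (d - i) * int ((n + (d - i) - 1) choose (d - i)))"
      by (rule sum.reindex_bij_witness[of _ "\<lambda>i. d - i" "\<lambda>i. d - i"]) auto
    also have "\<dots> = (\<Sum>i\<le>d. (-1) ^ i * (e i - e' i) * int ((n + d - 1 - i) choose (d - i)))"
    proof (intro sum.cong refl)
      fix i assume "i \<in> {..d}"
      then have "d - (d - i) = i" and "n + (d - i) - 1 = n + d - 1 - i" by auto
      then show "c (d - i) * int ((n + (d - i) - 1) choose (d - i))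
          = (-1) ^ i * (e i - e' i) * int ((n + d - 1 - i) choose (d - i))"
        unfolding c_def by metis
    qed
    also have "\<dots> = ?P e n - ?P e' n"
      unfolding sum_subtractf[symmetric] by (intro sum.cong refl) (simp only: right_diff_distrib left_diff_distrib)
    also have "\<dots> = 0"
      using N[OF n] by simp
    finally show "(\<Sum>k\<le>d. c k * int ((n + k - 1) choose k)) = 0" .
  qed auto
  then show ?thesis using assms(3) by (simp add: c_def)
qed

lemma (in cring) quotient_module_is_module:
  assumes "ideal J R"
  shows "module R (quotient_module R J)"
proof -
  interpret J: ideal J R by fact
  interpret Q: cring "R Quot J" using J.quotient_is_cring is_cring .
  have hom: "(+>) J \<in> ring_hom R (R Quot J)" by (rule J.rcos_ring_hom)
  have [simp]: "J +> a \<in> carrier (R Quot J)" if "a \<in> carrier R" for a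
    using ring_hom_closed[OF hom that] .
  show ?thesis
  proof (rule moduleI)
    show "abelian_group (quotient_module R J)"
    proof (rule abelian_groupI)
      fix x assume "x \<in> carrier (quotient_module R J)"
      then show "\<exists>y\<in>carrier (quotient_module R J).
          y \<oplus>\<^bsub>quotient_module R J\<^esub> x = \<zero>\<^bsub>quotient_module R J\<^esub>"
        by (auto simp: quotient_module_def intro!: bexI[of _ "\<ominus>\<^bsub>R Quot J\<^esub> x"] Q.l_neg)
    qed (auto simp: quotient_module_def Q.a_ac)
  qed (auto simp: quotient_module_def is_cring ring_hom_add[OF hom] ring_hom_mult[OF hom]
      ring_hom_one[OF hom] Q.l_distr Q.r_distr Q.m_assoc)
qed

lemma (in cring) binomial_ring:
  assumes a: "a \<in> carrier R" and b: "b \<in> carrier R"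
  shows "(a \<oplus> b) [^] (n::nat)
       = (\<Oplus>k\<in>{..n}. [(n choose k)] \<cdot> (a [^] k \<otimes> b [^] (n - k)))"
proof (induction n)
  case 0
  show ?case by simp
next
  case (Suc n)
  let ?t = "\<lambda>i j. a [^] (i::nat) \<otimes> b [^] (j::nat)"
  let ?F = "\<Oplus>k\<in>{..n}. [(n choose k)] \<cdot> ?t k (n - k)"
  let ?S = "\<Oplus>k\<in>{..n}. [(n choose k)] \<cdot> ?t (Suc k) (n - k)"
  let ?T = "\<Oplus>k\<in>{..n}. [(n choose Suc k)] \<cdot> ?t (Suc k) (n - k)"
  have t[simp]: "?t i j \<in> carrier R" for i j using a b by simp
  have ta: "?t i j \<otimes> a = ?t (Suc i) j" and tb: "?t i j \<otimes> b = ?t i (Suc j)" for i j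
    using a b by (simp_all add: m_ac)
  have A: "?F \<otimes> a = ?S"
    using a by (simp add: finsum_ldistr add_pow_ldistr ta Pi_def del: nat_pow_Suc)
  have "?F \<otimes> b = (\<Oplus>k\<in>{..n}. [(n choose k)] \<cdot> ?t k (Suc (n - k)))"
    using b by (simp add: finsum_ldistr add_pow_ldistr tb Pi_def del: nat_pow_Suc)
  also have "\<dots> = (\<Oplus>k\<in>{..n}. [(n choose k)] \<cdot> ?t k (Suc n - k))"
    by (intro finsum_cong') (use a b in \<open>auto simp: Suc_diff_le\<close>)
  also have "\<dots> = (\<Oplus>k\<in>{..Suc n}. [(n choose k)] \<cdot> ?t k (Suc n - k))"
    by (subst finsum_Suc) (use a b in \<open>auto simp: binomial_eq_0 simp del: nat_pow_Suc\<close>)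
  also have "\<dots> = ?T \<oplus> ?t 0 (Suc n)"
    by (subst finsum_Suc2) (use a b in \<open>auto simp del: nat_pow_Suc\<close>)
  finally have B: "?F \<otimes> b = ?T \<oplus> ?t 0 (Suc n)" .
  have "(a \<oplus> b) [^] Suc n = ?F \<otimes> a \<oplus> ?F \<otimes> b"
    using a b Suc.IH by (simp add: r_distr Pi_def)
  also have "\<dots> = (?S \<oplus> ?T) \<oplus> ?t 0 (Suc n)"
    unfolding A B by (rule a_assoc[symmetric]) (use a b in auto)
  also have "?S \<oplus> ?T = (\<Oplus>k\<in>{..n}. [(Suc n choose Suc k)] \<cdot> ?t (Suc k) (n - k))"
    by (subst finsum_addf[symmetric])
       (use a b in \<open>auto simp: add.nat_pow_mult simp del: nat_pow_Suc\<close>)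
  also have "\<dots> \<oplus> ?t 0 (Suc n) = (\<Oplus>k\<in>{..Suc n}. [(Suc n choose k)] \<cdot> ?t k (Suc n - k))"
    by (subst finsum_Suc2) (use a b in \<open>auto simp del: nat_pow_Suc binomial_Suc_Suc\<close>)
  finally show ?case .
qed

lemma (in cring) add_pow_eq_zero:
  assumes "[n] \<cdot> \<one> = \<zero>" "n dvd (m::nat)" "x \<in> carrier R"
  shows "[m] \<cdot> x = \<zero>"
proof -
  obtain k where k: "m = n * k" using assms(2) by blast
  have "[n] \<cdot> x = ([n] \<cdot> \<one>) \<otimes> x"
    using assms(3) add_pow_ldistr[of \<one> x n] by simp
  then have "[n] \<cdot> x = \<zero>" using assms by simp
  then show ?thesis
    unfolding k using add.nat_pow_pow[OF assms(3), of k n] by (simp add: mult.commute)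
qed

lemma (in cring) freshmans_dream:
  assumes a: "a \<in> carrier R" and b: "b \<in> carrier R"
    and p: "prime (p::nat)" "[p] \<cdot> \<one> = \<zero>"
  shows "(a \<oplus> b) [^] p = a [^] p \<oplus> b [^] p"
proof -
  obtain m where m: "p = Suc (Suc m)"
    using prime_ge_2_nat[OF p(1)] by (metis Suc_le_D Suc_le_mono numeral_2_eq_2)
  let ?f = "\<lambda>k. [(p choose k)] \<cdot> (a [^] k \<otimes> b [^] (p - k))"
  have f: "?f k \<in> carrier R" for k using a b by simp
  have z: "?f (Suc k) = \<zero>" if "k \<in> {..m}" for k
    using that m a b p by (intro add_pow_eq_zero[OF p(2)] dvd_choose_prime) auto
  have "(a \<oplus> b) [^] p = (\<Oplus>k\<in>{..Suc (Suc m)}. ?f k)"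
    using binomial_ring[OF a b, of p] m by simp
  also have "\<dots> = ?f (Suc (Suc m)) \<oplus> ((\<Oplus>k\<in>{..m}. ?f (Suc k)) \<oplus> ?f 0)"
    using f by (subst finsum_Suc, blast, subst finsum_Suc2) auto
  also have "(\<Oplus>k\<in>{..m}. ?f (Suc k)) = (\<Oplus>k\<in>{..m}. \<zero>)"
    using z by (intro finsum_cong') auto
  also have "\<dots> = \<zero>" by simp
  finally show ?thesis using a b m by (simp del: nat_pow_Suc)
qed

lemma (in cring) frobenius_add:
  assumes a: "a \<in> carrier R" and b: "b \<in> carrier R"
    and p: "prime (p::nat)" "[p] \<cdot> \<one> = \<zero>"
  shows "(a \<oplus> b) [^] (p ^ e) = a [^] (p ^ e) \<oplus> b [^] (p ^ e)"
proof (induction e)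
  case (Suc e)
  have "(a \<oplus> b) [^] (p ^ Suc e) = ((a \<oplus> b) [^] (p ^ e)) [^] p"
    using a b by (simp add: nat_pow_pow mult.commute)
  also have "\<dots> = (a [^] (p ^ e)) [^] p \<oplus> (b [^] (p ^ e)) [^] p"
    using a b p by (simp add: Suc.IH freshmans_dream)
  finally show ?case using a b by (simp add: nat_pow_pow mult.commute)
qed (use a b in simp)

lemma (in cring) ring_char_pow_one: "[ring_char R] \<cdot> \<one> = \<zero>"
proof -
  let ?S = "{n. [(n::nat)] \<cdot> \<one> = \<zero>}"
  show ?thesis
  proof (cases "\<exists>n>0. n \<in> ?S")
    case False
    then have "n \<in> ?S \<longleftrightarrow> n = 0" for n
      using add.nat_pow_0[of \<one>] by (cases "n = 0") (simp, blast)
    then have "?S = {0}" by blast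
    then show ?thesis by (simp add: ring_char_def)
  next
    case True
    define m where "m = (LEAST n. n > 0 \<and> n \<in> ?S)"
    have m: "m > 0" "m \<in> ?S" using LeastI_ex[of "\<lambda>n. n > 0 \<and> n \<in> ?S"] True
      unfolding m_def by blast+
    have "m dvd n" if n: "n \<in> ?S" for n
    proof -
      define k r where "k = n div m" and "r = n mod m"
      have nkr: "n = m * k + r" "r < m" using m by (auto simp: k_def r_def)
      have "add_pow R n \<one> = add_pow R (m * k) \<one> \<oplus> add_pow R r \<one>"
        unfolding nkr(1) by (rule add.nat_pow_mult[symmetric]) simp
      moreover have "add_pow R (m * k) \<one> = \<zero>"
        by (rule add_pow_eq_zero[of m]) (use m in simp_all)
      ultimately have r: "r \<in> ?S" using n by simp
      have "\<not> r > 0"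
        using not_less_Least[OF nkr(2)[unfolded m_def]] r by simp
      then show ?thesis using nkr by simp
    qed
    then have "Gcd ?S = m" using m by (intro dvd_antisym Gcd_greatest Gcd_dvd) auto
    then show ?thesis using m by (simp add: ring_char_def)
  qed
qed

lemma (in cring) frobenius_power_genideal:
  assumes A: "A \<subseteq> carrier R" and p: "prime (ring_char R)"
  shows "frobenius_power R (Idl A) (ring_char R ^ e)
       = Idl ((\<lambda>a. a [^] (ring_char R ^ e)) ` A)"
proof
  let ?q = "ring_char R ^ e"
  let ?J = "Idl ((\<lambda>a. a [^] ?q) ` A)"
  let ?K = "{x \<in> carrier R. x [^] ?q \<in> ?J}"
  have q: "?q > 0" using p by (simp add: prime_gt_0_nat)
  have sub: "(\<lambda>a. a [^] ?q) ` A \<subseteq> carrier R" using A by auto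
  interpret J: ideal ?J R by (rule genideal_ideal[OF sub])
  have add: "(x \<oplus> y) [^] ?q = x [^] ?q \<oplus> y [^] ?q" if "x \<in> carrier R" "y \<in> carrier R" for x y
    using frobenius_add[OF that p ring_char_pow_one] .
  have zero: "\<zero> [^] ?q = \<zero>" using q by (simp add: nat_pow_zero)
  have mult: "x \<otimes> y \<in> ?K" if "x \<in> carrier R" "y \<in> ?K" for x y
    using that by (auto simp: nat_pow_distrib J.I_l_closed)
  have "ideal ?K R"
  proof (rule idealI)
    show "subgroup ?K (add_monoid R)"
    proof (rule add.subgroupI)
      fix x assume x: "x \<in> ?K"
      have "\<ominus> x = \<ominus> \<one> \<otimes> x" using x by (simp add: l_minus)
      then show "\<ominus> x \<in> ?K" using mult[of "\<ominus> \<one>" x] x by (metis a_inv_closed one_closed)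
    qed (use zero J.zero_closed in \<open>auto simp: add intro!: exI[of _ \<zero>]\<close>)
    show "x \<otimes> a \<in> ?K" if "a \<in> ?K" "x \<in> carrier R" for a x
      using mult[OF that(2,1)] .
    then show "a \<otimes> x \<in> ?K" if "a \<in> ?K" "x \<in> carrier R" for a x
      using that m_comm[of a x] by auto
  qed (rule ring_axioms)
  moreover have "A \<subseteq> ?K" using A genideal_self[OF sub] by auto
  ultimately have "Idl A \<subseteq> ?K" by (rule genideal_minimal)
  then show "frobenius_power R (Idl A) ?q \<subseteq> ?J"
    unfolding frobenius_power_def by (intro genideal_minimal J.ideal_axioms) auto
  have "Idl A \<subseteq> carrier R" by (intro subsetI) (rule ideal.Icarr[OF genideal_ideal[OF A]])
  then have sub': "(\<lambda>a. a [^] ?q) ` (Idl A) \<subseteq> carrier R" by auto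
  have "(\<lambda>a. a [^] ?q) ` A \<subseteq> frobenius_power R (Idl A) ?q"
    unfolding frobenius_power_def
    using image_mono[OF genideal_self[OF A]] genideal_self[OF sub'] by (rule order_trans)
  then show "?J \<subseteq> frobenius_power R (Idl A) ?q"
    unfolding frobenius_power_def by (rule genideal_minimal[OF genideal_ideal[OF sub']])
qed

end

(* Let I be generated by a system of parameters y. Since R is Cohen-Macaulay, y and its Frobenius powers
   are regular, hence quasi-regular, so gr_I R is a polynomial ring over R/I and
   (I^(n+1))^* \<inter> I^n = I^n I^*. If I^* = I, then all powers of I are tightly closed and the tight Hilbert
   function is l(R/I) binom(n+d-1,d). Conversely, (I^(n+1))^* contains I^n I^*, which forces
   e_1^* \<ge> l(I^*/I) provided that e_0^* \<ge> l(R/I); hence e_1^* = 0 implies I^* = I, and comparing two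
   systems of parameters by exchanging one element at a time shows that R is F-rational.

   The bound e_0^* \<ge> l(R/I) follows from (I^n)^* \<subseteq> I^(n-h) with h independent of n, the only place where the
   completion has to be reduced. In characteristic p this comes from the filtration
   M_n = {x. x^p \<in> (I^[p])^n}. Reducedness of the completion and a limit argument make M cofinal with the
   I-adic filtration. The graded ring of M embeds into the polynomial ring over R/I^[p] through the
   Frobenius. Its rank is finite because the lengths of R/M_n are bounded by those of R/I^n, and by a Gauss
   lemma it already lies in the polynomials over a submodule of finite length; therefore it is finitely
   generated and M_(n0+k) \<subseteq> I^k. Iterating Frobenius roots bounds x in terms of x^q uniformly in q, and
   Artin-Rees removes the multiplier c in c x^q \<in> (I^n)^[q]. *)
theory Submission
  imports Defs Complex_Main "HOL-Library.Multiset_Order" "HOL-Library.Product_Lexorder"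
begin

text \<open>What resists is a rate: that M refines every power of I says nothing about how fast. A
  rate follows once M_(n+1) = I M_n for large n, that is, once the graded ring of M is a finite
  module over the polynomial ring on the parameters. That ring sits inside the polynomials over
  R/I^[p], on which R acts through p-th powers, and R/I^[p] need not be a finite module for this
  action, since no F-finiteness is assumed. The basis theorem thus does not apply to the ambient
  module, and a finite coefficient module has to be produced. The lengths bound how many initial
  forms can be independent once forms with a unit coefficient are inverted. The coefficients of the
  p-th powers of a maximal independent family generate the module sought, but only up to multipliers
  with a unit coefficient; these are what Gauss's lemma cancels. Among several successive Frobenius
  roots the last one costs a constant h in the exponent, the earlier ones only h/p, h/p^2 and so on,
  because exponents are divided by p in between; the total is at most 2h for every q.\<close>

section \<open>Ideals in Noetherian rings\<close>

context cring
begin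

lemma idealI':
  assumes "I \<subseteq> carrier R" "\<zero> \<in> I"
    and "\<And>a b. a \<in> I \<Longrightarrow> b \<in> I \<Longrightarrow> a \<oplus> b \<in> I"
    and smult: "\<And>a x. a \<in> I \<Longrightarrow> x \<in> carrier R \<Longrightarrow> x \<otimes> a \<in> I"
  shows "ideal I R"
proof (rule idealI)
  show "subgroup I (add_monoid R)"
  proof (rule add.subgroupI)
    fix a assume a: "a \<in> I"
    have "\<ominus> a = \<ominus> \<one> \<otimes> a" using a assms(1) by (auto simp: l_minus)
    then show "\<ominus> a \<in> I" using smult[OF a, of "\<ominus> \<one>"] by simp
  qed (use assms in auto)
  show "a \<otimes> x \<in> I" if "a \<in> I" "x \<in> carrier R" for a x
    using that smult[OF that] assms(1) m_comm[of a x] by auto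
qed (use assms ring_axioms in auto)

lemma ideal_D:
  assumes "ideal I R"
  shows "I \<subseteq> carrier R" "\<zero> \<in> I"
    and "a \<in> I \<Longrightarrow> b \<in> I \<Longrightarrow> a \<oplus> b \<in> I"
    and "a \<in> I \<Longrightarrow> b \<in> I \<Longrightarrow> a \<ominus> b \<in> I"
    and "a \<in> I \<Longrightarrow> \<ominus> a \<in> I"
    and "a \<in> I \<Longrightarrow> x \<in> carrier R \<Longrightarrow> x \<otimes> a \<in> I"
    and "a \<in> I \<Longrightarrow> x \<in> carrier R \<Longrightarrow> a \<otimes> x \<in> I"
    and "a \<in> I \<Longrightarrow> a \<in> carrier R"
proof -
  interpret ideal I R by fact
  show "I \<subseteq> carrier R" "\<zero> \<in> I"
    and "a \<in> I \<Longrightarrow> b \<in> I \<Longrightarrow> a \<oplus> b \<in> I"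
    and "a \<in> I \<Longrightarrow> b \<in> I \<Longrightarrow> a \<ominus> b \<in> I"
    and "a \<in> I \<Longrightarrow> \<ominus> a \<in> I"
    and "a \<in> I \<Longrightarrow> x \<in> carrier R \<Longrightarrow> x \<otimes> a \<in> I"
    and "a \<in> I \<Longrightarrow> x \<in> carrier R \<Longrightarrow> a \<otimes> x \<in> I"
    and "a \<in> I \<Longrightarrow> a \<in> carrier R"
    using a_subset zero_closed a_closed a_inv_closed I_l_closed I_r_closed Icarr
    by (auto simp only: a_minus_def)
qed

lemma ideal_add_cancel:
  assumes "ideal I R" "a \<in> I" "b \<in> carrier R" "a \<oplus> b \<in> I"
  shows "b \<in> I"
proof -
  have "b = (a \<oplus> b) \<ominus> a"
    using assms ideal_D(8)[OF assms(1)] by (simp add: a_minus_def a_comm[of a b] a_assoc r_neg)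
  then show ?thesis using assms ideal_D(4)[OF assms(1)] by metis
qed

lemma ideal_minus_cancel:
  assumes "ideal I R" "b \<in> I" "a \<in> carrier R" "a \<ominus> b \<in> I"
  shows "a \<in> I"
proof -
  have "a = (a \<ominus> b) \<oplus> b"
    using assms ideal_D(8)[OF assms(1)] by (simp add: a_minus_def a_assoc l_neg)
  then show ?thesis using assms ideal_D(3)[OF assms(1)] by metis
qed

lemma ideal_pow_mem:
  assumes "ideal I R" "a \<in> I" "n > 0"
  shows "a [^] (n::nat) \<in> I"
  using assms(3) by (cases n) (auto intro: ideal_D(6)[OF assms(1,2)] ideal_D(8)[OF assms(1,2)])

lemma genideal_is_ideal: "ideal (Idl S) R" if "S \<subseteq> carrier R"
  using genideal_ideal[OF that] .

lemma genideal_of_ideal: "ideal A R \<Longrightarrow> Idl A = A"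
  using genideal_minimal[of A A] genideal_self[of A] ideal_D(1)[of A] by blast

lemma genideal_mono: "S \<subseteq> T \<Longrightarrow> T \<subseteq> carrier R \<Longrightarrow> Idl S \<subseteq> Idl T"
  by (rule subset_Idl_subset) auto

lemma genideal_Un_genideal:
  assumes "S \<subseteq> carrier R" "T \<subseteq> carrier R"
  shows "Idl (T \<union> Idl S) = Idl (T \<union> S)"
proof
  note I = genideal_is_ideal[of "T \<union> S"]
  have c: "T \<union> S \<subseteq> carrier R" using assms by auto
  have "Idl S \<subseteq> Idl (T \<union> S)" using assms by (intro genideal_mono) auto
  then show "Idl (T \<union> Idl S) \<subseteq> Idl (T \<union> S)"
    using genideal_self[OF c] by (intro genideal_minimal I c) auto
  show "Idl (T \<union> S) \<subseteq> Idl (T \<union> Idl S)"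
    using genideal_self[OF assms(1)] ideal_D(1)[OF genideal_is_ideal[OF assms(1)]] assms
    by (intro genideal_mono) auto
qed

lemma genideal_insert_genideal:
  assumes "S \<subseteq> carrier R" "u \<in> carrier R"
  shows "Idl (insert u (Idl S)) = Idl (insert u S)"
  using genideal_Un_genideal[OF assms(1), of "{u}"] assms(2) by simp

lemma mem_genideal_Un:
  assumes "ideal A R" "ideal B R"
  shows "x \<in> Idl (A \<union> B) \<longleftrightarrow> (\<exists>a\<in>A. \<exists>b\<in>B. x = a \<oplus> b)"
  using union_genideal[OF assms] by (simp add: set_add_def')

lemma mem_genideal_insert:
  assumes A: "ideal A R" and u: "u \<in> carrier R"
  shows "x \<in> Idl (insert u A) \<longleftrightarrow> (\<exists>a\<in>A. \<exists>r\<in>carrier R. x = a \<oplus> r \<otimes> u)"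
proof -
  have c: "A \<subseteq> carrier R" using ideal_D(1)[OF A] .
  have "Idl (insert u A) = Idl (A \<union> Idl {u})"
    using genideal_Un_genideal[of "{u}" A] u c by simp
  also have "\<dots> = Idl (A \<union> PIdl u)" using cgenideal_eq_genideal[OF u] by simp
  finally show ?thesis
    using mem_genideal_Un[OF A cgenideal_ideal[OF u]] by (auto simp: cgenideal_def)
qed

lemma mem_genideal_insert':
  assumes S: "S \<subseteq> carrier R" and u: "u \<in> carrier R"
  shows "x \<in> Idl (insert u S) \<longleftrightarrow> (\<exists>a\<in>Idl S. \<exists>r\<in>carrier R. x = a \<oplus> r \<otimes> u)"
  using mem_genideal_insert[OF genideal_is_ideal[OF S] u] genideal_insert_genideal[OF S u] by simp

lemma genideal_insert_add:
  assumes C: "ideal C R" and a: "a \<in> carrier R" and s: "s \<in> C"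
  shows "Idl (insert (a \<oplus> s) C) = Idl (insert a C)"
proof (rule antisym; rule genideal_minimal)
  have sc: "s \<in> carrier R" using ideal_D(8)[OF C s] .
  have ins: "insert a C \<subseteq> carrier R" "insert (a \<oplus> s) C \<subseteq> carrier R" using a sc ideal_D(1)[OF C] by auto
  show I1: "ideal (Idl (insert a C)) R" "ideal (Idl (insert (a \<oplus> s) C)) R" using genideal_ideal ins by auto
  show "insert (a \<oplus> s) C \<subseteq> Idl (insert a C)"
    using genideal_self[OF ins(1)] ideal_D(3)[OF I1(1), of a s] s by auto
  have "a = (a \<oplus> s) \<ominus> s" using a sc by (simp add: a_minus_def a_assoc r_neg)
  then show "insert a C \<subseteq> Idl (insert (a \<oplus> s) C)"
    using genideal_self[OF ins(2)] ideal_D(4)[OF I1(2), of "a \<oplus> s" s] s by auto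
qed

definition colon :: "'a set \<Rightarrow> 'a \<Rightarrow> 'a set" where
  "colon A u = {r \<in> carrier R. u \<otimes> r \<in> A}"

lemma colon_ideal:
  assumes A: "ideal A R" and u: "u \<in> carrier R"
  shows "ideal (colon A u) R"
  by (rule idealI')
    (use ideal_D[OF A] u in \<open>auto simp: colon_def r_distr m_lcomm[of u]\<close>)

lemma subset_colon: "ideal A R \<Longrightarrow> u \<in> carrier R \<Longrightarrow> A \<subseteq> colon A u"
  using ideal_D[of A] by (auto simp: colon_def)

definition nzd :: "'a set \<Rightarrow> 'a \<Rightarrow> bool" where
  "nzd A u \<longleftrightarrow> (\<forall>r\<in>carrier R. u \<otimes> r \<in> A \<longrightarrow> r \<in> A)"

lemma nzdD: "nzd A u \<Longrightarrow> r \<in> carrier R \<Longrightarrow> u \<otimes> r \<in> A \<Longrightarrow> r \<in> A"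
  by (auto simp: nzd_def)

lemma nzd_pow:
  assumes "nzd A u" "u \<in> carrier R" shows "nzd A (u [^] (n::nat))"
proof (induction n)
  case (Suc n)
  show ?case unfolding nzd_def
  proof (intro ballI impI)
    fix r assume r: "r \<in> carrier R" "u [^] Suc n \<otimes> r \<in> A"
    then have "u [^] n \<otimes> (u \<otimes> r) \<in> A" using assms by (simp add: m_assoc)
    then have "u \<otimes> r \<in> A" using nzdD[OF Suc.IH] assms(2) r(1) by blast
    then show "r \<in> A" using nzdD[OF assms(1)] r(1) by blast
  qed
qed (auto simp: nzd_def)

lemma prime_D:
  assumes "primeideal P R"
  shows "ideal P R" "P \<noteq> carrier R" "\<one> \<notin> P"
    and "a \<in> carrier R \<Longrightarrow> b \<in> carrier R \<Longrightarrow> a \<otimes> b \<in> P \<Longrightarrow> a \<in> P \<or> b \<in> P"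
proof -
  interpret primeideal P R by fact
  show "ideal P R" "P \<noteq> carrier R" using ideal_axioms I_notcarr by auto
  show "\<one> \<notin> P" using one_imp_carrier I_notcarr by auto
  show "a \<in> carrier R \<Longrightarrow> b \<in> carrier R \<Longrightarrow> a \<otimes> b \<in> P \<Longrightarrow> a \<in> P \<or> b \<in> P"
    by (rule I_prime)
qed

lemma prime_pow:
  assumes "primeideal P R" "a \<in> carrier R" "a [^] (n::nat) \<in> P"
  shows "a \<in> P"
  using assms(3)
proof (induction n)
  case 0 then show ?case using prime_D(3)[OF assms(1)] by simp
next
  case (Suc n) then show ?case using prime_D(4)[OF assms(1), of "a [^] n" a] assms(2) by auto
qed

lemma primeI:
  assumes "ideal P R" "\<one> \<notin> P"
    and "\<And>a b. a \<in> carrier R \<Longrightarrow> b \<in> carrier R \<Longrightarrow> a \<otimes> b \<in> P \<Longrightarrow> a \<notin> P \<Longrightarrow> b \<in> P"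
  shows "primeideal P R"
proof (rule primeidealI)
  show "carrier R \<noteq> P" using assms(2) one_closed by metis
  show "a \<in> P \<or> b \<in> P" if "a \<in> carrier R" "b \<in> carrier R" "a \<otimes> b \<in> P" for a b
    using assms(3)[OF that] by blast
qed (rule assms is_cring)+

text \<open>Choose an element outside \<open>P\<close> from \<open>C\<close> and from each member of
  the family and multiply: the product lies in all of these ideals, and primality of
  \<open>P\<close> keeps it outside \<open>P\<close>.\<close>

lemma exists_mem_inter_not_mem_prime:
  assumes "finite \<Q>" "primeideal P R" "ideal C R" "\<not> C \<subseteq> P"
    and "\<And>Q. Q \<in> \<Q> \<Longrightarrow> ideal Q R \<and> \<not> Q \<subseteq> P"
  shows "\<exists>t\<in>C. t \<notin> P \<and> (\<forall>Q\<in>\<Q>. t \<in> Q)"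
  using assms(1,5)
proof (induction \<Q> rule: finite_induct)
  case empty then show ?case using assms(4) by auto
next
  case (insert Q \<Q>)
  then obtain t where t: "t \<in> C" "t \<notin> P" "\<And>Q'. Q' \<in> \<Q> \<Longrightarrow> t \<in> Q'" by auto
  from insert.prems[of Q] obtain q where q: "q \<in> Q" "q \<notin> P" and Q: "ideal Q R" by auto
  have tc: "t \<in> carrier R" "q \<in> carrier R" using ideal_D(8)[OF assms(3) t(1)] ideal_D(8)[OF Q q(1)] by auto
  have "t \<otimes> q \<in> C" "t \<otimes> q \<in> Q" "t \<otimes> q \<notin> P"
    using ideal_D(7)[OF assms(3) t(1) tc(2)] ideal_D(6)[OF Q q(1) tc(1)]
      prime_D(4)[OF assms(2) tc] t(2) q(2) by auto
  moreover have "t \<otimes> q \<in> Q'" if "Q' \<in> \<Q>" for Q'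
    using ideal_D(7)[of Q' t q] t(3) tc insert.prems[of Q'] that by auto
  ultimately show ?case by blast
qed

text \<open>Induction over \<open>\<Q>\<close>, removing a minimal member: some element of \<open>C\<close> lies in all other members but not in
  that one, and adding it to a solution for the others repairs the solution.\<close>

lemma coset_prime_avoidance:
  assumes "finite \<Q>" "\<And>Q. Q \<in> \<Q> \<Longrightarrow> primeideal Q R" "ideal C R" "a \<in> carrier R"
    and "\<And>Q. Q \<in> \<Q> \<Longrightarrow> \<not> insert a C \<subseteq> Q"
  shows "\<exists>s\<in>C. \<forall>Q\<in>\<Q>. a \<oplus> s \<notin> Q"
  using assms(1,2,5)
proof (induction "card \<Q>" arbitrary: \<Q>)
  case 0
  then show ?case using ideal_D(2)[OF assms(3)] by auto
next
  case (Suc n)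
  note pr = Suc.prems(2) and na = Suc.prems(3)
  have "\<Q> \<noteq> {}" using Suc by auto
  then obtain P where P: "P \<in> \<Q>" "\<And>Q. Q \<in> \<Q> \<Longrightarrow> Q \<subseteq> P \<Longrightarrow> Q = P"
    using finite_has_minimal[OF Suc.prems(1)] by blast
  obtain s where s: "s \<in> C" "\<And>Q. Q \<in> \<Q> - {P} \<Longrightarrow> a \<oplus> s \<notin> Q"
    using Suc(1)[of "\<Q> - {P}"] Suc(2) P(1) Suc.prems by fastforce
  have sc: "s \<in> carrier R" using ideal_D(8)[OF assms(3) s(1)] .
  show ?case
  proof (cases "a \<oplus> s \<in> P")
    case False
    then show ?thesis using s by blast
  next
    case True
    have PI: "ideal P R" using prime_D(1)[OF pr[OF P(1)]] .
    have "\<not> C \<subseteq> P"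
    proof
      assume C: "C \<subseteq> P"
      then have "a \<in> P" using ideal_add_cancel[OF PI, of s a] True s(1) assms(4) sc by (auto simp: a_comm)
      then show False using na[OF P(1)] C by auto
    qed
    moreover have "ideal Q R \<and> \<not> Q \<subseteq> P" if "Q \<in> \<Q> - {P}" for Q
      using that prime_D(1)[OF pr[of Q]] P(2)[of Q] by auto
    ultimately obtain t where t: "t \<in> C" "t \<notin> P" "\<And>Q. Q \<in> \<Q> - {P} \<Longrightarrow> t \<in> Q"
      using exists_mem_inter_not_mem_prime[of "\<Q> - {P}" P C] Suc.prems(1) pr[OF P(1)] assms(3) by blast
    have tc: "t \<in> carrier R" using ideal_D(8)[OF assms(3) t(1)] .
    have eq: "a \<oplus> (s \<oplus> t) = (a \<oplus> s) \<oplus> t" using assms(4) sc tc by (simp add: a_assoc)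
    have "a \<oplus> (s \<oplus> t) \<notin> Q" if Q: "Q \<in> \<Q>" for Q
    proof (cases "Q = P")
      case True
      show ?thesis unfolding eq True
        using ideal_add_cancel[OF PI \<open>a \<oplus> s \<in> P\<close> tc] t(2) by auto
    next
      case False
      have QI: "ideal Q R" using prime_D(1)[OF pr[OF Q]] .
      show ?thesis unfolding eq
        using ideal_add_cancel[OF QI t(3)[of Q], of "a \<oplus> s"] s(2)[of Q] Q False assms(4) sc tc
        by (auto simp: a_comm)
    qed
    then show ?thesis using ideal_D(3)[OF assms(3) s(1) t(1)] by blast
  qed
qed

end

section \<open>Maximal members of families of ideals and Noetherian induction\<close>

context noetherian_ring
begin

text \<open>The union of a nonempty chain of ideals is itself a member of the chain, so Zorn's lemma
  applies to every nonempty family.\<close>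

lemma noetherian_maximal:
  assumes "\<S> \<noteq> {}" "\<And>J. J \<in> \<S> \<Longrightarrow> ideal J R"
  shows "\<exists>M\<in>\<S>. \<forall>J\<in>\<S>. M \<subseteq> J \<longrightarrow> J = M"
proof (rule subset_Zorn_nonempty[OF assms(1)])
  fix C assume C: "C \<noteq> {}" "subset.chain \<S> C"
  then have "subset.chain {I. ideal I R} C" using assms(2) unfolding pred_on.chain_def by auto
  then have "\<Union>C \<in> C" using ideal_chain_is_trivial C(1) by blast
  then show "\<Union>C \<in> \<S>" using C(2) unfolding pred_on.chain_def by auto
qed

lemma noetherian_induct [consumes 1, case_names ideal]:
  assumes "ideal A R"
    and "\<And>A. ideal A R \<Longrightarrow> (\<And>B. ideal B R \<Longrightarrow> A \<subset> B \<Longrightarrow> P B) \<Longrightarrow> P A"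
  shows "P A"
proof (rule ccontr)
  assume "\<not> P A"
  then obtain M where M: "ideal M R" "\<not> P M" "\<And>J. ideal J R \<Longrightarrow> \<not> P J \<Longrightarrow> M \<subseteq> J \<Longrightarrow> J = M"
    using noetherian_maximal[of "{J. ideal J R \<and> \<not> P J}"] assms(1) by (metis (mono_tags, lifting) empty_iff mem_Collect_eq)
  have "P M" by (rule assms(2)[OF M(1)]) (use M(3) in blast)
  then show False using M(2) by simp
qed

lemma ideal_chain_stationary:
  fixes A :: "nat \<Rightarrow> 'a set"
  assumes "\<And>n. ideal (A n) R" "\<And>n. A n \<subseteq> A (Suc n)"
  shows "\<exists>n0. \<forall>n\<ge>n0. A n = A n0"
proof -
  have "\<exists>M\<in>range A. \<forall>J\<in>range A. M \<subseteq> J \<longrightarrow> J = M"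
    by (rule noetherian_maximal) (use assms(1) in auto)
  then obtain n0 where n0: "\<forall>n. A n0 \<subseteq> A n \<longrightarrow> A n = A n0" by (auto simp: image_iff)
  have "A n0 \<subseteq> A n" if "n \<ge> n0" for n
    using lift_Suc_mono_le[of A, OF assms(2) that] .
  then show ?thesis using n0 by metis
qed

end

section \<open>Products and powers of ideals\<close>

context cring
begin

lemma ideal_prod_least:
  assumes "ideal K R" "\<And>i j. i \<in> I \<Longrightarrow> j \<in> J \<Longrightarrow> i \<otimes> j \<in> K"
  shows "I \<cdot> J \<subseteq> K"
proof
  fix x assume "x \<in> I \<cdot> J"
  then show "x \<in> K"
    by (induction rule: ideal_prod.induct) (use assms(2) ideal_D(3)[OF assms(1)] in blast)+
qed

lemma ideals_set_sel [simp]: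
  "carrier (ideals_set R) = {I. ideal I R}" "mult (ideals_set R) = ideal_prod R"
  "one (ideals_set R) = carrier R"
  by (simp_all add: ideals_set_def)

lemma ideal_pow_0 [simp]: "ideal_pow R I 0 = carrier R"
  by (simp add: nat_pow_def ideals_set_def)

lemma ideal_pow_Suc: "ideal_pow R I (Suc n) = ideal_pow R I n \<cdot> I"
  by (simp add: nat_pow_def ideals_set_def)

declare ideal_pow_Suc [simp]

lemma ideal_pow_ideal: "ideal I R \<Longrightarrow> ideal (ideal_pow R I n) R"
  by (induction n) (auto simp: oneideal intro: ideal_prod_is_ideal)

lemma ideal_pow_1 [simp]: "ideal I R \<Longrightarrow> ideal_pow R I (Suc 0) = I"
  using ideal_prod_one[of I] ideal_prod_commute[OF _ oneideal, of I] by (simp)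

lemma ideal_pow_add:
  assumes "ideal I R"
  shows "ideal_pow R I (m + n) = ideal_pow R I m \<cdot> ideal_pow R I n"
proof -
  interpret S: comm_monoid "ideals_set R" by (rule ideals_set_is_comm_monoid)
  show ?thesis using S.nat_pow_mult[of I m n] assms by simp
qed

lemma ideal_pow_mult_mem:
  assumes "ideal I R" "a \<in> ideal_pow R I m" "b \<in> ideal_pow R I n"
  shows "a \<otimes> b \<in> ideal_pow R I (m + n)"
  unfolding ideal_pow_add[OF assms(1)] using assms(2,3) by (rule ideal_prod.prod)

lemma ideal_pow_antimono:
  assumes "ideal I R" "m \<le> n"
  shows "ideal_pow R I n \<subseteq> ideal_pow R I m"
proof -
  have "ideal_pow R I n = ideal_pow R I m \<cdot> ideal_pow R I (n - m)"
    using ideal_pow_add[OF assms(1), of m "n - m"] assms(2) by simp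
  then show ?thesis
    using ideal_prod_inter[OF ideal_pow_ideal ideal_pow_ideal, OF assms(1) assms(1)] by blast
qed

lemma ideal_prod_mono: "I \<subseteq> I' \<Longrightarrow> J \<subseteq> J' \<Longrightarrow> I \<cdot> J \<subseteq> I' \<cdot> J'"
proof
  fix x assume *: "I \<subseteq> I'" "J \<subseteq> J'" and "x \<in> I \<cdot> J"
  from this(3) show "x \<in> I' \<cdot> J'"
    by (induction rule: ideal_prod.induct) (use * in \<open>auto intro: ideal_prod.intros\<close>)
qed

lemma ideal_pow_mono: "I \<subseteq> J \<Longrightarrow> ideal_pow R I n \<subseteq> ideal_pow R J n"
  by (induction n) (auto simp del: ideal_pow_1 intro: ideal_prod_mono[THEN subsetD])

lemma pow_mem_ideal_pow:
  assumes "ideal I R" "a \<in> I"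
  shows "a [^] n \<in> ideal_pow R I n"
  by (induction n) (use assms in \<open>auto simp del: ideal_pow_1 intro: ideal_prod.prod\<close>)

lemma ideal_pow_pow:
  assumes "ideal I R"
  shows "ideal_pow R (ideal_pow R I m) n = ideal_pow R I (m * n)"
proof -
  interpret S: comm_monoid "ideals_set R" by (rule ideals_set_is_comm_monoid)
  show ?thesis using S.nat_pow_pow[of I m n] assms by simp
qed

lemma pow_mem_ideal_pow_mult:
  assumes "ideal I R" "a \<in> ideal_pow R I m"
  shows "a [^] n \<in> ideal_pow R I (m * n)"
  using pow_mem_ideal_pow[OF ideal_pow_ideal[OF assms(1)] assms(2)] ideal_pow_pow[OF assms(1)] by metis

section \<open>Associated primes and prime filtrations\<close>

lemma colon_mult_prime:
  assumes "ideal A R" "u \<in> carrier R" "t \<in> carrier R" "primeideal (colon A u) R" "t \<otimes> u \<notin> A"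
  shows "colon A (t \<otimes> u) = colon A u"
proof
  have t: "t \<notin> colon A u" using assms by (auto simp: colon_def m_comm)
  show "colon A (t \<otimes> u) \<subseteq> colon A u"
  proof
    fix r assume r: "r \<in> colon A (t \<otimes> u)"
    then have rc: "r \<in> carrier R" by (simp add: colon_def)
    have "u \<otimes> (t \<otimes> r) = t \<otimes> u \<otimes> r" using assms rc by (simp add: m_ac)
    then have "t \<otimes> r \<in> colon A u" using r assms rc by (simp add: colon_def)
    then show "r \<in> colon A u" using prime_D(4)[OF assms(4,3) rc] t by blast
  qed
  show "colon A u \<subseteq> colon A (t \<otimes> u)"
    using assms ideal_D(6)[OF assms(1) _ assms(3)] by (auto simp: colon_def m_assoc)
qed

lemma colon_cong:
  assumes "ideal A R" "a \<in> A" "v \<in> carrier R"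
  shows "colon A (a \<oplus> v) = colon A v"
proof -
  have ac: "a \<in> carrier R" using ideal_D(8)[OF assms(1,2)] .
  have "(a \<oplus> v) \<otimes> r \<in> A \<longleftrightarrow> v \<otimes> r \<in> A" if r: "r \<in> carrier R" for r
  proof -
    have ar: "a \<otimes> r \<in> A" using ideal_D(7)[OF assms(1,2) r] .
    have eq: "(a \<oplus> v) \<otimes> r = a \<otimes> r \<oplus> v \<otimes> r" using ac assms(3) r by (simp add: l_distr)
    show ?thesis unfolding eq
      using ideal_add_cancel[OF assms(1) ar, of "v \<otimes> r"] ideal_D(3)[OF assms(1) ar] assms(3) r by auto
  qed
  then show ?thesis by (auto simp: colon_def)
qed

definition assoc_primes :: "'a set \<Rightarrow> 'a set set" where
  "assoc_primes A = {colon A v | v. v \<in> carrier R \<and> primeideal (colon A v) R}"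

lemma assoc_primes_prime: "P \<in> assoc_primes A \<Longrightarrow> primeideal P R"
  by (auto simp: assoc_primes_def)

lemma nzd_not_mem_assoc_prime:
  assumes "ideal A R" "P \<in> assoc_primes A" "nzd A x"
  shows "x \<notin> P"
proof
  assume x: "x \<in> P"
  from assms(2) obtain v where v: "v \<in> carrier R" "P = colon A v" "primeideal P R"
    by (auto simp: assoc_primes_def)
  have xc: "x \<in> carrier R" using x v(2) by (auto simp: colon_def)
  have "x \<otimes> v \<in> A" using x v(1,2) xc by (auto simp: colon_def m_comm)
  then have "v \<in> A" using nzdD[OF assms(3) v(1)] by blast
  then have "\<one> \<in> P" using v by (simp add: colon_def)
  then show False using prime_D(3)[OF v(3)] by blast
qed

text \<open>The usual filtration of R/A with factors R/P, built from the bottom: the first factor is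
  (A + Ru)/A, isomorphic to R modulo \<open>colon A u\<close>, and the rest filters R/(A + Ru). It
  yields finiteness of the associated primes, the minimal primes over \<open>A\<close>, powers of an
  ideal inside \<open>A\<close> and finite length, all without primary decomposition.\<close>

inductive prime_filtration :: "'a set \<Rightarrow> 'a set list \<Rightarrow> bool" where
  Nil: "prime_filtration (carrier R) []"
| Cons: "ideal A R \<Longrightarrow> u \<in> carrier R \<Longrightarrow> primeideal (colon A u) R \<Longrightarrow>
    prime_filtration (Idl (insert u A)) Ps \<Longrightarrow> prime_filtration A (colon A u # Ps)"

lemma subset_genideal_insert: "ideal A R \<Longrightarrow> u \<in> carrier R \<Longrightarrow> insert u A \<subseteq> Idl (insert u A)"
  using ideal_D(1)[of A] by (intro genideal_self) auto

lemma prime_filtration_primes: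
  "prime_filtration A Ps \<Longrightarrow> P \<in> set Ps \<Longrightarrow> primeideal P R \<and> A \<subseteq> P"
proof (induction rule: prime_filtration.induct)
  case (Cons A u Ps)
  then show ?case using subset_colon[of A u] subset_genideal_insert[of A u] by auto
qed auto

text \<open>If \<open>u\<close> is outside \<open>Q\<close>, the first prime of the list already
  lies in \<open>Q\<close>; otherwise \<open>Q\<close> contains the next ideal of the filtration. In
  particular the minimal primes over \<open>A\<close> occur in the list.\<close>

lemma prime_filtration_least:
  assumes "prime_filtration A Ps" "primeideal Q R" "A \<subseteq> Q"
  shows "\<exists>P\<in>set Ps. P \<subseteq> Q"
  using assms
proof (induction rule: prime_filtration.induct)
  case Nil
  then show ?case using prime_D(3)[OF Nil(1)] by auto
next
  case (Cons A u Ps)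
  show ?case
  proof (cases "u \<in> Q")
    case True
    then have "Idl (insert u A) \<subseteq> Q" using Cons.prems prime_D(1) by (intro genideal_minimal) auto
    then show ?thesis using Cons.IH Cons.prems by auto
  next
    case False
    have "colon A u \<subseteq> Q"
    proof
      fix r assume "r \<in> colon A u"
      then have "r \<in> carrier R" "u \<otimes> r \<in> Q" using Cons.prems(2) by (auto simp: colon_def)
      then show "r \<in> Q" using prime_D(4)[OF Cons.prems(1)] Cons.hyps(2) False by blast
    qed
    then show ?thesis by auto
  qed
qed

text \<open>Every factor is killed by \<open>M\<close>, so one factor \<open>M\<close> is spent for
  each step down the filtration.\<close>

lemma prime_filtration_pow:
  assumes "prime_filtration A Ps" "ideal M R" "\<And>P. P \<in> set Ps \<Longrightarrow> M \<subseteq> P"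
  shows "ideal_pow R M (length Ps) \<subseteq> A"
  using assms
proof (induction rule: prime_filtration.induct)
  case (Cons A u Ps)
  have "i \<otimes> j \<in> A" if i: "i \<in> ideal_pow R M (length Ps)" and j: "j \<in> M" for i j
  proof -
    have "i \<in> Idl (insert u A)" using Cons i by auto
    then obtain a r where ar: "a \<in> A" "r \<in> carrier R" "i = a \<oplus> r \<otimes> u"
      using mem_genideal_insert[OF Cons.hyps(1,2)] by blast
    have "j \<in> colon A u" using Cons.prems(2) j by auto
    then have j': "j \<in> carrier R" "u \<otimes> j \<in> A" by (auto simp: colon_def)
    have ac: "a \<in> carrier R" using ideal_D(8)[OF Cons.hyps(1) ar(1)] .
    have "i \<otimes> j = a \<otimes> j \<oplus> r \<otimes> (u \<otimes> j)"
      using ar ac j' Cons.hyps(2) by (simp add: l_distr m_assoc)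
    then show ?thesis
      using ideal_D(3)[OF Cons.hyps(1) ideal_D(7)[OF Cons.hyps(1) ar(1) j'(1)] ideal_D(6)[OF Cons.hyps(1) j'(2) ar(2)]]
      by simp
  qed
  then show ?case using ideal_prod_least[OF Cons.hyps(1)] by simp
qed simp

text \<open>In R/P all nonzero elements have annihilator \<open>P\<close>. Hence either a nonzero
  multiple of \<open>v\<close> lies in the bottom factor, and then its annihilator is both that of
  \<open>v\<close> and that of the factor, or no multiple does, and the annihilator of
  \<open>v\<close> is unchanged in the next quotient.\<close>

lemma prime_filtration_assoc:
  assumes "prime_filtration A Ps" "v \<in> carrier R" "primeideal (colon A v) R"
  shows "colon A v \<in> set Ps"
  using assms
proof (induction rule: prime_filtration.induct)
  case Nil
  then show ?case using prime_D(3)[OF Nil(2)] by (auto simp: colon_def)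
next
  case (Cons A u Ps)
  let ?B = "Idl (insert u A)"
  show ?case
  proof (cases "\<exists>t\<in>carrier R. t \<otimes> v \<in> ?B \<and> t \<otimes> v \<notin> A")
    case True
    then obtain t where t: "t \<in> carrier R" "t \<otimes> v \<in> ?B" "t \<otimes> v \<notin> A" by blast
    then obtain a s where as: "a \<in> A" "s \<in> carrier R" "t \<otimes> v = a \<oplus> s \<otimes> u"
      using mem_genideal_insert[OF Cons.hyps(1,2)] by blast
    have su: "s \<otimes> u \<notin> A" using t(3) as ideal_D(3)[OF Cons.hyps(1) as(1)] by metis
    have "colon A v = colon A (t \<otimes> v)"
      using colon_mult_prime[OF Cons.hyps(1) Cons.prems(1) t(1) Cons.prems(2) t(3)] by simp
    also have "\<dots> = colon A (s \<otimes> u)"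
      unfolding as(3) using colon_cong[OF Cons.hyps(1) as(1)] as(2) Cons.hyps(2) by simp
    also have "\<dots> = colon A u"
      by (rule colon_mult_prime[OF Cons.hyps(1,2) as(2) Cons.hyps(3) su])
    finally show ?thesis by simp
  next
    case False
    have "A \<subseteq> ?B" using subset_genideal_insert[OF Cons.hyps(1,2)] by auto
    then have "colon ?B v = colon A v"
      using False Cons.prems(1) by (auto simp: colon_def m_comm)
    then show ?thesis using Cons.IH Cons.prems by simp
  qed
qed

end

locale noetherian_cring = noetherian_ring R + cring R for R (structure)
begin

lemma noetherian_maximal_obtain:
  assumes "ideal A R" "Q A"
  obtains M where "ideal M R" "Q M" "\<And>J. ideal J R \<Longrightarrow> Q J \<Longrightarrow> M \<subseteq> J \<Longrightarrow> J = M"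
proof -
  have "\<exists>M\<in>{J. ideal J R \<and> Q J}. \<forall>J\<in>{J. ideal J R \<and> Q J}. M \<subseteq> J \<longrightarrow> J = M"
    by (rule noetherian_maximal) (use assms in auto)
  then show ?thesis using that by (metis (mono_tags, lifting) mem_Collect_eq)
qed

text \<open>An annihilator that is maximal among those of nonzero elements of R/A containing
  \<open>colon A r\<close> is prime: if s a is nonzero, its annihilator contains that of s and
  therefore equals it.\<close>

lemma exists_prime_colon:
  assumes A: "ideal A R" and r: "r \<in> carrier R" "r \<notin> A"
  shows "\<exists>s\<in>carrier R. primeideal (colon A s) R \<and> colon A r \<subseteq> colon A s"
proof -
  let ?Q = "\<lambda>J. \<exists>s. s \<in> carrier R \<and> s \<notin> A \<and> J = colon A s \<and> colon A r \<subseteq> colon A s"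
  have "?Q (colon A r)" using r by blast
  then obtain M where M: "?Q M" "\<And>J. ideal J R \<Longrightarrow> ?Q J \<Longrightarrow> M \<subseteq> J \<Longrightarrow> J = M"
    using noetherian_maximal_obtain[of "colon A r" ?Q] colon_ideal[OF A r(1)] by metis
  then obtain s where s: "s \<in> carrier R" "s \<notin> A" "colon A r \<subseteq> colon A s" and Ms: "M = colon A s"
    by metis
  have "primeideal (colon A s) R"
  proof (rule primeI)
    show "ideal (colon A s) R" using A s colon_ideal by blast
    show "\<one> \<notin> colon A s" using s by (simp add: colon_def)
    fix a b assume ab: "a \<in> carrier R" "b \<in> carrier R" "a \<otimes> b \<in> colon A s" "a \<notin> colon A s"
    have sa: "s \<otimes> a \<notin> A" using ab s by (simp add: colon_def)
    have sub: "colon A s \<subseteq> colon A (s \<otimes> a)"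
    proof
      fix x assume x: "x \<in> colon A s"
      then have "s \<otimes> x \<otimes> a \<in> A" using ideal_D(7)[OF A _ ab(1)] by (simp add: colon_def)
      moreover have "s \<otimes> x \<otimes> a = s \<otimes> a \<otimes> x" using x s ab by (simp add: colon_def m_ac)
      ultimately show "x \<in> colon A (s \<otimes> a)" using x by (simp add: colon_def)
    qed
    have sac: "s \<otimes> a \<in> carrier R" using s(1) ab(1) by simp
    have "?Q (colon A (s \<otimes> a))" by (rule exI[of _ "s \<otimes> a"]) (use sac s(3) sa sub in blast)
    from M(2)[OF colon_ideal[OF A sac] this] sub Ms have "colon A (s \<otimes> a) = colon A s" by simp
    moreover have "b \<in> colon A (s \<otimes> a)" using ab s by (simp add: colon_def m_assoc)
    ultimately show "b \<in> colon A s" by simp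
  qed
  then show ?thesis using s by blast
qed

lemma exists_prime_filtration: "ideal A R \<Longrightarrow> \<exists>Ps. prime_filtration A Ps"
proof (induction rule: noetherian_induct)
  case (ideal A)
  show ?case
  proof (cases "A = carrier R")
    case True then show ?thesis using prime_filtration.Nil by auto
  next
    case False
    then have "\<one> \<notin> A" using ideal.one_imp_carrier[OF ideal(1)] by auto
    then obtain s where s: "s \<in> carrier R" "primeideal (colon A s) R"
      using exists_prime_colon[OF ideal(1) one_closed] by blast
    have "s \<notin> A" using prime_D(3)[OF s(2)] s(1) by (auto simp: colon_def)
    then have "A \<subset> Idl (insert s A)" using subset_genideal_insert[OF ideal(1) s(1)] by auto
    moreover have "ideal (Idl (insert s A)) R"
      using s(1) ideal_D(1)[OF ideal(1)] by (intro genideal_ideal) auto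
    ultimately obtain Ps where "prime_filtration (Idl (insert s A)) Ps" using ideal(2) by blast
    then show ?thesis using prime_filtration.Cons[OF ideal(1) s] by blast
  qed
qed

lemma finite_assoc_primes:
  assumes "ideal A R" shows "finite (assoc_primes A)"
proof -
  obtain Ps where "prime_filtration A Ps" using exists_prime_filtration[OF assms] by blast
  then have "assoc_primes A \<subseteq> set Ps" using prime_filtration_assoc by (auto simp: assoc_primes_def)
  then show ?thesis using finite_subset by blast
qed

lemma zero_divisor_mem_assoc_prime:
  assumes "ideal A R" "x \<in> carrier R" "\<not> nzd A x"
  shows "\<exists>P\<in>assoc_primes A. x \<in> P"
proof -
  obtain r where r: "r \<in> carrier R" "x \<otimes> r \<in> A" "r \<notin> A" using assms(3) by (auto simp: nzd_def)
  obtain s where "s \<in> carrier R" "primeideal (colon A s) R" "colon A r \<subseteq> colon A s"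
    using exists_prime_colon[OF assms(1) r(1,3)] by blast
  moreover have "x \<in> colon A r" using r assms(2) by (simp add: colon_def m_comm)
  ultimately show ?thesis by (auto simp: assoc_primes_def)
qed

end

section \<open>Noetherian local rings: Nakayama's lemma, primary ideals, Krull's intersection
  theorem\<close>

locale noetherian_local = noetherian_ring R + local_ring \<mm> R for \<mm> and R (structure)

sublocale noetherian_local \<subseteq> noetherian_cring ..

context noetherian_local
begin

lemma mm_ideal: "ideal \<mm> R" by (rule ideal_axioms)

lemma mm_prime: "primeideal \<mm> R" using maximalideal_prime[OF maximalideal_axioms] .

lemma proper_ideal_subset_mm:
  assumes A: "ideal A R" "\<one> \<notin> A" shows "A \<subseteq> \<mm>"
proof -
  obtain M where M: "ideal M R" "A \<subseteq> M \<and> \<one> \<notin> M"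
    and max: "\<And>J. ideal J R \<Longrightarrow> A \<subseteq> J \<and> \<one> \<notin> J \<Longrightarrow> M \<subseteq> J \<Longrightarrow> J = M"
    by (rule noetherian_maximal_obtain[of A "\<lambda>J. A \<subseteq> J \<and> \<one> \<notin> J"]) (use A in auto)
  have "maximalideal M R"
  proof (rule maximalidealI[OF M(1)])
    show "carrier R \<noteq> M" using M(2) one_closed by metis
    fix J assume J: "ideal J R" "M \<subseteq> J"
    show "J = M \<or> J = carrier R"
      using max[OF J(1) _ J(2)] ideal.one_imp_carrier[OF J(1)] M(2) J(2) by blast
  qed
  then show ?thesis using unique_maximal M(2) by blast
qed

lemma prime_subset_mm: "primeideal P R \<Longrightarrow> P \<subseteq> \<mm>"
  using proper_ideal_subset_mm prime_D by blast

lemma one_not_mem_mm: "\<one> \<notin> \<mm>" using prime_D(3)[OF mm_prime] .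

lemma unit_if_not_mem_mm:
  assumes "x \<in> carrier R" "x \<notin> \<mm>"
  shows "\<exists>y\<in>carrier R. y \<otimes> x = \<one>"
proof -
  have "\<one> \<in> PIdl x"
    using proper_ideal_subset_mm[OF cgenideal_ideal[OF assms(1)]] cgenideal_self[OF assms(1)] assms(2) by blast
  then show ?thesis by (auto simp: cgenideal_def)
qed

lemma prime_eq_mm:
  assumes Q: "primeideal Q R" "ideal_pow R \<mm> t \<subseteq> Q"
  shows "Q = \<mm>"
proof -
  have "x \<in> Q" if x: "x \<in> \<mm>" for x
    using prime_pow[OF Q(1) ideal_D(8)[OF mm_ideal x], of t] pow_mem_ideal_pow[OF mm_ideal x, of t] Q(2) by blast
  then show ?thesis using prime_subset_mm[OF Q(1)] by blast
qed

lemma cancel_unit: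
  assumes "ideal A R" "u \<in> carrier R" "u \<notin> \<mm>" "x \<in> carrier R" "u \<otimes> x \<in> A"
  shows "x \<in> A"
proof -
  obtain y where y: "y \<in> carrier R" "y \<otimes> u = \<one>" using unit_if_not_mem_mm[OF assms(2,3)] by blast
  have "x = y \<otimes> (u \<otimes> x)" using y assms by (simp add: m_assoc[symmetric])
  then show ?thesis using ideal_D(6)[OF assms(1,5) y(1)] by simp
qed

text \<open>An ideal \<open>K\<close> maximal among those between \<open>A\<close> and A + N that do
  not contain \<open>N\<close> replaces a finite generating set: every element of A + N outside
  \<open>K\<close> generates \<open>N\<close> modulo \<open>K\<close>. This forces
  \<open>\<mm> \<cdot> N\<close> into \<open>K\<close>, and then the hypothesis puts
  \<open>N\<close> itself there.\<close>

lemma nakayama: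
  assumes A: "ideal A R" and N: "ideal N R" and sub: "N \<subseteq> Idl (A \<union> \<mm> \<cdot> N)"
  shows "N \<subseteq> A"
proof (rule ccontr)
  assume nsub: "\<not> N \<subseteq> A"
  have Ac: "A \<subseteq> carrier R" "N \<subseteq> carrier R" using ideal_D(1) A N by auto
  define N' where "N' = Idl (A \<union> N)"
  have N': "ideal N' R" "A \<subseteq> N'" "N \<subseteq> N'"
    using genideal_ideal[of "A \<union> N"] genideal_self[of "A \<union> N"] Ac by (auto simp: N'_def)
  let ?Q = "\<lambda>K. A \<subseteq> K \<and> K \<subseteq> N' \<and> \<not> N \<subseteq> K"
  obtain K where K0: "ideal K R" "?Q K" and max: "\<And>J. ideal J R \<Longrightarrow> ?Q J \<Longrightarrow> K \<subseteq> J \<Longrightarrow> J = K"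
    by (rule noetherian_maximal_obtain[of A ?Q]) (use A N' nsub in auto)
  note K = K0(1) K0(2)[THEN conjunct1] K0(2)[THEN conjunct2, THEN conjunct1] K0(2)[THEN conjunct2, THEN conjunct2]
  obtain x where x: "x \<in> N" "x \<notin> K" using K(4) by blast
  have xc: "x \<in> carrier R" using x Ac by auto
  have ins: "N \<subseteq> Idl (insert y K)" if y: "y \<in> N'" "y \<notin> K" for y
  proof -
    have yc: "y \<in> carrier R" using ideal_D(8)[OF N'(1) y(1)] .
    have s: "insert y K \<subseteq> Idl (insert y K)" using subset_genideal_insert[OF K(1) yc] .
    have "Idl (insert y K) \<subseteq> N'" using y K N' by (intro genideal_minimal) auto
    moreover have "ideal (Idl (insert y K)) R"
      using yc ideal_D(1)[OF K(1)] by (intro genideal_ideal) auto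
    moreover have "Idl (insert y K) \<noteq> K" using s y(2) by auto
    ultimately show ?thesis using max[of "Idl (insert y K)"] s K(2) by blast
  qed
  \<comment> \<open>Otherwise \<mu> x would generate x modulo \<open>K\<close>, say x = k + r \<mu>
    x, and 1 - r \<mu> is a unit.\<close>
  have mx: "\<mu> \<otimes> x \<in> K" if mu: "\<mu> \<in> \<mm>" for \<mu>
  proof (rule ccontr)
    have muc: "\<mu> \<in> carrier R" using ideal_D(8)[OF mm_ideal mu] .
    assume n: "\<mu> \<otimes> x \<notin> K"
    have "\<mu> \<otimes> x \<in> N'" using ideal_D(6)[OF N x(1) muc] N'(3) by auto
    then have "x \<in> Idl (insert (\<mu> \<otimes> x) K)" using ins n x(1) by auto
    then obtain k r where kr: "k \<in> K" "r \<in> carrier R" "x = k \<oplus> r \<otimes> (\<mu> \<otimes> x)"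
      using mem_genideal_insert[OF K(1)] muc xc by (meson m_closed)
    have kc: "k \<in> carrier R" using ideal_D(8)[OF K(1) kr(1)] .
    have rm: "r \<otimes> \<mu> \<in> \<mm>" using ideal_D(6)[OF mm_ideal mu kr(2)] .
    have "(\<one> \<ominus> r \<otimes> \<mu>) \<otimes> x = x \<ominus> r \<otimes> (\<mu> \<otimes> x)"
      using kr(2) muc xc by (simp add: a_minus_def l_distr l_minus m_assoc)
    also have "\<dots> = (k \<oplus> r \<otimes> (\<mu> \<otimes> x)) \<ominus> r \<otimes> (\<mu> \<otimes> x)" using kr(3) by simp
    also have "\<dots> = k" using kc kr(2) muc xc by (simp add: a_minus_def a_assoc r_neg)
    finally have in_K: "(\<one> \<ominus> r \<otimes> \<mu>) \<otimes> x \<in> K" using kr(1) by simp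
    have unit: "\<one> \<ominus> r \<otimes> \<mu> \<notin> \<mm>"
      using ideal_minus_cancel[OF mm_ideal rm one_closed] one_not_mem_mm by blast
    have "\<one> \<ominus> r \<otimes> \<mu> \<in> carrier R" using kr(2) muc by simp
    from cancel_unit[OF K(1) this unit xc in_K] show False using x(2) by simp
  qed
  have "Idl (A \<union> \<mm> \<cdot> N) \<subseteq> K"
  proof (rule genideal_minimal[OF K(1)])
    have "\<mu> \<otimes> n \<in> K" if mu: "\<mu> \<in> \<mm>" and n: "n \<in> N" for \<mu> n
    proof -
      have muc: "\<mu> \<in> carrier R" using ideal_D(8)[OF mm_ideal mu] .
      have "n \<in> Idl (insert x K)" using ins[of x] x N'(3) n by blast
      then obtain k r where kr: "k \<in> K" "r \<in> carrier R" "n = k \<oplus> r \<otimes> x"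
        using mem_genideal_insert[OF K(1) xc] by blast
      have kc: "k \<in> carrier R" using ideal_D(8)[OF K(1) kr(1)] .
      have "\<mu> \<otimes> n = \<mu> \<otimes> k \<oplus> r \<otimes> (\<mu> \<otimes> x)"
        using kr kc muc xc by (simp add: r_distr m_lcomm)
      then show ?thesis
        using ideal_D(3)[OF K(1) ideal_D(6)[OF K(1) kr(1) muc] ideal_D(6)[OF K(1) mx[OF mu] kr(2)]] by simp
    qed
    then show "A \<union> \<mm> \<cdot> N \<subseteq> K" using K(2) ideal_prod_least[OF K(1)] by blast
  qed
  then show False using sub x by blast
qed

text \<open>Elementwise exponents suffice: they put \<open>\<mm>\<close> into every prime of a
  filtration of R/A, and the number of factors is a uniform exponent.\<close>

lemma m_primary_pow:
  assumes "ideal A R" "\<And>x. x \<in> \<mm> \<Longrightarrow> \<exists>n::nat. x [^] n \<in> A"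
  shows "\<exists>t. ideal_pow R \<mm> t \<subseteq> A"
proof -
  obtain Ps where Ps: "prime_filtration A Ps" using exists_prime_filtration[OF assms(1)] by blast
  have "\<mm> \<subseteq> P" if "P \<in> set Ps" for P
  proof
    fix x assume x: "x \<in> \<mm>"
    have P: "primeideal P R" "A \<subseteq> P" using prime_filtration_primes[OF Ps that] by auto
    then show "x \<in> P" using assms(2)[OF x] prime_pow[OF P(1) ideal_D(8)[OF mm_ideal x]] by blast
  qed
  then show ?thesis using prime_filtration_pow[OF Ps mm_ideal] by blast
qed

lemma m_primary_if_primes:
  assumes "ideal A R" "\<And>Q. primeideal Q R \<Longrightarrow> A \<subseteq> Q \<Longrightarrow> Q = \<mm>"
  shows "\<exists>t. ideal_pow R \<mm> t \<subseteq> A"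
proof -
  obtain Ps where Ps: "prime_filtration A Ps" using exists_prime_filtration[OF assms(1)] by blast
  have "\<mm> \<subseteq> P" if "P \<in> set Ps" for P
    using prime_filtration_primes[OF Ps that] assms(2) by blast
  then show ?thesis using prime_filtration_pow[OF Ps mm_ideal] by blast
qed

lemma radical_eq_mm_iff:
  assumes "ideal A R"
  shows "radical R A = \<mm> \<longleftrightarrow> A \<subseteq> \<mm> \<and> (\<exists>t. ideal_pow R \<mm> t \<subseteq> A)"
proof
  assume r: "radical R A = \<mm>"
  have "A \<subseteq> \<mm>"
  proof
    fix x assume x: "x \<in> A"
    then have "x [^] (1::nat) \<in> A" using ideal_D(8)[OF assms] by simp
    then show "x \<in> \<mm>" using r x ideal_D(8)[OF assms] unfolding radical_def by blast
  qed
  moreover have "\<exists>t. ideal_pow R \<mm> t \<subseteq> A"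
    by (rule m_primary_pow[OF assms]) (use r in \<open>auto simp: radical_def\<close>)
  ultimately show "A \<subseteq> \<mm> \<and> (\<exists>t. ideal_pow R \<mm> t \<subseteq> A)" by blast
next
  assume "A \<subseteq> \<mm> \<and> (\<exists>t. ideal_pow R \<mm> t \<subseteq> A)"
  then obtain t where t: "A \<subseteq> \<mm>" "ideal_pow R \<mm> t \<subseteq> A" by blast
  show "radical R A = \<mm>"
  proof
    show "radical R A \<subseteq> \<mm>" using t(1) prime_pow[OF mm_prime] by (auto simp: radical_def)
    show "\<mm> \<subseteq> radical R A"
      using pow_mem_ideal_pow[OF mm_ideal, of _ t] t(2) ideal_D(8)[OF mm_ideal] by (auto simp: radical_def)
  qed
qed

text \<open>An ideal \<open>K\<close> maximal with \<open>K \<inter> N = J + \<mm> N\<close> contains a power of \<open>\<mm>\<close>.\<close>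

lemma krull_intersection:
  assumes J: "ideal J R" and x: "\<And>n. x \<in> Idl (J \<union> ideal_pow R \<mm> n)"
  shows "x \<in> J"
proof -
  have Jc: "J \<subseteq> carrier R" using ideal_D(1)[OF J] .
  have mc: "ideal_pow R \<mm> n \<subseteq> carrier R" for n using ideal_D(1)[OF ideal_pow_ideal[OF mm_ideal]] .
  define N where "N = (\<Inter>n. Idl (J \<union> ideal_pow R \<mm> n))"
  have Ii: "ideal (Idl (J \<union> ideal_pow R \<mm> n)) R" for n using Jc mc by (intro genideal_ideal) auto
  have N: "ideal N R" unfolding N_def by (rule i_Intersect) (use Ii in auto)
  have Nc: "N \<subseteq> carrier R" using ideal_D(1)[OF N] .
  define L where "L = Idl (J \<union> \<mm> \<cdot> N)"
  have mN: "\<mm> \<cdot> N \<subseteq> N" using ideal_prod_inter[OF mm_ideal N] by auto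
  have LI: "ideal L R" unfolding L_def using Jc mN Nc by (intro genideal_ideal) auto
  have L: "J \<subseteq> L" "\<mm> \<cdot> N \<subseteq> L"
    using genideal_self[of "J \<union> \<mm> \<cdot> N"] Jc mN Nc unfolding L_def by auto
  obtain K where K0: "ideal K R" "L \<subseteq> K \<and> K \<inter> N \<subseteq> L"
    and max: "\<And>J. ideal J R \<Longrightarrow> L \<subseteq> J \<and> J \<inter> N \<subseteq> L \<Longrightarrow> K \<subseteq> J \<Longrightarrow> J = K"
    by (rule noetherian_maximal_obtain[of L "\<lambda>K. L \<subseteq> K \<and> K \<inter> N \<subseteq> L"]) (use LI in auto)
  note K = K0(1) K0(2)[THEN conjunct1] K0(2)[THEN conjunct2]
  have "\<exists>n::nat. y [^] n \<in> K" if y: "y \<in> \<mm>" for y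
  proof -
    have yc: "y \<in> carrier R" using ideal_D(8)[OF mm_ideal y] .
    \<comment> \<open>A Fitting argument. Let the ideals \<open>colon K (y [^] n)\<close> be
      stationary. An element k + r y^n of \<open>N\<close> is multiplied by \<open>y\<close> into
      \<open>\<mm> \<cdot> N\<close>, so r y^(n+1) and hence r y^n lie in \<open>K\<close>. Adding
      y^n to \<open>K\<close> thus keeps the intersection with \<open>N\<close> inside
      \<open>L\<close>, and maximality puts y^n into \<open>K\<close>.\<close>
    have "\<exists>n0::nat. \<forall>n\<ge>n0. colon K (y [^] n) = colon K (y [^] n0)"
    proof (rule ideal_chain_stationary[where A = "\<lambda>n::nat. colon K (y [^] n)"])
      show "ideal (colon K (y [^] n)) R" for n :: nat using colon_ideal[OF K(1)] yc by simp
      show "colon K (y [^] n) \<subseteq> colon K (y [^] Suc n)" for n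
      proof
        fix r assume r: "r \<in> colon K (y [^] n)"
        then have "y \<otimes> (y [^] n \<otimes> r) \<in> K" using ideal_D(6)[OF K(1) _ yc] by (simp add: colon_def)
        moreover have "y \<otimes> (y [^] n \<otimes> r) = y [^] Suc n \<otimes> r" using r yc by (simp add: colon_def m_ac)
        ultimately show "r \<in> colon K (y [^] Suc n)" using r by (simp add: colon_def)
      qed
    qed
    then obtain n where n: "colon K (y [^] Suc n) = colon K (y [^] n)" by (meson le_Suc_eq order_refl)
    have yn: "y [^] n \<in> carrier R" using yc by simp
    let ?K = "Idl (insert (y [^] n) K)"
    have KK: "insert (y [^] n) K \<subseteq> ?K" using subset_genideal_insert[OF K(1) yn] .
    have "?K \<inter> N \<subseteq> L"
    proof
      fix v assume v: "v \<in> ?K \<inter> N"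
      then obtain k r where kr: "k \<in> K" "r \<in> carrier R" "v = k \<oplus> r \<otimes> y [^] n"
        using mem_genideal_insert[OF K(1) yn] by blast
      have kc: "k \<in> carrier R" using ideal_D(8)[OF K(1) kr(1)] .
      have "y \<otimes> v \<in> K" using ideal_prod.prod[OF y, of v N R] v L(2) K(2) by auto
      moreover have "y \<otimes> v = y \<otimes> k \<oplus> y [^] Suc n \<otimes> r"
        using kr kc yc by (simp add: r_distr m_ac)
      ultimately have "y [^] Suc n \<otimes> r \<in> K"
        using ideal_add_cancel[OF K(1) ideal_D(6)[OF K(1) kr(1) yc], of "y [^] Suc n \<otimes> r"] kr(2) yc by simp
      then have "r \<in> colon K (y [^] n)" using n kr(2) by (auto simp: colon_def)
      then have "r \<otimes> y [^] n \<in> K" using kr(2) yn by (simp add: colon_def m_comm)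
      then have "v \<in> K" using ideal_D(3)[OF K(1) kr(1)] kr(3) by blast
      then show "v \<in> L" using v K(3) by blast
    qed
    moreover have "ideal ?K R" using ideal_D(1)[OF K(1)] yn by (intro genideal_ideal) auto
    ultimately have "?K = K" using max[of ?K] KK K(2) by blast
    then show ?thesis using KK by blast
  qed
  then obtain t where t: "ideal_pow R \<mm> t \<subseteq> K" using m_primary_pow[OF K(1)] by blast
  \<comment> \<open>\<open>N\<close> lies in J + \<mm>^t, hence in \<open>K\<close>; so it is
    contained in K \<inter> N and therefore in \<open>L\<close>, to which Nakayama's lemma
    applies.\<close>
  have "Idl (J \<union> ideal_pow R \<mm> t) \<subseteq> K" using t L(1) K(1,2) by (intro genideal_minimal) auto
  then have "N \<subseteq> L" using K(3) unfolding N_def by blast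
  then have "N \<subseteq> J" using nakayama[OF J N] unfolding L_def by blast
  then show ?thesis using x unfolding N_def by blast
qed

end

section \<open>Length\<close>

context cring
begin

text \<open>\<open>n\<close> strict inclusions ending at \<open>B\<close>. The lowest ideal need
  only contain \<open>A\<close>, which makes the notion monotone at both ends.\<close>

fun ideal_chain :: "nat \<Rightarrow> 'a set \<Rightarrow> 'a set \<Rightarrow> bool" where
  "ideal_chain 0 A B \<longleftrightarrow> A \<subseteq> B"
| "ideal_chain (Suc n) A B \<longleftrightarrow> (\<exists>N. ideal N R \<and> ideal_chain n A N \<and> N \<subset> B)"

text \<open>The length of B/A for ideals A \<subseteq> B without forming the quotient. All
  computations take place here; only the values of the tight Hilbert function are transferred to
  \<open>module_length\<close>.\<close>

definition ilen :: "'a set \<Rightarrow> 'a set \<Rightarrow> enat" where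
  "ilen A B = Sup {enat n | n. ideal_chain n A B}"

lemma ideal_chain_subset: "ideal_chain n A B \<Longrightarrow> A \<subseteq> B"
  by (induction n arbitrary: B) (simp, fastforce)

lemma ideal_chain_mono_right: "ideal_chain n A N \<Longrightarrow> N \<subseteq> B \<Longrightarrow> ideal_chain n A B"
  by (cases n) (simp, auto 0 3)

lemma ideal_chain_mono_left: "ideal_chain n A B \<Longrightarrow> A' \<subseteq> A \<Longrightarrow> ideal_chain n A' B"
  by (induction n arbitrary: B) (simp, fastforce)

lemma ideal_chain_Suc_D: "ideal_chain (Suc n) A B \<Longrightarrow> ideal_chain n A B"
  using ideal_chain_mono_right by fastforce

lemma ideal_chain_le: "ideal_chain n A B \<Longrightarrow> m \<le> n \<Longrightarrow> ideal_chain m A B"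
proof (induction n)
  case (Suc n)
  show ?case
  proof (cases "m = Suc n")
    case False
    then show ?thesis using Suc ideal_chain_Suc_D[of n A B] by simp
  qed (use Suc in simp)
qed simp

lemma ideal_chain_concat: "ideal_chain i A B \<Longrightarrow> ideal_chain j B C \<Longrightarrow> ideal_chain (i + j) A C"
proof (induction j arbitrary: C)
  case 0
  then show ?case using ideal_chain_mono_right by simp
next
  case (Suc j)
  then show ?case by auto
qed

lemma le_ilen_iff:
  assumes "A \<subseteq> B"
  shows "enat n \<le> ilen A B \<longleftrightarrow> ideal_chain n A B"
proof
  assume n: "enat n \<le> ilen A B"
  show "ideal_chain n A B"
  proof (cases n)
    case 0 then show ?thesis using assms by simp
  next
    case (Suc m)
    then have "enat m < ilen A B" using n by (metis Suc_ile_eq)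
    then obtain k where "m < k" "ideal_chain k A B" unfolding ilen_def less_Sup_iff by auto
    then show ?thesis using ideal_chain_le[of k A B n] Suc by simp
  qed
next
  assume "ideal_chain n A B"
  then show "enat n \<le> ilen A B" unfolding ilen_def by (intro Sup_upper) auto
qed

lemma ilen_le_iff: "ilen A B \<le> x \<longleftrightarrow> (\<forall>n. ideal_chain n A B \<longrightarrow> enat n \<le> x)"
  unfolding ilen_def Sup_le_iff by auto

lemma ilen_mono: "A' \<subseteq> A \<Longrightarrow> B \<subseteq> B' \<Longrightarrow> ilen A B \<le> ilen A' B'"
  unfolding ilen_le_iff
  using ideal_chain_mono_left ideal_chain_mono_right ideal_chain_subset le_ilen_iff
  by (meson order_trans)

lemma one_le_ilen: "ideal A R \<Longrightarrow> A \<subset> B \<Longrightarrow> 1 \<le> ilen A B"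
  using le_ilen_iff[of A B 1] by (auto simp: one_enat_def)

lemma ilen_refl [simp]: "ilen A A = 0"
proof -
  have "\<not> ideal_chain (Suc 0) A A" by auto
  then have "\<not> enat 1 \<le> ilen A A" using le_ilen_iff[of A A 1] by simp
  then show ?thesis by (cases "ilen A A") (auto simp: zero_enat_def)
qed

text \<open>By the modular law a strict step N' \<subset> N stays strict after intersecting with
  \<open>B\<close> or after adding \<open>B\<close>, so each step is counted in at least one of the
  two chains.\<close>

lemma ideal_chain_split:
  assumes A: "ideal A R" and B: "ideal B R" "A \<subseteq> B"
  shows "ideal N R \<Longrightarrow> ideal_chain n A N \<Longrightarrow>
    \<exists>i j. n \<le> i + j \<and> ideal_chain i A (N \<inter> B) \<and> ideal_chain j B (Idl (N \<union> B))"
proof (induction n arbitrary: N)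
  case 0
  have "B \<subseteq> Idl (N \<union> B)"
    using genideal_self[of "N \<union> B"] ideal_D(1)[OF 0(1)] ideal_D(1)[OF B(1)] by auto
  then show ?case using 0 B by (intro exI[of _ 0]) auto
next
  case (Suc n)
  then obtain N' where N': "ideal N' R" "ideal_chain n A N'" "N' \<subset> N" by auto
  obtain i j where ij: "n \<le> i + j" "ideal_chain i A (N' \<inter> B)" "ideal_chain j B (Idl (N' \<union> B))"
    using Suc.IH[OF N'(1,2)] by blast
  have c: "N \<subseteq> carrier R" "B \<subseteq> carrier R" "N' \<subseteq> carrier R"
    using ideal_D(1) Suc.prems(1) B(1) N'(1) by auto
  have sub: "Idl (N' \<union> B) \<subseteq> Idl (N \<union> B)" using c N'(3) by (intro genideal_mono) auto
  show ?case
  proof (cases "N' \<inter> B = N \<inter> B")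
    case False
    then have "N' \<inter> B \<subset> N \<inter> B" using N'(3) by auto
    then have "ideal_chain (Suc i) A (N \<inter> B)" using ij(2) i_intersect[OF N'(1) B(1)] by auto
    moreover have "ideal_chain j B (Idl (N \<union> B))" using ideal_chain_mono_right[OF ij(3) sub] .
    ultimately show ?thesis using ij(1) by (intro exI[of _ "Suc i"] exI[of _ j]) simp
  next
    case True
    obtain x where x: "x \<in> N" "x \<notin> N'" using N'(3) by auto
    have xc: "x \<in> carrier R" using x c by auto
    have "x \<notin> Idl (N' \<union> B)"
    proof
      assume "x \<in> Idl (N' \<union> B)"
      then obtain n' b where nb: "n' \<in> N'" "b \<in> B" "x = n' \<oplus> b"
        using mem_genideal_Un[OF N'(1) B(1)] by blast
      have "b \<in> N" by (rule ideal_add_cancel[OF Suc.prems(1), of n']) (use nb N'(3) x c in auto)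
      then have "b \<in> N'" using True nb(2) by auto
      then show False using ideal_D(3)[OF N'(1) nb(1)] nb(3) x(2) by blast
    qed
    moreover have "x \<in> Idl (N \<union> B)" using genideal_self[of "N \<union> B"] c x(1) by auto
    ultimately have "Idl (N' \<union> B) \<subset> Idl (N \<union> B)" using sub by auto
    moreover have "ideal (Idl (N' \<union> B)) R" using c by (intro genideal_ideal) auto
    ultimately have "ideal_chain (Suc j) B (Idl (N \<union> B))" using ij(3) by auto
    moreover have "ideal_chain i A (N \<inter> B)" using ij(2) True by simp
    ultimately show ?thesis using ij(1) by (intro exI[of _ i] exI[of _ "Suc j"]) simp
  qed
qed

lemma ilen_add:
  assumes "ideal A R" "ideal B R" "ideal C R" "A \<subseteq> B" "B \<subseteq> C"
  shows "ilen A C = ilen A B + ilen B C"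
proof (rule antisym)
  show "ilen A C \<le> ilen A B + ilen B C"
    unfolding ilen_le_iff
  proof (intro allI impI)
    fix n assume "ideal_chain n A C"
    then obtain i j where ij: "n \<le> i + j" "ideal_chain i A (C \<inter> B)" "ideal_chain j B (Idl (C \<union> B))"
      using ideal_chain_split[OF assms(1,2,4,3)] by blast
    have "C \<inter> B = B" "Idl (C \<union> B) = C" using assms(5) genideal_of_ideal[OF assms(3)] by (auto simp: Un_absorb2)
    then have "enat i \<le> ilen A B" "enat j \<le> ilen B C"
      using ij le_ilen_iff[OF assms(4)] le_ilen_iff[OF assms(5)] by auto
    then have "enat i + enat j \<le> ilen A B + ilen B C" by (rule add_mono)
    moreover have "enat n \<le> enat i + enat j" using ij(1) by simp
    ultimately show "enat n \<le> ilen A B + ilen B C" by (rule order_trans[rotated])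
  qed
  show "ilen A B + ilen B C \<le> ilen A C"
  proof (cases "ilen A B")
    case (enat i)
    note i = this
    show ?thesis
    proof (cases "ilen B C")
      case (enat j)
      have "ideal_chain i A B" "ideal_chain j B C"
        using i enat le_ilen_iff[OF assms(4), of i] le_ilen_iff[OF assms(5), of j] by auto
      from ideal_chain_concat[OF this] show ?thesis
        using le_ilen_iff[of A C "i + j"] assms(4,5) i enat by auto
    next
      case infinity
      then show ?thesis using ilen_mono[OF assms(4) order_refl, of C] by simp
    qed
  next
    case infinity
    then show ?thesis using ilen_mono[OF order_refl assms(5), of A] by simp
  qed
qed

lemma ilen_map_le:
  assumes f: "\<And>N. ideal N R \<Longrightarrow> A \<subseteq> N \<Longrightarrow> N \<subseteq> B \<Longrightarrow> ideal (f N) R \<and> A' \<subseteq> f N \<and> f N \<subseteq> B'"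
    and strict: "\<And>N N'. ideal N R \<Longrightarrow> ideal N' R \<Longrightarrow> A \<subseteq> N \<Longrightarrow> N' \<subseteq> B \<Longrightarrow> N \<subset> N' \<Longrightarrow> f N \<subset> f N'"
    and B: "ideal B R" "A \<subseteq> B"
  shows "ilen A B \<le> ilen A' B'"
proof -
  have *: "ideal_chain n A' (f N)" if "ideal_chain n A N" "ideal N R" "N \<subseteq> B" for n N
    using that
  proof (induction n arbitrary: N)
    case 0
    then show ?case using f[of N] by simp
  next
    case (Suc n)
    then obtain N' where N': "ideal N' R" "ideal_chain n A N'" "N' \<subset> N" by auto
    have N'B: "N' \<subseteq> B" "A \<subseteq> N'" using N' Suc.prems ideal_chain_subset by auto
    have "ideal_chain n A' (f N')" using Suc.IH[OF N'(2,1) N'B(1)] .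
    moreover have "f N' \<subset> f N" using strict[OF N'(1) Suc.prems(2) N'B(2) Suc.prems(3) N'(3)] .
    moreover have "ideal (f N') R" using f[OF N'(1) N'B(2,1)] by blast
    ultimately show ?case by auto
  qed
  have fB: "A' \<subseteq> f B" "f B \<subseteq> B'" using f[of B] B by auto
  show ?thesis unfolding ilen_le_iff
  proof (intro allI impI)
    fix n assume "ideal_chain n A B"
    then have "ideal_chain n A' B'" using ideal_chain_mono_right[OF *[OF _ B(1) order_refl] fB(2)] by blast
    then show "enat n \<le> ilen A' B'" using le_ilen_iff[of A' B'] fB by auto
  qed
qed

text \<open>The ideal P + Q f. It describes one cyclic step of a length computation and, iterated,
  the span of several elements with multipliers from prescribed ideals.\<close>

definition lin :: "'a set \<Rightarrow> 'a \<Rightarrow> 'a set \<Rightarrow> 'a set" where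
  "lin P f Q = {s \<oplus> g \<otimes> f | s g. s \<in> P \<and> g \<in> Q}"

lemma lin_ideal:
  assumes P: "ideal P R" and Q: "ideal Q R" and f: "f \<in> carrier R"
  shows "ideal (lin P f Q) R"
proof (rule idealI')
  note Pc = ideal_D(8)[OF P] and Qc = ideal_D(8)[OF Q]
  show "lin P f Q \<subseteq> carrier R" using Pc Qc f by (auto simp: lin_def)
  have "\<zero> = \<zero> \<oplus> \<zero> \<otimes> f" using f by simp
  then show "\<zero> \<in> lin P f Q" using ideal_D(2)[OF P] ideal_D(2)[OF Q] unfolding lin_def by blast
  fix v assume "v \<in> lin P f Q"
  then obtain a k where v: "a \<in> P" "k \<in> Q" "v = a \<oplus> k \<otimes> f" by (auto simp: lin_def)
  {
    fix w assume "w \<in> lin P f Q"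
    then obtain a' k' where w: "a' \<in> P" "k' \<in> Q" "w = a' \<oplus> k' \<otimes> f" by (auto simp: lin_def)
    have "v \<oplus> w = (a \<oplus> a') \<oplus> (k \<oplus> k') \<otimes> f"
      using v w Pc Qc f by (simp add: l_distr a_ac)
    then show "v \<oplus> w \<in> lin P f Q" using ideal_D(3)[OF P v(1) w(1)] ideal_D(3)[OF Q v(2) w(2)]
      unfolding lin_def by blast
  }
  fix x assume x: "x \<in> carrier R"
  have "x \<otimes> v = x \<otimes> a \<oplus> (x \<otimes> k) \<otimes> f"
    using v Pc Qc f x by (simp add: r_distr m_assoc)
  then show "x \<otimes> v \<in> lin P f Q" using ideal_D(6)[OF P v(1) x] ideal_D(6)[OF Q v(2) x]
    unfolding lin_def by blast
qed

lemma lin_mono: "Q \<subseteq> Q' \<Longrightarrow> lin P f Q \<subseteq> lin P f Q'"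
  unfolding lin_def by blast

lemma subset_lin: "ideal P R \<Longrightarrow> ideal Q R \<Longrightarrow> f \<in> carrier R \<Longrightarrow> P \<subseteq> lin P f Q"
proof
  fix s assume *: "ideal P R" "ideal Q R" "f \<in> carrier R" and s: "s \<in> P"
  have "s = s \<oplus> \<zero> \<otimes> f" using ideal_D(8)[OF *(1) s] *(3) by simp
  then show "s \<in> lin P f Q" unfolding lin_def using s ideal_D(2)[OF *(2)] by blast
qed

lemma mult_mem_lin: "ideal P R \<Longrightarrow> ideal Q R \<Longrightarrow> f \<in> carrier R \<Longrightarrow> g \<in> Q \<Longrightarrow> g \<otimes> f \<in> lin P f Q"
proof -
  assume *: "ideal P R" "ideal Q R" "f \<in> carrier R" and g: "g \<in> Q"
  have "g \<otimes> f = \<zero> \<oplus> g \<otimes> f" using ideal_D(8)[OF *(2) g] *(3) by simp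
  then show "g \<otimes> f \<in> lin P f Q" unfolding lin_def using g ideal_D(2)[OF *(1)] by blast
qed

text \<open>The isomorphism of (A + Ru)/A with R modulo \<open>colon A u\<close>, on ideals: N goes
  to \<open>colon N u\<close>, and K back to A + K u. Both maps are strictly increasing, and each
  gives one inequality.\<close>

lemma ilen_cyclic:
  assumes A: "ideal A R" and u: "u \<in> carrier R"
  shows "ilen A (Idl (insert u A)) = ilen (colon A u) (carrier R)"
proof (rule antisym)
  have Ac: "A \<subseteq> carrier R" using ideal_D(1)[OF A] .
  have BI: "ideal (Idl (insert u A)) R" using Ac u by (intro genideal_ideal) auto
  have AB: "insert u A \<subseteq> Idl (insert u A)" using subset_genideal_insert[OF A u] .
  show "ilen A (Idl (insert u A)) \<le> ilen (colon A u) (carrier R)"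
  proof (rule ilen_map_le[where f = "\<lambda>N. colon N u"])
    fix N N' assume N: "ideal N R" "ideal N' R" "A \<subseteq> N" "N' \<subseteq> Idl (insert u A)" "N \<subset> N'"
    obtain x where x: "x \<in> N'" "x \<notin> N" using N(5) by blast
    obtain a r where ar: "a \<in> A" "r \<in> carrier R" "x = a \<oplus> r \<otimes> u"
      using mem_genideal_insert[OF A u] x N(4) by blast
    have "r \<otimes> u \<in> N'" by (rule ideal_add_cancel[OF N(2), of a]) (use ar x N u in auto)
    moreover have "r \<otimes> u \<notin> N" using ideal_D(3)[OF N(1), of a "r \<otimes> u"] ar x N by auto
    ultimately have "r \<in> colon N' u" "r \<notin> colon N u" using ar(2) u by (auto simp: colon_def m_comm)
    moreover have "colon N u \<subseteq> colon N' u" using N(5) by (auto simp: colon_def)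
    ultimately show "colon N u \<subset> colon N' u" by blast
  next
    fix N assume N: "ideal N R" "A \<subseteq> N" "N \<subseteq> Idl (insert u A)"
    show "ideal (colon N u) R \<and> colon A u \<subseteq> colon N u \<and> colon N u \<subseteq> carrier R"
      using colon_ideal[OF N(1) u] N(2) by (auto simp: colon_def)
  qed (use BI AB in auto)
  have CI: "ideal (colon A u) R" using colon_ideal[OF A u] .
  define g where "g K = lin A u K" for K
  have g_colon: "k \<in> K" if K: "ideal K R" "colon A u \<subseteq> K" and k: "k \<in> carrier R" "k \<otimes> u \<in> g K" for K k
  proof -
    from k obtain a k' where ak: "a \<in> A" "k' \<in> K" "k \<otimes> u = a \<oplus> k' \<otimes> u" by (auto simp: g_def lin_def)
    have c: "k' \<in> carrier R" "a \<in> carrier R" using ideal_D(8)[OF K(1) ak(2)] ideal_D(8)[OF A ak(1)] by auto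
    have "(k \<ominus> k') \<otimes> u = k \<otimes> u \<ominus> k' \<otimes> u" using k c u by (simp add: a_minus_def l_distr l_minus)
    also have "\<dots> = (a \<oplus> k' \<otimes> u) \<ominus> k' \<otimes> u" using ak(3) by simp
    also have "\<dots> = a" using c u by (simp add: a_minus_def a_assoc r_neg)
    finally have "u \<otimes> (k \<ominus> k') \<in> A" using ak(1) k(1) c u by (simp add: m_comm)
    then have "k \<ominus> k' \<in> K" using K(2) k(1) c by (auto simp: colon_def)
    then show "k \<in> K" using ideal_minus_cancel[OF K(1) ak(2) k(1)] by blast
  qed
  show "ilen (colon A u) (carrier R) \<le> ilen A (Idl (insert u A))"
  proof (rule ilen_map_le[where f = g])
    fix N N' assume N: "ideal N R" "ideal N' R" "colon A u \<subseteq> N" "N' \<subseteq> carrier R" "N \<subset> N'"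
    obtain x where x: "x \<in> N'" "x \<notin> N" using N(5) by blast
    have xc: "x \<in> carrier R" using x N(4) by auto
    have "x \<otimes> u \<notin> g N" using g_colon[OF N(1,3) xc] x(2) by blast
    moreover have "x \<otimes> u \<in> g N'" unfolding g_def by (rule mult_mem_lin[OF A N(2) u x(1)])
    moreover have "g N \<subseteq> g N'" unfolding g_def by (rule lin_mono) (use N(5) in blast)
    ultimately show "g N \<subset> g N'" by blast
  next
    fix N assume N: "ideal N R" "colon A u \<subseteq> N" "N \<subseteq> carrier R"
    have "g N \<subseteq> Idl (insert u A)"
    proof
      fix x assume "x \<in> g N"
      then show "x \<in> Idl (insert u A)" using mem_genideal_insert[OF A u] N(3) unfolding g_def lin_def by blast
    qed
    then show "ideal (g N) R \<and> A \<subseteq> g N \<and> g N \<subseteq> Idl (insert u A)"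
      using lin_ideal[OF A N(1) u] subset_lin[OF A N(1) u] unfolding g_def by blast
  qed (use oneideal ideal_D(1)[OF CI] in auto)
qed

lemma submodule_preimage_ideal:
  assumes J: "ideal J R" and H: "submodule H R (quotient_module R J)"
  shows "ideal {r \<in> carrier R. J +> r \<in> H} R" "J \<subseteq> {r \<in> carrier R. J +> r \<in> H}"
proof -
  interpret J: ideal J R by fact
  interpret H: submodule H R "quotient_module R J" by fact
  have hom: "(+>) J \<in> ring_hom R (R Quot J)" by (rule J.rcos_ring_hom)
  have zero: "J \<in> H" using H.one_closed by (simp add: quotient_module_def FactRing_def)
  have zero': "J +> \<zero> = J" using a_rcos_zero[OF J ideal_D(2)[OF J]] .
  show "ideal {r \<in> carrier R. J +> r \<in> H} R"
  proof (rule idealI')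
    show "\<zero> \<in> {r \<in> carrier R. J +> r \<in> H}" using zero zero' by simp
    show "a \<oplus> b \<in> {r \<in> carrier R. J +> r \<in> H}"
      if "a \<in> {r \<in> carrier R. J +> r \<in> H}" "b \<in> {r \<in> carrier R. J +> r \<in> H}" for a b
      using that H.m_closed[of "J +> a" "J +> b"] ring_hom_add[OF hom, of a b]
      by (simp add: quotient_module_def)
    show "x \<otimes> a \<in> {r \<in> carrier R. J +> r \<in> H}"
      if "a \<in> {r \<in> carrier R. J +> r \<in> H}" "x \<in> carrier R" for a x
      using that H.smult_closed[of x "J +> a"] ring_hom_mult[OF hom, of x a]
      by (simp add: quotient_module_def)
  qed auto
  show "J \<subseteq> {r \<in> carrier R. J +> r \<in> H}"
    using a_rcos_zero[OF J] zero ideal_D(1)[OF J] by auto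
qed

lemma ideal_image_submodule:
  assumes J: "ideal J R" and B: "ideal B R"
  shows "submodule ((+>) J ` B) R (quotient_module R J)"
proof -
  interpret J: ideal J R by fact
  interpret M: module R "quotient_module R J" by (rule quotient_module_is_module[OF J])
  have hom: "(+>) J \<in> ring_hom R (R Quot J)" by (rule J.rcos_ring_hom)
  have Bc: "b \<in> carrier R" if "b \<in> B" for b using ideal_D(8)[OF B that] .
  have sub: "(+>) J ` B \<subseteq> carrier (quotient_module R J)"
    using ring_hom_closed[OF hom] Bc by (auto simp: quotient_module_def)
  have smult: "a \<odot>\<^bsub>quotient_module R J\<^esub> X \<in> (+>) J ` B"
    if a: "a \<in> carrier R" and X: "X \<in> (+>) J ` B" for a X
  proof -
    obtain b where b: "b \<in> B" "X = J +> b" using X by blast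
    have "a \<odot>\<^bsub>quotient_module R J\<^esub> X = J +> (a \<otimes> b)"
      using ring_hom_mult[OF hom a Bc[OF b(1)]] b(2) by (simp add: quotient_module_def)
    then show ?thesis using ideal_D(6)[OF B b(1) a] by blast
  qed
  have zero: "\<zero>\<^bsub>quotient_module R J\<^esub> \<in> (+>) J ` B"
    using a_rcos_zero[OF J ideal_D(2)[OF J]] ideal_D(2)[OF B]
    by (force simp: quotient_module_def FactRing_def)
  show ?thesis
  proof (rule M.submoduleI)
    show "\<ominus>\<^bsub>quotient_module R J\<^esub> X \<in> (+>) J ` B" if "X \<in> (+>) J ` B" for X
    proof -
      have "\<ominus>\<^bsub>quotient_module R J\<^esub> X = (\<ominus> \<one>) \<odot>\<^bsub>quotient_module R J\<^esub> X"
        using that sub M.smult_l_minus[of \<one> X] M.smult_one[of X] by auto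
      then show ?thesis using smult[of "\<ominus> \<one>" X] that by simp
    qed
    show "X \<oplus>\<^bsub>quotient_module R J\<^esub> Y \<in> (+>) J ` B" if X: "X \<in> (+>) J ` B" and Y: "Y \<in> (+>) J ` B" for X Y
    proof -
      obtain b b' where b: "b \<in> B" "X = J +> b" "b' \<in> B" "Y = J +> b'" using X Y by blast
      have "X \<oplus>\<^bsub>quotient_module R J\<^esub> Y = J +> (b \<oplus> b')"
        using ring_hom_add[OF hom Bc[OF b(1)] Bc[OF b(3)]] b by (simp add: quotient_module_def)
      then show ?thesis using ideal_D(3)[OF B b(1,3)] by blast
    qed
  qed (use sub zero smult in auto)
qed

text \<open>Chains of submodules of R/J correspond to chains of ideals above \<open>J\<close>, by
  preimages in one direction and images in the other.\<close>

lemma module_length_quotient: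
  assumes J: "ideal J R"
  shows "module_length R (quotient_module R J) = ilen J (carrier R)"
proof (rule antisym)
  have Jc: "J \<subseteq> carrier R" using ideal_D(1)[OF J] .
  let ?M = "quotient_module R J"
  show "module_length R ?M \<le> ilen J (carrier R)"
    unfolding module_length_def
  proof (rule Sup_least)
    fix x assume "x \<in> {enat n | n. \<exists>N. (\<forall>i\<le>n. submodule (N i) R ?M) \<and> (\<forall>i<n. N i \<subset> N (Suc i))}"
    then obtain n N where x: "x = enat n" and N: "\<And>i. i \<le> n \<Longrightarrow> submodule (N i) R ?M"
      "\<And>i. i < n \<Longrightarrow> N i \<subset> N (Suc i)" by auto
    define p where "p i = {r \<in> carrier R. J +> r \<in> N i}" for i :: nat
    have pI: "ideal (p i) R" "J \<subseteq> p i" if "i \<le> n" for i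
      using submodule_preimage_ideal[OF J N(1)[OF that]] by (auto simp: p_def)
    have "ideal_chain i J (p i)" if "i \<le> n" for i
      using that
    proof (induction i)
      case 0 then show ?case using pI(2) by simp
    next
      case (Suc i)
      have s: "N i \<subset> N (Suc i)" using N(2) Suc.prems by simp
      then obtain X where X: "X \<in> N (Suc i)" "X \<notin> N i" by blast
      have "X \<in> carrier ?M" using module.submoduleE(1)[OF quotient_module_is_module[OF J] N(1)[OF Suc.prems]] X(1) by auto
      then obtain r where r: "r \<in> carrier R" "X = J +> r"
        by (auto simp: quotient_module_def FactRing_def A_RCOSETS_def')
      have "p i \<subset> p (Suc i)" using s X r by (auto simp: p_def)
      then show ?case using Suc pI(1)[of i] by auto
    qed
    then have "ideal_chain n J (carrier R)"
      using ideal_chain_mono_right[of n J "p n" "carrier R"] by (auto simp: p_def)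
    then show "x \<le> ilen J (carrier R)" using le_ilen_iff[OF Jc] x by simp
  qed
  have *: "\<exists>N. (\<forall>i\<le>n. submodule (N i) R ?M) \<and> (\<forall>i<n. N i \<subset> N (Suc i)) \<and> N n = (+>) J ` B"
    if "ideal_chain n J B" "ideal B R" for n B
    using that
  proof (induction n arbitrary: B)
    case 0
    then show ?case using ideal_image_submodule[OF J 0(2)] by (intro exI[of _ "\<lambda>_. (+>) J ` B"]) simp
  next
    case (Suc n)
    then obtain B' where B': "ideal B' R" "ideal_chain n J B'" "B' \<subset> B" by auto
    from Suc.IH[OF B'(2,1)] obtain N where N: "\<And>i. i \<le> n \<Longrightarrow> submodule (N i) R ?M"
      "\<And>i. i < n \<Longrightarrow> N i \<subset> N (Suc i)" "N n = (+>) J ` B'" by blast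
    have Bc: "B \<subseteq> carrier R" using ideal_D(1)[OF Suc.prems(2)] .
    obtain x where x: "x \<in> B" "x \<notin> B'" using B'(3) by blast
    have nx: "J +> x \<notin> (+>) J ` B'"
    proof
      assume "J +> x \<in> (+>) J ` B'"
      then obtain b where b: "b \<in> B'" "J +> x = J +> b" by blast
      have bc: "b \<in> carrier R" "x \<in> carrier R" using b x B' Bc by auto
      have "x \<ominus> b \<in> J" using quotient_eq_iff_same_a_r_cos[OF J bc(2,1)] b(2) by simp
      then have "x \<ominus> b \<in> B'" using ideal_chain_subset[OF B'(2)] by auto
      then show False using ideal_minus_cancel[OF B'(1) b(1) bc(2)] x(2) by blast
    qed
    have "(+>) J ` B' \<subseteq> (+>) J ` B" using B'(3) by (intro image_mono) auto
    then have Nn: "N n \<subset> (+>) J ` B" using nx imageI[OF x(1), of "(+>) J"] unfolding N(3) psubset_eq by metis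
    define N' where "N' = N(Suc n := (+>) J ` B)"
    have "submodule (N' i) R ?M" if "i \<le> Suc n" for i
      using that N(1)[of i] ideal_image_submodule[OF J Suc.prems(2)] by (cases "i = Suc n") (simp_all add: N'_def)
    moreover have "N' i \<subset> N' (Suc i)" if "i < Suc n" for i
      using that N(2)[of i] Nn by (cases "i = n") (simp_all add: N'_def)
    moreover have "N' (Suc n) = (+>) J ` B" by (simp add: N'_def)
    ultimately show ?case by metis
  qed
  show "ilen J (carrier R) \<le> module_length R ?M"
    unfolding ilen_le_iff
  proof (intro allI impI)
    fix n assume "ideal_chain n J (carrier R)"
    from *[OF this oneideal] show "enat n \<le> module_length R ?M"
      unfolding module_length_def by (intro Sup_upper) auto
  qed
qed

lemma ilen_prime_filtration_le:
  assumes "prime_filtration A Ps" "\<And>P. P \<in> set Ps \<Longrightarrow> ilen P (carrier R) \<le> 1"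
  shows "ilen A (carrier R) \<le> enat (length Ps)"
  using assms
proof (induction rule: prime_filtration.induct)
  case (Cons A u Ps)
  let ?B = "Idl (insert u A)"
  have Ac: "A \<subseteq> carrier R" using ideal_D(1)[OF Cons.hyps(1)] .
  have BI: "ideal ?B R" using Ac Cons.hyps(2) by (intro genideal_ideal) auto
  have "ilen A (carrier R) = ilen A ?B + ilen ?B (carrier R)"
    using subset_genideal_insert[OF Cons.hyps(1,2)] ideal_D(1)[OF BI]
    by (intro ilen_add Cons.hyps(1) BI oneideal) auto
  also have "\<dots> \<le> 1 + enat (length Ps)"
    using Cons.IH Cons.prems ilen_cyclic[OF Cons.hyps(1,2)] by (intro add_mono) auto
  finally show ?case by (simp add: one_enat_def)
qed (simp add: zero_enat_def[symmetric])

end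

context noetherian_local
begin

lemma ilen_mm_le: "ilen \<mm> (carrier R) \<le> 1"
proof -
  have "\<not> ideal_chain (Suc (Suc 0)) \<mm> (carrier R)"
  proof
    assume "ideal_chain (Suc (Suc 0)) \<mm> (carrier R)"
    then obtain M N where N: "ideal N R" "N \<subset> carrier R" "M \<subset> N" "\<mm> \<subseteq> M" by auto
    then have "\<one> \<notin> N" using ideal.one_imp_carrier by blast
    then show False using proper_ideal_subset_mm[OF N(1)] N by blast
  qed
  then have "\<not> enat 2 \<le> ilen \<mm> (carrier R)"
    using le_ilen_iff[OF ideal_D(1)[OF mm_ideal], of 2] by (simp add: numeral_2_eq_2)
  then show ?thesis by (cases "ilen \<mm> (carrier R)") (auto simp: one_enat_def)
qed

text \<open>All primes of a filtration equal \<open>\<mm>\<close>, so every factor has length at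
  most 1 and the number of factors is a bound.\<close>

lemma ilen_finite:
  assumes "ideal A R" "ideal_pow R \<mm> t \<subseteq> A"
  shows "\<exists>n. ilen A (carrier R) = enat n"
proof -
  obtain Ps where Ps: "prime_filtration A Ps" using exists_prime_filtration[OF assms(1)] by blast
  have "ilen P (carrier R) \<le> 1" if "P \<in> set Ps" for P
  proof -
    have P: "primeideal P R" "A \<subseteq> P" using prime_filtration_primes[OF Ps that] by auto
    then have "P = \<mm>" using prime_eq_mm[OF P(1)] assms(2) by blast
    then show ?thesis using ilen_mm_le by simp
  qed
  then have "ilen A (carrier R) \<le> enat (length Ps)" using ilen_prime_filtration_le[OF Ps] by blast
  then show ?thesis by (cases "ilen A (carrier R)") auto
qed

end

section \<open>Regular sequences\<close>

context cring
begin

text \<open>Successive nonzerodivisors modulo the ideal generated by \<open>S\<close>. Properness is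
  not part of it, being automatic inside \<open>\<mm>\<close>; the base set \<open>S\<close> makes
  inductions from the front possible.\<close>

fun reg :: "'a set \<Rightarrow> 'a list \<Rightarrow> bool" where
  "reg S [] \<longleftrightarrow> True"
| "reg S (x # xs) \<longleftrightarrow> nzd (Idl S) x \<and> reg (insert x S) xs"

lemma reg_append: "reg S (xs @ ys) \<longleftrightarrow> reg S xs \<and> reg (set xs \<union> S) ys"
  by (induction xs arbitrary: S) auto

lemma reg_iff_nth:
  "reg S xs \<longleftrightarrow> (\<forall>i<length xs. nzd (Idl (set (take i xs) \<union> S)) (xs ! i))"
proof (induction xs arbitrary: S)
  case (Cons x xs)
  have "(\<forall>i<length (x # xs). nzd (Idl (set (take i (x # xs)) \<union> S)) ((x # xs) ! i)) \<longleftrightarrow>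
    nzd (Idl S) x \<and> (\<forall>i<length xs. nzd (Idl (set (take i xs) \<union> insert x S)) (xs ! i))"
    by (auto simp: less_Suc_eq_0_disj)
  then show ?case using Cons by simp
qed simp

lemma reg_if_regular_sequence: "regular_sequence R xs \<Longrightarrow> reg {} xs"
  by (simp add: reg_iff_nth regular_sequence_def nzd_def)

text \<open>The half of permutability valid in every commutative ring: x r = a + s u puts s into (S,
  x) because \<open>u\<close> is regular there, say s = b + t x, and then \<open>x\<close> cancels
  from x (r - t u) modulo S.\<close>

lemma nzd_swap:
  assumes S: "S \<subseteq> carrier R" and x: "x \<in> carrier R" and u: "u \<in> carrier R"
    and nx: "nzd (Idl S) x" and nu: "nzd (Idl (insert x S)) u"
  shows "nzd (Idl (insert u S)) x"
  unfolding nzd_def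
proof (intro ballI impI)
  fix r assume r: "r \<in> carrier R" "x \<otimes> r \<in> Idl (insert u S)"
  have SI: "ideal (Idl S) R" using genideal_ideal[OF S] .
  have xSI: "ideal (Idl (insert x S)) R" using S x by (intro genideal_ideal) auto
  obtain a s where as: "a \<in> Idl S" "s \<in> carrier R" "x \<otimes> r = a \<oplus> s \<otimes> u"
    using mem_genideal_insert'[OF S u] r(2) by blast
  have ac: "a \<in> carrier R" using ideal_D(8)[OF SI as(1)] .
  have a_in: "a \<in> Idl (insert x S)" using genideal_mono[of S "insert x S"] as(1) S x by auto
  have "x \<in> Idl (insert x S)" using genideal_self[of "insert x S"] S x by auto
  then have "x \<otimes> r \<in> Idl (insert x S)" using ideal_D(7)[OF xSI _ r(1)] by blast
  then have "u \<otimes> s \<in> Idl (insert x S)"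
    using ideal_add_cancel[OF xSI a_in, of "s \<otimes> u"] as u by (simp add: m_comm)
  then have "s \<in> Idl (insert x S)" using nzdD[OF nu as(2)] by blast
  then obtain b t where bt: "b \<in> Idl S" "t \<in> carrier R" "s = b \<oplus> t \<otimes> x"
    using mem_genideal_insert'[OF S x] by blast
  have bc: "b \<in> carrier R" using ideal_D(8)[OF SI bt(1)] .
  have "x \<otimes> r = a \<oplus> (b \<oplus> t \<otimes> x) \<otimes> u" using as(3) bt(3) by simp
  also have "\<dots> = (a \<oplus> b \<otimes> u) \<oplus> x \<otimes> (t \<otimes> u)"
    using bt(2) bc ac x u by (simp add: l_distr r_distr a_assoc m_ac)
  finally have "x \<otimes> r = (a \<oplus> b \<otimes> u) \<oplus> x \<otimes> (t \<otimes> u)" .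
  then have "x \<otimes> (r \<ominus> t \<otimes> u) = ((a \<oplus> b \<otimes> u) \<oplus> x \<otimes> (t \<otimes> u)) \<ominus> x \<otimes> (t \<otimes> u)"
    using r x u bt(2) by (simp add: a_minus_def r_distr r_minus)
  also have "\<dots> = a \<oplus> b \<otimes> u" using ac bc x u bt(2) by (simp add: a_minus_def a_assoc r_neg)
  also have "\<dots> \<in> Idl S" using ideal_D(3)[OF SI as(1) ideal_D(7)[OF SI bt(1) u]] .
  finally have "r \<ominus> t \<otimes> u \<in> Idl S" using nzdD[OF nx, of "r \<ominus> t \<otimes> u"] r u bt by simp
  moreover have "r = (r \<ominus> t \<otimes> u) \<oplus> t \<otimes> u" using r u bt(2) by (simp add: a_minus_def a_assoc l_neg)
  ultimately show "r \<in> Idl (insert u S)" using mem_genideal_insert'[OF S u] bt(2) by blast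
qed

text \<open>\<open>u\<close> moves to the front one element at a time. Keeping an element of
  \<open>xs\<close> regular after \<open>u\<close> precedes it needs \<open>u\<close> to be regular
  modulo that element and its predecessors, whence the range up to \<open>length xs\<close>.\<close>

lemma reg_insert:
  assumes "S \<subseteq> carrier R" "set xs \<subseteq> carrier R" "u \<in> carrier R" "reg S xs"
    and "\<And>i. i \<le> length xs \<Longrightarrow> nzd (Idl (set (take i xs) \<union> S)) u"
  shows "reg S (u # xs)"
  using assms
proof (induction xs arbitrary: S)
  case Nil
  then show ?case using Nil(5)[of 0] by simp
next
  case (Cons x xs)
  have n0: "nzd (Idl S) u" using Cons.prems(5)[of 0] by simp
  have n1: "nzd (Idl (insert x S)) u" using Cons.prems(5)[of 1] by simp
  have "reg (insert x S) (u # xs)"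
  proof (rule Cons.IH)
    fix i assume "i \<le> length xs"
    then show "nzd (Idl (set (take i xs) \<union> insert x S)) u" using Cons.prems(5)[of "Suc i"] by simp
  qed (use Cons.prems in auto)
  then have "reg (insert u (insert x S)) xs" by simp
  moreover have "nzd (Idl (insert u S)) x"
    by (rule nzd_swap) (use Cons.prems n1 in auto)
  ultimately show ?case using n0 by (simp add: insert_commute)
qed

end

section \<open>Regular sequences and chains of primes\<close>

context noetherian_cring
begin

text \<open>\<open>P\<close> is maximal among the ideals over \<open>A\<close> that miss the
  multiplicative set of all s x^n with s outside \<open>Q\<close>; such an ideal is prime, lies in
  \<open>Q\<close> and omits \<open>x\<close>. \<open>A\<close> misses this set because
  \<open>x\<close> is regular modulo \<open>A\<close>. A regular element of \<open>Q\<close> thus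
  forces a strict drop in a chain of primes, which takes the place of height theorems.\<close>

lemma exists_prime_between:
  assumes A: "ideal A R" and Q: "primeideal Q R" "A \<subseteq> Q" and x: "x \<in> carrier R" "nzd A x"
  shows "\<exists>P. primeideal P R \<and> A \<subseteq> P \<and> P \<subseteq> Q \<and> x \<notin> P"
proof -
  let ?D = "\<lambda>J. \<forall>s\<in>carrier R - Q. \<forall>n::nat. s \<otimes> x [^] n \<notin> J"
  have xn: "x [^] n \<in> carrier R" for n :: nat using x by simp
  have "?D A"
  proof (intro ballI allI notI)
    fix s and n :: nat assume s: "s \<in> carrier R - Q" "s \<otimes> x [^] n \<in> A"
    have "x [^] n \<otimes> s \<in> A" using s xn[of n] by (simp add: m_comm)
    then have "s \<in> A" using nzdD[OF nzd_pow[OF x(2,1)], of s n] s(1) by blast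
    then show False using s Q(2) by blast
  qed
  then obtain P where P: "ideal P R" "A \<subseteq> P \<and> ?D P"
    and max: "\<And>J. ideal J R \<Longrightarrow> A \<subseteq> J \<and> ?D J \<Longrightarrow> P \<subseteq> J \<Longrightarrow> J = P"
    using noetherian_maximal_obtain[of A "\<lambda>J. A \<subseteq> J \<and> ?D J"] A by (metis (no_types, lifting) subset_refl)
  have D: "s \<otimes> x [^] n \<notin> P" if "s \<in> carrier R" "s \<notin> Q" for s and n :: nat
    using P(2) that by blast
  have ex: "\<exists>s\<in>carrier R. s \<notin> Q \<and> (\<exists>n::nat. s \<otimes> x [^] n \<in> Idl (insert a P))" if "a \<in> carrier R" "a \<notin> P" for a
  proof (rule ccontr)
    assume n: "\<not> ?thesis"
    have sub: "insert a P \<subseteq> Idl (insert a P)" using subset_genideal_insert[OF P(1) that(1)] .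
    have "ideal (Idl (insert a P)) R" using ideal_D(1)[OF P(1)] that(1) by (intro genideal_ideal) auto
    moreover have "A \<subseteq> Idl (insert a P)" using sub P(2) by blast
    moreover have "?D (Idl (insert a P))" using n by blast
    ultimately have "Idl (insert a P) = P" using max[of "Idl (insert a P)"] sub by blast
    then show False using sub that(2) by blast
  qed
  have one: "\<one> \<notin> Q" using prime_D(3)[OF Q(1)] .
  have "primeideal P R"
  proof (rule primeI[OF P(1)])
    show "\<one> \<notin> P" using D[OF one_closed one, of 0] by simp
    fix a b assume ab: "a \<in> carrier R" "b \<in> carrier R" "a \<otimes> b \<in> P" "a \<notin> P"
    show "b \<in> P"
    proof (rule ccontr)
      assume b: "b \<notin> P"
      obtain s and n :: nat where s: "s \<in> carrier R" "s \<notin> Q" "s \<otimes> x [^] n \<in> Idl (insert a P)"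
        using ex[OF ab(1,4)] by blast
      obtain t and m :: nat where t: "t \<in> carrier R" "t \<notin> Q" "t \<otimes> x [^] m \<in> Idl (insert b P)"
        using ex[OF ab(2) b] by blast
      obtain j r where j: "j \<in> P" "r \<in> carrier R" "s \<otimes> x [^] n = j \<oplus> r \<otimes> a"
        using mem_genideal_insert[OF P(1) ab(1)] s(3) by blast
      obtain k q where k: "k \<in> P" "q \<in> carrier R" "t \<otimes> x [^] m = k \<oplus> q \<otimes> b"
        using mem_genideal_insert[OF P(1) ab(2)] t(3) by blast
      have c: "j \<in> carrier R" "k \<in> carrier R" using ideal_D(8)[OF P(1)] j(1) k(1) by auto
      have "(s \<otimes> t) \<otimes> x [^] (n + m) = (s \<otimes> x [^] n) \<otimes> (t \<otimes> x [^] m)"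
        using s(1) t(1) x(1) by (simp add: nat_pow_mult[symmetric] m_ac)
      also have "\<dots> = (j \<otimes> (k \<oplus> q \<otimes> b) \<oplus> (r \<otimes> a) \<otimes> k) \<oplus> (r \<otimes> q) \<otimes> (a \<otimes> b)"
        unfolding j(3) k(3) using c j(2) k(2) ab by (simp add: l_distr r_distr a_ac m_ac)
      also have "\<dots> \<in> P"
        using ideal_D(7)[OF P(1) j(1), of "k \<oplus> q \<otimes> b"] ideal_D(6)[OF P(1) k(1), of "r \<otimes> a"]
          ideal_D(6)[OF P(1) ab(3), of "r \<otimes> q"] c j(2) k(2) ab(1,2)
        by (intro ideal_D(3)[OF P(1)]) auto
      finally have "(s \<otimes> t) \<otimes> x [^] (n + m) \<in> P" .
      moreover have "s \<otimes> t \<notin> Q" using prime_D(4)[OF Q(1) s(1) t(1)] s(2) t(2) by blast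
      ultimately show False using D[of "s \<otimes> t" "n + m"] s(1) t(1) by simp
    qed
  qed
  moreover have "P \<subseteq> Q"
  proof
    fix y assume y: "y \<in> P"
    have yc: "y \<in> carrier R" using ideal_D(8)[OF P(1) y] .
    show "y \<in> Q" using D[OF yc, of 0] y yc by auto
  qed
  moreover have "x \<notin> P" using D[OF one_closed one, of 1] x by simp
  ultimately show ?thesis using P(2) by blast
qed

lemma reg_prime_chain:
  assumes "reg S xs" "S \<subseteq> carrier R" "set xs \<subseteq> carrier R" "primeideal Q R" "set xs \<union> S \<subseteq> Q"
  shows "\<exists>P. prime_chain R (length xs) P \<and> P (length xs) = Q \<and> S \<subseteq> P 0"
  using assms
proof (induction xs arbitrary: S)
  case Nil
  then show ?case by (intro exI[of _ "\<lambda>_. Q"]) (simp add: prime_chain_def)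
next
  case (Cons x xs)
  obtain P where P: "prime_chain R (length xs) P" "P (length xs) = Q" "insert x S \<subseteq> P 0"
    using Cons.IH[of "insert x S"] Cons.prems by auto
  have P0: "primeideal (P 0) R" using P(1) by (simp add: prime_chain_def)
  have "Idl S \<subseteq> P 0" using P(3) prime_D(1)[OF P0] by (intro genideal_minimal) auto
  then obtain P' where P': "primeideal P' R" "Idl S \<subseteq> P'" "P' \<subseteq> P 0" "x \<notin> P'"
    using exists_prime_between[OF genideal_ideal[OF Cons.prems(2)] P0, of x] Cons.prems by auto
  define F where "F i = (case i of 0 \<Rightarrow> P' | Suc j \<Rightarrow> P j)" for i
  have [simp]: "F 0 = P'" "F (Suc j) = P j" for j by (simp_all add: F_def)
  have "P' \<subset> P 0" using P'(3,4) P(3) by blast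
  then have "prime_chain R (length (x # xs)) F"
    using P(1) P'(1) unfolding prime_chain_def
    by (auto simp: F_def split: nat.split)
  moreover have "F (length (x # xs)) = Q" using P(2) by simp
  moreover have "S \<subseteq> F 0" using P'(2) genideal_self[OF Cons.prems(2)] by simp
  ultimately show ?case by blast
qed

end

section \<open>Permutation of regular sequences and regularity of systems of parameters\<close>

context noetherian_local
begin

lemma mm_carrier: "\<mm> \<subseteq> carrier R" using ideal_D(1)[OF mm_ideal] .

text \<open>The half of permutability that needs Nakayama's lemma. If y r lies in (S), regularity of
  \<open>y\<close> modulo (S, x) gives r = a + s x, and cancelling \<open>x\<close> shows that y s
  lies in (S) as well. So the ideal N of all such r satisfies N \<subseteq> (S) + \<mm> N.\<close>

lemma reg_swap:
  assumes S: "S \<subseteq> carrier R" and x: "x \<in> \<mm>" and y: "y \<in> \<mm>" and r: "reg S (x # y # zs)"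
  shows "reg S (y # x # zs)"
proof -
  have xc: "x \<in> carrier R" "y \<in> carrier R" using x y mm_carrier by auto
  have nx: "nzd (Idl S) x" and ny: "nzd (Idl (insert x S)) y" and rest: "reg (insert y (insert x S)) zs"
    using r by auto
  have SI: "ideal (Idl S) R" using genideal_ideal[OF S] .
  define N where "N = colon (Idl S) y"
  have N: "ideal N R" "Idl S \<subseteq> N" unfolding N_def using colon_ideal[OF SI xc(2)] subset_colon[OF SI xc(2)] by auto
  have "N \<subseteq> Idl (Idl S \<union> \<mm> \<cdot> N)"
  proof
    fix r assume r: "r \<in> N"
    then have rc: "r \<in> carrier R" "y \<otimes> r \<in> Idl S" by (auto simp: N_def colon_def)
    have "Idl S \<subseteq> Idl (insert x S)" using S xc by (intro genideal_mono) auto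
    then have "r \<in> Idl (insert x S)" using nzdD[OF ny rc(1)] rc(2) by blast
    then obtain a s where as: "a \<in> Idl S" "s \<in> carrier R" "r = a \<oplus> s \<otimes> x"
      using mem_genideal_insert'[OF S xc(1)] by blast
    have ac: "a \<in> carrier R" using ideal_D(8)[OF SI as(1)] .
    have "y \<otimes> r = y \<otimes> a \<oplus> x \<otimes> (y \<otimes> s)" using as ac xc by (simp add: r_distr m_ac)
    then have "x \<otimes> (y \<otimes> s) \<in> Idl S"
      using ideal_add_cancel[OF SI ideal_D(6)[OF SI as(1) xc(2)], of "x \<otimes> (y \<otimes> s)"] rc(2) xc as(2) by simp
    then have "y \<otimes> s \<in> Idl S" using nzdD[OF nx, of "y \<otimes> s"] xc as(2) by simp
    then have s: "s \<in> N" using as(2) by (simp add: N_def colon_def)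
    have "x \<otimes> s \<in> \<mm> \<cdot> N" using ideal_prod.prod[OF x s] .
    then have sx: "s \<otimes> x \<in> \<mm> \<cdot> N" using xc as(2) by (simp add: m_comm)
    have "\<mm> \<cdot> N \<subseteq> carrier R" using ideal_prod_in_carrier[OF mm_ideal N(1)] .
    then have c: "Idl S \<union> \<mm> \<cdot> N \<subseteq> carrier R" using ideal_D(1)[OF SI] by auto
    have "a \<in> Idl (Idl S \<union> \<mm> \<cdot> N)" "s \<otimes> x \<in> Idl (Idl S \<union> \<mm> \<cdot> N)"
      using genideal_self[OF c] as(1) sx by auto
    then show "r \<in> Idl (Idl S \<union> \<mm> \<cdot> N)" using ideal_D(3)[OF genideal_ideal[OF c]] as(3) by blast
  qed
  then have "N \<subseteq> Idl S" using nakayama[OF SI N(1)] by blast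
  then have "nzd (Idl S) y" by (auto simp: nzd_def N_def colon_def)
  moreover have "nzd (Idl (insert y S)) x" using nzd_swap[OF S xc nx ny] .
  ultimately show ?thesis using rest by (simp add: insert_commute)
qed

lemma reg_move_last:
  assumes "S \<subseteq> carrier R" "x \<in> \<mm>" "set ys \<subseteq> \<mm>" "reg S (x # ys)"
  shows "reg S (ys @ [x])"
  using assms
proof (induction ys arbitrary: S)
  case (Cons y ys)
  have "reg S (y # x # ys)" using reg_swap[of S x y ys] Cons.prems by auto
  then have "nzd (Idl S) y" "reg (insert y S) (x # ys)" by auto
  then show ?case using Cons.IH[of "insert y S"] Cons.prems mm_carrier by auto
qed simp

text \<open>Every system of parameters of a Cohen--Macaulay ring is regular. The last element of \<open>ys\<close> may be
  changed modulo the others without changing the ideal, and coset avoidance yields a change that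
  is regular modulo all initial segments of \<open>xs\<close>. It can thus be moved to the front in both lists,
  which reduces their lengths.\<close>

lemma reg_if_m_primary:
  assumes "S \<subseteq> \<mm>" "set xs \<subseteq> \<mm>" "set ys \<subseteq> \<mm>" "length xs = length ys" "reg S xs"
    "ideal_pow R \<mm> t \<subseteq> Idl (set ys \<union> S)"
  shows "reg S ys"
  using assms
proof (induction "length ys" arbitrary: S xs ys)
  case 0 then show ?case by simp
next
  case (Suc n)
  obtain xs' e where xs: "xs = xs' @ [e]" using Suc by (metis length_Suc_conv rev_exhaust list.discI)
  obtain ys' a where ys: "ys = ys' @ [a]" using Suc by (metis length_Suc_conv rev_exhaust list.discI)
  have len: "length xs' = n" "length ys' = n" using xs ys Suc by auto
  have Sc: "S \<subseteq> carrier R" using Suc.prems mm_carrier by auto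
  have inm: "set xs' \<subseteq> \<mm>" "e \<in> \<mm>" "set ys' \<subseteq> \<mm>" "a \<in> \<mm>" using Suc.prems xs ys by auto
  have ac: "a \<in> carrier R" using inm mm_carrier by auto
  define A where "A i = Idl (set (take i xs') \<union> S)" for i
  have tk: "set (take i xs') \<union> S \<subseteq> carrier R" for i
    using set_take_subset[of i xs'] inm(1) mm_carrier Sc by blast
  have AI: "ideal (A i) R" for i unfolding A_def using genideal_ideal[OF tk] .
  \<comment> \<open>These primes decide regularity modulo the initial segments of
    \<open>xs'\<close>, the full list included. None contains both \<open>a\<close> and
    \<open>C\<close>: it would contain a power of \<open>\<mm>\<close>, hence also the element of
    \<open>xs\<close> that is regular modulo the segment in question.\<close>
  define \<Q> where "\<Q> = (\<Union>i\<le>n. assoc_primes (A i))"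
  define C where "C = Idl (set ys' \<union> S)"
  have C0: "set ys' \<union> S \<subseteq> carrier R" using inm mm_carrier Sc by auto
  have CI: "ideal C R" unfolding C_def using genideal_ideal[OF C0] .
  have aC: "Idl (insert a C) = Idl (set ys \<union> S)"
    unfolding C_def ys using genideal_insert_genideal[OF C0 ac] by (simp add: Un_commute)
  have "\<exists>s\<in>C. \<forall>Q\<in>\<Q>. a \<oplus> s \<notin> Q"
  proof (rule coset_prime_avoidance)
    show "finite \<Q>" unfolding \<Q>_def using finite_assoc_primes[OF AI] by auto
    show "primeideal Q R" if "Q \<in> \<Q>" for Q using that assoc_primes_prime unfolding \<Q>_def by blast
    show "\<not> insert a C \<subseteq> Q" if Q: "Q \<in> \<Q>" for Q
    proof
      assume sub: "insert a C \<subseteq> Q"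
      obtain i where i: "i \<le> n" "Q \<in> assoc_primes (A i)" using Q unfolding \<Q>_def by blast
      have Qp: "primeideal Q R" using assoc_primes_prime[OF i(2)] .
      have "Idl (insert a C) \<subseteq> Q" using sub prime_D(1)[OF Qp] by (intro genideal_minimal) auto
      then have pow: "ideal_pow R \<mm> t \<subseteq> Q" using Suc.prems(6) aC by auto
      have "xs ! i \<in> \<mm>" using nth_mem[of i xs] i(1) Suc.prems(2) len xs by auto
      then have "(xs ! i) [^] t \<in> Q" using pow_mem_ideal_pow[OF mm_ideal] pow by blast
      then have "xs ! i \<in> Q" using prime_pow[OF Qp] \<open>xs ! i \<in> \<mm>\<close> mm_carrier by blast
      moreover have "nzd (A i) (xs ! i)"
        using Suc.prems(5) i(1) len unfolding reg_iff_nth A_def xs by simp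
      ultimately show False using nzd_not_mem_assoc_prime[OF AI i(2)] by blast
    qed
  qed (rule CI ac)+
  then obtain s where s: "s \<in> C" "\<And>Q. Q \<in> \<Q> \<Longrightarrow> a \<oplus> s \<notin> Q" by blast
  have sc: "s \<in> carrier R" using ideal_D(8)[OF CI s(1)] .
  define u where "u = a \<oplus> s"
  have "C \<subseteq> \<mm>" unfolding C_def using inm Suc.prems(1) mm_ideal by (intro genideal_minimal) auto
  then have um: "u \<in> \<mm>" unfolding u_def using ideal_D(3)[OF mm_ideal] s(1) inm by blast
  have uc: "u \<in> carrier R" using um mm_carrier by auto
  have nu: "nzd (A i) u" if "i \<le> n" for i
  proof (rule ccontr)
    assume "\<not> nzd (A i) u"
    then obtain P where "P \<in> assoc_primes (A i)" "u \<in> P"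
      using zero_divisor_mem_assoc_prime[OF AI uc] by blast
    then show False using s(2)[of P] that unfolding \<Q>_def u_def by blast
  qed
  have "reg S (u # xs')"
    by (rule reg_insert) (use Sc inm mm_carrier uc nu Suc.prems(5) len in \<open>auto simp: xs reg_append A_def\<close>)
  then have ru: "reg (insert u S) xs'" by simp
  have uC: "Idl (insert u C) = Idl (insert a C)"
    unfolding u_def by (rule genideal_insert_add[OF CI ac s(1)])
  have "Idl (set ys' \<union> insert u S) = Idl (set ys \<union> S)"
    using genideal_insert_genideal[OF C0 uc] aC uC unfolding C_def by simp
  then have "reg (insert u S) ys'"
    using Suc.hyps(1)[of ys' "insert u S" xs'] len um ru inm Suc.prems by simp
  then have "reg S (u # ys')" using nu[of 0] unfolding A_def by simp
  then have "reg S (ys' @ [u])" using reg_move_last[OF Sc um inm(3)] by blast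
  then have r: "reg S ys'" "nzd C u" unfolding reg_append C_def by auto
  have "nzd C a" unfolding nzd_def
  proof (intro ballI impI)
    fix r' assume r': "r' \<in> carrier R" "a \<otimes> r' \<in> C"
    have "u \<otimes> r' = a \<otimes> r' \<oplus> s \<otimes> r'" unfolding u_def using ac sc r'(1) by (simp add: l_distr)
    then have "u \<otimes> r' \<in> C" using ideal_D(3)[OF CI r'(2) ideal_D(7)[OF CI s(1) r'(1)]] by simp
    then show "r' \<in> C" using nzdD[OF r(2) r'(1)] by blast
  qed
  then show ?case using r(1) unfolding ys reg_append C_def by simp
qed

lemma krull_dim_prime_chain: "krull_dim R = enat d \<Longrightarrow> prime_chain R n P \<Longrightarrow> n \<le> d"
proof -
  assume d: "krull_dim R = enat d" and P: "prime_chain R n P"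
  have "enat n \<le> krull_dim R" unfolding krull_dim_def by (rule Sup_upper) (use P in auto)
  then show ?thesis using d by simp
qed

lemma prime_chain_top:
  assumes "krull_dim R = enat d" "prime_chain R d P"
  shows "P d = \<mm>"
proof (rule ccontr)
  assume n: "P d \<noteq> \<mm>"
  have "primeideal (P d) R" using assms(2) by (simp add: prime_chain_def)
  then have "P d \<subset> \<mm>" using prime_subset_mm n by blast
  then have "prime_chain R (Suc d) (P(Suc d := \<mm>))"
    using assms(2) mm_prime unfolding prime_chain_def by (auto simp: le_Suc_eq less_Suc_eq)
  then show False using krull_dim_prime_chain[OF assms(1)] by fastforce
qed

text \<open>Any prime containing the sequence is the top of a chain of length \<open>d\<close>, and
  a chain of that length can only end at \<open>\<mm>\<close>.\<close>

lemma reg_m_primary: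
  assumes "krull_dim R = enat d" "reg {} xs" "set xs \<subseteq> \<mm>" "length xs = d"
  shows "\<exists>t. ideal_pow R \<mm> t \<subseteq> Idl (set xs)"
proof (rule m_primary_if_primes)
  have c: "set xs \<subseteq> carrier R" using assms(3) mm_carrier by auto
  show "ideal (Idl (set xs)) R" using genideal_ideal[OF c] .
  fix Q assume Q: "primeideal Q R" "Idl (set xs) \<subseteq> Q"
  have "set xs \<subseteq> Q" using genideal_self[OF c] Q(2) by auto
  then obtain P where "prime_chain R d P" "P d = Q"
    using reg_prime_chain[OF assms(2) _ c Q(1)] assms(4) by auto
  then show "Q = \<mm>" using prime_chain_top[OF assms(1)] by blast
qed

end

section \<open>Quasi-regularity\<close>

text \<open>Monomials of degree \<open>n\<close> in \<open>d\<close> variables as multisets of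
  indices: multiplication is addition, divisibility is \<open>\<subseteq>#\<close>, and the multiset
  order is a well-ordering compatible with multiplication.\<close>

abbreviation Mon :: "nat \<Rightarrow> nat \<Rightarrow> nat multiset set" where
  "Mon d n \<equiv> multisets_of_size {..<d} n"

lemma finite_Mon [simp]: "finite (Mon d n)"
  by (rule finite_multisets_of_size) simp

lemma Mon_iff: "\<alpha> \<in> Mon d n \<longleftrightarrow> set_mset \<alpha> \<subseteq> {..<d} \<and> size \<alpha> = n"
  by (simp add: multisets_of_size_def)

lemma Mon_add: "\<alpha> \<in> Mon d n \<Longrightarrow> \<beta> \<in> Mon d m \<Longrightarrow> \<alpha> + \<beta> \<in> Mon d (n + m)"
  by (simp add: Mon_iff)

lemma Mon_split: "Mon (Suc d) (Suc n) = Mon d (Suc n) \<union> add_mset d ` Mon (Suc d) n"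
proof (intro equalityI subsetI)
  fix \<alpha> assume a: "\<alpha> \<in> Mon (Suc d) (Suc n)"
  show "\<alpha> \<in> Mon d (Suc n) \<union> add_mset d ` Mon (Suc d) n"
  proof (cases "d \<in># \<alpha>")
    case True
    then obtain \<beta> where "\<alpha> = add_mset d \<beta>" by (metis insert_DiffM)
    then show ?thesis using a by (auto simp: Mon_iff)
  next
    case False
    have "i < d" if "i \<in># \<alpha>" for i
    proof -
      have "i < Suc d" using a that by (auto simp: Mon_iff)
      moreover have "i \<noteq> d" using False that by auto
      ultimately show ?thesis by simp
    qed
    then show ?thesis using a by (auto simp: Mon_iff)
  qed
qed (auto simp: Mon_iff)

lemma Mon_split_disjoint: "Mon d (Suc n) \<inter> add_mset d ` Mon (Suc d) n = {}"
  by (auto simp: Mon_iff)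

section \<open>Forms, their values, and the ideals generated by monomials\<close>

context cring
begin

definition mon :: "(nat \<Rightarrow> 'a) \<Rightarrow> nat multiset \<Rightarrow> 'a" where
  "mon y \<alpha> = foldr (\<lambda>i a. y i \<otimes> a) (sorted_list_of_multiset \<alpha>) \<one>"

definition ev :: "(nat \<Rightarrow> 'a) \<Rightarrow> nat \<Rightarrow> nat \<Rightarrow> (nat multiset \<Rightarrow> 'a) \<Rightarrow> 'a" where
  "ev y d n c = (\<Oplus>\<alpha>\<in>Mon d n. c \<alpha> \<otimes> mon y \<alpha>)"

definition gid :: "(nat \<Rightarrow> 'a) \<Rightarrow> nat \<Rightarrow> 'a set" where
  "gid y d = Idl (y ` {..<d})"

lemma finsum_in_subgroup:
  assumes "\<zero> \<in> A" "\<And>a b. a \<in> A \<Longrightarrow> b \<in> A \<Longrightarrow> a \<oplus> b \<in> A" "A \<subseteq> carrier R"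
    and "finite S" "\<And>i. i \<in> S \<Longrightarrow> f i \<in> A"
  shows "(\<Oplus>i\<in>S. f i) \<in> A"
  using assms(4,5)
proof (induction S rule: finite_induct)
  case (insert i S)
  have "(\<Oplus>i\<in>insert i S. f i) = f i \<oplus> (\<Oplus>i\<in>S. f i)"
    by (rule finsum_insert) (use insert assms(3) in auto)
  then show ?case using insert assms(2) by auto
qed (use assms(1) in simp)

context
  fixes y :: "nat \<Rightarrow> 'a"
  assumes yc [simp]: "\<And>i. y i \<in> carrier R"
begin

declare Pi_iff [simp]

lemma mon_foldr_closed: "foldr (\<lambda>i a. y i \<otimes> a) xs \<one> \<in> carrier R"
  by (induction xs) auto

lemma mon_closed [simp]: "mon y \<alpha> \<in> carrier R"
  unfolding mon_def by (rule mon_foldr_closed)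

lemma mon_empty [simp]: "mon y {#} = \<one>"
  by (simp add: mon_def)

lemma mon_add_mset: "mon y (add_mset i \<alpha>) = y i \<otimes> mon y \<alpha>"
proof -
  have "foldr (\<lambda>i a. y i \<otimes> a) (insort i xs) \<one> = y i \<otimes> foldr (\<lambda>i a. y i \<otimes> a) xs \<one>" for xs
  proof (induction xs)
    case (Cons x xs)
    then show ?case using mon_foldr_closed[of xs] by (auto simp: m_lcomm)
  qed simp
  then show ?thesis by (simp add: mon_def)
qed

lemma mon_add: "mon y (\<alpha> + \<beta>) = mon y \<alpha> \<otimes> mon y \<beta>"
  by (induction \<alpha>) (auto simp: mon_add_mset m_assoc)

lemma mon_nat_pow: "mon (\<lambda>i. y i [^] (q::nat)) \<alpha> = mon y \<alpha> [^] q"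
proof (induction \<alpha>)
  case empty
  then show ?case by (simp add: mon_def)
next
  case (add i \<alpha>)
  have "foldr (\<lambda>i a. y i [^] q \<otimes> a) (insort i xs) \<one> = y i [^] q \<otimes> foldr (\<lambda>i a. y i [^] q \<otimes> a) xs \<one>"
    "foldr (\<lambda>i a. y i [^] q \<otimes> a) xs \<one> \<in> carrier R" for xs
    by (induction xs) (auto simp: m_lcomm)
  then have "mon (\<lambda>i. y i [^] q) (add_mset i \<alpha>) = y i [^] q \<otimes> mon (\<lambda>i. y i [^] q) \<alpha>"
    by (simp add: mon_def)
  then show ?case using add by (simp add: mon_add_mset nat_pow_distrib)
qed

lemma ev_term_closed: "c \<in> UNIV \<rightarrow> carrier R \<Longrightarrow> c \<alpha> \<otimes> mon y \<alpha> \<in> carrier R"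
  by auto

lemma ev_closed [simp]: "c \<in> UNIV \<rightarrow> carrier R \<Longrightarrow> ev y d n c \<in> carrier R"
  unfolding ev_def by (rule finsum_closed) auto

lemma ev_add:
  assumes "c \<in> UNIV \<rightarrow> carrier R" "c' \<in> UNIV \<rightarrow> carrier R"
  shows "ev y d n (\<lambda>\<alpha>. c \<alpha> \<oplus> c' \<alpha>) = ev y d n c \<oplus> ev y d n c'"
proof -
  have "ev y d n (\<lambda>\<alpha>. c \<alpha> \<oplus> c' \<alpha>) = (\<Oplus>\<alpha>\<in>Mon d n. c \<alpha> \<otimes> mon y \<alpha> \<oplus> c' \<alpha> \<otimes> mon y \<alpha>)"
    unfolding ev_def using assms by (intro finsum_cong') (auto simp: l_distr Pi_iff)
  also have "\<dots> = ev y d n c \<oplus> ev y d n c'"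
    unfolding ev_def using assms by (intro finsum_addf) (auto simp: Pi_iff)
  finally show ?thesis .
qed

lemma ev_smult:
  assumes "c \<in> UNIV \<rightarrow> carrier R" "r \<in> carrier R"
  shows "ev y d n (\<lambda>\<alpha>. r \<otimes> c \<alpha>) = r \<otimes> ev y d n c"
proof -
  have "r \<otimes> ev y d n c = (\<Oplus>\<alpha>\<in>Mon d n. r \<otimes> (c \<alpha> \<otimes> mon y \<alpha>))"
    unfolding ev_def using assms by (intro finsum_rdistr) (auto simp: Pi_iff)
  also have "\<dots> = ev y d n (\<lambda>\<alpha>. r \<otimes> c \<alpha>)"
    unfolding ev_def using assms by (intro finsum_cong') (auto simp: m_assoc Pi_iff)
  finally show ?thesis by simp
qed

lemma ev_minus:
  assumes c: "c \<in> UNIV \<rightarrow> carrier R" "c' \<in> UNIV \<rightarrow> carrier R"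
  shows "ev y d n (\<lambda>\<alpha>. c \<alpha> \<ominus> c' \<alpha>) = ev y d n c \<ominus> ev y d n c'"
proof -
  have "(\<lambda>\<alpha>. c \<alpha> \<ominus> c' \<alpha>) = (\<lambda>\<alpha>. c \<alpha> \<oplus> (\<ominus> \<one>) \<otimes> c' \<alpha>)"
    using c by (auto simp: a_minus_def l_minus Pi_iff)
  moreover have "ev y d n (\<lambda>\<alpha>. c \<alpha> \<oplus> (\<ominus> \<one>) \<otimes> c' \<alpha>) = ev y d n c \<oplus> (\<ominus> \<one>) \<otimes> ev y d n c'"
    using ev_add[of c "\<lambda>\<alpha>. (\<ominus> \<one>) \<otimes> c' \<alpha>"] ev_smult[of c' "\<ominus> \<one>"] c by (simp add: Pi_iff)
  moreover have "\<dots> = ev y d n c \<ominus> ev y d n c'" using c by (simp add: a_minus_def l_minus)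
  ultimately show ?thesis by simp
qed

lemma ev_cong:
  assumes "\<And>\<alpha>. \<alpha> \<in> Mon d n \<Longrightarrow> c \<alpha> = c' \<alpha>" "c' \<in> UNIV \<rightarrow> carrier R"
  shows "ev y d n c = ev y d n c'"
  unfolding ev_def using assms by (intro finsum_cong') (auto simp: Pi_iff)

lemma ev_zero: "(\<And>\<alpha>. \<alpha> \<in> Mon d n \<Longrightarrow> c \<alpha> = \<zero>) \<Longrightarrow> ev y d n c = \<zero>"
proof -
  assume "\<And>\<alpha>. \<alpha> \<in> Mon d n \<Longrightarrow> c \<alpha> = \<zero>"
  then have "ev y d n c = (\<Oplus>\<alpha>\<in>Mon d n. \<zero>)"
    unfolding ev_def by (intro finsum_cong') auto
  then show ?thesis by simp
qed

lemma ev_single: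
  assumes "\<alpha> \<in> Mon d n" "r \<in> carrier R"
  shows "ev y d n (\<lambda>\<beta>. if \<beta> = \<alpha> then r else \<zero>) = r \<otimes> mon y \<alpha>"
proof -
  have "ev y d n (\<lambda>\<beta>. if \<beta> = \<alpha> then r else \<zero>) = (\<Oplus>\<beta>\<in>Mon d n. if \<alpha> = \<beta> then r \<otimes> mon y \<beta> else \<zero>)"
    unfolding ev_def using assms by (intro finsum_cong') auto
  also have "\<dots> = r \<otimes> mon y \<alpha>"
    using finsum_singleton[OF assms(1), of "\<lambda>\<beta>. r \<otimes> mon y \<beta>"] assms by simp
  finally show ?thesis .
qed

lemma ev_remove:
  assumes "\<alpha> \<in> Mon d n" "c \<in> UNIV \<rightarrow> carrier R"
  shows "ev y d n c = c \<alpha> \<otimes> mon y \<alpha> \<oplus> ev y d n (c(\<alpha> := \<zero>))"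
proof -
  have "c = (\<lambda>\<beta>. (if \<beta> = \<alpha> then c \<alpha> else \<zero>) \<oplus> (c(\<alpha> := \<zero>)) \<beta>)"
    using assms(2) by (auto simp: Pi_iff)
  then have "ev y d n c = ev y d n (\<lambda>\<beta>. (if \<beta> = \<alpha> then c \<alpha> else \<zero>) \<oplus> (c(\<alpha> := \<zero>)) \<beta>)" by simp
  also have "\<dots> = ev y d n (\<lambda>\<beta>. if \<beta> = \<alpha> then c \<alpha> else \<zero>) \<oplus> ev y d n (c(\<alpha> := \<zero>))"
    using assms(2) by (intro ev_add) (auto simp: Pi_iff)
  also have "ev y d n (\<lambda>\<beta>. if \<beta> = \<alpha> then c \<alpha> else \<zero>) = c \<alpha> \<otimes> mon y \<alpha>"
    by (rule ev_single[OF assms(1)]) (use assms(2) in \<open>auto simp: Pi_iff\<close>)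
  finally show ?thesis .
qed

lemma gid_ideal [simp]: "ideal (gid y d) R"
  unfolding gid_def by (rule genideal_ideal) auto

lemma gid_mem: "i < d \<Longrightarrow> y i \<in> gid y d"
proof -
  assume i: "i < d"
  have "y ` {..<d} \<subseteq> carrier R" by auto
  from genideal_self[OF this] show ?thesis using i unfolding gid_def by auto
qed

lemma gid_mono: "d \<le> e \<Longrightarrow> gid y d \<subseteq> gid y e"
  unfolding gid_def by (rule genideal_mono) auto

lemma mon_mem_ideal_pow: "\<alpha> \<in> Mon d n \<Longrightarrow> mon y \<alpha> \<in> ideal_pow R (gid y d) n"
proof (induction \<alpha> arbitrary: n)
  case empty
  then show ?case by (simp add: Mon_iff)
next
  case (add i \<alpha>)
  then obtain m where n: "n = Suc m" "\<alpha> \<in> Mon d m" "i < d" by (auto simp: Mon_iff)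
  have "y i \<otimes> mon y \<alpha> \<in> gid y d \<cdot> ideal_pow R (gid y d) m"
    using gid_mem[OF n(3)] add.IH[OF n(2)] by (rule ideal_prod.prod)
  then show ?case
    using ideal_prod_commute[OF gid_ideal ideal_pow_ideal[OF gid_ideal]] n(1) by (simp add: mon_add_mset)
qed

text \<open>The ideal generated by \<open>J I\<^sup>n\<close> and the monomials in \<open>S\<close>, where \<open>I = (y\<^sub>0, \<dots>, y\<^sub>d\<^sub>-\<^sub>1)\<close>.\<close>

definition evs :: "nat \<Rightarrow> nat \<Rightarrow> 'a set \<Rightarrow> nat multiset set \<Rightarrow> 'a set" where
  "evs d n J S = {ev y d n c | c. c \<in> UNIV \<rightarrow> carrier R \<and> (\<forall>\<alpha>\<in>Mon d n - S. c \<alpha> \<in> J)}"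

lemma evs_ideal:
  assumes J: "ideal J R" shows "ideal (evs d n J S) R"
proof (rule idealI')
  show "evs d n J S \<subseteq> carrier R" by (auto simp: evs_def)
  have "ev y d n (\<lambda>_. \<zero>) = \<zero>" by (rule ev_zero) simp
  then show "\<zero> \<in> evs d n J S" unfolding evs_def using ideal_D(2)[OF J]
    by (intro CollectI exI[of _ "\<lambda>_. \<zero>"]) auto
  fix v assume "v \<in> evs d n J S"
  then obtain c where c: "v = ev y d n c" "c \<in> UNIV \<rightarrow> carrier R" "\<forall>\<alpha>\<in>Mon d n - S. c \<alpha> \<in> J"
    by (auto simp: evs_def)
  {
    fix w assume "w \<in> evs d n J S"
    then obtain c' where c': "w = ev y d n c'" "c' \<in> UNIV \<rightarrow> carrier R" "\<forall>\<alpha>\<in>Mon d n - S. c' \<alpha> \<in> J"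
      by (auto simp: evs_def)
    have "v \<oplus> w = ev y d n (\<lambda>\<alpha>. c \<alpha> \<oplus> c' \<alpha>)" using ev_add[OF c(2) c'(2)] c(1) c'(1) by simp
    moreover have "(\<lambda>\<alpha>. c \<alpha> \<oplus> c' \<alpha>) \<in> UNIV \<rightarrow> carrier R" using c(2) c'(2) by (auto simp: Pi_iff)
    moreover have "\<forall>\<alpha>\<in>Mon d n - S. c \<alpha> \<oplus> c' \<alpha> \<in> J" using c(3) c'(3) ideal_D(3)[OF J] by blast
    ultimately show "v \<oplus> w \<in> evs d n J S" unfolding evs_def by blast
  }
  fix x assume x: "x \<in> carrier R"
  have "x \<otimes> v = ev y d n (\<lambda>\<alpha>. x \<otimes> c \<alpha>)" using ev_smult[OF c(2) x] c(1) by simp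
  moreover have "(\<lambda>\<alpha>. x \<otimes> c \<alpha>) \<in> UNIV \<rightarrow> carrier R" using c(2) x by (auto simp: Pi_iff)
  moreover have "\<forall>\<alpha>\<in>Mon d n - S. x \<otimes> c \<alpha> \<in> J" using c(3) ideal_D(6)[OF J] x by blast
  ultimately show "x \<otimes> v \<in> evs d n J S" unfolding evs_def by blast
qed

lemma term_mem_evs:
  assumes "ideal J R" "\<alpha> \<in> Mon d n" "r \<in> carrier R" "\<alpha> \<in> S \<or> r \<in> J"
  shows "r \<otimes> mon y \<alpha> \<in> evs d n J S"
proof -
  have "r \<otimes> mon y \<alpha> = ev y d n (\<lambda>\<beta>. if \<beta> = \<alpha> then r else \<zero>)" using ev_single[OF assms(2,3)] by simp
  moreover have "(\<lambda>\<beta>. if \<beta> = \<alpha> then r else \<zero>) \<in> UNIV \<rightarrow> carrier R" using assms by auto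
  moreover have "\<forall>\<beta>\<in>Mon d n - S. (if \<beta> = \<alpha> then r else \<zero>) \<in> J" using assms(4) ideal_D(2)[OF assms(1)] by auto
  ultimately show ?thesis unfolding evs_def by blast
qed

text \<open>Stated for an additively closed set and not only for ideals: in Gauss's lemma the
  products have to be located in sets that are stable under p-th powers as scalars but not under all
  of \<open>R\<close>.\<close>

lemma ev_mult_in:
  assumes A: "\<zero> \<in> A" "\<And>a b. a \<in> A \<Longrightarrow> b \<in> A \<Longrightarrow> a \<oplus> b \<in> A" "A \<subseteq> carrier R"
    and e: "\<And>\<alpha>. e \<alpha> \<in> carrier R" and f: "\<And>\<alpha>. f \<alpha> \<in> carrier R"
    and t: "\<And>\<beta> \<alpha>. \<beta> \<in> Mon d m \<Longrightarrow> \<alpha> \<in> Mon d n \<Longrightarrow> (e \<beta> \<otimes> f \<alpha>) \<otimes> mon y (\<beta> + \<alpha>) \<in> A"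
  shows "ev y d m e \<otimes> ev y d n f \<in> A"
proof -
  have fc: "ev y d n f \<in> carrier R" using f by simp
  have *: "(e \<beta> \<otimes> mon y \<beta>) \<otimes> ev y d n f \<in> A" if b: "\<beta> \<in> Mon d m" for \<beta>
  proof -
    have "(e \<beta> \<otimes> mon y \<beta>) \<otimes> ev y d n f = (\<Oplus>\<alpha>\<in>Mon d n. (e \<beta> \<otimes> mon y \<beta>) \<otimes> (f \<alpha> \<otimes> mon y \<alpha>))"
      unfolding ev_def using e f by (intro finsum_rdistr) auto
    also have "\<dots> \<in> A"
    proof (rule finsum_in_subgroup[OF A finite_Mon])
      fix \<alpha> assume a: "\<alpha> \<in> Mon d n"
      have "(e \<beta> \<otimes> mon y \<beta>) \<otimes> (f \<alpha> \<otimes> mon y \<alpha>) = (e \<beta> \<otimes> f \<alpha>) \<otimes> mon y (\<beta> + \<alpha>)"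
        using e f by (simp add: mon_add m_ac)
      then show "(e \<beta> \<otimes> mon y \<beta>) \<otimes> (f \<alpha> \<otimes> mon y \<alpha>) \<in> A" using t[OF b a] by simp
    qed
    finally show ?thesis .
  qed
  have "ev y d m e \<otimes> ev y d n f = (\<Oplus>\<beta>\<in>Mon d m. (e \<beta> \<otimes> mon y \<beta>) \<otimes> ev y d n f)"
    unfolding ev_def[of y d m e] using e fc by (intro finsum_ldistr) auto
  also have "\<dots> \<in> A" by (rule finsum_in_subgroup[OF A finite_Mon]) (use * in auto)
  finally show ?thesis .
qed

lemma evs_mult:
  assumes "v \<in> evs d n R' UNIV" "w \<in> evs d m J {}" and J: "ideal J R"
  shows "v \<otimes> w \<in> evs d (n + m) J {}"
proof -
  obtain c where c: "v = ev y d n c" "c \<in> UNIV \<rightarrow> carrier R" using assms(1) by (auto simp: evs_def)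
  obtain c' where c': "w = ev y d m c'" "c' \<in> UNIV \<rightarrow> carrier R" "\<forall>\<alpha>\<in>Mon d m. c' \<alpha> \<in> J"
    using assms(2) by (auto simp: evs_def)
  note E = evs_ideal[OF J, of d "n + m" "{}"]
  show ?thesis unfolding c(1) c'(1)
  proof (rule ev_mult_in[OF ideal_D(2,3,1)[OF E]])
    fix \<beta> \<alpha> assume b: "\<beta> \<in> Mon d n" "\<alpha> \<in> Mon d m"
    have "c \<beta> \<otimes> c' \<alpha> \<in> J" using ideal_D(6)[OF J, of "c' \<alpha>" "c \<beta>"] c(2) c'(3) b(2) by auto
    then show "(c \<beta> \<otimes> c' \<alpha>) \<otimes> mon y (\<beta> + \<alpha>) \<in> evs d (n + m) J {}"
      using term_mem_evs[OF J Mon_add[OF b]] ideal_D(8)[OF J] by blast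
  qed (use c c' in auto)
qed

lemma evs_carrier: "evs d n (carrier R) {} = evs d n J UNIV"
  unfolding evs_def by (auto simp: Pi_iff)

lemma ideal_pow_eq_evs: "ideal_pow R (gid y d) n = evs d n J UNIV"
proof
  have sub: "ideal_pow R (gid y d) n \<subseteq> evs d n (carrier R) {}"
  proof (induction n)
    case 0
    have "x \<in> evs d 0 (carrier R) {}" if "x \<in> carrier R" for x
      using term_mem_evs[OF oneideal, of "{#}" d 0 x "{}"] that by (simp add: Mon_iff)
    then show ?case by auto
  next
    case (Suc n)
    have "gid y d \<subseteq> evs d 1 (carrier R) {}"
      unfolding gid_def
    proof (rule genideal_minimal[OF evs_ideal[OF oneideal]])
      have "y i \<in> evs d 1 (carrier R) {}" if "i < d" for i
        using term_mem_evs[OF oneideal, of "{#i#}" d 1 \<one> "{}"] that by (simp add: Mon_iff mon_add_mset)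
      then show "y ` {..<d} \<subseteq> evs d 1 (carrier R) {}" by auto
    qed
    then have "i \<otimes> j \<in> evs d (Suc n) (carrier R) {}" if "i \<in> ideal_pow R (gid y d) n" "j \<in> gid y d" for i j
      using evs_mult[of i d n _ j 1 "carrier R"] Suc that evs_carrier[of d n] oneideal by auto
    then show ?case using ideal_prod_least[OF evs_ideal[OF oneideal]] by simp
  qed
  then show "ideal_pow R (gid y d) n \<subseteq> evs d n J UNIV" using evs_carrier by simp
  show "evs d n J UNIV \<subseteq> ideal_pow R (gid y d) n"
  proof
    fix v assume "v \<in> evs d n J UNIV"
    then obtain c where c: "v = ev y d n c" "c \<in> UNIV \<rightarrow> carrier R" by (auto simp: evs_def)
    note I = ideal_pow_ideal[OF gid_ideal, of d n]
    show "v \<in> ideal_pow R (gid y d) n" unfolding c(1) ev_def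
      by (rule finsum_in_subgroup[OF ideal_D(2,3,1)[OF I] finite_Mon])
        (use c mon_mem_ideal_pow ideal_D(6)[OF I] in \<open>auto simp: Pi_iff\<close>)
  qed
qed

lemma ideal_prod_pow_eq_evs:
  assumes J: "ideal J R"
  shows "J \<cdot> ideal_pow R (gid y d) n = evs d n J {}"
proof
  note I = ideal_pow_ideal[OF gid_ideal, of d n]
  show "J \<cdot> ideal_pow R (gid y d) n \<subseteq> evs d n J {}"
  proof (rule ideal_prod_least[OF evs_ideal[OF J]])
    fix j x assume j: "j \<in> J" and "x \<in> ideal_pow R (gid y d) n"
    then obtain c where c: "x = ev y d n c" "c \<in> UNIV \<rightarrow> carrier R"
      unfolding ideal_pow_eq_evs[where J = J] by (auto simp: evs_def)
    have jc: "j \<in> carrier R" using ideal_D(8)[OF J j] .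
    have "j \<otimes> x = ev y d n (\<lambda>\<alpha>. j \<otimes> c \<alpha>)" using ev_smult[OF c(2) jc] c(1) by simp
    moreover have "(\<lambda>\<alpha>. j \<otimes> c \<alpha>) \<in> UNIV \<rightarrow> carrier R" using c jc by (auto simp: Pi_iff)
    moreover have "\<forall>\<alpha>\<in>Mon d n - {}. j \<otimes> c \<alpha> \<in> J" using ideal_D(7)[OF J j] c(2) by (auto simp: Pi_iff)
    ultimately show "j \<otimes> x \<in> evs d n J {}" unfolding evs_def by blast
  qed
  show "evs d n J {} \<subseteq> J \<cdot> ideal_pow R (gid y d) n"
  proof
    fix v assume "v \<in> evs d n J {}"
    then obtain c where c: "v = ev y d n c" "c \<in> UNIV \<rightarrow> carrier R" "\<forall>\<alpha>\<in>Mon d n. c \<alpha> \<in> J" by (auto simp: evs_def)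
    note P = ideal_prod_is_ideal[OF J I]
    show "v \<in> J \<cdot> ideal_pow R (gid y d) n" unfolding c(1) ev_def
    proof (rule finsum_in_subgroup[OF ideal_D(2,3,1)[OF P] finite_Mon])
      fix \<alpha> assume a: "\<alpha> \<in> Mon d n"
      show "c \<alpha> \<otimes> mon y \<alpha> \<in> J \<cdot> ideal_pow R (gid y d) n"
        by (rule ideal_prod.prod) (use c(3) a mon_mem_ideal_pow in auto)
    qed
  qed
qed

lemma gid_pow_Suc: "ideal_pow R (gid y d) (Suc n) = gid y d \<cdot> ideal_pow R (gid y d) n"
  using ideal_prod_commute[OF ideal_pow_ideal[OF gid_ideal] gid_ideal] by simp

lemma ev_split:
  assumes c: "c \<in> UNIV \<rightarrow> carrier R"
  shows "ev y (Suc d) (Suc n) c = ev y d (Suc n) c \<oplus> y d \<otimes> ev y (Suc d) n (\<lambda>\<alpha>. c (add_mset d \<alpha>))"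
proof -
  have t: "c \<alpha> \<otimes> mon y \<alpha> \<in> carrier R" for \<alpha> using ev_term_closed[OF c] .
  have "ev y (Suc d) (Suc n) c = (\<Oplus>\<alpha>\<in>Mon d (Suc n) \<union> add_mset d ` Mon (Suc d) n. c \<alpha> \<otimes> mon y \<alpha>)"
    unfolding ev_def Mon_split ..
  also have "\<dots> = ev y d (Suc n) c \<oplus> (\<Oplus>\<alpha>\<in>add_mset d ` Mon (Suc d) n. c \<alpha> \<otimes> mon y \<alpha>)"
    unfolding ev_def using t by (intro finsum_Un_disjoint Mon_split_disjoint) auto
  also have "(\<Oplus>\<alpha>\<in>add_mset d ` Mon (Suc d) n. c \<alpha> \<otimes> mon y \<alpha>)
      = (\<Oplus>\<alpha>\<in>Mon (Suc d) n. c (add_mset d \<alpha>) \<otimes> mon y (add_mset d \<alpha>))"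
    using t by (intro finsum_reindex) (auto simp: inj_on_def)
  also have "\<dots> = (\<Oplus>\<alpha>\<in>Mon (Suc d) n. y d \<otimes> (c (add_mset d \<alpha>) \<otimes> mon y \<alpha>))"
    using c by (intro finsum_cong') (auto simp: mon_add_mset m_lcomm Pi_iff)
  also have "\<dots> = y d \<otimes> ev y (Suc d) n (\<lambda>\<alpha>. c (add_mset d \<alpha>))"
    unfolding ev_def using c by (intro finsum_rdistr[symmetric]) (auto simp: Pi_iff)
  finally show ?thesis .
qed

text \<open>A value in I^(n+1) = I I^n is also the value of a form of degree n with coefficients in
  I; the difference of the two forms has value zero, so the vanishing case suffices.\<close>

lemma quasi_regular_aux:
  assumes zero: "\<And>c. c \<in> UNIV \<rightarrow> carrier R \<Longrightarrow> ev y d n c = \<zero> \<Longrightarrow> \<forall>\<alpha>\<in>Mon d n. c \<alpha> \<in> gid y d"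
    and c: "c \<in> UNIV \<rightarrow> carrier R" "ev y d n c \<in> ideal_pow R (gid y d) (Suc n)"
  shows "\<forall>\<alpha>\<in>Mon d n. c \<alpha> \<in> gid y d"
proof -
  have "ev y d n c \<in> evs d n (gid y d) {}"
    using c(2) unfolding gid_pow_Suc ideal_prod_pow_eq_evs[OF gid_ideal] .
  then obtain b where b: "ev y d n c = ev y d n b" "b \<in> UNIV \<rightarrow> carrier R" "\<forall>\<alpha>\<in>Mon d n. b \<alpha> \<in> gid y d"
    by (auto simp: evs_def)
  have "ev y d n (\<lambda>\<alpha>. c \<alpha> \<ominus> b \<alpha>) = \<zero>"
    using ev_minus[OF c(1) b(2)] b by (simp add: a_minus_def r_neg)
  moreover have "(\<lambda>\<alpha>. c \<alpha> \<ominus> b \<alpha>) \<in> UNIV \<rightarrow> carrier R" using c(1) b(2) by (auto simp: Pi_iff)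
  ultimately have *: "\<forall>\<alpha>\<in>Mon d n. c \<alpha> \<ominus> b \<alpha> \<in> gid y d" using zero by blast
  show ?thesis
  proof
    fix \<alpha> assume a: "\<alpha> \<in> Mon d n"
    show "c \<alpha> \<in> gid y d"
      by (rule ideal_minus_cancel[OF gid_ideal, of "b \<alpha>"]) (use * a b(3) c(1) in auto)
  qed
qed

text \<open>The induction on the number of elements shows in passing that \<open>y\<^sub>d\<close> is regular modulo all powers
  of \<open>(y\<^sub>0, \<dots>, y\<^sub>d\<^sub>-\<^sub>1)\<close>.\<close>

lemma quasi_regular_zero:
  assumes "\<forall>k<d. nzd (gid y k) (y k)" "c \<in> UNIV \<rightarrow> carrier R" "ev y d n c = \<zero>"
  shows "\<forall>\<alpha>\<in>Mon d n. c \<alpha> \<in> gid y d"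
  using assms
proof (induction d arbitrary: n c)
  case 0
  show ?case
  proof (cases n)
    case 0
    have "ev y 0 0 c = c {#}" using \<open>c \<in> UNIV \<rightarrow> carrier R\<close> unfolding ev_def by (simp add: Pi_iff)
    then have "c {#} = \<zero>" using \<open>ev y 0 n c = \<zero>\<close> 0 by simp
    then show ?thesis using 0 ideal_D(2)[OF gid_ideal] by simp
  next
    case (Suc m)
    then show ?thesis by simp
  qed
next
  case (Suc d)
  have regd: "\<forall>k<d. nzd (gid y k) (y k)" "nzd (gid y d) (y d)" using Suc.prems(1) by auto
  have QR: "\<forall>\<alpha>\<in>Mon d n. c \<alpha> \<in> gid y d"
    if "c \<in> UNIV \<rightarrow> carrier R" "ev y d n c \<in> ideal_pow R (gid y d) (Suc n)" for n c
    by (rule quasi_regular_aux[OF _ that]) (use Suc.IH[OF regd(1)] in blast)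
  \<comment> \<open>Let I be generated by the first d elements and y_d r lie in I^(j+1). Write r,
    which is in I^j by induction, as a form of degree j. Quasi-regularity of the first d elements
    puts y_d times each coefficient into I, and y_d cancels modulo I.\<close>
  have nzd_pow: "nzd (ideal_pow R (gid y d) j) (y d)" for j
  proof (induction j)
    case 0
    then show ?case by (auto simp: nzd_def)
  next
    case (Suc j)
    show ?case unfolding nzd_def
    proof (intro ballI impI)
      fix r assume r: "r \<in> carrier R" "y d \<otimes> r \<in> ideal_pow R (gid y d) (Suc j)"
      have "y d \<otimes> r \<in> ideal_pow R (gid y d) j"
        using r(2) ideal_pow_antimono[OF gid_ideal, of j "Suc j"] by auto
      then have "r \<in> ideal_pow R (gid y d) j" using nzdD[OF Suc r(1)] by blast
      then obtain c where c: "r = ev y d j c" "c \<in> UNIV \<rightarrow> carrier R"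
        unfolding ideal_pow_eq_evs[where J = "carrier R"] by (auto simp: evs_def)
      have "ev y d j (\<lambda>\<alpha>. y d \<otimes> c \<alpha>) \<in> ideal_pow R (gid y d) (Suc j)"
        using ev_smult[OF c(2) yc] r(2) c(1) by simp
      then have yca: "\<forall>\<alpha>\<in>Mon d j. y d \<otimes> c \<alpha> \<in> gid y d"
        using QR[of "\<lambda>\<alpha>. y d \<otimes> c \<alpha>"] c(2) by (auto simp: Pi_iff)
      have ca: "c \<alpha> \<in> gid y d" if "\<alpha> \<in> Mon d j" for \<alpha>
        using nzdD[OF regd(2), of "c \<alpha>"] yca that c(2) by auto
      have "r \<in> evs d j (gid y d) {}" unfolding evs_def using c ca by blast
      then show "r \<in> ideal_pow R (gid y d) (Suc j)"
        unfolding gid_pow_Suc ideal_prod_pow_eq_evs[OF gid_ideal] .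
    qed
  qed
  \<comment> \<open>Induction on the degree. Write the form as F + Y_d H. Its vanishing puts y_d h,
    hence the value h of H, into the (n+1)-st power of the ideal of the first d elements. So the
    coefficients of H are settled by the degree induction; and h is also the value of a form G in
    the first d variables, so that F + y_d G vanishes and the induction on \<open>d\<close> settles
    F.\<close>
  show ?case using Suc.prems(2,3)
  proof (induction n arbitrary: c)
    case 0
    have "ev y (Suc d) 0 c = c {#}" using \<open>c \<in> UNIV \<rightarrow> carrier R\<close> unfolding ev_def by (simp add: Pi_iff)
    then have "c {#} = \<zero>" using 0 by simp
    then show ?case using ideal_D(2)[OF gid_ideal] by simp
  next
    case (Suc n)
    define c' where "c' = (\<lambda>\<alpha>. c (add_mset d \<alpha>))"
    have c': "c' \<in> UNIV \<rightarrow> carrier R" using Suc.prems(1) unfolding c'_def by auto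
    define h where "h = ev y (Suc d) n c'"
    have hc: "h \<in> carrier R" unfolding h_def using c' by simp
    note P = ideal_pow_ideal[OF gid_ideal, of d "Suc n"]
    have e1: "ev y d (Suc n) c \<in> ideal_pow R (gid y d) (Suc n)"
      unfolding ideal_pow_eq_evs[where J = "carrier R"] evs_def using Suc.prems(1) by blast
    have e0: "ev y d (Suc n) c \<oplus> y d \<otimes> h = \<zero>"
      using ev_split[OF Suc.prems(1), of d n] Suc.prems(2) unfolding h_def c'_def by simp
    then have "y d \<otimes> h \<in> ideal_pow R (gid y d) (Suc n)"
      using ideal_add_cancel[OF P e1, of "y d \<otimes> h"] ideal_D(2)[OF P] hc by simp
    then have h_in: "h \<in> ideal_pow R (gid y d) (Suc n)" using nzdD[OF nzd_pow hc] by blast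
    then obtain g where g: "h = ev y d (Suc n) g" "g \<in> UNIV \<rightarrow> carrier R"
      unfolding ideal_pow_eq_evs[where J = "carrier R"] by (auto simp: evs_def)
    have "h \<in> ideal_pow R (gid y (Suc d)) (Suc n)"
      using subsetD[OF ideal_pow_mono[OF gid_mono[of d "Suc d"]] h_in] by simp
    then have c'_in: "\<forall>\<alpha>\<in>Mon (Suc d) n. c' \<alpha> \<in> gid y (Suc d)"
      unfolding h_def by (intro quasi_regular_aux[OF _ c']) (use Suc.IH in blast)+
    have "ev y d (Suc n) (\<lambda>\<alpha>. c \<alpha> \<oplus> y d \<otimes> g \<alpha>) = ev y d (Suc n) c \<oplus> y d \<otimes> h"
      using ev_add[OF Suc.prems(1), of "\<lambda>\<alpha>. y d \<otimes> g \<alpha>"] ev_smult[OF g(2) yc] g by (simp add: Pi_iff)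
    then have "ev y d (Suc n) (\<lambda>\<alpha>. c \<alpha> \<oplus> y d \<otimes> g \<alpha>) = \<zero>" using e0 by simp
    moreover have "(\<lambda>\<alpha>. c \<alpha> \<oplus> y d \<otimes> g \<alpha>) \<in> UNIV \<rightarrow> carrier R" using Suc.prems(1) g(2) by (auto simp: Pi_iff)
    ultimately have cg: "\<forall>\<alpha>\<in>Mon d (Suc n). c \<alpha> \<oplus> y d \<otimes> g \<alpha> \<in> gid y d"
      using Suc.IH[of _] \<open>\<And>n c. \<lbrakk>\<forall>k<d. nzd (gid y k) (y k); c \<in> UNIV \<rightarrow> carrier R; ev y d n c = \<zero>\<rbrakk> \<Longrightarrow> \<forall>\<alpha>\<in>Mon d n. c \<alpha> \<in> gid y d\<close>[OF regd(1)]
      by blast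
    show ?case
    proof
      fix \<alpha> assume "\<alpha> \<in> Mon (Suc d) (Suc n)"
      then consider "\<alpha> \<in> Mon d (Suc n)" | \<beta> where "\<beta> \<in> Mon (Suc d) n" "\<alpha> = add_mset d \<beta>"
        unfolding Mon_split by blast
      then show "c \<alpha> \<in> gid y (Suc d)"
      proof cases
        case 1
        have "c \<alpha> \<oplus> y d \<otimes> g \<alpha> \<in> gid y (Suc d)" using cg 1 gid_mono[of d "Suc d"] by auto
        moreover have "y d \<otimes> g \<alpha> \<in> gid y (Suc d)"
          using ideal_D(7)[OF gid_ideal gid_mem[of d "Suc d"]] g(2) by auto
        moreover have "c \<alpha> \<in> carrier R" "g \<alpha> \<in> carrier R" using Suc.prems(1) g(2) by auto
        ultimately show ?thesis
          using ideal_add_cancel[OF gid_ideal, of "y d \<otimes> g \<alpha>" "Suc d" "c \<alpha>"] by (simp add: a_comm)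
      next
        case 2
        then show ?thesis using c'_in unfolding c'_def by blast
      qed
    qed
  qed
qed

lemma quasi_regular:
  assumes "\<forall>k<d. nzd (gid y k) (y k)" "c \<in> UNIV \<rightarrow> carrier R"
    "ev y d n c \<in> ideal_pow R (gid y d) (Suc n)" "\<alpha> \<in> Mon d n"
  shows "c \<alpha> \<in> gid y d"
  using quasi_regular_aux[of d n c] quasi_regular_zero[OF assms(1)] assms(2-4) by blast

text \<open>Monomials are adjoined one at a time. Each step is cyclic, and by quasi-regularity its
  annihilator is exactly \<open>J\<close>, so it has the length of R/J.\<close>

lemma ilen_evs:
  assumes reg: "\<forall>k<d. nzd (gid y k) (y k)" and J: "ideal J R" "gid y d \<subseteq> J" and S: "S \<subseteq> Mon d n"
  shows "ilen (evs d n J {}) (evs d n J S) = of_nat (card S) * ilen J (carrier R)"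
proof -
  have "finite S" using S finite_subset finite_Mon by blast
  then show ?thesis using S
  proof (induction S rule: finite_induct)
    case empty
    then show ?case by simp
  next
    case (insert \<alpha> S)
    have E: "ideal (evs d n J S) R" "ideal (evs d n J {}) R" "ideal (evs d n J (insert \<alpha> S)) R"
      using evs_ideal[OF J(1)] by auto
    have a: "\<alpha> \<in> Mon d n" using insert.prems by auto
    have eq: "Idl (insert (mon y \<alpha>) (evs d n J S)) = evs d n J (insert \<alpha> S)"
    proof
      have "mon y \<alpha> \<in> evs d n J (insert \<alpha> S)"
        using term_mem_evs[OF J(1) a one_closed, of "insert \<alpha> S"] by simp
      moreover have "evs d n J S \<subseteq> evs d n J (insert \<alpha> S)" unfolding evs_def by blast
      ultimately show "Idl (insert (mon y \<alpha>) (evs d n J S)) \<subseteq> evs d n J (insert \<alpha> S)"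
        by (intro genideal_minimal E) auto
      show "evs d n J (insert \<alpha> S) \<subseteq> Idl (insert (mon y \<alpha>) (evs d n J S))"
      proof
        fix v assume "v \<in> evs d n J (insert \<alpha> S)"
        then obtain c where c: "v = ev y d n c" "c \<in> UNIV \<rightarrow> carrier R" "\<forall>\<beta>\<in>Mon d n - insert \<alpha> S. c \<beta> \<in> J"
          by (auto simp: evs_def)
        have "c(\<alpha> := \<zero>) \<in> UNIV \<rightarrow> carrier R" "\<forall>\<beta>\<in>Mon d n - S. (c(\<alpha> := \<zero>)) \<beta> \<in> J"
          using c ideal_D(2)[OF J(1)] by auto
        then have e: "ev y d n (c(\<alpha> := \<zero>)) \<in> evs d n J S" unfolding evs_def by blast
        have ca: "c \<alpha> \<in> carrier R" using c(2) by auto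
        have "v = ev y d n (c(\<alpha> := \<zero>)) \<oplus> c \<alpha> \<otimes> mon y \<alpha>"
          using ev_remove[OF a c(2)] c(1) ideal_D(8)[OF E(1) e] ca by (simp add: a_comm)
        then show "v \<in> Idl (insert (mon y \<alpha>) (evs d n J S))"
          using mem_genideal_insert[OF E(1) mon_closed] e ca by blast
      qed
    qed
    have col: "colon (evs d n J S) (mon y \<alpha>) = J"
    proof
      show "J \<subseteq> colon (evs d n J S) (mon y \<alpha>)"
        using term_mem_evs[OF J(1) a, of _ S] ideal_D(8)[OF J(1)] by (auto simp: colon_def m_comm)
      show "colon (evs d n J S) (mon y \<alpha>) \<subseteq> J"
      proof
        fix r assume "r \<in> colon (evs d n J S) (mon y \<alpha>)"
        then have r: "r \<in> carrier R" "r \<otimes> mon y \<alpha> \<in> evs d n J S" by (auto simp: colon_def m_comm)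
        then obtain c where c: "r \<otimes> mon y \<alpha> = ev y d n c" "c \<in> UNIV \<rightarrow> carrier R" "\<forall>\<beta>\<in>Mon d n - S. c \<beta> \<in> J"
          by (auto simp: evs_def)
        define e where "e = (\<lambda>\<beta>. if \<beta> = \<alpha> then r else \<zero>)"
        have ec: "e \<in> UNIV \<rightarrow> carrier R" using r(1) unfolding e_def by auto
        have "ev y d n (\<lambda>\<beta>. e \<beta> \<ominus> c \<beta>) = \<zero>"
          using ev_minus[OF ec c(2)] ev_single[OF a r(1)] c(1) ev_closed[OF c(2)]
          unfolding e_def by (simp add: a_minus_def r_neg)
        moreover have "(\<lambda>\<beta>. e \<beta> \<ominus> c \<beta>) \<in> UNIV \<rightarrow> carrier R" using ec c(2) by (auto simp: Pi_iff)
        ultimately have "e \<alpha> \<ominus> c \<alpha> \<in> gid y d" using quasi_regular_zero[OF reg] a by blast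
        then have "r \<ominus> c \<alpha> \<in> J" using J(2) unfolding e_def by auto
        moreover have "c \<alpha> \<in> J" using c(3) a insert.hyps(2) by blast
        ultimately show "r \<in> J" using ideal_minus_cancel[OF J(1) _ r(1)] by blast
      qed
    qed
    have sub: "evs d n J {} \<subseteq> evs d n J S" "evs d n J S \<subseteq> evs d n J (insert \<alpha> S)"
      unfolding evs_def by blast+
    have "ilen (evs d n J {}) (evs d n J (insert \<alpha> S))
        = ilen (evs d n J {}) (evs d n J S) + ilen (evs d n J S) (evs d n J (insert \<alpha> S))"
      by (rule ilen_add[OF E(2,1,3) sub])
    also have "ilen (evs d n J S) (evs d n J (insert \<alpha> S)) = ilen J (carrier R)"
      using ilen_cyclic[OF E(1) mon_closed, of \<alpha>] eq col by simp
    also have "ilen (evs d n J {}) (evs d n J S) = of_nat (card S) * ilen J (carrier R)"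
      using insert.IH insert.prems by auto
    finally show ?case using insert.hyps by (simp add: distrib_right add.commute)
  qed
qed

text \<open>I^n/J I^n is free over R/J on the monomials of degree n. \<open>J\<close> = I gives the
  Hilbert function of I; \<open>J\<close> = I^* measures what tight closure adds.\<close>

lemma ilen_prod_pow:
  assumes "\<forall>k<d. nzd (gid y k) (y k)" "ideal J R" "gid y d \<subseteq> J"
  shows "ilen (J \<cdot> ideal_pow R (gid y d) n) (ideal_pow R (gid y d) n)
    = of_nat (card (Mon d n)) * ilen J (carrier R)"
proof -
  have "evs d n J (Mon d n) = evs d n J UNIV" unfolding evs_def by blast
  then show ?thesis
    using ilen_evs[OF assms order_refl, of n] ideal_prod_pow_eq_evs[OF assms(2), of d n]
      ideal_pow_eq_evs[of d n J] by metis
qed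

lemma ilen_pow:
  assumes "\<forall>k<d. nzd (gid y k) (y k)"
  shows "ilen (ideal_pow R (gid y d) n) (carrier R)
    = of_nat (\<Sum>k<n. card (Mon d k)) * ilen (gid y d) (carrier R)"
proof (induction n)
  case (Suc n)
  note P = ideal_pow_ideal[OF gid_ideal]
  have "ilen (ideal_pow R (gid y d) (Suc n)) (carrier R)
      = ilen (ideal_pow R (gid y d) (Suc n)) (ideal_pow R (gid y d) n)
        + ilen (ideal_pow R (gid y d) n) (carrier R)"
    using ideal_pow_antimono[OF gid_ideal, of n "Suc n"] ideal_D(1)[OF P]
    by (intro ilen_add P oneideal) auto
  also have "ilen (ideal_pow R (gid y d) (Suc n)) (ideal_pow R (gid y d) n)
      = of_nat (card (Mon d n)) * ilen (gid y d) (carrier R)"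
    using ilen_prod_pow[OF assms gid_ideal order_refl] unfolding gid_pow_Suc .
  finally show ?case using Suc by (simp add: distrib_right add.commute)
qed simp

end

end

text \<open>Hockey-stick summation; for \<open>n = 0\<close> both sides vanish, the right one
  because d - 1 < d.\<close>

lemma sum_card_Mon:
  assumes "d \<ge> 1"
  shows "(\<Sum>k<n. card (Mon d k)) = (n + d - 1) choose d"
proof -
  have c: "card (Mon d k) = (d - 1 + k) choose k" for k
    using card_multisets_of_size[of "{..<d}" k] assms by simp
  show ?thesis
  proof (cases n)
    case 0
    then show ?thesis using assms by (simp add: binomial_eq_0)
  next
    case (Suc m)
    have "(\<Sum>k<n. card (Mon d k)) = (\<Sum>k\<le>m. (d - 1 + k) choose k)"
      unfolding c Suc lessThan_Suc_atMost ..
    also have "\<dots> = (\<Sum>k\<le>m. (d - 1 + k) choose (d - 1))"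
      using binomial_symmetric[of "d - 1" "d - 1 + _"] by simp
    also have "\<dots> = (d - 1 + m + 1) choose (d - 1 + 1)" by (rule choose_rising_sum(1))
    also have "\<dots> = (d + m) choose d" using assms by simp
    finally show ?thesis using Suc by (simp add: add.commute)
  qed
qed

section \<open>Graded submodules and the Artin--Rees lemma\<close>

text \<open>A monotone subsequence that decreases is constant from some point on, hence also
  increasing.\<close>

lemma exists_incseq_subseq_nat:
  fixes s :: "nat \<Rightarrow> nat"
  shows "\<exists>r::nat \<Rightarrow> nat. strict_mono r \<and> (\<forall>k. s (r k) \<le> s (r (Suc k)))"
proof -
  obtain f :: "nat \<Rightarrow> nat" where f: "strict_mono f" "monoseq (\<lambda>n. s (f n))"
    using seq_monosub by blast
  show ?thesis
  proof (cases "\<forall>m. \<forall>n\<ge>m. s (f m) \<le> s (f n)")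
    case True
    then show ?thesis using f(1) by (intro exI[of _ f]) auto
  next
    case False
    then have dec: "\<And>m n. m \<le> n \<Longrightarrow> s (f n) \<le> s (f m)" using f(2) unfolding monoseq_def by blast
    define v where "v = (LEAST v. \<exists>n. s (f n) = v)"
    have "\<exists>n. s (f n) = v" unfolding v_def by (rule LeastI_ex) blast
    then obtain N where N: "s (f N) = v" by blast
    have "v \<le> s (f n)" for n unfolding v_def by (rule Least_le) blast
    then have eq: "s (f (N + n)) = v" for n using dec[of N "N + n"] N by (simp add: antisym)
    have "strict_mono (\<lambda>n. f (N + n))" using f(1) by (auto simp: strict_mono_def)
    then show ?thesis using eq by (intro exI[of _ "\<lambda>n. f (N + n)"]) (metis add_Suc_right order_refl)
  qed
qed

lemma dickson_subseq:
  fixes f :: "nat \<Rightarrow> nat \<Rightarrow> nat"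
  shows "\<exists>r::nat \<Rightarrow> nat. strict_mono r \<and> (\<forall>i<d. \<forall>k. f (r k) i \<le> f (r (Suc k)) i)"
proof (induction d)
  case 0
  show ?case by (intro exI[of _ id]) (auto simp: strict_mono_def)
next
  case (Suc d)
  then obtain r where r: "strict_mono r" "\<forall>i<d. \<forall>k. f (r k) i \<le> f (r (Suc k)) i" by blast
  obtain q :: "nat \<Rightarrow> nat" where q: "strict_mono q" "\<forall>k. f (r (q k)) d \<le> f (r (q (Suc k))) d"
    using exists_incseq_subseq_nat[of "\<lambda>k. f (r k) d"] by blast
  have m: "strict_mono (r \<circ> q)" using strict_mono_o[OF r(1) q(1)] .
  have "f (r (q k)) i \<le> f (r (q (Suc k))) i" if "i < d" for i k
  proof (rule lift_Suc_mono_le[of "\<lambda>k. f (r k) i"])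
    show "f (r n) i \<le> f (r (Suc n)) i" for n using r(2) that by blast
    show "q k \<le> q (Suc k)" using q(1) by (simp add: strict_mono_less_eq)
  qed
  then have "\<forall>i<Suc d. \<forall>k. f ((r \<circ> q) k) i \<le> f ((r \<circ> q) (Suc k)) i" using q(2) by (auto simp: less_Suc_eq)
  then show ?case using m by blast
qed

text \<open>Dickson's lemma. An infinite divisibility chain, and not just one divisible pair, is
  extracted because the ascending chain condition is applied along it.\<close>

lemma dickson_multiset:
  fixes a :: "nat \<Rightarrow> nat multiset"
  assumes "\<And>k. set_mset (a k) \<subseteq> {..<d}"
  shows "\<exists>r::nat \<Rightarrow> nat. strict_mono r \<and> (\<forall>k. a (r k) \<subseteq># a (r (Suc k)))"
proof -
  obtain r :: "nat \<Rightarrow> nat" where r: "strict_mono r" "\<forall>i<d. \<forall>k. count (a (r k)) i \<le> count (a (r (Suc k))) i"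
    using dickson_subseq[of d "\<lambda>k i. count (a k) i"] by blast
  have "count (a (r k)) i \<le> count (a (r (Suc k))) i" for k i
  proof (cases "i < d")
    case True then show ?thesis using r(2) by blast
  next
    case False
    then have "i \<notin># a (r k)" using assms[of "r k"] by auto
    then show ?thesis by (simp add: not_in_iff)
  qed
  then show ?thesis using r(1) by (auto simp: subseteq_mset_def)
qed

section \<open>Graded submodules of free modules over a polynomial ring\<close>

context cring
begin

text \<open>Multiplication by Y_i on coefficient families; the first component of the index is the
  basis vector.\<close>

definition shift :: "nat \<Rightarrow> (nat \<times> nat multiset \<Rightarrow> 'a) \<Rightarrow> nat \<times> nat multiset \<Rightarrow> 'a" where
  "shift i f = (\<lambda>(j, \<gamma>). if i \<in># \<gamma> then f (j, \<gamma> - {#i#}) else \<zero>)"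

text \<open>All sums of products Y_i h with h in \<open>H\<close>. Scalars are absent because
  \<open>H\<close> is closed under them in the applications.\<close>

inductive_set shift_span :: "nat \<Rightarrow> (nat \<times> nat multiset \<Rightarrow> 'a) set \<Rightarrow> (nat \<times> nat multiset \<Rightarrow> 'a) set"
  for d H where
  zero: "(\<lambda>_. \<zero>) \<in> shift_span d H"
| step: "f \<in> shift_span d H \<Longrightarrow> h \<in> H \<Longrightarrow> i < d \<Longrightarrow> (\<lambda>\<omega>. f \<omega> \<oplus> shift i h \<omega>) \<in> shift_span d H"

end

context noetherian_cring
begin

text \<open>Graded submodules of a finite free module over \<open>R[Y\<^sub>0, \<dots>, Y\<^sub>d\<^sub>-\<^sub>1]\<close> are finitely generated; elements are
  given by their coefficients, indexed by a basis vector \<open>j < t\<close> and a monomial. The proof compares ideals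
  of leading coefficients along the divisibility order of the monomials.\<close>

lemma graded_submodule_fg:
  fixes H :: "nat \<Rightarrow> (nat \<times> nat multiset \<Rightarrow> 'a) set" and d t :: nat
  assumes Hc: "\<And>n f \<omega>. f \<in> H n \<Longrightarrow> f \<omega> \<in> carrier R"
    and Hsupp: "\<And>n f j \<alpha>. f \<in> H n \<Longrightarrow> f (j, \<alpha>) \<noteq> \<zero> \<Longrightarrow> j < t \<and> \<alpha> \<in> Mon d n"
    and Hadd: "\<And>n f g. f \<in> H n \<Longrightarrow> g \<in> H n \<Longrightarrow> (\<lambda>\<omega>. f \<omega> \<oplus> g \<omega>) \<in> H n"
    and Hsmult: "\<And>n f r. f \<in> H n \<Longrightarrow> r \<in> carrier R \<Longrightarrow> (\<lambda>\<omega>. r \<otimes> f \<omega>) \<in> H n"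
    and Hzero: "\<And>n. (\<lambda>_. \<zero>) \<in> H n"
    and Hshift: "\<And>n f i. f \<in> H n \<Longrightarrow> i < d \<Longrightarrow> shift i f \<in> H (Suc n)"
  shows "\<exists>n0. \<forall>n\<ge>n0. H (Suc n) \<subseteq> shift_span d (H n)"
proof -
  \<comment> \<open>Leading coefficients for the order that compares the basis index before the
    monomial. As the multiset order respects multiplication, multiplying by Y_i moves the leading
    position by Y_i.\<close>
  define L where "L j \<alpha> = {f (j, \<alpha>) | f. f \<in> H (size \<alpha>) \<and> (\<forall>\<omega>>(j, \<alpha>). f \<omega> = \<zero>)}" for j and \<alpha> :: "nat multiset"
  have L_I: "f (j, \<alpha>) \<in> L j \<alpha>" if "f \<in> H (size \<alpha>)" "\<forall>\<omega>>(j, \<alpha>). f \<omega> = \<zero>" for f j \<alpha>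
    using that unfolding L_def by blast
  have L_ideal: "ideal (L j \<alpha>) R" for j \<alpha>
  proof (rule idealI')
    show "L j \<alpha> \<subseteq> carrier R" using Hc by (auto simp: L_def)
    show "\<zero> \<in> L j \<alpha>" using Hzero unfolding L_def by (intro CollectI exI[of _ "\<lambda>_. \<zero>"]) auto
    fix a assume "a \<in> L j \<alpha>"
    then obtain f where f: "a = f (j, \<alpha>)" "f \<in> H (size \<alpha>)" "\<forall>\<omega>>(j, \<alpha>). f \<omega> = \<zero>" by (auto simp: L_def)
    {
      fix b assume "b \<in> L j \<alpha>"
      then obtain g where g: "b = g (j, \<alpha>)" "g \<in> H (size \<alpha>)" "\<forall>\<omega>>(j, \<alpha>). g \<omega> = \<zero>" by (auto simp: L_def)
      have "(\<lambda>\<omega>. f \<omega> \<oplus> g \<omega>) \<in> H (size \<alpha>)" using Hadd f g by blast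
      moreover have "\<forall>\<omega>>(j, \<alpha>). f \<omega> \<oplus> g \<omega> = \<zero>" using f(3) g(3) by simp
      ultimately show "a \<oplus> b \<in> L j \<alpha>" using L_I[of "\<lambda>\<omega>. f \<omega> \<oplus> g \<omega>" \<alpha> j] f(1) g(1) by simp
    }
    fix x assume x: "x \<in> carrier R"
    have "(\<lambda>\<omega>. x \<otimes> f \<omega>) \<in> H (size \<alpha>)" using Hsmult f x by blast
    moreover have "\<forall>\<omega>>(j, \<alpha>). x \<otimes> f \<omega> = \<zero>" using f(3) x by simp
    ultimately show "x \<otimes> a \<in> L j \<alpha>" using L_I[of "\<lambda>\<omega>. x \<otimes> f \<omega>" \<alpha> j] f(1) by simp
  qed
  have lex_shift: "(j', \<gamma> - {#i#}) > (j, \<alpha>)" if "(j', \<gamma>) > (j, add_mset i \<alpha>)" "i \<in># \<gamma>" for j j' i :: nat and \<alpha> \<gamma>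
  proof -
    have eq: "\<gamma> = (\<gamma> - {#i#}) + {#i#}" using that(2) by simp
    have "j < j' \<or> j = j' \<and> \<alpha> + {#i#} < (\<gamma> - {#i#}) + {#i#}" using that(1) eq by auto
    then show ?thesis unfolding add_less_cancel_right by auto
  qed
  have L_step: "L j \<alpha> \<subseteq> L j (add_mset i \<alpha>)" if i: "i < d" for j i \<alpha>
  proof
    fix a assume "a \<in> L j \<alpha>"
    then obtain f where f: "a = f (j, \<alpha>)" "f \<in> H (size \<alpha>)" "\<forall>\<omega>>(j, \<alpha>). f \<omega> = \<zero>" by (auto simp: L_def)
    have "shift i f \<in> H (size (add_mset i \<alpha>))" using Hshift[OF f(2) i] by simp
    moreover have "shift i f \<omega> = \<zero>" if w: "\<omega> > (j, add_mset i \<alpha>)" for \<omega>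
    proof -
      obtain j' \<gamma> where "\<omega> = (j', \<gamma>)" by (cases \<omega>) auto
      then show ?thesis using f(3) lex_shift[of j i \<alpha> j' \<gamma>] w by (auto simp: shift_def)
    qed
    moreover have "a = shift i f (j, add_mset i \<alpha>)" using f(1) by (simp add: shift_def)
    ultimately show "a \<in> L j (add_mset i \<alpha>)" using L_I[of "shift i f" "add_mset i \<alpha>" j] by simp
  qed
  have L_mono: "L j \<alpha> \<subseteq> L j (\<alpha> + \<beta>)" if "set_mset \<beta> \<subseteq> {..<d}" for j \<alpha> \<beta>
    using that
  proof (induction \<beta>)
    case (add i \<beta>)
    then show ?case using L_step[of i j "\<alpha> + \<beta>"] by auto
  qed simp
  \<comment> \<open>Monomials whose leading ideal is not inherited on removal of any one variable.
    Infinitely many of them would contain a divisibility chain, along which the leading ideals would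
    increase strictly.\<close>
  define Bad where "Bad j = {\<alpha>. set_mset \<alpha> \<subseteq> {..<d} \<and> (\<forall>i. i \<in># \<alpha> \<longrightarrow> L j (\<alpha> - {#i#}) \<noteq> L j \<alpha>)}" for j
  have fin: "finite (Bad j)" for j
  proof (rule ccontr)
    assume "infinite (Bad j)"
    then obtain a :: "nat \<Rightarrow> nat multiset" where a: "inj a" "range a \<subseteq> Bad j"
      using infinite_countable_subset by blast
    have aB: "a k \<in> Bad j" for k using a(2) by auto
    then have as: "set_mset (a k) \<subseteq> {..<d}" for k unfolding Bad_def by blast
    obtain r :: "nat \<Rightarrow> nat" where r: "strict_mono r" "\<forall>k. a (r k) \<subseteq># a (r (Suc k))"
      using dickson_multiset[of a d, OF as] by blast
    have strict: "L j (a (r k)) \<subset> L j (a (r (Suc k)))" for k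
    proof -
      let ?\<alpha> = "a (r k)" and ?\<beta> = "a (r (Suc k))"
      have "r k \<noteq> r (Suc k)" using r(1) by (metis lessI less_irrefl strict_mono_less)
      then have ne: "?\<alpha> \<noteq> ?\<beta>" using a(1) by (auto dest: injD)
      have eq: "?\<beta> = ?\<alpha> + (?\<beta> - ?\<alpha>)" using r(2) by (metis subset_mset.add_diff_inverse)
      then have "?\<beta> - ?\<alpha> \<noteq> {#}" using ne by (metis add.right_neutral)
      then obtain i where i: "i \<in># ?\<beta> - ?\<alpha>" by blast
      define \<delta> where "\<delta> = ?\<beta> - ?\<alpha> - {#i#}"
      have d1: "?\<beta> - ?\<alpha> = add_mset i \<delta>" unfolding \<delta>_def by (rule insert_DiffM[OF i, symmetric])
      have b: "?\<beta> - {#i#} = ?\<alpha> + \<delta>" using eq unfolding d1 by (metis add_mset_add_single add_diff_cancel_right' union_mset_add_mset_right)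
      have ib: "i \<in># ?\<beta>" using in_diffD[OF i] .
      have "set_mset \<delta> \<subseteq> set_mset ?\<beta>" unfolding \<delta>_def by (meson in_diffD subsetI)
      then have sd: "set_mset \<delta> \<subseteq> {..<d}" using as[of "r (Suc k)"] by blast
      have id: "i < d" using ib as[of "r (Suc k)"] by auto
      have s1: "L j ?\<alpha> \<subseteq> L j (?\<beta> - {#i#})" using L_mono[OF sd, of j ?\<alpha>] b by simp
      have s2: "L j (?\<beta> - {#i#}) \<subseteq> L j ?\<beta>" using L_step[OF id, of j "?\<beta> - {#i#}"] ib by simp
      have "L j (?\<beta> - {#i#}) \<noteq> L j ?\<beta>" using aB[of "r (Suc k)"] ib unfolding Bad_def by blast
      then show ?thesis using s1 s2 by blast
    qed
    obtain n0 where n0: "\<forall>n\<ge>n0. L j (a (r n)) = L j (a (r n0))"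
      using ideal_chain_stationary[of "\<lambda>k. L j (a (r k))", OF L_ideal] strict by (meson psubset_imp_subset)
    have "L j (a (r (Suc n0))) = L j (a (r n0))" using n0 le_SucI by blast
    then show False using strict[of n0] by simp
  qed
  \<comment> \<open>Beyond the largest degree of a bad monomial every leading coefficient already
    occurs one degree lower at a divisor, so the leading term of f is cancelled by some Y_i h.
    Well-foundedness of the order ends the process.\<close>
  have finU: "finite (\<Union>j<t. size ` Bad j)" using fin by auto
  from finU[unfolded finite_nat_set_iff_bounded]
  obtain n0 where n0: "\<forall>m\<in>(\<Union>j<t. size ` Bad j). m < n0" by blast
  have "f \<in> shift_span d (H n)" if n: "n \<ge> n0" and f: "f \<in> H (Suc n)" for n f
  proof -
    have P: "\<forall>f\<in>H (Suc n). (\<forall>\<omega>'\<ge>\<omega>. f \<omega>' = \<zero>) \<longrightarrow> f \<in> shift_span d (H n)" for \<omega> :: "nat \<times> nat multiset"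
    proof (induction \<omega> rule: less_induct)
      case (less \<omega>)
      show ?case
      proof (intro ballI impI)
        fix f assume f: "f \<in> H (Suc n)" "\<forall>\<omega>'\<ge>\<omega>. f \<omega>' = \<zero>"
        define S where "S = {\<omega>'. f \<omega>' \<noteq> \<zero>}"
        have "S \<subseteq> {..<t} \<times> Mon d (Suc n)" unfolding S_def using Hsupp[OF f(1)] by auto
        then have finS: "finite S" using finite_subset by (metis finite_Mon finite_SigmaI finite_lessThan)
        show "f \<in> shift_span d (H n)"
        proof (cases "S = {}")
          case True
          then have "f = (\<lambda>_. \<zero>)" unfolding S_def by auto
          then show ?thesis using shift_span.zero by simp
        next
          case False
          define m where "m = Max S"
          have mS: "m \<in> S" unfolding m_def using Max_in[OF finS False] .
          obtain j \<alpha> where m: "m = (j, \<alpha>)" by (cases m) auto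
          have fm: "f m \<noteq> \<zero>" using mS unfolding S_def by simp
          have above: "f \<omega>' = \<zero>" if "\<omega>' > m" for \<omega>'
          proof (rule ccontr)
            assume "f \<omega>' \<noteq> \<zero>"
            then have "\<omega>' \<le> m" unfolding m_def using Max_ge[OF finS] by (simp add: S_def)
            then show False using that by simp
          qed
          have m_less: "m < \<omega>" using fm f(2) not_le by blast
          have ja: "j < t" "\<alpha> \<in> Mon d (Suc n)" using Hsupp[OF f(1)] fm unfolding m by auto
          have "size \<alpha> = Suc n" using ja(2) by (simp add: Mon_iff)
          have "\<alpha> \<notin> Bad j"
          proof
            assume "\<alpha> \<in> Bad j"
            then have "size \<alpha> < n0" using n0 ja(1) by blast
            then show False using n \<open>size \<alpha> = Suc n\<close> by simp
          qed
          then obtain i where i: "i \<in># \<alpha>" "L j (\<alpha> - {#i#}) = L j \<alpha>"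
            using ja(2) unfolding Bad_def by (auto simp: Mon_iff)
          have id: "i < d" using i(1) ja(2) by (auto simp: Mon_iff)
          have sz: "size (\<alpha> - {#i#}) = n" using ja(2) i(1) by (simp add: Mon_iff size_Diff_singleton)
          have "f m \<in> L j \<alpha>" unfolding L_def m using f(1) above \<open>size \<alpha> = Suc n\<close> m by auto
          then have "f m \<in> L j (\<alpha> - {#i#})" using i(2) by simp
          then obtain h where h: "f m = h (j, \<alpha> - {#i#})" "h \<in> H n" "\<forall>\<omega>>(j, \<alpha> - {#i#}). h \<omega> = \<zero>"
            unfolding L_def sz by blast
          define f' where "f' = (\<lambda>\<omega>. f \<omega> \<oplus> (\<ominus> \<one>) \<otimes> shift i h \<omega>)"
          have sh: "shift i h \<in> H (Suc n)" using Hshift[OF h(2) id] .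
          have f': "f' \<in> H (Suc n)" unfolding f'_def using Hadd[OF f(1) Hsmult[OF sh, of "\<ominus> \<one>"]] by simp
          have "f' \<omega>' = \<zero>" if w: "\<omega>' \<ge> m" for \<omega>'
          proof (cases "\<omega>' = m")
            case True
            have "shift i h m = f m" using h(1) i(1) unfolding m by (simp add: shift_def)
            then show ?thesis using True Hc[OF f(1), of m] by (simp add: f'_def l_minus r_neg)
          next
            case False
            then have gt: "\<omega>' > m" using w by simp
            obtain j' \<gamma> where w': "\<omega>' = (j', \<gamma>)" by (cases \<omega>') auto
            have "shift i h \<omega>' = \<zero>"
              using h(3) lex_shift[of j i "\<alpha> - {#i#}" j' \<gamma>] gt i(1) unfolding w' m by (auto simp: shift_def)
            then show ?thesis using above[OF gt] by (simp add: f'_def)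
          qed
          then have "f' \<in> shift_span d (H n)" using less.IH[OF m_less] f' by blast
          then have "(\<lambda>\<omega>. f' \<omega> \<oplus> shift i h \<omega>) \<in> shift_span d (H n)" using h(2) id by (rule shift_span.step)
          moreover have "(\<lambda>\<omega>. f' \<omega> \<oplus> shift i h \<omega>) = f"
            using Hc[OF f(1)] Hc[OF sh] by (auto simp: f'_def l_minus a_assoc l_neg)
          ultimately show ?thesis by simp
        qed
      qed
    qed
    \<comment> \<open>\<open>(t, {#})\<close> lies above every position of the support, since basis
      indices are below \<open>t\<close>; it starts the induction.\<close>
    have "f \<omega>' = \<zero>" if "\<omega>' \<ge> (t, {#})" for \<omega>'
    proof (rule ccontr)
      assume "f \<omega>' \<noteq> \<zero>"
      then have "fst \<omega>' < t" using Hsupp[OF f, of "fst \<omega>'" "snd \<omega>'"] by simp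
      then show False using that by (cases \<omega>') auto
    qed
    then show ?thesis using P[of "(t, {#})"] f by blast
  qed
  then show ?thesis by blast
qed

end

context cring
begin

lemma ev_shift:
  assumes yc: "\<And>i. y i \<in> carrier R" and c: "c \<in> UNIV \<rightarrow> carrier R" and i: "i < d"
  shows "ev y d (Suc n) (\<lambda>\<gamma>. if i \<in># \<gamma> then c (\<gamma> - {#i#}) else \<zero>) = y i \<otimes> ev y d n c"
proof -
  note [simp] = mon_closed[of y, OF yc] yc
  have cc: "c \<alpha> \<in> carrier R" for \<alpha> using c by auto
  have "ev y d (Suc n) (\<lambda>\<gamma>. if i \<in># \<gamma> then c (\<gamma> - {#i#}) else \<zero>)
      = (\<Oplus>\<gamma>\<in>add_mset i ` Mon d n. c (\<gamma> - {#i#}) \<otimes> mon y \<gamma>)"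
    unfolding ev_def
  proof (rule add.finprod_mono_neutral_cong_right)
    show "add_mset i ` Mon d n \<subseteq> Mon d (Suc n)" using i by (auto simp: Mon_iff)
    fix \<gamma> assume g: "\<gamma> \<in> Mon d (Suc n) - add_mset i ` Mon d n"
    have "i \<notin># \<gamma>"
    proof
      assume ig: "i \<in># \<gamma>"
      have "\<gamma> = add_mset i (\<gamma> - {#i#})" using ig by simp
      moreover have "\<gamma> - {#i#} \<in> Mon d n" using g ig by (auto simp: Mon_iff size_Diff_singleton dest: in_diffD)
      ultimately show False using g by blast
    qed
    then show "(if i \<in># \<gamma> then c (\<gamma> - {#i#}) else \<zero>) \<otimes> mon y \<gamma> = \<zero>" by simp
  qed (use cc in auto)
  also have "\<dots> = (\<Oplus>\<alpha>\<in>Mon d n. c (add_mset i \<alpha> - {#i#}) \<otimes> mon y (add_mset i \<alpha>))"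
    using cc by (intro finsum_reindex) (auto simp: inj_on_def)
  also have "\<dots> = (\<Oplus>\<alpha>\<in>Mon d n. y i \<otimes> (c \<alpha> \<otimes> mon y \<alpha>))"
    using cc by (intro finsum_cong') (auto simp: mon_add_mset[of y, OF yc] m_lcomm)
  also have "\<dots> = y i \<otimes> ev y d n c"
    unfolding ev_def using cc by (intro finsum_rdistr[symmetric]) auto
  finally show ?thesis .
qed

end

context noetherian_cring
begin

text \<open>The forms whose value at \<open>y\<close> lies in \<open>A\<close> constitute a graded
  submodule of the polynomial ring, taken with a single basis vector. Beyond the degree
  \<open>n0\<close> of its generators, an element of A \<inter> I^(n+1) is a sum of products of some
  y_i with elements of A \<inter> I^n; each degree splits off one factor I.\<close>

lemma artin_rees:
  assumes yc: "\<And>i. y i \<in> carrier R" and A: "ideal A R"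
  shows "\<exists>n0. \<forall>k. A \<inter> ideal_pow R (gid y d) (n0 + k) \<subseteq> ideal_pow R (gid y d) k \<cdot> A"
proof -
  let ?I = "gid y d"
  have I: "ideal ?I R" using gid_ideal[of y, OF yc] .
  note In = ideal_pow_ideal[OF I]
  define H where "H n = {f :: nat \<times> nat multiset \<Rightarrow> 'a. (\<forall>\<omega>. f \<omega> \<in> carrier R) \<and>
    (\<forall>j \<alpha>. f (j, \<alpha>) \<noteq> \<zero> \<longrightarrow> j < 1 \<and> \<alpha> \<in> Mon d n) \<and> ev y d n (\<lambda>\<alpha>. f (0, \<alpha>)) \<in> A}" for n
  have fc: "(\<lambda>\<alpha>. f (0, \<alpha>)) \<in> UNIV \<rightarrow> carrier R" if "f \<in> H n" for f n using that unfolding H_def by auto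
  have sh: "(\<lambda>\<alpha>. shift i f (0, \<alpha>)) = (\<lambda>\<gamma>. if i \<in># \<gamma> then f (0, \<gamma> - {#i#}) else \<zero>)" for i and f :: "nat \<times> nat multiset \<Rightarrow> 'a"
    by (auto simp: shift_def)
  have "\<exists>n0. \<forall>n\<ge>n0. H (Suc n) \<subseteq> shift_span d (H n)"
  proof (rule graded_submodule_fg[where t = 1])
    show "f \<omega> \<in> carrier R" if "f \<in> H n" for n f \<omega> using that unfolding H_def by blast
    show "j < 1 \<and> \<alpha> \<in> Mon d n" if "f \<in> H n" "f (j, \<alpha>) \<noteq> \<zero>" for n f j \<alpha> using that unfolding H_def by blast
    show "(\<lambda>_. \<zero>) \<in> H n" for n
      using ev_zero[of y d n "\<lambda>_. \<zero>", OF yc] ideal_D(2)[OF A] unfolding H_def by simp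
    show "(\<lambda>\<omega>. f \<omega> \<oplus> g \<omega>) \<in> H n" if fg: "f \<in> H n" "g \<in> H n" for n f g
    proof -
      have "ev y d n (\<lambda>\<alpha>. f (0, \<alpha>) \<oplus> g (0, \<alpha>)) \<in> A"
        using ev_add[of y, OF yc fc[OF fg(1)] fc[OF fg(2)]] fg ideal_D(3)[OF A] unfolding H_def by simp
      moreover have "j < 1 \<and> \<alpha> \<in> Mon d n" if "f (j, \<alpha>) \<oplus> g (j, \<alpha>) \<noteq> \<zero>" for j \<alpha>
      proof -
        have "f (j, \<alpha>) \<noteq> \<zero> \<or> g (j, \<alpha>) \<noteq> \<zero>" using that by auto
        then show ?thesis using fg unfolding H_def by blast
      qed
      ultimately show ?thesis using fg unfolding H_def by simp
    qed
    show "(\<lambda>\<omega>. r \<otimes> f \<omega>) \<in> H n" if f: "f \<in> H n" and r: "r \<in> carrier R" for n f r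
    proof -
      have "ev y d n (\<lambda>\<alpha>. r \<otimes> f (0, \<alpha>)) \<in> A"
        using ev_smult[of y, OF yc fc[OF f] r] f ideal_D(6)[OF A _ r] unfolding H_def by simp
      moreover have "j < 1 \<and> \<alpha> \<in> Mon d n" if "r \<otimes> f (j, \<alpha>) \<noteq> \<zero>" for j \<alpha>
      proof -
        have "f (j, \<alpha>) \<noteq> \<zero>" using that r by auto
        then show ?thesis using f unfolding H_def by blast
      qed
      ultimately show ?thesis using f r unfolding H_def by simp
    qed
    show "shift i f \<in> H (Suc n)" if f: "f \<in> H n" and i: "i < d" for n f i
    proof -
      have "ev y d (Suc n) (\<lambda>\<alpha>. shift i f (0, \<alpha>)) \<in> A"
        unfolding sh using ev_shift[of y, OF yc fc[OF f] i, where n = n] f ideal_D(6)[OF A _ yc] unfolding H_def by simp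
      moreover have "j < 1 \<and> \<alpha> \<in> Mon d (Suc n)" if nz: "shift i f (j, \<alpha>) \<noteq> \<zero>" for j \<alpha>
      proof -
        have ia: "i \<in># \<alpha>" "f (j, \<alpha> - {#i#}) \<noteq> \<zero>" using nz by (auto simp: shift_def split: if_splits)
        then have "j < 1" "\<alpha> - {#i#} \<in> Mon d n" using f unfolding H_def by blast+
        moreover have "add_mset i (\<alpha> - {#i#}) \<in> Mon d (Suc n)" using calculation(2) i by (auto simp: Mon_iff)
        ultimately show ?thesis using ia(1) by simp
      qed
      moreover have "shift i f \<omega> \<in> carrier R" for \<omega> using f unfolding H_def by (cases \<omega>) (auto simp: shift_def)
      ultimately show ?thesis unfolding H_def by blast
    qed
  qed
  then obtain n0 where n0: "\<And>n. n \<ge> n0 \<Longrightarrow> H (Suc n) \<subseteq> shift_span d (H n)" by blast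
  have An: "ideal (A \<inter> ideal_pow R ?I n) R" for n using i_intersect[OF A In] .
  have span: "ev y d (Suc n) (\<lambda>\<alpha>. f (0, \<alpha>)) \<in> ?I \<cdot> (A \<inter> ideal_pow R ?I n) \<and> (\<forall>\<omega>. f \<omega> \<in> carrier R)"
    if "f \<in> shift_span d (H n)" for f n
    using that
  proof (induction rule: shift_span.induct)
    case zero
    note P = ideal_prod_is_ideal[OF I An, of n]
    show ?case using ev_zero[of y d "Suc n" "\<lambda>_. \<zero>", OF yc] ideal_D(2)[OF P] by simp
  next
    case (step f h i)
    note P = ideal_prod_is_ideal[OF I An, of n]
    have c1: "(\<lambda>\<alpha>. f (0, \<alpha>)) \<in> UNIV \<rightarrow> carrier R" using step.IH by auto
    have shc: "shift i h \<omega> \<in> carrier R" for \<omega> using step.hyps(2) unfolding H_def by (cases \<omega>) (auto simp: shift_def)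
    then have c2: "(\<lambda>\<alpha>. shift i h (0, \<alpha>)) \<in> UNIV \<rightarrow> carrier R" by auto
    have e: "ev y d n (\<lambda>\<alpha>. h (0, \<alpha>)) \<in> A \<inter> ideal_pow R ?I n"
    proof
      show "ev y d n (\<lambda>\<alpha>. h (0, \<alpha>)) \<in> A" using step.hyps(2) unfolding H_def by blast
      show "ev y d n (\<lambda>\<alpha>. h (0, \<alpha>)) \<in> ideal_pow R ?I n"
        unfolding ideal_pow_eq_evs[of y, OF yc, where J = A] evs_def[of y, OF yc] using fc[OF step.hyps(2)] by blast
    qed
    have "ev y d (Suc n) (\<lambda>\<alpha>. shift i h (0, \<alpha>)) \<in> ?I \<cdot> (A \<inter> ideal_pow R ?I n)"
      unfolding sh ev_shift[of y, OF yc fc[OF step.hyps(2)] step.hyps(3), where n = n]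
      using gid_mem[of y, OF yc step.hyps(3)] e by (rule ideal_prod.prod)
    then show ?case using ev_add[of y, OF yc c1 c2, where d = d and n = "Suc n"] step.IH shc by (auto intro: ideal_prod.sum)
  qed
  have stepAR: "A \<inter> ideal_pow R ?I (Suc n) \<subseteq> ?I \<cdot> (A \<inter> ideal_pow R ?I n)" if n: "n \<ge> n0" for n
  proof
    fix x assume x: "x \<in> A \<inter> ideal_pow R ?I (Suc n)"
    then obtain c where c: "x = ev y d (Suc n) c" "c \<in> UNIV \<rightarrow> carrier R"
      unfolding ideal_pow_eq_evs[of y, OF yc, where J = A] evs_def[of y, OF yc] by blast
    define f where "f = (\<lambda>(j::nat, \<alpha>). if j = 0 \<and> \<alpha> \<in> Mon d (Suc n) then c \<alpha> else \<zero>)"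
    have e: "ev y d (Suc n) (\<lambda>\<alpha>. f (0, \<alpha>)) = x"
      unfolding c(1) by (rule ev_cong[of y, OF yc]) (use c(2) in \<open>auto simp: f_def\<close>)
    have "f \<in> H (Suc n)" unfolding H_def using e x c(2) by (auto simp: f_def Pi_iff split: if_splits)
    then have "f \<in> shift_span d (H n)" using n0[OF n] by blast
    then show "x \<in> ?I \<cdot> (A \<inter> ideal_pow R ?I n)" using span e by metis
  qed
  have "A \<inter> ideal_pow R ?I (n0 + k) \<subseteq> ideal_pow R ?I k \<cdot> (A \<inter> ideal_pow R ?I n0)" for k
  proof (induction k)
    case 0
    have "x \<in> carrier R \<cdot> (A \<inter> ideal_pow R ?I n0)" if "x \<in> A \<inter> ideal_pow R ?I n0" for x
      using ideal_prod.prod[OF one_closed that, where R = R] ideal_D(8)[OF A] that by simp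
    then show ?case by auto
  next
    case (Suc k)
    have "A \<inter> ideal_pow R ?I (n0 + Suc k) \<subseteq> ?I \<cdot> (A \<inter> ideal_pow R ?I (n0 + k))"
      using stepAR[of "n0 + k"] by simp
    also have "\<dots> \<subseteq> ?I \<cdot> (ideal_pow R ?I k \<cdot> (A \<inter> ideal_pow R ?I n0))"
      using ideal_prod_mono[OF order_refl Suc] .
    also have "\<dots> = ideal_pow R ?I (Suc k) \<cdot> (A \<inter> ideal_pow R ?I n0)"
      using ideal_prod_assoc[OF I In An] ideal_prod_commute[OF In I] by simp
    finally show ?case .
  qed
  moreover have "ideal_pow R ?I k \<cdot> (A \<inter> ideal_pow R ?I n0) \<subseteq> ideal_pow R ?I k \<cdot> A" for k
    by (rule ideal_prod_mono) auto
  ultimately show ?thesis by blast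
qed

text \<open>Artin-Rees for the principal ideal of \<open>c\<close>: if c z is in I^(h+k), it lies in
  I^k c, and \<open>c\<close> cancels. That \<open>h\<close> depends on \<open>c\<close> is absorbed
  later by taking a large Frobenius power.\<close>

lemma artin_rees_nzd:
  assumes yc: "\<And>i. y i \<in> carrier R" and c: "c \<in> carrier R" "nzd {\<zero>} c"
  shows "\<exists>h. \<forall>k. \<forall>z\<in>carrier R. c \<otimes> z \<in> ideal_pow R (gid y d) (h + k) \<longrightarrow> z \<in> ideal_pow R (gid y d) k"
proof -
  have I: "ideal (gid y d) R" using gid_ideal[of y, OF yc] .
  have A: "ideal (PIdl c) R" using cgenideal_ideal[OF c(1)] .
  obtain h where h: "\<And>k. PIdl c \<inter> ideal_pow R (gid y d) (h + k) \<subseteq> ideal_pow R (gid y d) k \<cdot> (PIdl c)"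
    using artin_rees[of y, OF yc A] by blast
  have "z \<in> ideal_pow R (gid y d) k"
    if z: "z \<in> carrier R" "c \<otimes> z \<in> ideal_pow R (gid y d) (h + k)" for z k
  proof -
    note Ik = ideal_pow_ideal[OF I, of k]
    have "c \<otimes> z = z \<otimes> c" using z(1) c(1) by (rule m_comm[rotated])
    then have "c \<otimes> z \<in> PIdl c" using z(1) by (auto simp: cgenideal_def)
    then have "c \<otimes> z \<in> ideal_pow R (gid y d) k \<cdot> (PIdl c)" using h[of k] z(2) by blast
    moreover have "\<exists>w\<in>ideal_pow R (gid y d) k. x = c \<otimes> w" if "x \<in> ideal_pow R (gid y d) k \<cdot> (PIdl c)" for x
      using that
    proof (induction rule: ideal_prod.induct)
      case (prod i j)
      then obtain r where r: "r \<in> carrier R" "j = r \<otimes> c" by (auto simp: cgenideal_def)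
      have ic: "i \<in> carrier R" using ideal_D(8)[OF Ik prod(1)] .
      have "i \<otimes> j = c \<otimes> (i \<otimes> r)" using r ic c(1) by (simp add: m_ac)
      then show ?case using ideal_D(7)[OF Ik prod(1) r(1)] by blast
    next
      case (sum s1 s2)
      then obtain w1 w2 where w: "w1 \<in> ideal_pow R (gid y d) k" "s1 = c \<otimes> w1"
        "w2 \<in> ideal_pow R (gid y d) k" "s2 = c \<otimes> w2" by blast
      have "s1 \<oplus> s2 = c \<otimes> (w1 \<oplus> w2)" using w ideal_D(8)[OF Ik] c(1) by (simp add: r_distr)
      then show ?case using ideal_D(3)[OF Ik w(1,3)] by blast
    qed
    ultimately obtain w where w: "w \<in> ideal_pow R (gid y d) k" "c \<otimes> z = c \<otimes> w" by blast
    have wc: "w \<in> carrier R" using ideal_D(8)[OF Ik w(1)] .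
    have "c \<otimes> (z \<ominus> w) = \<zero>" using w(2) z(1) wc c(1) by (simp add: a_minus_def r_distr r_minus r_neg)
    then have "z \<ominus> w = \<zero>" using nzdD[OF c(2), of "z \<ominus> w"] z(1) wc by simp
    then have "z \<ominus> w \<in> ideal_pow R (gid y d) k" using ideal_D(2)[OF Ik] by simp
    then show ?thesis using ideal_minus_cancel[OF Ik w(1) z(1)] by blast
  qed
  then show ?thesis by blast
qed

end

section \<open>Tight closure\<close>

context cring
begin

lemma ring_circ_carrier: "c \<in> ring_circ R \<Longrightarrow> c \<in> carrier R"
  by (simp add: ring_circ_def)

lemma one_mem_ring_circ: "\<one> \<in> ring_circ R"
  using prime_D(3) by (auto simp: ring_circ_def minimal_prime_def)

lemma ring_circ_mult: "a \<in> ring_circ R \<Longrightarrow> b \<in> ring_circ R \<Longrightarrow> a \<otimes> b \<in> ring_circ R"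
  using prime_D(4) unfolding ring_circ_def minimal_prime_def by blast

lemma frobenius_power_ideal: "J \<subseteq> carrier R \<Longrightarrow> ideal (frobenius_power R J q) R"
  unfolding frobenius_power_def by (rule genideal_ideal) auto

lemma pow_mem_frobenius_power: "J \<subseteq> carrier R \<Longrightarrow> b \<in> J \<Longrightarrow> b [^] q \<in> frobenius_power R J q"
  unfolding frobenius_power_def using genideal_self[of "(\<lambda>a. a [^] q) ` J"] by auto

lemma frobenius_power_least:
  assumes "ideal K R" "\<And>b. b \<in> J \<Longrightarrow> b [^] q \<in> K"
  shows "frobenius_power R J q \<subseteq> K"
  unfolding frobenius_power_def by (rule genideal_minimal) (use assms in auto)

lemma mult_frobenius_power:
  assumes J: "J \<subseteq> carrier R" "J' \<subseteq> carrier R" and a: "a \<in> carrier R" "\<And>b. b \<in> J \<Longrightarrow> a \<otimes> b \<in> J'"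
    and x: "x \<in> frobenius_power R J q"
  shows "a [^] q \<otimes> x \<in> frobenius_power R J' q"
proof -
  note I' = frobenius_power_ideal[OF J(2), of q]
  have aq: "a [^] q \<in> carrier R" using a by simp
  have "frobenius_power R J q \<subseteq> colon (frobenius_power R J' q) (a [^] q)"
  proof (rule frobenius_power_least[OF colon_ideal[OF I' aq]])
    fix b assume b: "b \<in> J"
    then have bc: "b \<in> carrier R" using J by auto
    have "a [^] q \<otimes> b [^] q = (a \<otimes> b) [^] q" using a(1) bc by (simp add: nat_pow_distrib)
    then show "b [^] q \<in> colon (frobenius_power R J' q) (a [^] q)"
      using pow_mem_frobenius_power[OF J(2) a(2)[OF b]] bc by (simp add: colon_def)
  qed
  then show ?thesis using x by (auto simp: colon_def)
qed

lemma mem_tight_closure_iff: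
  "x \<in> tight_closure R J \<longleftrightarrow> x \<in> carrier R \<and> (\<exists>c\<in>ring_circ R. \<exists>e0. \<forall>e\<ge>e0.
     c \<otimes> x [^] (ring_char R ^ e) \<in> frobenius_power R J (ring_char R ^ e))"
  by (simp add: tight_closure_def eventually_sequentially)

text \<open>The multiplier \<open>c\<close> for x serves a x unchanged. With a = 1 this is
  monotonicity; with \<open>a\<close> in I^n it shows that a I^* lies in the tight closure of
  I^(n+1).\<close>

lemma tight_closure_mult:
  assumes J: "J \<subseteq> carrier R" "J' \<subseteq> carrier R" and a: "a \<in> carrier R" "\<And>b. b \<in> J \<Longrightarrow> a \<otimes> b \<in> J'"
    and x: "x \<in> tight_closure R J"
  shows "a \<otimes> x \<in> tight_closure R J'"
proof -
  from x obtain c e0 where c: "x \<in> carrier R" "c \<in> ring_circ R"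
    "\<And>e. e \<ge> e0 \<Longrightarrow> c \<otimes> x [^] (ring_char R ^ e) \<in> frobenius_power R J (ring_char R ^ e)"
    unfolding mem_tight_closure_iff by blast
  have cc: "c \<in> carrier R" using ring_circ_carrier[OF c(2)] .
  have "c \<otimes> (a \<otimes> x) [^] (ring_char R ^ e) \<in> frobenius_power R J' (ring_char R ^ e)" if "e \<ge> e0" for e
  proof -
    have "c \<otimes> (a \<otimes> x) [^] (ring_char R ^ e) = a [^] (ring_char R ^ e) \<otimes> (c \<otimes> x [^] (ring_char R ^ e))"
      using a(1) c(1) cc by (simp add: nat_pow_distrib m_ac)
    then show ?thesis using mult_frobenius_power[OF J a c(3)[OF that]] by simp
  qed
  then show ?thesis unfolding mem_tight_closure_iff using a(1) c by auto
qed

lemma tight_closure_mono: "J \<subseteq> J' \<Longrightarrow> J' \<subseteq> carrier R \<Longrightarrow> tight_closure R J \<subseteq> tight_closure R J'"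
proof
  fix x assume J: "J \<subseteq> J'" "J' \<subseteq> carrier R" and x: "x \<in> tight_closure R J"
  have xc: "x \<in> carrier R" using x by (simp add: mem_tight_closure_iff)
  have "\<one> \<otimes> b \<in> J'" if "b \<in> J" for b using that J by (metis l_one subsetD)
  then have "\<one> \<otimes> x \<in> tight_closure R J'"
    using tight_closure_mult[OF subset_trans[OF J] J(2) one_closed _ x] by blast
  then show "x \<in> tight_closure R J'" using xc by simp
qed

lemma subset_tight_closure: "J \<subseteq> carrier R \<Longrightarrow> J \<subseteq> tight_closure R J"
proof
  fix x assume J: "J \<subseteq> carrier R" and x: "x \<in> J"
  have "\<one> \<otimes> x [^] (ring_char R ^ e) \<in> frobenius_power R J (ring_char R ^ e)" for e
    using pow_mem_frobenius_power[OF J x] x J by auto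
  then show "x \<in> tight_closure R J" unfolding mem_tight_closure_iff using x J one_mem_ring_circ by blast
qed

lemma tight_closure_carrier: "tight_closure R J \<subseteq> carrier R"
  by (auto simp: mem_tight_closure_iff)

end

section \<open>Frobenius on forms and tight closures of powers\<close>

locale char_p_cring = cring R for R (structure) +
  assumes prime_char: "prime (ring_char R)"
begin

lemma frob_add:
  "a \<in> carrier R \<Longrightarrow> b \<in> carrier R \<Longrightarrow>
    (a \<oplus> b) [^] (ring_char R ^ e) = a [^] (ring_char R ^ e) \<oplus> b [^] (ring_char R ^ e)"
  using frobenius_add[OF _ _ prime_char ring_char_pow_one] .

lemma char_pow_pos: "0 < ring_char R ^ e"
  using prime_char by (simp add: prime_gt_0_nat)

lemma frob_minus:
  assumes "a \<in> carrier R" "b \<in> carrier R"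
  shows "(a \<ominus> b) [^] (ring_char R ^ e) = a [^] (ring_char R ^ e) \<ominus> b [^] (ring_char R ^ e)"
proof -
  have "a = (a \<ominus> b) \<oplus> b" using assms by (simp add: a_minus_def a_assoc l_neg)
  then have "a [^] (ring_char R ^ e) = (a \<ominus> b) [^] (ring_char R ^ e) \<oplus> b [^] (ring_char R ^ e)"
    using frob_add[of "a \<ominus> b" b e] assms by simp
  then show ?thesis using assms by (simp add: a_minus_def a_assoc r_neg)
qed

lemma frob_finsum:
  assumes "finite S" "f \<in> S \<rightarrow> carrier R"
  shows "(\<Oplus>i\<in>S. f i) [^] (ring_char R ^ e) = (\<Oplus>i\<in>S. f i [^] (ring_char R ^ e))"
  using assms
proof (induction S rule: finite_induct)
  case empty
  then show ?case using char_pow_pos[of e] by (simp add: nat_pow_zero)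
next
  case (insert i S)
  then have "(\<lambda>i. f i [^] (ring_char R ^ e)) \<in> S \<rightarrow> carrier R" "f i \<in> carrier R" "f \<in> S \<rightarrow> carrier R" by auto
  then show ?case using insert by (simp add: frob_add)
qed

lemma ev_frob:
  assumes yc: "\<And>i. y i \<in> carrier R" and c: "c \<in> UNIV \<rightarrow> carrier R"
  shows "ev y d n c [^] (ring_char R ^ e) = ev (\<lambda>i. y i [^] (ring_char R ^ e)) d n (\<lambda>\<alpha>. c \<alpha> [^] (ring_char R ^ e))"
proof -
  let ?q = "ring_char R ^ e"
  have cc: "c \<alpha> \<in> carrier R" for \<alpha> using c by auto
  have "ev y d n c [^] ?q = (\<Oplus>\<alpha>\<in>Mon d n. (c \<alpha> \<otimes> mon y \<alpha>) [^] ?q)"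
    unfolding ev_def using cc mon_closed[of y, OF yc] by (intro frob_finsum) auto
  also have "\<dots> = ev (\<lambda>i. y i [^] ?q) d n (\<lambda>\<alpha>. c \<alpha> [^] ?q)"
    unfolding ev_def using cc mon_closed[of y, OF yc]
    by (intro finsum_cong') (auto simp: nat_pow_distrib mon_nat_pow[of y, OF yc])
  finally show ?thesis .
qed

lemma frobenius_power_gid:
  assumes yc: "\<And>i. y i \<in> carrier R"
  shows "frobenius_power R (gid y d) (ring_char R ^ e) = gid (\<lambda>i. y i [^] (ring_char R ^ e)) d"
  unfolding gid_def using frobenius_power_genideal[of "y ` {..<d}" e] yc prime_char
  by (auto simp: image_image)

lemma frobenius_power_gid_pow:
  assumes yc: "\<And>i. y i \<in> carrier R"
  shows "frobenius_power R (ideal_pow R (gid y d) n) (ring_char R ^ e)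
    \<subseteq> ideal_pow R (gid (\<lambda>i. y i [^] (ring_char R ^ e)) d) n"
proof (rule frobenius_power_least)
  have yqc: "y i [^] (ring_char R ^ e) \<in> carrier R" for i using yc by simp
  show "ideal (ideal_pow R (gid (\<lambda>i. y i [^] (ring_char R ^ e)) d) n) R"
    using ideal_pow_ideal[OF gid_ideal[of "\<lambda>i. y i [^] (ring_char R ^ e)", OF yqc]] .
  fix b assume "b \<in> ideal_pow R (gid y d) n"
  then obtain c where c: "b = ev y d n c" "c \<in> UNIV \<rightarrow> carrier R"
    unfolding ideal_pow_eq_evs[of y, OF yc, where J = "carrier R"] evs_def[of y, OF yc] by blast
  have "(\<lambda>\<alpha>. c \<alpha> [^] (ring_char R ^ e)) \<in> UNIV \<rightarrow> carrier R" using c(2) by auto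
  then show "b [^] (ring_char R ^ e) \<in> ideal_pow R (gid (\<lambda>i. y i [^] (ring_char R ^ e)) d) n"
    unfolding c(1) ev_frob[of y, OF yc c(2)]
      ideal_pow_eq_evs[of "\<lambda>i. y i [^] (ring_char R ^ e)", OF yqc, where J = "carrier R"]
      evs_def[of "\<lambda>i. y i [^] (ring_char R ^ e)", OF yqc] by blast
qed

lemma tight_closure_ideal:
  assumes J: "J \<subseteq> carrier R" "J \<noteq> {}"
  shows "ideal (tight_closure R J) R"
proof (rule idealI')
  note F = frobenius_power_ideal[OF J(1)]
  show "tight_closure R J \<subseteq> carrier R" by (rule tight_closure_carrier)
  have "\<one> \<otimes> \<zero> [^] (ring_char R ^ e) \<in> frobenius_power R J (ring_char R ^ e)" for e
    using ideal_D(2)[OF F] char_pow_pos[of e] by (simp add: nat_pow_zero)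
  then show "\<zero> \<in> tight_closure R J" unfolding mem_tight_closure_iff using one_mem_ring_circ by blast
  fix x assume x: "x \<in> tight_closure R J"
  then obtain c e0 where c: "x \<in> carrier R" "c \<in> ring_circ R"
    "\<And>e. e \<ge> e0 \<Longrightarrow> c \<otimes> x [^] (ring_char R ^ e) \<in> frobenius_power R J (ring_char R ^ e)"
    unfolding mem_tight_closure_iff by blast
  have cc: "c \<in> carrier R" using ring_circ_carrier[OF c(2)] .
  {
    fix z assume "z \<in> tight_closure R J"
    then obtain b e1 where b: "z \<in> carrier R" "b \<in> ring_circ R"
      "\<And>e. e \<ge> e1 \<Longrightarrow> b \<otimes> z [^] (ring_char R ^ e) \<in> frobenius_power R J (ring_char R ^ e)"
      unfolding mem_tight_closure_iff by blast
    have bc: "b \<in> carrier R" using ring_circ_carrier[OF b(2)] .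
    have "(c \<otimes> b) \<otimes> (x \<oplus> z) [^] (ring_char R ^ e) \<in> frobenius_power R J (ring_char R ^ e)"
      if e: "e \<ge> max e0 e1" for e
    proof -
      let ?q = "ring_char R ^ e"
      have "(c \<otimes> b) \<otimes> (x \<oplus> z) [^] ?q = b \<otimes> (c \<otimes> x [^] ?q) \<oplus> c \<otimes> (b \<otimes> z [^] ?q)"
        using frob_add[OF c(1) b(1)] bc cc b(1) c(1) by (simp add: r_distr m_ac)
      moreover have "b \<otimes> (c \<otimes> x [^] ?q) \<in> frobenius_power R J ?q"
        using ideal_D(6)[OF F c(3)[of e] bc] e by simp
      moreover have "c \<otimes> (b \<otimes> z [^] ?q) \<in> frobenius_power R J ?q"
        using ideal_D(6)[OF F b(3)[of e] cc] e by simp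
      ultimately show ?thesis using ideal_D(3)[OF F] by simp
    qed
    then show "x \<oplus> z \<in> tight_closure R J"
      unfolding mem_tight_closure_iff using ring_circ_mult[OF c(2) b(2)] c(1) b(1) by (meson a_closed)
  }
  fix r assume r: "r \<in> carrier R"
  have cl: "r [^] n \<otimes> v \<in> frobenius_power R J n" if "v \<in> frobenius_power R J n" for v and n :: nat
    using ideal_D(6)[OF F that] r by simp
  have "c \<otimes> (r \<otimes> x) [^] (ring_char R ^ e) \<in> frobenius_power R J (ring_char R ^ e)" if "e \<ge> e0" for e
  proof -
    have "c \<otimes> (r \<otimes> x) [^] (ring_char R ^ e) = r [^] (ring_char R ^ e) \<otimes> (c \<otimes> x [^] (ring_char R ^ e))"
      using r c(1) cc by (simp add: nat_pow_distrib m_ac)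
    then show ?thesis using cl[OF c(3)[OF that]] by simp
  qed
  then show "r \<otimes> x \<in> tight_closure R J"
    unfolding mem_tight_closure_iff using c(1,2) r by (meson m_closed)
qed

text \<open>Let x be the value of a form with coefficients b. Then x^q is the value at y^q of the
  form with coefficients b^q, and c x^q lies in the (n+1)-st power of I^[q]. Quasi-regularity of y^q
  puts every c b^q into I^[q]. Since the same \<open>c\<close> serves all coefficients and all large
  q, each b lies in I^*.\<close>

lemma tight_closure_pow_inter:
  assumes yc: "\<And>i. y i \<in> carrier R"
    and reg: "\<And>e. \<forall>k<d. nzd (gid (\<lambda>i. y i [^] (ring_char R ^ e)) k) (y k [^] (ring_char R ^ e))"
  shows "tight_closure R (ideal_pow R (gid y d) (Suc n)) \<inter> ideal_pow R (gid y d) n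
    \<subseteq> tight_closure R (gid y d) \<cdot> ideal_pow R (gid y d) n"
proof
  let ?I = "gid y d"
  have I: "ideal ?I R" using gid_ideal[of y, OF yc] .
  have T: "ideal (tight_closure R ?I) R" using tight_closure_ideal[OF ideal_D(1)[OF I]] ideal_D(2)[OF I] by blast
  fix x assume x: "x \<in> tight_closure R (ideal_pow R ?I (Suc n)) \<inter> ideal_pow R ?I n"
  then obtain b where b: "x = ev y d n b" "b \<in> UNIV \<rightarrow> carrier R"
    unfolding ideal_pow_eq_evs[of y, OF yc, where J = "carrier R"] evs_def[of y, OF yc] by blast
  from x obtain c e0 where c: "c \<in> ring_circ R" "\<And>e. e \<ge> e0 \<Longrightarrow>
      c \<otimes> x [^] (ring_char R ^ e) \<in> frobenius_power R (ideal_pow R ?I (Suc n)) (ring_char R ^ e)"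
    unfolding Int_iff mem_tight_closure_iff by blast
  have cc: "c \<in> carrier R" using ring_circ_carrier[OF c(1)] .
  have "b \<alpha> \<in> tight_closure R ?I" if a: "\<alpha> \<in> Mon d n" for \<alpha>
  proof -
    have "c \<otimes> b \<alpha> [^] (ring_char R ^ e) \<in> frobenius_power R ?I (ring_char R ^ e)" if e: "e \<ge> e0" for e
    proof -
      let ?q = "ring_char R ^ e"
      let ?z = "\<lambda>i. y i [^] ?q"
      have zc: "?z i \<in> carrier R" for i using yc by simp
      have bq: "(\<lambda>\<alpha>. b \<alpha> [^] ?q) \<in> UNIV \<rightarrow> carrier R" using b(2) by auto
      have "c \<otimes> x [^] ?q = ev ?z d n (\<lambda>\<alpha>. c \<otimes> b \<alpha> [^] ?q)"
        unfolding b(1) ev_frob[of y, OF yc b(2)] using ev_smult[of ?z, OF zc bq cc] by simp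
      then have "ev ?z d n (\<lambda>\<alpha>. c \<otimes> b \<alpha> [^] ?q) \<in> ideal_pow R (gid ?z d) (Suc n)"
        using c(2)[OF e] frobenius_power_gid_pow[of y, OF yc, where d = d and n = "Suc n" and e = e] by auto
      moreover have "(\<lambda>\<alpha>. c \<otimes> b \<alpha> [^] ?q) \<in> UNIV \<rightarrow> carrier R" using bq cc by auto
      ultimately have "c \<otimes> b \<alpha> [^] ?q \<in> gid ?z d"
        using quasi_regular[of ?z, OF zc reg _ _ a] by blast
      then show ?thesis using frobenius_power_gid[of y, OF yc] by simp
    qed
    then show ?thesis unfolding mem_tight_closure_iff using c(1) b(2) by auto
  qed
  then show "x \<in> tight_closure R ?I \<cdot> ideal_pow R ?I n"
    unfolding ideal_prod_pow_eq_evs[of y, OF yc T] evs_def[of y, OF yc] using b by blast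
qed

lemma pow_mult_tight_closure:
  assumes yc: "\<And>i. y i \<in> carrier R"
  shows "tight_closure R (gid y d) \<cdot> ideal_pow R (gid y d) n \<subseteq> tight_closure R (ideal_pow R (gid y d) (Suc n))"
proof -
  let ?I = "gid y d"
  have I: "ideal ?I R" using gid_ideal[of y, OF yc] .
  note Ic = ideal_D(1)[OF I] and Pc = ideal_D(1)[OF ideal_pow_ideal[OF I]]
  have T: "ideal (tight_closure R (ideal_pow R ?I (Suc n))) R"
    using tight_closure_ideal[OF Pc] ideal_D(2)[OF ideal_pow_ideal[OF I]] by blast
  show ?thesis
  proof (rule ideal_prod_least[OF T])
    fix t u assume t: "t \<in> tight_closure R ?I" and u: "u \<in> ideal_pow R ?I n"
    have uc: "u \<in> carrier R" "t \<in> carrier R" using Pc u tight_closure_carrier t by auto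
    have ub: "u \<otimes> b \<in> ideal_pow R ?I (Suc n)" if "b \<in> ?I" for b
      using ideal_prod.prod[OF u that, where R = R] by simp
    have "u \<otimes> t \<in> tight_closure R (ideal_pow R ?I (Suc n))"
      using tight_closure_mult[OF Ic Pc uc(1) ub t] .
    then show "t \<otimes> u \<in> tight_closure R (ideal_pow R ?I (Suc n))" using uc by (simp add: m_comm)
  qed
qed

lemma tight_closure_pow_eq:
  assumes yc: "\<And>i. y i \<in> carrier R"
    and reg: "\<And>e. \<forall>k<d. nzd (gid (\<lambda>i. y i [^] (ring_char R ^ e)) k) (y k [^] (ring_char R ^ e))"
    and tc: "tight_closure R (gid y d) = gid y d"
  shows "tight_closure R (ideal_pow R (gid y d) n) = ideal_pow R (gid y d) n"
proof (induction n)
  case 0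
  show ?case using tight_closure_carrier subset_tight_closure[of "carrier R"] by auto
next
  case (Suc n)
  have I: "ideal (gid y d) R" using gid_ideal[of y, OF yc] .
  note P = ideal_pow_ideal[OF I]
  have "tight_closure R (ideal_pow R (gid y d) (Suc n)) \<subseteq> tight_closure R (ideal_pow R (gid y d) n)"
    by (rule tight_closure_mono[OF ideal_pow_antimono[OF I] ideal_D(1)[OF P]]) simp
  then have "tight_closure R (ideal_pow R (gid y d) (Suc n)) \<subseteq> gid y d \<cdot> ideal_pow R (gid y d) n"
    using tight_closure_pow_inter[of y, OF yc reg, where n = n] unfolding tc Suc by blast
  then show ?case
    using subset_tight_closure[OF ideal_D(1)[OF P], of "Suc n"] ideal_prod_commute[OF I P] by auto
qed

end

context cring
begin

definition nth0 :: "'a list \<Rightarrow> nat \<Rightarrow> 'a" where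
  "nth0 xs i = (if i < length xs then xs ! i else \<zero>)"

lemma nth0_closed: "set xs \<subseteq> carrier R \<Longrightarrow> nth0 xs i \<in> carrier R"
  unfolding nth0_def using nth_mem[of i xs] by auto

lemma nth0_image: "k \<le> length xs \<Longrightarrow> nth0 xs ` {..<k} = set (take k xs)"
  unfolding set_conv_nth by (force simp: nth0_def)

lemma gid_nth0: "k \<le> length xs \<Longrightarrow> gid (nth0 xs) k = Idl (set (take k xs))"
  unfolding gid_def by (simp add: nth0_image)

lemma gid_nth0_length: "gid (nth0 xs) (length xs) = Idl (set xs)"
  by (simp add: gid_nth0)

lemma reg_nth0: "reg {} xs \<Longrightarrow> \<forall>k<length xs. nzd (gid (nth0 xs) k) (nth0 xs k)"
  unfolding reg_iff_nth by (simp add: gid_nth0) (simp add: nth0_def)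

lemma nth0_map_pow: "0 < (q::nat) \<Longrightarrow> set xs \<subseteq> carrier R \<Longrightarrow> nth0 (map (\<lambda>x. x [^] q) xs) = (\<lambda>i. nth0 xs i [^] q)"
  by (auto simp: nth0_def fun_eq_iff nat_pow_zero)

end

section \<open>Systems of parameters in a Cohen-Macaulay local ring\<close>

locale cm_local = noetherian_local +
  fixes d :: nat and x0 :: "'a list"
  assumes dim: "krull_dim R = enat d"
    and x0: "reg {} x0" "set x0 \<subseteq> \<mm>" "length x0 = d"
begin

text \<open>A power of \<open>\<mm>\<close> replaces the radical of
  \<open>system_of_parameters\<close>. The sequence \<open>x0\<close> of the locale witnesses the
  Cohen-Macaulay property; regularity of every other system is derived from it.\<close>

definition sop :: "'a list \<Rightarrow> bool" where
  "sop xs \<longleftrightarrow> set xs \<subseteq> \<mm> \<and> length xs = d \<and> (\<exists>t. ideal_pow R \<mm> t \<subseteq> Idl (set xs))"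

lemma sop_carrier: "sop xs \<Longrightarrow> set xs \<subseteq> carrier R"
  using mm_carrier by (auto simp: sop_def)

lemma sop_reg: "sop xs \<Longrightarrow> reg {} xs"
  using reg_if_m_primary[of "{}" x0 xs] x0 unfolding sop_def by auto

lemma reg_sop: "reg {} xs \<Longrightarrow> set xs \<subseteq> \<mm> \<Longrightarrow> length xs = d \<Longrightarrow> sop xs"
  using reg_m_primary[OF dim] by (auto simp: sop_def)

lemma sop_cong: "sop xs \<Longrightarrow> set ys \<subseteq> \<mm> \<Longrightarrow> length ys = d \<Longrightarrow> Idl (set xs) = Idl (set ys) \<Longrightarrow> sop ys"
  by (simp add: sop_def)

lemma sop_radical:
  assumes xs: "sop xs" and ys: "set ys \<subseteq> \<mm>" "length ys = d"
    and pow: "\<And>x. x \<in> set xs \<Longrightarrow> \<exists>n::nat. x [^] n \<in> Idl (set ys)"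
  shows "sop ys"
proof -
  have yc: "set ys \<subseteq> carrier R" using ys mm_carrier by auto
  have "\<exists>t. ideal_pow R \<mm> t \<subseteq> Idl (set ys)"
  proof (rule m_primary_if_primes[OF genideal_ideal[OF yc]])
    fix Q assume Q: "primeideal Q R" "Idl (set ys) \<subseteq> Q"
    have "set xs \<subseteq> Q"
    proof
      fix x assume x: "x \<in> set xs"
      then obtain n :: nat where "x [^] n \<in> Q" using pow Q(2) by blast
      then show "x \<in> Q" using prime_pow[OF Q(1)] x sop_carrier[OF xs] by blast
    qed
    then have "Idl (set xs) \<subseteq> Q" using prime_D(1)[OF Q(1)] by (intro genideal_minimal) auto
    then obtain t where t: "ideal_pow R \<mm> t \<subseteq> Q" using xs unfolding sop_def by blast
    then show "Q = \<mm>" using prime_eq_mm[OF Q(1)] by blast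
  qed
  then show ?thesis using ys by (simp add: sop_def)
qed

lemma sop_nzd_last: "sop (ks @ [w]) \<Longrightarrow> nzd (Idl (set ks)) w"
  using sop_reg[of "ks @ [w]"] by (simp add: reg_append)

lemma sop_snoc_replace:
  assumes "sop (ks @ [w])" "u \<in> \<mm>" "nzd (Idl (set ks)) u"
  shows "sop (ks @ [u])"
  by (rule reg_sop) (use assms sop_reg[OF assms(1)] in \<open>auto simp: reg_append sop_def\<close>)

lemma prime_height_ge:
  assumes "primeideal Q R" "enat n \<le> prime_height R Q"
  shows "\<exists>k\<ge>n. \<exists>P. prime_chain R k P \<and> P k = Q"
proof (cases n)
  case 0
  then show ?thesis using assms(1) by (intro exI[of _ 0]) (auto simp: prime_chain_def intro: exI[of _ "\<lambda>_. Q"])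
next
  case (Suc m)
  then have "enat m < prime_height R Q" using assms(2) by (metis Suc_ile_eq)
  then obtain k P where "m < k" "prime_chain R k P" "P k = Q" unfolding prime_height_def less_Sup_iff by auto
  then show ?thesis using Suc by (intro exI[of _ k]) auto
qed

lemma prime_height_le_dim: "primeideal Q R \<Longrightarrow> prime_height R Q \<le> enat d"
  unfolding prime_height_def using krull_dim_prime_chain[OF dim] by (intro Sup_least) auto

lemma sop_height:
  assumes "sop xs" shows "height R (Idl (set xs)) = enat d"
proof -
  have c: "set xs \<subseteq> carrier R" using sop_carrier[OF assms] .
  have sub: "Idl (set xs) \<subseteq> \<mm>" using assms mm_ideal unfolding sop_def by (intro genideal_minimal) auto
  obtain P where P: "prime_chain R d P" "P d = \<mm>"
    using reg_prime_chain[OF sop_reg[OF assms] _ c mm_prime] assms by (auto simp: sop_def)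
  have hm: "prime_height R \<mm> = enat d"
  proof (rule antisym)
    show "enat d \<le> prime_height R \<mm>" unfolding prime_height_def by (rule Sup_upper) (use P in auto)
  qed (rule prime_height_le_dim[OF mm_prime])
  obtain t where t: "ideal_pow R \<mm> t \<subseteq> Idl (set xs)" using assms unfolding sop_def by blast
  have "Q = \<mm>" if "primeideal Q R" "Idl (set xs) \<subseteq> Q" for Q
    using prime_eq_mm[OF that(1)] t that(2) by blast
  then have iff: "primeideal Q R \<and> Idl (set xs) \<subseteq> Q \<longleftrightarrow> Q = \<mm>" for Q
    using mm_prime sub by blast
  show ?thesis unfolding height_def iff using hm by simp
qed

text \<open>Elements are added one at a time, each outside the primes other than
  \<open>\<mm>\<close> of a prime filtration modulo the current ideal. Every prime over the enlarged
  ideal, \<open>\<mm>\<close> excepted, then strictly contains such a prime, so its height is at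
  least one larger. At height \<open>d\<close> only \<open>\<mm>\<close> is left.\<close>

lemma exists_sop_extension:
  assumes ws: "set ws \<subseteq> carrier R" and h: "height R (Idl (set ws)) = enat (length ws)"
  shows "\<exists>zs. sop (ws @ zs)"
proof -
  let ?k = "length ws"
  have hQ: "enat ?k \<le> prime_height R Q" if "primeideal Q R" "Idl (set ws) \<subseteq> Q" for Q
    unfolding h[symmetric] height_def by (rule Inf_lower) (use that in auto)
  \<comment> \<open>A finite height excludes the unit ideal, whose height is the infimum of the
    empty set.\<close>
  have "\<exists>Q. primeideal Q R \<and> Idl (set ws) \<subseteq> Q"
  proof (rule ccontr)
    assume "\<not> ?thesis"
    then have "{prime_height R Q | Q. primeideal Q R \<and> Idl (set ws) \<subseteq> Q} = {}" by blast
    then show False using h unfolding height_def by (simp add: Inf_enat_def)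
  qed
  then obtain Q where Q: "primeideal Q R" "Idl (set ws) \<subseteq> Q" by blast
  have wm: "set ws \<subseteq> \<mm>" using genideal_self[OF ws] Q(2) prime_subset_mm[OF Q(1)] by blast
  have kd: "?k \<le> d" using hQ[OF Q] prime_height_le_dim[OF Q(1)] by (metis enat_ord_simps(1) order_trans)
  have ext: "\<exists>zs. length zs = j \<and> set zs \<subseteq> \<mm> \<and>
      (\<forall>Q. primeideal Q R \<and> set (ws @ zs) \<subseteq> Q \<longrightarrow> Q = \<mm> \<or> enat (?k + j) \<le> prime_height R Q)" for j
  proof (induction j)
    case 0
    show ?case
    proof (intro exI[of _ "[]"] conjI allI impI)
      fix Q assume Q: "primeideal Q R \<and> set (ws @ []) \<subseteq> Q"
      then have "Idl (set ws) \<subseteq> Q" using prime_D(1) by (intro genideal_minimal) auto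
      then show "Q = \<mm> \<or> enat (?k + 0) \<le> prime_height R Q" using hQ Q by simp
    qed auto
  next
    case (Suc j)
    then obtain zs where zs: "length zs = j" "set zs \<subseteq> \<mm>"
      "\<And>Q. primeideal Q R \<Longrightarrow> set (ws @ zs) \<subseteq> Q \<Longrightarrow> Q = \<mm> \<or> enat (?k + j) \<le> prime_height R Q" by blast
    have c: "set (ws @ zs) \<subseteq> carrier R" using ws zs(2) mm_carrier by auto
    obtain Ps where Ps: "prime_filtration (Idl (set (ws @ zs))) Ps"
      using exists_prime_filtration[OF genideal_ideal[OF c]] by blast
    let ?Q = "{P \<in> set Ps. P \<noteq> \<mm>}"
    have Pp: "primeideal P R" if "P \<in> set Ps" for P using prime_filtration_primes[OF Ps that] by blast
    have "\<exists>s\<in>\<mm>. \<forall>Q\<in>?Q. \<zero> \<oplus> s \<notin> Q"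
    proof (rule coset_prime_avoidance)
      show "\<not> insert \<zero> \<mm> \<subseteq> P" if P: "P \<in> ?Q" for P
        using P prime_subset_mm[OF Pp[of P]] by blast
    qed (use Pp mm_ideal in auto)
    then obtain z where z: "z \<in> \<mm>" "\<And>Q. Q \<in> ?Q \<Longrightarrow> \<zero> \<oplus> z \<notin> Q" by blast
    have zc: "z \<in> carrier R" using z(1) mm_carrier by auto
    show ?case
    proof (intro exI[of _ "zs @ [z]"] conjI allI impI)
      fix Q assume Q: "primeideal Q R \<and> set (ws @ zs @ [z]) \<subseteq> Q"
      then have Qp: "primeideal Q R" by blast
      have "Idl (set (ws @ zs)) \<subseteq> Q" using Q prime_D(1) by (intro genideal_minimal) auto
      then obtain P where P: "P \<in> set Ps" "P \<subseteq> Q" using prime_filtration_least[OF Ps Qp] by blast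
      show "Q = \<mm> \<or> enat (?k + Suc j) \<le> prime_height R Q"
      proof (cases "P = \<mm>")
        case True
        then show ?thesis using P(2) prime_subset_mm[OF Qp] by auto
      next
        case False
        then have "z \<notin> P" using z(2)[of P] P(1) zc by simp
        then have PQ: "P \<subset> Q" using P(2) Q by auto
        have "set (ws @ zs) \<subseteq> P"
          using prime_filtration_primes[OF Ps P(1)] genideal_self[OF c] by blast
        then have "enat (?k + j) \<le> prime_height R P" using zs(3)[OF Pp[OF P(1)]] False by blast
        then obtain n F where F: "n \<ge> ?k + j" "prime_chain R n F" "F n = P"
          using prime_height_ge[OF Pp[OF P(1)]] by blast
        have "prime_chain R (Suc n) (F(Suc n := Q))"
          using F(2,3) PQ Qp unfolding prime_chain_def by (auto simp: le_Suc_eq less_Suc_eq)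
        then have "enat (Suc n) \<le> prime_height R Q"
          unfolding prime_height_def by (intro Sup_upper CollectI exI[of _ "Suc n"]) auto
        moreover have "enat (?k + Suc j) \<le> enat (Suc n)" using F(1) by simp
        ultimately show ?thesis by (meson order_trans)
      qed
    qed (use zs z in auto)
  qed
  obtain zs where zs: "length zs = d - ?k" "set zs \<subseteq> \<mm>"
    "\<And>Q. primeideal Q R \<Longrightarrow> set (ws @ zs) \<subseteq> Q \<Longrightarrow> Q = \<mm> \<or> enat (?k + (d - ?k)) \<le> prime_height R Q"
    using ext[of "d - ?k"] by blast
  have c: "set (ws @ zs) \<subseteq> carrier R" using ws zs(2) mm_carrier by auto
  have "\<exists>t. ideal_pow R \<mm> t \<subseteq> Idl (set (ws @ zs))"
  proof (rule m_primary_if_primes[OF genideal_ideal[OF c]])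
    fix Q assume Q: "primeideal Q R" "Idl (set (ws @ zs)) \<subseteq> Q"
    have "set (ws @ zs) \<subseteq> Q" using genideal_self[OF c] Q(2) by blast
    then consider "Q = \<mm>" | "enat d \<le> prime_height R Q" using zs(3)[OF Q(1)] kd by fastforce
    then show "Q = \<mm>"
    proof cases
      case 2
      then obtain n F where F: "n \<ge> d" "prime_chain R n F" "F n = Q" using prime_height_ge[OF Q(1)] by blast
      then have "n = d" using krull_dim_prime_chain[OF dim F(2)] by simp
      then show ?thesis using prime_chain_top[OF dim] F by blast
    qed
  qed
  then have "sop (ws @ zs)" using wm zs kd by (auto simp: sop_def)
  then show ?thesis by blast
qed

end

section \<open>Independence of tight closedness from the system of parameters\<close>

locale cm_local_char_p = cm_local + char_p_cring R
begin

abbreviation tc_closed :: "'a list \<Rightarrow> bool" where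
  "tc_closed xs \<equiv> tight_closure R (Idl (set xs)) = Idl (set xs)"

lemma sop_map_pow: "sop xs \<Longrightarrow> sop (map (\<lambda>x. x [^] (ring_char R ^ e)) xs)"
proof (rule sop_radical)
  assume xs: "sop xs"
  let ?ys = "map (\<lambda>x. x [^] (ring_char R ^ e)) xs"
  have c: "set ?ys \<subseteq> carrier R" using sop_carrier[OF xs] by auto
  show "set ?ys \<subseteq> \<mm>" using xs ideal_pow_mem[OF mm_ideal _ char_pow_pos] unfolding sop_def by auto
  show "length ?ys = d" using xs by (simp add: sop_def)
  show "\<exists>n::nat. x [^] n \<in> Idl (set ?ys)" if "x \<in> set xs" for x
    using genideal_self[OF c] that by (intro exI[of _ "ring_char R ^ e"]) auto
qed

lemma sop_frob_reg:
  assumes "sop xs"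
  shows "\<forall>k<d. nzd (gid (\<lambda>i. nth0 xs i [^] (ring_char R ^ e)) k) (nth0 xs k [^] (ring_char R ^ e))"
  using reg_nth0[OF sop_reg[OF sop_map_pow[OF assms, of e]]]
    nth0_map_pow[OF char_pow_pos sop_carrier[OF assms], of e] assms unfolding sop_def by simp

text \<open>Linkage through powers of \<open>w\<close>. Let K be generated by \<open>ks\<close>.
  Tight closedness passes from (K, w) to (K, w^s) for s \<ge> 1, because powers of w cancel modulo
  Frobenius powers of K. For large s, w^s = k + a v with k in K, and (K, w^s) : a = (K, v);
  multiplication by \<open>a\<close> carries the tight closure of (K, v) into that of (K, w^s),
  which is already known.\<close>

lemma tc_closed_exchange:
  assumes w: "sop (ks @ [w])" and v: "sop (ks @ [v])" and tc: "tc_closed (ks @ [w])"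
  shows "tc_closed (ks @ [v])"
proof -
  let ?K = "Idl (set ks)"
  have kc: "set ks \<subseteq> carrier R" and wc: "w \<in> carrier R" and vc: "v \<in> carrier R"
    using sop_carrier[OF w] sop_carrier[OF v] by auto
  have KI: "ideal ?K R" using genideal_ideal[OF kc] .
  have setw: "set (ks @ [x]) = insert x (set ks)" for x by simp
  have ins: "ideal (Idl (insert x (set ks))) R" "?K \<subseteq> Idl (insert x (set ks))" "x \<in> Idl (insert x (set ks))"
    if "x \<in> carrier R" for x
    using that kc genideal_ideal[of "insert x (set ks)"] genideal_self[of "insert x (set ks)"]
      genideal_mono[of "set ks" "insert x (set ks)"] by auto
  have tcI: "ideal (tight_closure R (Idl (insert x (set ks)))) R" if "x \<in> carrier R" for x
    using tight_closure_ideal[OF ideal_D(1)[OF ins(1)[OF that]]] ins(3)[OF that] by blast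
  have stc: "Idl (insert x (set ks)) \<subseteq> tight_closure R (Idl (insert x (set ks)))" if "x \<in> carrier R" for x
    using subset_tight_closure[OF ideal_D(1)[OF ins(1)[OF that]]] .
  have nw: "nzd ?K w" using sop_nzd_last[OF w] .
  have pw: "tight_closure R (Idl (insert (w [^] Suc s) (set ks))) \<subseteq> Idl (insert (w [^] Suc s) (set ks))" for s
  proof (induction s)
    case 0
    then show ?case using tc wc unfolding setw by simp
  next
    case (Suc s)
    let ?J = "Idl (insert (w [^] Suc (Suc s)) (set ks))"
    let ?t = "Suc s"
    have wt: "w [^] ?t \<in> carrier R" "w [^] Suc ?t \<in> carrier R" using wc by auto
    show ?case
    proof
      fix x assume x: "x \<in> tight_closure R ?J"
      have "?J \<subseteq> Idl (insert (w [^] ?t) (set ks))"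
      proof (rule genideal_minimal[OF ins(1)[OF wt(1)]])
        have "w \<otimes> w [^] ?t \<in> Idl (insert (w [^] ?t) (set ks))"
          using ideal_D(6)[OF ins(1)[OF wt(1)] ins(3)[OF wt(1)] wc] .
        then show "insert (w [^] Suc ?t) (set ks) \<subseteq> Idl (insert (w [^] ?t) (set ks))"
          using genideal_self[OF kc] ins(2)[OF wt(1)] wc by (auto simp: m_comm)
      qed
      then have "x \<in> Idl (insert (w [^] ?t) (set ks))"
        using tight_closure_mono[OF _ ideal_D(1)[OF ins(1)[OF wt(1)]]] x Suc by blast
      then obtain k r where kr: "k \<in> ?K" "r \<in> carrier R" "x = k \<oplus> r \<otimes> w [^] ?t"
        using mem_genideal_insert'[OF kc wt(1)] by blast
      have "k \<in> tight_closure R ?J" using kr(1) ins(2)[OF wt(2)] stc[OF wt(2)] by blast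
      \<comment> \<open>With W = w^q, the relation for r w^t says that c r^q W^t lies in the ideal
        of W^(t+1) and the q-th powers of \<open>ks\<close>. W is regular modulo the latter, so W^t
        cancels and c r^q lies in (K, w)^[q]; hence r is in the tight closure of (K, w), and x = k +
        r w^t gains one more factor w.\<close>
      then have "r \<otimes> w [^] ?t \<in> tight_closure R ?J"
        using ideal_add_cancel[OF tcI[OF wt(2)], of k "r \<otimes> w [^] ?t"] kr x wt by simp
      then obtain c e0 where c: "c \<in> ring_circ R" "\<And>e. e \<ge> e0 \<Longrightarrow>
          c \<otimes> (r \<otimes> w [^] ?t) [^] (ring_char R ^ e) \<in> frobenius_power R ?J (ring_char R ^ e)"
        unfolding mem_tight_closure_iff by blast
      have cc: "c \<in> carrier R" using ring_circ_carrier[OF c(1)] .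
      have "c \<otimes> r [^] (ring_char R ^ e) \<in> frobenius_power R (Idl (insert w (set ks))) (ring_char R ^ e)"
        if e: "e \<ge> e0" for e
      proof -
        let ?q = "ring_char R ^ e"
        let ?Kq = "(\<lambda>a. a [^] ?q) ` set ks"
        have Kqc: "?Kq \<subseteq> carrier R" using kc by auto
        have KqI: "ideal (Idl ?Kq) R" using genideal_ideal[OF Kqc] .
        define W where "W = w [^] ?q"
        have Wc: "W \<in> carrier R" using wc by (simp add: W_def)
        have wW: "(w [^] Suc ?t) [^] ?q = W [^] Suc ?t"
          unfolding W_def nat_pow_pow[OF wc] by (simp only: mult.commute)
        have fJ: "frobenius_power R ?J ?q = Idl (insert (W [^] Suc ?t) ?Kq)"
          using frobenius_power_genideal[of "insert (w [^] Suc ?t) (set ks)" e] kc wt(2) prime_char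
          unfolding image_insert wW by blast
        have fw: "frobenius_power R (Idl (insert w (set ks))) ?q = Idl (insert W ?Kq)"
          using frobenius_power_genideal[of "insert w (set ks)" e] kc wc prime_char unfolding W_def by simp
        have nW: "nzd (Idl ?Kq) W"
          using sop_nzd_last[of "map (\<lambda>x. x [^] ?q) ks" W] sop_map_pow[OF w, of e] unfolding W_def by simp
        have wWt: "(w [^] ?t) [^] ?q = W [^] ?t"
          unfolding W_def nat_pow_pow[OF wc] by (simp only: mult.commute)
        have "c \<otimes> (r \<otimes> w [^] ?t) [^] ?q = (c \<otimes> r [^] ?q) \<otimes> W [^] ?t"
          using cc kr(2) wt(1) Wc unfolding nat_pow_distrib[OF kr(2) wt(1)] wWt
          by (intro m_assoc[symmetric]) auto
        then have "(c \<otimes> r [^] ?q) \<otimes> W [^] ?t \<in> Idl (insert (W [^] Suc ?t) ?Kq)" using c(2)[OF e] fJ by simp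
        then obtain k' b where kb: "k' \<in> Idl ?Kq" "b \<in> carrier R"
          "(c \<otimes> r [^] ?q) \<otimes> W [^] ?t = k' \<oplus> b \<otimes> W [^] Suc ?t"
          using mem_genideal_insert'[OF Kqc, of "W [^] Suc ?t"] Wc by blast
        have k'c: "k' \<in> carrier R" using ideal_D(8)[OF KqI kb(1)] .
        define g where "g = c \<otimes> r [^] ?q"
        have gc: "g \<in> carrier R" using cc kr(2) by (simp add: g_def)
        have "W [^] ?t \<otimes> (g \<ominus> b \<otimes> W) = g \<otimes> W [^] ?t \<ominus> b \<otimes> W [^] Suc ?t"
          using gc kb(2) Wc by (simp add: a_minus_def r_distr r_minus m_ac)
        also have "\<dots> = (k' \<oplus> b \<otimes> W [^] Suc ?t) \<ominus> b \<otimes> W [^] Suc ?t" using kb(3) unfolding g_def by simp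
        also have "\<dots> = k'" using k'c kb(2) Wc by (simp add: a_minus_def a_assoc r_neg)
        finally have "g \<ominus> b \<otimes> W \<in> Idl ?Kq"
          using nzdD[OF nzd_pow[OF nW Wc, of ?t], of "g \<ominus> b \<otimes> W"] gc kb Wc by simp
        moreover have "g = (g \<ominus> b \<otimes> W) \<oplus> b \<otimes> W" using gc kb(2) Wc by (simp add: a_minus_def a_assoc l_neg)
        ultimately have "g \<in> Idl (insert W ?Kq)" using mem_genideal_insert'[OF Kqc Wc] kb(2) by blast
        then show ?thesis using fw unfolding g_def by simp
      qed
      then have "r \<in> tight_closure R (Idl (insert w (set ks)))"
        unfolding mem_tight_closure_iff using kr(2) c(1) by blast
      then have "r \<in> Idl (insert w (set ks))" using tc unfolding setw by simp
      then obtain k2 r2 where k2: "k2 \<in> ?K" "r2 \<in> carrier R" "r = k2 \<oplus> r2 \<otimes> w"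
        using mem_genideal_insert'[OF kc wc] by blast
      have c2: "k \<in> carrier R" "k2 \<in> carrier R" using ideal_D(8)[OF KI] kr(1) k2(1) by auto
      have "x = k \<oplus> (k2 \<oplus> r2 \<otimes> w) \<otimes> w [^] ?t" using kr(3) k2(3) by simp
      also have "\<dots> = (k \<oplus> k2 \<otimes> w [^] ?t) \<oplus> r2 \<otimes> w [^] Suc ?t"
        using k2(2) c2 wc by (simp add: l_distr r_distr a_assoc m_ac)
      finally have "x = (k \<oplus> k2 \<otimes> w [^] ?t) \<oplus> r2 \<otimes> w [^] Suc ?t" .
      moreover have "k \<oplus> k2 \<otimes> w [^] ?t \<in> ?K"
        using ideal_D(3)[OF KI kr(1) ideal_D(7)[OF KI k2(1) wt(1)]] .
      ultimately show "x \<in> ?J" using mem_genideal_insert'[OF kc wt(2)] k2(2) by blast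
    qed
  qed
  \<comment> \<open>The exponent \<open>Suc t\<close> below keeps the power of \<open>w\<close>
    positive, as \<open>pw\<close> requires, even for \<open>t\<close> = 0.\<close>
  obtain t where t: "ideal_pow R \<mm> t \<subseteq> Idl (insert v (set ks))" using v unfolding sop_def by auto
  let ?w = "w [^] Suc t"
  have wtc: "?w \<in> carrier R" using wc by simp
  have "w \<in> \<mm>" using w by (auto simp: sop_def)
  then have "?w \<in> Idl (insert v (set ks))"
    using subsetD[OF t subsetD[OF ideal_pow_antimono[OF mm_ideal le_SucI[OF order_refl]] pow_mem_ideal_pow[OF mm_ideal]]] by blast
  then obtain k a where ka: "k \<in> ?K" "a \<in> carrier R" "?w = k \<oplus> a \<otimes> v"
    using mem_genideal_insert'[OF kc vc] by blast
  have k_c: "k \<in> carrier R" using ideal_D(8)[OF KI ka(1)] .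
  have na: "nzd ?K a" unfolding nzd_def
  proof (intro ballI impI)
    fix r assume r: "r \<in> carrier R" "a \<otimes> r \<in> ?K"
    have "?w \<otimes> r = r \<otimes> k \<oplus> v \<otimes> (a \<otimes> r)"
      unfolding ka(3) using k_c ka(2) vc r(1) by (simp add: l_distr r_distr m_ac)
    then have "?w \<otimes> r \<in> ?K" using ideal_D(3)[OF KI ideal_D(6)[OF KI ka(1) r(1)] ideal_D(6)[OF KI r(2) vc]] by simp
    then show "r \<in> ?K" using nzdD[OF nzd_pow[OF nw wc] r(1)] by blast
  qed
  have "x \<in> Idl (insert v (set ks))" if x: "x \<in> tight_closure R (Idl (insert v (set ks)))" for x
  proof -
    have xc: "x \<in> carrier R" using x tight_closure_carrier by blast
    have ab: "a \<otimes> b \<in> Idl (insert ?w (set ks))" if b: "b \<in> Idl (insert v (set ks))" for b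
    proof -
      obtain k1 r1 where k1: "k1 \<in> ?K" "r1 \<in> carrier R" "b = k1 \<oplus> r1 \<otimes> v"
        using mem_genideal_insert'[OF kc vc] b by blast
      have k1c: "k1 \<in> carrier R" using ideal_D(8)[OF KI k1(1)] .
      have "a \<otimes> v = ?w \<ominus> k" unfolding ka(3) using k_c ka(2) vc by (simp add: a_minus_def a_comm[of k] a_assoc r_neg)
      have "a \<otimes> b = a \<otimes> k1 \<oplus> r1 \<otimes> (a \<otimes> v)" using k1 k1c ka(2) vc by (simp add: r_distr m_lcomm)
      also have "\<dots> = (a \<otimes> k1 \<ominus> r1 \<otimes> k) \<oplus> r1 \<otimes> ?w"
        unfolding \<open>a \<otimes> v = ?w \<ominus> k\<close> using k1 k1c ka(2) k_c wtc
        by (simp add: a_minus_def r_distr r_minus a_ac del: nat_pow_Suc)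
      finally have "a \<otimes> b = (a \<otimes> k1 \<ominus> r1 \<otimes> k) \<oplus> r1 \<otimes> ?w" .
      moreover have "a \<otimes> k1 \<ominus> r1 \<otimes> k \<in> ?K"
        using ideal_D(4)[OF KI ideal_D(6)[OF KI k1(1) ka(2)] ideal_D(6)[OF KI ka(1) k1(2)]] .
      ultimately show ?thesis using mem_genideal_insert'[OF kc wtc] k1(2) by blast
    qed
    have "a \<otimes> x \<in> tight_closure R (Idl (insert ?w (set ks)))"
      using tight_closure_mult[OF ideal_D(1)[OF ins(1)[OF vc]] ideal_D(1)[OF ins(1)[OF wtc]] ka(2) ab x] .
    then have "a \<otimes> x \<in> Idl (insert ?w (set ks))" using pw by blast
    then obtain k1 s where k1: "k1 \<in> ?K" "s \<in> carrier R" "a \<otimes> x = k1 \<oplus> s \<otimes> ?w"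
      using mem_genideal_insert'[OF kc wtc] by blast
    have k1c: "k1 \<in> carrier R" using ideal_D(8)[OF KI k1(1)] .
    have "a \<otimes> x = (k1 \<oplus> s \<otimes> k) \<oplus> a \<otimes> (s \<otimes> v)"
      unfolding k1(3) ka(3) using k1c k1(2) k_c ka(2) vc by (simp add: r_distr a_assoc m_lcomm)
    then have "a \<otimes> (x \<ominus> s \<otimes> v) = ((k1 \<oplus> s \<otimes> k) \<oplus> a \<otimes> (s \<otimes> v)) \<ominus> a \<otimes> (s \<otimes> v)"
      using xc ka(2) k1(2) vc by (simp add: a_minus_def r_distr r_minus)
    also have "\<dots> = k1 \<oplus> s \<otimes> k" using k1c k1(2) k_c ka(2) vc by (simp add: a_minus_def a_assoc r_neg)
    also have "\<dots> \<in> ?K" using ideal_D(3)[OF KI k1(1) ideal_D(6)[OF KI ka(1) k1(2)]] .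
    finally have "x \<ominus> s \<otimes> v \<in> ?K" using nzdD[OF na, of "x \<ominus> s \<otimes> v"] xc k1(2) vc by simp
    moreover have "x = (x \<ominus> s \<otimes> v) \<oplus> s \<otimes> v" using xc k1(2) vc by (simp add: a_minus_def a_assoc l_neg)
    ultimately show ?thesis using mem_genideal_insert'[OF kc vc] k1(2) by blast
  qed
  then show ?thesis unfolding setw using stc[OF vc] by blast
qed

text \<open>Changing the last element \<open>a\<close> of \<open>ys\<close> modulo (fs, ys') keeps
  the first ideal and can make the new element \<open>u\<close> regular modulo (fs, zs'). Then
  \<open>u\<close> joins the common prefix, the induction compares ys' with zs', and one exchange
  turns \<open>u\<close> into the last element of \<open>zs\<close>.\<close>

lemma tc_closed_sop:
  assumes "sop (fs @ ys)" "sop (fs @ zs)" "length ys = length zs" "tc_closed (fs @ ys)"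
  shows "tc_closed (fs @ zs)"
  using assms
proof (induction "length ys" arbitrary: fs ys zs)
  case 0
  then show ?case by simp
next
  case (Suc n)
  obtain ys' a where ys: "ys = ys' @ [a]" using Suc by (metis length_Suc_conv rev_exhaust list.discI)
  obtain zs' b where zs: "zs = zs' @ [b]" using Suc by (metis length_Suc_conv rev_exhaust list.discI)
  define Y where "Y = set (fs @ ys')"
  define Z where "Z = set (fs @ zs')"
  have inm: "set fs \<subseteq> \<mm>" "set ys' \<subseteq> \<mm>" "set zs' \<subseteq> \<mm>" "a \<in> \<mm>" "b \<in> \<mm>"
    and len: "length fs + Suc n = d" "length ys' = n" "length zs' = n"
    using Suc.prems Suc.hyps ys zs by (auto simp: sop_def)
  have Yc: "Y \<subseteq> carrier R" "Z \<subseteq> carrier R" "Y \<subseteq> \<mm>" and ac: "a \<in> carrier R"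
    using inm mm_carrier by (auto simp: Y_def Z_def)
  have CI: "ideal (Idl Y) R" and ZI: "ideal (Idl Z) R" using genideal_ideal Yc by auto
  have aY: "Idl (insert a (Idl Y)) = Idl (set (fs @ ys))"
    using genideal_insert_genideal[OF Yc(1) ac] by (simp add: Y_def ys)
  have "\<exists>s\<in>Idl Y. \<forall>Q\<in>assoc_primes (Idl Z). a \<oplus> s \<notin> Q"
  proof (rule coset_prime_avoidance[OF finite_assoc_primes[OF ZI] assoc_primes_prime CI ac])
    fix Q assume Q: "Q \<in> assoc_primes (Idl Z)"
    show "\<not> insert a (Idl Y) \<subseteq> Q"
    proof
      assume sub: "insert a (Idl Y) \<subseteq> Q"
      have Qp: "primeideal Q R" using assoc_primes_prime[OF Q] .
      have "Idl (set (fs @ ys)) \<subseteq> Q" unfolding aY[symmetric] using sub prime_D(1)[OF Qp] by (intro genideal_minimal)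
      then obtain t where t: "ideal_pow R \<mm> t \<subseteq> Q" using Suc.prems(1) unfolding sop_def by blast
      have "b [^] t \<in> Q" using pow_mem_ideal_pow[OF mm_ideal inm(5)] t by blast
      then have "b \<in> Q" using prime_pow[OF Qp] inm(5) mm_carrier by blast
      moreover have "nzd (Idl Z) b" using sop_nzd_last[of "fs @ zs'" b] Suc.prems(2) zs unfolding Z_def by simp
      ultimately show False using nzd_not_mem_assoc_prime[OF ZI Q] by blast
    qed
  qed
  then obtain s where s: "s \<in> Idl Y" "\<And>Q. Q \<in> assoc_primes (Idl Z) \<Longrightarrow> a \<oplus> s \<notin> Q" by blast
  define u where "u = a \<oplus> s"
  have "Idl Y \<subseteq> \<mm>" using Yc mm_ideal by (intro genideal_minimal)
  then have um: "u \<in> \<mm>" unfolding u_def using ideal_D(3)[OF mm_ideal inm(4)] s(1) by blast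
  have uc: "u \<in> carrier R" using um mm_carrier by auto
  have nu: "nzd (Idl Z) u" using zero_divisor_mem_assoc_prime[OF ZI uc] s(2) unfolding u_def by blast
  have su: "sop ((fs @ zs') @ [u])"
    using sop_snoc_replace[of "fs @ zs'" b u] Suc.prems(2) zs um nu unfolding Z_def by simp
  have eqY: "Idl (set ((fs @ [u]) @ ys')) = Idl (set (fs @ ys))"
    using genideal_insert_add[OF CI ac s(1)] genideal_insert_genideal[OF Yc(1) uc] aY
    unfolding u_def Y_def by simp
  have eqZ: "set ((fs @ [u]) @ zs') = set ((fs @ zs') @ [u])" by auto
  have "tc_closed ((fs @ [u]) @ zs')"
  proof (rule Suc.hyps(1))
    show "sop ((fs @ [u]) @ ys')"
      by (rule sop_cong[OF Suc.prems(1)]) (use inm um len eqY in auto)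
    show "sop ((fs @ [u]) @ zs')"
      by (rule sop_cong[OF su]) (use inm um len eqZ in auto)
    show "tc_closed ((fs @ [u]) @ ys')" using Suc.prems(4) eqY by simp
  qed (use len in auto)
  then have "tc_closed ((fs @ zs') @ [u])" unfolding eqZ .
  then have "tc_closed ((fs @ zs') @ [b])"
    using tc_closed_exchange[OF su, of b] Suc.prems(2) zs by simp
  then show ?case using zs by simp
qed

text \<open>An ideal J = (ws) of the principal class extends to a system of parameters ws, zs, and
  zs may be replaced by powers. All ideals so obtained are tightly closed and contain J, so J^* lies
  in every J + \<mm>^n, and these intersect in J.\<close>

lemma F_rational_if_tc_closed_sop:
  assumes xs: "sop xs" and tc: "tc_closed xs"
  shows "F_rational R"
  unfolding F_rational_def
proof (intro allI impI)
  have tc_all: "tc_closed zs" if "sop zs" for zs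
    using tc_closed_sop[of "[]" xs zs] xs tc that by (auto simp: sop_def)
  fix J assume "principal_class R J"
  then obtain ws where ws: "set ws \<subseteq> carrier R" "J = Idl (set ws)" "enat (length ws) = height R J"
    unfolding principal_class_def by blast
  obtain zs where zs: "sop (ws @ zs)" using exists_sop_extension[OF ws(1)] ws by auto
  have zc: "set zs \<subseteq> carrier R" "set zs \<subseteq> \<mm>" using zs mm_carrier by (auto simp: sop_def)
  have JI: "ideal J R" using ws genideal_ideal by simp
  have "tight_closure R J \<subseteq> J"
  proof
    fix x assume x: "x \<in> tight_closure R J"
    show "x \<in> J"
    proof (rule krull_intersection[OF JI])
      fix n
      \<comment> \<open>Exponents start at 1, since z^0 = 1 would not lie in \<open>\<mm>\<close>;
        the result for n follows by antitonicity.\<close>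
      have "x \<in> Idl (J \<union> ideal_pow R \<mm> (Suc n))"
      proof -
        let ?z = "map (\<lambda>z. z [^] Suc n) zs"
        have pm: "z [^] Suc n \<in> ideal_pow R \<mm> (Suc n)" if "z \<in> set zs" for z
          using pow_mem_ideal_pow[OF mm_ideal, of z "Suc n"] zc(2) that by blast
        have zcm: "set ?z \<subseteq> \<mm>" using zc(2) ideal_pow_mem[OF mm_ideal, of _ "Suc n"] by auto
        have c: "set (ws @ ?z) \<subseteq> carrier R" using ws(1) zcm mm_carrier by auto
        have sz: "sop (ws @ ?z)"
        proof (rule sop_radical[OF zs])
          show "set (ws @ ?z) \<subseteq> \<mm>" using zs zcm by (auto simp: sop_def)
          show "length (ws @ ?z) = d" using zs by (simp add: sop_def)
          fix x assume "x \<in> set (ws @ zs)"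
          then consider "x \<in> set ws" | "x \<in> set zs" by auto
          then show "\<exists>n::nat. x [^] n \<in> Idl (set (ws @ ?z))"
          proof cases
            case 1
            then have "x \<in> Idl (set (ws @ ?z))" "x \<in> carrier R" using genideal_self[OF c] ws(1) by auto
            then have "x [^] (1::nat) \<in> Idl (set (ws @ ?z))" by simp
            then show ?thesis by blast
          next
            case 2
            then have "x [^] Suc n \<in> Idl (set (ws @ ?z))" using genideal_self[OF c] by auto
            then show ?thesis by blast
          qed
        qed
        have "J \<subseteq> Idl (set (ws @ ?z))" unfolding ws(2) by (rule genideal_mono) (use c in auto)
        then have "tight_closure R J \<subseteq> tight_closure R (Idl (set (ws @ ?z)))"
          by (rule tight_closure_mono) (rule ideal_D(1)[OF genideal_ideal[OF c]])
        then have "x \<in> Idl (set (ws @ ?z))" using tc_all[OF sz] x by blast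
        moreover have "Idl (set (ws @ ?z)) \<subseteq> Idl (J \<union> ideal_pow R \<mm> (Suc n))"
        proof (rule genideal_minimal)
          have uc: "J \<union> ideal_pow R \<mm> (Suc n) \<subseteq> carrier R"
            using ideal_D(1)[OF JI] ideal_D(1)[OF ideal_pow_ideal[OF mm_ideal]] by blast
          show "ideal (Idl (J \<union> ideal_pow R \<mm> (Suc n))) R" using genideal_ideal[OF uc] .
          have "set ws \<subseteq> J" using genideal_self[OF ws(1)] ws(2) by simp
          then show "set (ws @ ?z) \<subseteq> Idl (J \<union> ideal_pow R \<mm> (Suc n))"
            using genideal_self[OF uc] pm by auto
        qed
        ultimately show ?thesis by blast
      qed
      moreover have "Idl (J \<union> ideal_pow R \<mm> (Suc n)) \<subseteq> Idl (J \<union> ideal_pow R \<mm> n)"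
        using ideal_pow_antimono[OF mm_ideal, of n "Suc n"] ideal_D(1)[OF JI]
          ideal_D(1)[OF ideal_pow_ideal[OF mm_ideal, of n]] by (intro genideal_mono) auto
      ultimately show "x \<in> Idl (J \<union> ideal_pow R \<mm> n)" by blast
    qed
  qed
  then show "tight_closure R J = J" using subset_tight_closure[OF ideal_D(1)[OF JI]] by blast
qed

lemma tc_closed_if_F_rational:
  assumes "F_rational R" "sop xs"
  shows "tc_closed xs"
proof -
  have "principal_class R (Idl (set xs))"
    unfolding principal_class_def using sop_carrier[OF assms(2)] sop_height[OF assms(2)] assms(2)
    by (auto simp: sop_def)
  then show ?thesis using assms(1) unfolding F_rational_def by blast
qed

end

section \<open>The Frobenius filtration\<close>

lemma binomial_asymp:
  "(\<lambda>n. real ((n + c) choose d) / real n ^ d) \<longlonglongrightarrow> 1 / fact d"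
proof -
  have t: "(\<lambda>n. (real (n + c) - real i) / real n) \<longlonglongrightarrow> 1" for i
  proof -
    have "(\<lambda>n. 1 + (real c - real i) / real n) \<longlonglongrightarrow> 1 + 0"
      by (intro tendsto_add tendsto_const lim_const_over_n)
    moreover have "\<forall>\<^sub>F n in sequentially. 1 + (real c - real i) / real n = (real (n + c) - real i) / real n"
      using eventually_gt_at_top[of 0] by eventually_elim (simp add: field_simps)
    ultimately show ?thesis using tendsto_cong by fastforce
  qed
  have "(\<lambda>n. (\<Prod>i<d. (real (n + c) - real i) / real n) / fact d) \<longlonglongrightarrow> (\<Prod>i<d. 1) / fact d"
    by (intro tendsto_divide tendsto_prod t tendsto_const) simp
  moreover have "(\<Prod>i<d. (real (n + c) - real i) / real n) / fact d = real ((n + c) choose d) / real n ^ d" for n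
    by (simp add: binomial_gbinomial gbinomial_prod_rev prod_dividef atLeast0LessThan)
  ultimately show ?thesis by simp
qed

lemma binomial_asymp_shift:
  "(\<lambda>n. real ((n + c - i) choose d) / real n ^ d) \<longlonglongrightarrow> 1 / fact d"
proof -
  have "(\<lambda>n. real (((n + i) + c - i) choose d) / real (n + i) ^ d) \<longlonglongrightarrow> 1 / fact d"
  proof -
    have r: "(\<lambda>n. real n / real (n + i)) \<longlonglongrightarrow> 1"
    proof -
      have "(\<lambda>n. 1 / (1 + real i / real n)) \<longlonglongrightarrow> 1 / (1 + 0)"
        by (intro tendsto_intros lim_const_over_n) auto
      moreover have "\<forall>\<^sub>F n in sequentially. 1 / (1 + real i / real n) = real n / real (n + i)"
        using eventually_gt_at_top[of 0] by eventually_elim (simp add: field_simps)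
      ultimately show ?thesis using tendsto_cong by fastforce
    qed
    have "(\<lambda>n. real ((n + c) choose d) / real n ^ d * (real n / real (n + i)) ^ d) \<longlonglongrightarrow> 1 / fact d * 1 ^ d"
      by (intro tendsto_mult tendsto_power binomial_asymp r)
    moreover have "\<forall>\<^sub>F n in sequentially. real ((n + c) choose d) / real n ^ d * (real n / real (n + i)) ^ d
        = real (((n + i) + c - i) choose d) / real (n + i) ^ d"
      using eventually_gt_at_top[of 0] by eventually_elim (simp add: field_simps power_divide)
    ultimately show ?thesis using tendsto_cong by fastforce
  qed
  then show ?thesis by (rule LIMSEQ_offset)
qed

text \<open>The bounded shift \<open>h\<close> does not affect the leading coefficient in n, so
  division by n^d and passage to the limit compare \<open>s\<close> with \<open>l\<close>.\<close>

lemma binomial_growth_le: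
  fixes s l h d :: nat
  assumes "\<And>n. s * ((n - h + d - 1) choose d) \<le> l * ((n + d - 1) choose d)" "d \<ge> 1"
  shows "s \<le> l"
proof -
  have "(\<lambda>n. real l * (real (((n + h) + d - 1) choose d) / real n ^ d)) \<longlonglongrightarrow> real l * (1 / fact d)"
    using binomial_asymp[of "h + d - 1" d] assms(2) by (intro tendsto_mult tendsto_const) (simp add: add.assoc)
  moreover have "(\<lambda>n. real s * (real ((n + d - 1) choose d) / real n ^ d)) \<longlonglongrightarrow> real s * (1 / fact d)"
    using binomial_asymp[of "d - 1" d] assms(2) by (intro tendsto_mult tendsto_const) simp
  moreover have "real s * (real ((n + d - 1) choose d) / real n ^ d)
      \<le> real l * (real (((n + h) + d - 1) choose d) / real n ^ d)" for n
  proof -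
    have "real (s * ((n + d - 1) choose d)) \<le> real (l * (((n + h) + d - 1) choose d))"
      using assms(1)[of "n + h"] by (simp only: of_nat_le_iff) simp
    then have "real (s * ((n + d - 1) choose d)) / real n ^ d \<le> real (l * (((n + h) + d - 1) choose d)) / real n ^ d"
      by (rule divide_right_mono) simp
    then show ?thesis by simp
  qed
  ultimately have "real s * (1 / fact d) \<le> real l * (1 / fact d)" by (intro LIMSEQ_le) auto
  then have "real s * (1 / fact d) * fact d \<le> real l * (1 / fact d) * fact d" by (rule mult_right_mono) simp
  then show ?thesis by simp
qed

section \<open>Descending chains, the completion, reducedness\<close>

context cring
begin

text \<open>The lengths of R/A_n are bounded by that of R/J; from an index where this length is
  largest, a further strict descent would exceed it.\<close>

lemma ideal_dcc:
  fixes A :: "nat \<Rightarrow> 'a set"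
  assumes A: "\<And>n. ideal (A n) R" "\<And>n. A (Suc n) \<subseteq> A n" and J: "\<And>n. J \<subseteq> A n"
    and fin: "ilen J (carrier R) = enat l"
  shows "\<exists>n0. \<forall>n\<ge>n0. A n = A n0"
proof -
  have Ac: "A n \<subseteq> carrier R" for n using ideal_D(1)[OF A(1)] .
  have le: "ilen (A n) (carrier R) \<le> enat l" for n using ilen_mono[OF J order_refl, of n "carrier R"] fin by simp
  define f where "f n = the_enat (ilen (A n) (carrier R))" for n
  have f: "ilen (A n) (carrier R) = enat (f n)" for n
    using le[of n] unfolding f_def by (cases "ilen (A n) (carrier R)") auto
  have "\<exists>n0. \<forall>n. f n \<le> f n0"
  proof -
    have "f n < Suc l" for n using le[of n] unfolding f by simp
    then show ?thesis using ex_has_greatest_nat[of "\<lambda>_. True" 0 f "Suc l"] by blast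
  qed
  then obtain n0 where n0: "\<And>n. f n \<le> f n0" by blast
  have "A n = A n0" if n: "n \<ge> n0" for n
  proof (rule ccontr)
    assume ne: "A n \<noteq> A n0"
    have sub: "A n \<subseteq> A n0" using lift_Suc_antimono_le[of A, OF A(2) n] .
    then have "1 \<le> ilen (A n) (A n0)" using one_le_ilen[OF A(1), of n "A n0"] ne by auto
    then have "1 + ilen (A n0) (carrier R) \<le> ilen (A n) (carrier R)"
      unfolding ilen_add[OF A(1) A(1) oneideal sub Ac] by (rule add_right_mono)
    then have "enat (Suc (f n0)) \<le> enat (f n)" unfolding f by (simp add: one_enat_def)
    then show False using n0[of n] by simp
  qed
  then show ?thesis by blast
qed

text \<open>The freeness of I^n/J I^n over R/J, read off on coefficients. With \<open>J\<close> =
  \<open>\<mm>\<close> it says that a form with a unit coefficient has its value outside \<mm>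
  I^n.\<close>

lemma quasi_regular_ideal:
  assumes yc: "\<And>i. y i \<in> carrier R" and reg: "\<forall>k<d. nzd (gid y k) (y k)"
    and J: "ideal J R" "gid y d \<subseteq> J" and c: "c \<in> UNIV \<rightarrow> carrier R"
    and e: "ev y d n c \<in> J \<cdot> ideal_pow R (gid y d) n" and a: "\<alpha> \<in> Mon d n"
  shows "c \<alpha> \<in> J"
proof -
  obtain b where b: "ev y d n c = ev y d n b" "b \<in> UNIV \<rightarrow> carrier R" "\<forall>\<alpha>\<in>Mon d n. b \<alpha> \<in> J"
    using e unfolding ideal_prod_pow_eq_evs[of y, OF yc J(1)] evs_def[of y, OF yc] by blast
  have "ev y d n (\<lambda>\<alpha>. c \<alpha> \<ominus> b \<alpha>) = \<zero>"
    using ev_minus[of y, OF yc c b(2)] b(1) ev_closed[of y, OF yc b(2)] by (simp add: a_minus_def r_neg)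
  moreover have bc: "b \<alpha> \<in> carrier R" "c \<alpha> \<in> carrier R" for \<alpha> using b(2) c by auto
  then have "(\<lambda>\<alpha>. c \<alpha> \<ominus> b \<alpha>) \<in> UNIV \<rightarrow> carrier R" by auto
  ultimately have "c \<alpha> \<ominus> b \<alpha> \<in> J" using quasi_regular_zero[of y, OF yc reg] a J(2) by blast
  then show ?thesis using ideal_minus_cancel[OF J(1) _ bc(2)] b(3) a by blast
qed

lemma nat_pow_adic_completion:
  assumes I: "ideal I R" and r: "\<And>j. \<rho> j \<in> carrier R"
  shows "(\<lambda>j. ideal_pow R I j +> \<rho> j) [^]\<^bsub>adic_completion R I\<^esub> (q::nat) = (\<lambda>j. ideal_pow R I j +> \<rho> j [^] q)"
proof (induction q)
  case 0
  have "\<one>\<^bsub>adic_completion R I\<^esub> = (\<lambda>j. ideal_pow R I j +> \<one>)"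
    by (simp add: adic_completion_def FactRing_def)
  then show ?case by (simp add: nat_pow_def)
next
  case (Suc q)
  have h: "ideal_pow R I j +> (a \<otimes> b) = (ideal_pow R I j +> a) \<otimes>\<^bsub>R Quot ideal_pow R I j\<^esub> (ideal_pow R I j +> b)"
    if "a \<in> carrier R" "b \<in> carrier R" for a b j
    using ring_hom_mult[OF ideal.rcos_ring_hom[OF ideal_pow_ideal[OF I]] that] .
  have "s [^]\<^bsub>adic_completion R I\<^esub> Suc q = s [^]\<^bsub>adic_completion R I\<^esub> q \<otimes>\<^bsub>adic_completion R I\<^esub> s" for s
    by (simp add: nat_pow_def)
  moreover have "s \<otimes>\<^bsub>adic_completion R I\<^esub> t = (\<lambda>j. s j \<otimes>\<^bsub>R Quot ideal_pow R I j\<^esub> t j)" for s t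
    by (simp add: adic_completion_def)
  ultimately show ?case unfolding Suc using h r by (simp add: Suc)
qed

text \<open>The coherent sequence \<open>\<rho>\<close> represents an element of the completion with vanishing \<open>q\<close>-th power.\<close>

lemma reduced_completion_D:
  assumes red: "reduced_ring (adic_completion R I)" and I: "ideal I R"
    and r: "\<And>j. \<rho> j \<in> carrier R" "\<And>j. \<rho> (Suc j) \<ominus> \<rho> j \<in> ideal_pow R I j"
    and q: "\<And>j. \<rho> j [^] (q::nat) \<in> ideal_pow R I j"
  shows "\<rho> j \<in> ideal_pow R I j"
proof -
  define s where "s = (\<lambda>j. ideal_pow R I j +> \<rho> j)"
  note P = ideal_pow_ideal[OF I]
  have zero: "\<zero>\<^bsub>adic_completion R I\<^esub> = (\<lambda>j. ideal_pow R I j)"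
    by (simp add: adic_completion_def FactRing_def)
  have "s (Suc j) \<subseteq> s j" for j
  proof
    fix v assume "v \<in> s (Suc j)"
    then obtain h where h: "h \<in> ideal_pow R I (Suc j)" "v = h \<oplus> \<rho> (Suc j)"
      unfolding s_def a_r_coset_def' by blast
    have hj: "h \<in> ideal_pow R I j" using ideal_pow_antimono[OF I, of j "Suc j"] h(1) by auto
    have hc: "h \<in> carrier R" using ideal_D(8)[OF P hj] .
    have "v = (h \<oplus> (\<rho> (Suc j) \<ominus> \<rho> j)) \<oplus> \<rho> j"
      using h(2) hc r(1)[of j] r(1)[of "Suc j"] by (simp add: a_minus_def a_assoc l_neg)
    then show "v \<in> s j" unfolding s_def a_r_coset_def' using ideal_D(3)[OF P hj r(2)] by blast
  qed
  moreover have "s j \<in> carrier (R Quot ideal_pow R I j)" for j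
    using ring_hom_closed[OF ideal.rcos_ring_hom[OF P] r(1)] unfolding s_def .
  ultimately have "s \<in> carrier (adic_completion R I)" by (simp add: adic_completion_def)
  moreover have "s [^]\<^bsub>adic_completion R I\<^esub> q = \<zero>\<^bsub>adic_completion R I\<^esub>"
    unfolding s_def nat_pow_adic_completion[OF I r(1)] zero using a_rcos_zero[OF P q] by auto
  ultimately have "s = \<zero>\<^bsub>adic_completion R I\<^esub>" using red unfolding reduced_ring_def by blast
  then have "s j = ideal_pow R I j" using zero by metis
  then show ?thesis using ideal.rcos_const_imp_mem[OF P r(1)] unfolding s_def by blast
qed

end

context noetherian_local
begin

text \<open>Constant sequences map R to the completion, and this map is injective by Krull's
  intersection theorem.\<close>

lemma reduced_if_completion_reduced:
  assumes red: "reduced_ring (adic_completion R \<mm>)" and x: "x \<in> carrier R" "x [^] (n::nat) = \<zero>"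
  shows "x = \<zero>"
proof -
  note P = ideal_pow_ideal[OF mm_ideal]
  have "x \<in> ideal_pow R \<mm> j" for j
    by (rule reduced_completion_D[OF red mm_ideal, of "\<lambda>_. x" n])
      (use x ideal_D(2)[OF P] in \<open>auto simp: a_minus_def r_neg\<close>)
  then have "x \<in> Idl ({\<zero>} \<union> ideal_pow R \<mm> j)" for j
    using genideal_self[of "{\<zero>} \<union> ideal_pow R \<mm> j"] ideal_D(1)[OF P] by auto
  then show ?thesis using krull_intersection[OF zeroideal] by blast
qed

text \<open>If c r = 0 and \<open>c\<close> avoids the minimal primes, then r lies in each of them,
  hence in every prime of a filtration of R. So r is nilpotent, and zero in a reduced ring.\<close>

lemma ring_circ_nzd:
  assumes red: "\<And>x n. x \<in> carrier R \<Longrightarrow> x [^] (n::nat) = \<zero> \<Longrightarrow> x = \<zero>" and c: "c \<in> ring_circ R"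
  shows "nzd {\<zero>} c"
  unfolding nzd_def
proof (intro ballI impI)
  fix r assume r: "r \<in> carrier R" "c \<otimes> r \<in> {\<zero>}"
  have cc: "c \<in> carrier R" using ring_circ_carrier[OF c] .
  obtain Ps where Ps: "prime_filtration {\<zero>} Ps" using exists_prime_filtration[OF zeroideal] by blast
  have "r \<in> P" if P: "P \<in> set Ps" for P
  proof -
    obtain Q where Q: "Q \<in> set Ps" "Q \<subseteq> P" "\<And>Q'. Q' \<in> set Ps \<Longrightarrow> Q' \<subseteq> Q \<Longrightarrow> Q' = Q"
      using finite_has_minimal2[OF finite_set P] by blast
    have Qp: "primeideal Q R" using prime_filtration_primes[OF Ps Q(1)] by blast
    have "minimal_prime R Q" unfolding minimal_prime_def
    proof (intro conjI allI impI Qp)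
      fix Q' assume Q': "primeideal Q' R \<and> Q' \<subseteq> Q"
      then have "{\<zero>} \<subseteq> Q'" using ideal_D(2)[OF prime_D(1)] by blast
      then obtain P' where P': "P' \<in> set Ps" "P' \<subseteq> Q'" using prime_filtration_least[OF Ps] Q' by blast
      have "P' \<subseteq> Q" using P'(2) Q' by blast
      then have "P' = Q" using Q(3)[OF P'(1)] by blast
      then show "Q' = Q" using P'(2) Q' by blast
    qed
    then have "c \<notin> Q" using c by (simp add: ring_circ_def)
    moreover have "c \<otimes> r \<in> Q" using r(2) ideal_D(2)[OF prime_D(1)[OF Qp]] by simp
    ultimately show ?thesis using prime_D(4)[OF Qp cc r(1)] Q(2) by blast
  qed
  then have "PIdl r \<subseteq> P" if "P \<in> set Ps" for P
    using that prime_filtration_primes[OF Ps that] prime_D(1) by (intro cgenideal_minimal) auto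
  then have "ideal_pow R (PIdl r) (length Ps) \<subseteq> {\<zero>}"
    using prime_filtration_pow[OF Ps cgenideal_ideal[OF r(1)]] by blast
  then have "r [^] length Ps = \<zero>"
    using pow_mem_ideal_pow[OF cgenideal_ideal[OF r(1)] cgenideal_self[OF r(1)], of "length Ps"] by blast
  then show "r \<in> {\<zero>}" using red[OF r(1)] by simp
qed

end

section \<open>The filtration M of Frobenius preimages and its cofinality\<close>

locale unramified_sop = cm_local_char_p +
  fixes xs :: "'a list"
  assumes sop: "sop xs" and unramified: "reduced_ring (adic_completion R \<mm>)"
    and dim_pos: "d \<ge> 1"
begin

abbreviation "p \<equiv> ring_char R"
abbreviation "y \<equiv> nth0 xs"
abbreviation "yp \<equiv> \<lambda>i. nth0 xs i [^] p"
abbreviation "I \<equiv> gid y d"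
abbreviation "B \<equiv> gid yp d"

lemma yc: "y i \<in> carrier R" using nth0_closed[OF sop_carrier[OF sop]] .
lemma zc: "yp i \<in> carrier R" using yc by simp

lemma gid_xs: "I = Idl (set xs)"
  using gid_nth0_length[of xs] sop by (simp add: sop_def)

lemma reg_pow: "\<forall>k<d. nzd (gid (\<lambda>i. y i [^] (p ^ e)) k) (y k [^] (p ^ e))"
  using sop_frob_reg[OF sop] .

lemma regy: "\<forall>k<d. nzd (gid y k) (y k)"
proof -
  have "y i [^] (1::nat) = y i" for i using yc by simp
  then show ?thesis using reg_pow[of 0] by simp
qed

lemma regz: "\<forall>k<d. nzd (gid yp k) (yp k)"
  using reg_pow[of 1] by simp

lemma I_ideal: "ideal I R" using gid_ideal[of y, OF yc] .
lemma B_ideal: "ideal B R" using gid_ideal[of yp, OF zc] .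
lemma In_ideal: "ideal (ideal_pow R I n) R" using ideal_pow_ideal[OF I_ideal] .
lemma Bn_ideal: "ideal (ideal_pow R B n) R" using ideal_pow_ideal[OF B_ideal] .

lemma I_subset_mm: "I \<subseteq> \<mm>"
  unfolding gid_xs using sop mm_ideal unfolding sop_def by (intro genideal_minimal) auto

lemma mm_pow_subset_I: "\<exists>t. ideal_pow R \<mm> t \<subseteq> I"
  unfolding gid_xs using sop by (simp add: sop_def)

lemma mm_pow_subset_I_pow: "\<exists>t. ideal_pow R \<mm> t \<subseteq> ideal_pow R I k"
proof -
  obtain t where "ideal_pow R \<mm> t \<subseteq> I" using mm_pow_subset_I by blast
  then have "ideal_pow R (ideal_pow R \<mm> t) k \<subseteq> ideal_pow R I k" by (rule ideal_pow_mono)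
  then show ?thesis unfolding ideal_pow_pow[OF mm_ideal] by blast
qed

lemma ilen_I: "\<exists>l. ilen I (carrier R) = enat l"
  using mm_pow_subset_I ilen_finite[OF I_ideal] by blast

definition lam :: nat where "lam = the_enat (ilen I (carrier R))"

lemma ilen_I_eq: "ilen I (carrier R) = enat lam"
  using ilen_I unfolding lam_def by auto

lemma ilen_In: "ilen (ideal_pow R I n) (carrier R) = enat (((n + d - 1) choose d) * lam)"
  using ilen_pow[of y, OF yc regy, of n] unfolding ilen_I_eq sum_card_Mon[OF dim_pos]
  by (simp add: of_nat_eq_enat)

lemma B_subset_I: "B \<subseteq> I"
  unfolding gid_def[of yp]
proof (rule genideal_minimal[OF I_ideal])
  show "yp ` {..<d} \<subseteq> I" using ideal_pow_mem[OF I_ideal gid_mem[of y, OF yc]] char_pow_pos[of 1] by auto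
qed

definition M :: "nat \<Rightarrow> 'a set" where
  "M n = {x \<in> carrier R. x [^] p \<in> ideal_pow R B n}"

lemma M_ideal: "ideal (M n) R"
proof (rule idealI')
  note P = Bn_ideal[of n]
  show "\<zero> \<in> M n" using ideal_D(2)[OF P] char_pow_pos[of 1] by (simp add: M_def nat_pow_zero)
  show "a \<oplus> b \<in> M n" if "a \<in> M n" "b \<in> M n" for a b
    using that ideal_D(3)[OF P] frob_add[of a b 1] by (simp add: M_def)
  show "r \<otimes> a \<in> M n" if "a \<in> M n" "r \<in> carrier R" for a r
    using that ideal_D(6)[OF P, of "a [^] p" "r [^] p"] by (simp add: M_def nat_pow_distrib)
qed (auto simp: M_def)

lemma M_antimono: "m \<le> n \<Longrightarrow> M n \<subseteq> M m"
  using ideal_pow_antimono[OF B_ideal] by (auto simp: M_def)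

lemma I_pow_subset_M: "ideal_pow R I n \<subseteq> M n"
proof
  fix x assume x: "x \<in> ideal_pow R I n"
  have "x [^] p \<in> frobenius_power R (ideal_pow R I n) (p ^ 1)"
    using pow_mem_frobenius_power[OF ideal_D(1)[OF In_ideal] x, of "p ^ 1"] by simp
  then show "x \<in> M n"
    using frobenius_power_gid_pow[of y, OF yc, where d = d and n = n and e = 1] ideal_D(8)[OF In_ideal x]
    by (auto simp: M_def)
qed

text \<open>Chevalley's theorem for the filtration \<open>M\<close>: if it failed to be cofinal with the \<open>I\<close>-adic one, a limit
  argument would give a nonzero element of the completion with vanishing \<open>p\<close>-th power.\<close>

lemma M_chevalley: "\<exists>n. M n \<subseteq> ideal_pow R I k"
proof (rule ccontr)
  assume "\<not> ?thesis"
  then have nM: "\<not> M n \<subseteq> ideal_pow R I k" for n by blast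
  \<comment> \<open>R/I^j has finite length, so for fixed j the ideals M_n + I^j become stationary
    in n, with limit \<open>F j\<close> below. An element of \<open>F j\<close> has a decomposition
    with M_n-part as deep as desired; this places its p-th power in I^j.\<close>
  define E where "E j n = Idl (M n \<union> ideal_pow R I j)" for j n
  have c: "M n \<union> ideal_pow R I j \<subseteq> carrier R" for n j using ideal_D(1)[OF M_ideal] ideal_D(1)[OF In_ideal] by blast
  have EI: "ideal (E j n) R" for j n unfolding E_def using genideal_ideal[OF c] .
  have "\<exists>n0. \<forall>n\<ge>n0. E j n = E j n0" for j
  proof (rule ideal_dcc[OF EI])
    show "E j (Suc n) \<subseteq> E j n" for n
      unfolding E_def by (rule genideal_mono[OF _ c]) (use M_antimono[of n "Suc n"] in auto)
    show "ideal_pow R I j \<subseteq> E j n" for n unfolding E_def using genideal_self[OF c] by blast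
    show "ilen (ideal_pow R I j) (carrier R) = enat (((j + d - 1) choose d) * lam)" by (rule ilen_In)
  qed
  then obtain N where N: "\<And>j n. n \<ge> N j \<Longrightarrow> E j n = E j (N j)" by metis
  define F where "F j = E j (N j)" for j
  have F_mem: "\<exists>u\<in>M n. \<exists>i\<in>ideal_pow R I j. r = u \<oplus> i" if "r \<in> F j" "n \<ge> N j" for r j n
  proof -
    have "r \<in> Idl (M n \<union> ideal_pow R I j)" using that N unfolding F_def E_def by blast
    then show ?thesis using mem_genideal_Un[OF M_ideal In_ideal] by blast
  qed
  have MF: "u \<in> F j" if "u \<in> M n" "n \<ge> N j" for u j n
    using that genideal_self[OF c, of n j] N[OF that(2)] unfolding F_def E_def by blast
  have Fc: "r \<in> carrier R" if "r \<in> F j" for r j using ideal_D(8)[OF EI] that unfolding F_def by blast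
  have F_pow: "r [^] p \<in> ideal_pow R I j" if r: "r \<in> F j" for r j
  proof -
    obtain u i where ui: "u \<in> M (max (N j) j)" "i \<in> ideal_pow R I j" "r = u \<oplus> i"
      using F_mem[OF r max.cobounded1[of "N j" j]] by blast
    have uc: "u \<in> carrier R" "i \<in> carrier R" using ideal_D(8)[OF M_ideal ui(1)] ideal_D(8)[OF In_ideal ui(2)] by auto
    have "u [^] p \<in> ideal_pow R B (max (N j) j)" using ui(1) by (simp add: M_def)
    then have "u [^] p \<in> ideal_pow R B j" using ideal_pow_antimono[OF B_ideal, of j "max (N j) j"] by auto
    then have "u [^] p \<in> ideal_pow R I j" using ideal_pow_mono[OF B_subset_I] by blast
    moreover have "i [^] p \<in> ideal_pow R I j" using ideal_pow_mem[OF In_ideal ui(2)] char_pow_pos[of 1] by simp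
    ultimately show ?thesis using ideal_D(3)[OF In_ideal] frob_add[OF uc, of 1] ui(3) by simp
  qed
  obtain x where x: "x \<in> M (N k)" "x \<notin> ideal_pow R I k" using nM[of "N k"] by blast
  \<comment> \<open>A coherent sequence starting at \<open>x\<close>: decompose r in M_m + I^(k+n)
    for m large enough. The M_m-part lies in the next \<open>F\<close> and differs from r by an
    element of I^(k+n).\<close>
  have "\<exists>r. \<forall>n. (r n \<in> F (k + n) \<and> (n = 0 \<longrightarrow> r n = x)) \<and> r (Suc n) \<ominus> r n \<in> ideal_pow R I (k + n)"
  proof (rule dependent_nat_choice)
    show "\<exists>r. r \<in> F (k + 0) \<and> ((0::nat) = 0 \<longrightarrow> r = x)" using MF[OF x(1)] by simp
    fix r n assume r: "r \<in> F (k + n) \<and> (n = 0 \<longrightarrow> r = x)"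
    let ?m = "max (N (k + n)) (N (k + Suc n))"
    obtain u i where ui: "u \<in> M ?m" "i \<in> ideal_pow R I (k + n)" "r = u \<oplus> i" using F_mem[of r "k + n" ?m] r by auto
    have uc: "u \<in> carrier R" "i \<in> carrier R" using ideal_D(8)[OF M_ideal ui(1)] ideal_D(8)[OF In_ideal ui(2)] by auto
    have "u \<ominus> r = \<ominus> i" unfolding ui(3) using uc by (simp add: a_minus_def minus_add a_assoc[symmetric] r_neg)
    then have "u \<ominus> r \<in> ideal_pow R I (k + n)" using ideal_D(5)[OF In_ideal ui(2)] by simp
    moreover have "u \<in> F (k + Suc n)" using MF[OF ui(1)] by simp
    ultimately show "\<exists>r'. (r' \<in> F (k + Suc n) \<and> (Suc n = 0 \<longrightarrow> r' = x)) \<and> r' \<ominus> r \<in> ideal_pow R I (k + n)" by blast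
  qed
  then obtain r where r: "\<And>n. r n \<in> F (k + n)" "r 0 = x" "\<And>n. r (Suc n) \<ominus> r n \<in> ideal_pow R I (k + n)" by auto
  have rc: "r n \<in> carrier R" for n using Fc[OF r(1)] .
  have ImP: "ideal_pow R I j \<subseteq> ideal_pow R \<mm> j" for j using ideal_pow_mono[OF I_subset_mm] .
  \<comment> \<open>For j < k the truncated subtraction repeats \<open>x\<close>, so the sequence is
    coherent from index 0 on.\<close>
  have rm: "r (j - k) \<in> ideal_pow R \<mm> j" for j
  proof (rule reduced_completion_D[OF unramified mm_ideal, of "\<lambda>j. r (j - k)" p])
    show "r (j - k) \<in> carrier R" for j by (rule rc)
    show "r (Suc j - k) \<ominus> r (j - k) \<in> ideal_pow R \<mm> j" for j
    proof (cases "j \<ge> k")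
      case True
      then have "r (Suc j - k) \<ominus> r (j - k) \<in> ideal_pow R I j" using r(3)[of "j - k"] by (simp add: Suc_diff_le)
      then show ?thesis using ImP by blast
    next
      case False
      then have "Suc j - k = 0" "j - k = 0" by auto
      then have "r (Suc j - k) \<ominus> r (j - k) = \<zero>" using rc[of 0] by (simp add: a_minus_def r_neg)
      then show ?thesis using ideal_D(2)[OF ideal_pow_ideal[OF mm_ideal]] by simp
    qed
    show "r (j - k) [^] p \<in> ideal_pow R \<mm> j" for j
    proof -
      have "r (j - k) [^] p \<in> ideal_pow R I (k + (j - k))" using F_pow[OF r(1)] .
      then have 1: "r (j - k) [^] p \<in> ideal_pow R \<mm> (k + (j - k))" using ImP by blast
      have "j \<le> k + (j - k)" by simp
      from subsetD[OF ideal_pow_antimono[OF mm_ideal this] 1] show ?thesis .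
    qed
  qed
  have tele: "r n \<ominus> x \<in> ideal_pow R I k" for n
  proof (induction n)
    case 0
    then show ?case using r(2) rc[of 0] ideal_D(2)[OF In_ideal] by (simp add: a_minus_def r_neg)
  next
    case (Suc n)
    have xc: "x \<in> carrier R" using rc[of 0] r(2) by simp
    have "r (Suc n) \<ominus> x = (r (Suc n) \<ominus> r n) \<oplus> (r n \<ominus> x)"
      using rc[of "Suc n"] rc[of n] xc by (simp add: a_minus_def a_assoc r_neg1)
    moreover have "r (Suc n) \<ominus> r n \<in> ideal_pow R I k"
      using r(3)[of n] ideal_pow_antimono[OF I_ideal, of k "k + n"] by auto
    ultimately show ?case using ideal_D(3)[OF In_ideal] Suc by simp
  qed
  \<comment> \<open>The limit is zero, so r_t lies in a power of \<open>\<mm>\<close> contained in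
    I^k; since r_t - x is in I^k by telescoping, x is in I^k, contrary to its choice.\<close>
  obtain t where t: "ideal_pow R \<mm> t \<subseteq> ideal_pow R I k" using mm_pow_subset_I_pow by blast
  have "r t \<in> ideal_pow R \<mm> (t + k)" using rm[of "t + k"] by simp
  then have rt: "r t \<in> ideal_pow R I k" using ideal_pow_antimono[OF mm_ideal, of t "t + k"] t by auto
  have xc: "x \<in> carrier R" using rc[of 0] r(2) by simp
  have "x = r t \<ominus> (r t \<ominus> x)" using rc[of t] xc by (simp add: a_minus_def minus_add a_assoc[symmetric] r_neg)
  then have "x \<in> ideal_pow R I k" using ideal_D(4)[OF In_ideal rt tele[of t]] by simp
  then show False using x(2) by blast
qed

end

section \<open>Independent initial forms and the bound on their number\<close>

context unramified_sop
begin

lemma M_mult: "a \<in> M m \<Longrightarrow> b \<in> M n \<Longrightarrow> a \<otimes> b \<in> M (m + n)"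
  unfolding M_def using ideal_pow_mult_mem[OF B_ideal, of "a [^] p" m "b [^] p" n]
  by (auto simp: nat_pow_distrib)

text \<open>M_(n+1) together with I^(n-k) f for every (k, f) in the list. Modulo M_(n+1) this is the
  degree n part of the submodule generated by the initial forms over the polynomial ring; an f of
  degree k > n contributes nothing, hence the multiplier set \<open>{\<zero>}\<close>.\<close>

fun Sp :: "(nat \<times> 'a) list \<Rightarrow> nat \<Rightarrow> 'a set" where
  "Sp [] n = M (Suc n)"
| "Sp ((k, f) # fs) n = lin (Sp fs n) f (if k \<le> n then ideal_pow R I (n - k) else {\<zero>})"

text \<open>Independence over \<open>(R/\<mm>)[Y\<^sub>0, \<dots>, Y\<^sub>d\<^sub>-\<^sub>1]\<close> of the initial forms of the \<open>f \<in> M k\<close> in the graded ring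
  of the filtration \<open>M\<close>, in the sense of localizing at \<open>\<mm>[Y\<^sub>0, \<dots>, Y\<^sub>d\<^sub>-\<^sub>1]\<close>: the multipliers
  \<open>g \<in> I\<^sup>a - \<mm>I\<^sup>a\<close> are the forms with some unit coefficient.\<close>

fun ind :: "(nat \<times> 'a) list \<Rightarrow> bool" where
  "ind [] \<longleftrightarrow> True"
| "ind ((k, f) # fs) \<longleftrightarrow> ind fs \<and> f \<in> M k \<and>
    (\<forall>a g. g \<in> ideal_pow R I a \<longrightarrow> g \<notin> \<mm> \<cdot> ideal_pow R I a \<longrightarrow> g \<otimes> f \<notin> Sp fs (k + a))"

lemma ind_M: "ind fs \<Longrightarrow> (k, f) \<in> set fs \<Longrightarrow> f \<in> M k"
  by (induction fs rule: ind.induct) auto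

lemma Sp_ideal: "ind fs \<Longrightarrow> ideal (Sp fs n) R"
proof (induction fs rule: ind.induct)
  case (2 k f fs)
  have "f \<in> carrier R" using 2(2) ideal_D(8)[OF M_ideal] by auto
  then show ?case using 2 lin_ideal[of "Sp fs n" "if k \<le> n then ideal_pow R I (n - k) else {\<zero>}" f]
      In_ideal zeroideal by auto
qed (simp add: M_ideal)

lemma Sp_subset_M: "ind fs \<Longrightarrow> Sp fs n \<subseteq> M n"
proof (induction fs rule: ind.induct)
  case 1
  then show ?case using M_antimono[of n "Suc n"] by simp
next
  case (2 k f fs)
  have f: "f \<in> M k" "f \<in> carrier R" using 2(2) ideal_D(8)[OF M_ideal] by auto
  show ?case
  proof
    fix x assume "x \<in> Sp ((k, f) # fs) n"
    then obtain s g where x: "x = s \<oplus> g \<otimes> f" "s \<in> Sp fs n"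
      "g \<in> (if k \<le> n then ideal_pow R I (n - k) else {\<zero>})" by (auto simp: lin_def)
    have s: "s \<in> M n" using 2 x(2) by auto
    have "g \<otimes> f \<in> M n"
    proof (cases "k \<le> n")
      case True
      then have "g \<in> M (n - k)" using x(3) I_pow_subset_M by auto
      then show ?thesis using M_mult[OF _ f(1)] True by fastforce
    next
      case False
      then show ?thesis using x(3) f(2) ideal_D(2)[OF M_ideal] by simp
    qed
    then show "x \<in> M n" using ideal_D(3)[OF M_ideal s] x(1) by simp
  qed
qed

text \<open>The products of f with the monomials are adjoined one by one. If one of them gave
  nothing new, a form with coefficient 1 at that monomial would multiply f into
  \<open>Sp fs n\<close>; its value is outside \<mm> I^(n-k), against independence.\<close>

lemma ilen_Sp_step:
  assumes ind: "ind ((k, f) # fs)" and kn: "k \<le> n"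
  shows "enat (card (Mon d (n - k))) \<le> ilen (Sp fs n) (Sp ((k, f) # fs) n)"
proof -
  let ?a = "n - k" and ?P = "Sp fs n"
  have P: "ideal ?P R" using Sp_ideal ind by simp
  have f: "f \<in> M k" "f \<in> carrier R" using ind ideal_D(8)[OF M_ideal] by auto
  have nind: "g \<otimes> f \<notin> ?P" if "g \<in> ideal_pow R I ?a" "g \<notin> \<mm> \<cdot> ideal_pow R I ?a" for g
  proof -
    have "g \<otimes> f \<notin> Sp fs (k + ?a)" using ind that by simp
    then show ?thesis using kn by simp
  qed
  \<comment> \<open>With the coefficient ideal \<open>{\<zero>}\<close> these are the values of
    forms supported on \<open>S\<close>.\<close>
  have EI: "ideal (evs y d ?a {\<zero>} S) R" for S using evs_ideal[of y, OF yc zeroideal] .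
  have A: "ideal (lin ?P f (evs y d ?a {\<zero>} S)) R" for S using lin_ideal[OF P EI f(2)] .
  have PA: "?P \<subseteq> lin ?P f (evs y d ?a {\<zero>} S)" for S using subset_lin[OF P EI f(2)] .
  have evs_sub: "evs y d ?a {\<zero>} S \<subseteq> ideal_pow R I ?a" for S
    unfolding ideal_pow_eq_evs[of y, OF yc, where J = "{\<zero>}"] evs_def[of y, OF yc] by blast
  have main: "enat (card S) \<le> ilen ?P (lin ?P f (evs y d ?a {\<zero>} S))" if "finite S" "S \<subseteq> Mon d ?a" for S
    using that
  proof (induction S rule: finite_induct)
    case empty
    then show ?case by (simp add: zero_enat_def[symmetric])
  next
    case (insert \<alpha> S)
    let ?A = "lin ?P f (evs y d ?a {\<zero>} S)" and ?A' = "lin ?P f (evs y d ?a {\<zero>} (insert \<alpha> S))"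
    have a: "\<alpha> \<in> Mon d ?a" using insert.prems by auto
    have mc: "mon y \<alpha> \<in> carrier R" using mon_closed[of y, OF yc] .
    have sub: "?A \<subseteq> ?A'" unfolding lin_def evs_def[of y, OF yc] by blast
    have "mon y \<alpha> \<in> evs y d ?a {\<zero>} (insert \<alpha> S)"
      using term_mem_evs[of y, OF yc zeroideal a one_closed, of "insert \<alpha> S"] mc by simp
    then have mem: "mon y \<alpha> \<otimes> f \<in> ?A'" by (rule mult_mem_lin[OF P EI f(2)])
    have "mon y \<alpha> \<otimes> f \<notin> ?A"
    proof
      assume "mon y \<alpha> \<otimes> f \<in> ?A"
      then obtain s h where sh: "s \<in> ?P" "h \<in> evs y d ?a {\<zero>} S" "mon y \<alpha> \<otimes> f = s \<oplus> h \<otimes> f"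
        unfolding lin_def by blast
      obtain c where c: "h = ev y d ?a c" "c \<in> UNIV \<rightarrow> carrier R" "\<forall>\<beta>\<in>Mon d ?a - S. c \<beta> \<in> {\<zero>}"
        using sh(2) unfolding evs_def[of y, OF yc] by blast
      have hc: "h \<in> carrier R" using ideal_D(8)[OF EI sh(2)] .
      have sc: "s \<in> carrier R" using ideal_D(8)[OF P sh(1)] .
      define g where "g = mon y \<alpha> \<ominus> h"
      have "g \<otimes> f = mon y \<alpha> \<otimes> f \<ominus> h \<otimes> f"
        unfolding g_def using mc hc f(2) by (simp add: a_minus_def l_distr l_minus)
      also have "\<dots> = s" unfolding sh(3) using sc hc f(2) by (simp add: a_minus_def a_assoc r_neg)
      finally have "g \<otimes> f \<in> ?P" using sh(1) by simp
      moreover have "g \<in> ideal_pow R I ?a"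
        unfolding g_def using mon_mem_ideal_pow[of y, OF yc a] subsetD[OF evs_sub sh(2)]
        by (rule ideal_D(4)[OF In_ideal])
      ultimately have gm: "g \<in> \<mm> \<cdot> ideal_pow R I ?a" using nind by blast
      define e where "e = (\<lambda>\<beta>. if \<beta> = \<alpha> then \<one> else \<zero>)"
      have ec: "e \<in> UNIV \<rightarrow> carrier R" by (auto simp: e_def)
      have "ev y d ?a e = mon y \<alpha>" unfolding e_def using ev_single[of y, OF yc a one_closed] mc by simp
      then have "g = ev y d ?a (\<lambda>\<beta>. e \<beta> \<ominus> c \<beta>)" using ev_minus[of y, OF yc ec c(2)] c(1) by (simp add: g_def)
      moreover have "e \<beta> \<in> carrier R" "c \<beta> \<in> carrier R" for \<beta> using ec c(2) by auto
      then have "(\<lambda>\<beta>. e \<beta> \<ominus> c \<beta>) \<in> UNIV \<rightarrow> carrier R" by auto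
      ultimately have "e \<alpha> \<ominus> c \<alpha> \<in> \<mm>"
        using quasi_regular_ideal[of y, OF yc regy mm_ideal I_subset_mm _ _ a, of "\<lambda>\<beta>. e \<beta> \<ominus> c \<beta>"] gm by simp
      moreover have "c \<alpha> = \<zero>" using c(3) a insert.hyps(2) by blast
      ultimately show False using one_not_mem_mm by (simp add: e_def a_minus_def)
    qed
    then have "?A \<subset> ?A'" using sub mem by blast
    then have "1 \<le> ilen ?A ?A'" using one_le_ilen[OF A] by blast
    then have "enat (card S) + 1 \<le> ilen ?P ?A + ilen ?A ?A'" using insert by (intro add_mono) auto
    also have "\<dots> = ilen ?P ?A'" using ilen_add[OF P A A PA sub] by simp
    finally show ?case using insert.hyps by (simp add: one_enat_def)
  qed
  have "lin ?P f (evs y d ?a {\<zero>} (Mon d ?a)) \<subseteq> Sp ((k, f) # fs) n"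
    using lin_mono[OF evs_sub] kn by simp
  then show ?thesis using main[OF finite_Mon order_refl] ilen_mono[OF order_refl] order_trans by blast
qed

text \<open>The Hilbert function of a free graded module over the polynomial ring in d variables
  with one generator of degree k for each (k, f).\<close>

definition mons :: "(nat \<times> 'a) list \<Rightarrow> nat \<Rightarrow> nat" where
  "mons fs n = (\<Sum>(k, f)\<leftarrow>fs. if k \<le> n then card (Mon d (n - k)) else 0)"

lemma ilen_Sp: "ind fs \<Longrightarrow> enat (mons fs n) \<le> ilen (M (Suc n)) (Sp fs n)"
proof (induction fs rule: ind.induct)
  case 1
  then show ?case by (simp add: mons_def zero_enat_def[symmetric])
next
  case (2 k f fs)
  have ind: "ind fs" using 2(2) by simp
  have f: "f \<in> carrier R" using 2(2) ideal_D(8)[OF M_ideal] by auto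
  have sub1: "M (Suc n) \<subseteq> Sp fs n" using ind
  proof (induction fs rule: ind.induct)
    case (2 k f fs)
    have "f \<in> carrier R" using 2(2) ideal_D(8)[OF M_ideal] by auto
    then have "Sp fs n \<subseteq> Sp ((k, f) # fs) n"
      using 2(2) subset_lin[OF Sp_ideal[of fs n], of "if k \<le> n then ideal_pow R I (n - k) else {\<zero>}" f]
        In_ideal zeroideal by simp
    then show ?case using 2 order_trans[of "M (Suc n)" "Sp fs n"] by simp
  qed simp
  have sub2: "Sp fs n \<subseteq> Sp ((k, f) # fs) n"
    using subset_lin[OF Sp_ideal[OF ind], of "if k \<le> n then ideal_pow R I (n - k) else {\<zero>}" f n] In_ideal zeroideal f by simp
  have "ilen (M (Suc n)) (Sp ((k, f) # fs) n) = ilen (M (Suc n)) (Sp fs n) + ilen (Sp fs n) (Sp ((k, f) # fs) n)"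
    by (rule ilen_add[OF M_ideal Sp_ideal[OF ind] Sp_ideal[OF 2(2)] sub1 sub2])
  moreover have "enat (if k \<le> n then card (Mon d (n - k)) else 0) \<le> ilen (Sp fs n) (Sp ((k, f) # fs) n)"
    using ilen_Sp_step[OF 2(2)] by (auto simp: zero_enat_def[symmetric])
  ultimately have "enat (mons fs n) + enat (if k \<le> n then card (Mon d (n - k)) else 0) \<le> ilen (M (Suc n)) (Sp ((k, f) # fs) n)"
    using 2(1)[OF ind] by (metis add_mono)
  then show ?case by (simp add: mons_def add.commute)
qed

text \<open>The graded pieces add up to a lower bound for the length of R/M_n, and I^n \<subseteq>
  M_n bounds that length by the one of R/I^n.\<close>

lemma sum_mons_le: "ind fs \<Longrightarrow> (\<Sum>j<n. mons fs j) \<le> lam * ((n + d - 1) choose d)"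
proof -
  assume ind: "ind fs"
  have "enat (\<Sum>j<n. mons fs j) \<le> ilen (M n) (carrier R)"
  proof (induction n)
    case 0
    then show ?case by (simp add: zero_enat_def[symmetric])
  next
    case (Suc n)
    have "enat (mons fs n) \<le> ilen (M (Suc n)) (M n)"
      using ilen_Sp[OF ind, of n] ilen_mono[OF order_refl Sp_subset_M[OF ind]] order_trans by blast
    then have "enat (mons fs n) + enat (\<Sum>j<n. mons fs j) \<le> ilen (M (Suc n)) (M n) + ilen (M n) (carrier R)"
      using Suc by (intro add_mono)
    also have "\<dots> = ilen (M (Suc n)) (carrier R)"
      using ilen_add[OF M_ideal M_ideal oneideal M_antimono ideal_D(1)[OF M_ideal], of n "Suc n"] by simp
    finally show ?case by (simp add: add.commute)
  qed
  also have "\<dots> \<le> ilen (ideal_pow R I n) (carrier R)" by (rule ilen_mono[OF I_pow_subset_M order_refl])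
  finally show ?thesis unfolding ilen_In by (simp add: mult.commute)
qed

text \<open>A free module with \<open>length fs\<close> generators has summed Hilbert function of
  leading coefficient \<open>length fs\<close> / d!, against \<open>lam\<close> / d! for R/I^n; the
  largest generator degree h merely shifts the argument.\<close>

lemma ind_length: "ind fs \<Longrightarrow> length fs \<le> lam"
proof -
  assume ind: "ind fs"
  define h where "h = Max (insert 0 (fst ` set fs))"
  have h: "k \<le> h" if "(k, f) \<in> set fs" for k f unfolding h_def using that by (intro Max_ge) force+
  have "length fs * ((n - h + d - 1) choose d) \<le> (\<Sum>j<n. mons fs j)" for n
    using h
  proof (induction fs)
    case (Cons kf fs)
    obtain k f where kf: "kf = (k, f)" by (cases kf) auto
    have "k \<le> h" using Cons.prems[of k f] kf by simp
    then have "(n - h + d - 1) choose d \<le> (n - k + d - 1) choose d" by (intro binomial_right_mono) auto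
    also have "\<dots> = (\<Sum>i<n - k. card (Mon d i))" using sum_card_Mon[OF dim_pos, of "n - k"] by simp
    also have "\<dots> = (\<Sum>j\<in>{k..<n}. card (Mon d (j - k)))"
      by (rule sum.reindex_bij_witness[of _ "\<lambda>j. j - k" "\<lambda>i. i + k"]) auto
    also have "\<dots> = (\<Sum>j<n. if k \<le> j then card (Mon d (j - k)) else 0)"
      by (rule sum.mono_neutral_cong_left) auto
    finally have "(n - h + d - 1) choose d \<le> (\<Sum>j<n. if k \<le> j then card (Mon d (j - k)) else 0)" .
    moreover have "length fs * ((n - h + d - 1) choose d) \<le> (\<Sum>j<n. mons fs j)"
      using Cons by auto
    ultimately show ?case by (simp add: kf mons_def sum.distrib)
  qed simp
  then have "length fs * ((n - h + d - 1) choose d) \<le> lam * ((n + d - 1) choose d)" for n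
    using sum_mons_le[OF ind, of n] order_trans by blast
  then show ?thesis using binomial_growth_le dim_pos by blast
qed

text \<open>For a list of greatest length no further x is independent of it, and the failure of
  independence supplies the multiplier \<open>g\<close> with a unit coefficient.\<close>

lemma exists_maximal_ind:
  "\<exists>fs. ind fs \<and> (\<forall>n. \<forall>x\<in>M n. \<exists>a g. g \<in> ideal_pow R I a \<and> g \<notin> \<mm> \<cdot> ideal_pow R I a \<and> g \<otimes> x \<in> Sp fs (n + a))"
proof -
  have "\<forall>fs. ind fs \<longrightarrow> length fs < Suc lam" using ind_length by (simp add: less_Suc_eq_le)
  then obtain fs where fs: "ind fs" "\<And>gs. ind gs \<Longrightarrow> length gs \<le> length fs"
    using ex_has_greatest_nat[of ind "[]" length "Suc lam"] by auto
  have "\<exists>a g. g \<in> ideal_pow R I a \<and> g \<notin> \<mm> \<cdot> ideal_pow R I a \<and> g \<otimes> x \<in> Sp fs (n + a)" if x: "x \<in> M n" for x n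
  proof (rule ccontr)
    assume "\<not> ?thesis"
    then have "ind ((n, x) # fs)" using fs(1) x unfolding ind.simps by blast
    then show False using fs(2)[of "(n, x) # fs"] by simp
  qed
  then show ?thesis using fs(1) by blast
qed

section \<open>Forms over twisted submodules and Gauss's lemma\<close>

text \<open>Submodules of \<open>R/B\<close> over \<open>R\<close> acting through the Frobenius, and the graded pieces of the polynomials
  over them inside the graded ring of \<open>B\<close>.\<close>

definition tws :: "'a set \<Rightarrow> bool" where
  "tws U \<longleftrightarrow> U \<subseteq> carrier R \<and> B \<subseteq> U \<and> (\<forall>u\<in>U. \<forall>v\<in>U. u \<oplus> v \<in> U) \<and> (\<forall>r\<in>carrier R. \<forall>u\<in>U. r [^] p \<otimes> u \<in> U)"

lemma tws_D:
  assumes "tws U"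
  shows "U \<subseteq> carrier R" "B \<subseteq> U" "u \<in> U \<Longrightarrow> v \<in> U \<Longrightarrow> u \<oplus> v \<in> U"
    "r \<in> carrier R \<Longrightarrow> u \<in> U \<Longrightarrow> r [^] p \<otimes> u \<in> U" "\<zero> \<in> U" "u \<in> U \<Longrightarrow> u \<in> carrier R"
  using assms ideal_D(2)[OF B_ideal] unfolding tws_def by blast+

lemma zero_pow_p: "\<zero> [^] p = \<zero>"
  using char_pow_pos[of 1] by (simp add: nat_pow_zero)

text \<open>Values at y^p of forms of degree n with coefficients in \<open>U\<close>. As
  \<open>U\<close> contains \<open>B\<close>, this contains B^(n+1) and is the full preimage in B^n
  of the degree n forms over U/B.\<close>

definition Uev :: "'a set \<Rightarrow> nat \<Rightarrow> 'a set" where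
  "Uev U n = {ev yp d n w | w. w \<in> UNIV \<rightarrow> U}"

lemma ev_p:
  assumes "c \<in> UNIV \<rightarrow> carrier R"
  shows "ev y d n c [^] p = ev yp d n (\<lambda>\<alpha>. c \<alpha> [^] p)"
  using ev_frob[of y, OF yc assms, of d n 1] by simp

lemma UevI:
  assumes U: "tws U" and c: "c \<in> UNIV \<rightarrow> carrier R" and w: "\<And>\<alpha>. \<alpha> \<in> Mon d n \<Longrightarrow> c \<alpha> \<in> U"
  shows "ev yp d n c \<in> Uev U n"
proof -
  define w where "w = (\<lambda>\<alpha>. if \<alpha> \<in> Mon d n then c \<alpha> else \<zero>)"
  have "ev yp d n c = ev yp d n w"
    by (rule ev_cong[of yp, OF zc, symmetric]) (use c in \<open>auto simp: w_def\<close>)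
  moreover have "w \<in> UNIV \<rightarrow> U" using assms(3) tws_D(5)[OF U] by (auto simp: w_def)
  ultimately show ?thesis unfolding Uev_def by blast
qed

lemma Uev_carrier: "tws U \<Longrightarrow> Uev U n \<subseteq> carrier R"
  unfolding Uev_def using ev_closed[of yp, OF zc] tws_D(1) by blast

lemma Uev_add:
  assumes U: "tws U" and "a \<in> Uev U n" "b \<in> Uev U n"
  shows "a \<oplus> b \<in> Uev U n"
proof -
  obtain v w where v: "a = ev yp d n v" "\<And>\<alpha>. v \<alpha> \<in> U" and w: "b = ev yp d n w" "\<And>\<alpha>. w \<alpha> \<in> U"
    using assms unfolding Uev_def by blast
  have "v \<in> UNIV \<rightarrow> carrier R" "w \<in> UNIV \<rightarrow> carrier R" using v(2) w(2) tws_D(6)[OF U] by auto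
  then have "a \<oplus> b = ev yp d n (\<lambda>\<alpha>. v \<alpha> \<oplus> w \<alpha>)" using ev_add[of yp, OF zc] v(1) w(1) by simp
  moreover have "(\<lambda>\<alpha>. v \<alpha> \<oplus> w \<alpha>) \<in> UNIV \<rightarrow> U" using v(2) w(2) tws_D(3)[OF U] by auto
  ultimately show ?thesis unfolding Uev_def by blast
qed

lemma Uev_zero: "tws U \<Longrightarrow> \<zero> \<in> Uev U n"
  using UevI[of U "\<lambda>_. \<zero>" n] ev_zero[of yp d n "\<lambda>_. \<zero>", OF zc] tws_D(5) by auto

lemma Uev_term:
  assumes U: "tws U" and u: "u \<in> U" and a: "\<alpha> \<in> Mon d n"
  shows "u \<otimes> mon yp \<alpha> \<in> Uev U n"
proof -
  have uc: "u \<in> carrier R" using tws_D(6)[OF U u] .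
  have "u \<otimes> mon yp \<alpha> = ev yp d n (\<lambda>\<beta>. if \<beta> = \<alpha> then u else \<zero>)"
    using ev_single[of yp, OF zc a uc] by simp
  also have "\<dots> \<in> Uev U n" by (rule UevI[OF U]) (use u uc tws_D(5)[OF U] in auto)
  finally show ?thesis .
qed

lemma B_pow_subset_Uev:
  assumes U: "tws U"
  shows "ideal_pow R B (Suc n) \<subseteq> Uev U n"
proof
  fix x assume "x \<in> ideal_pow R B (Suc n)"
  then obtain b where b: "x = ev yp d n b" "b \<in> UNIV \<rightarrow> carrier R" "\<forall>\<alpha>\<in>Mon d n. b \<alpha> \<in> B"
    unfolding gid_pow_Suc[of yp, OF zc] ideal_prod_pow_eq_evs[of yp, OF zc B_ideal] evs_def[of yp, OF zc] by blast
  then show "x \<in> Uev U n" using UevI[OF U b(2), of n] tws_D(2)[OF U] by blast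
qed

text \<open>g^p is the value at y^p of a form whose coefficients are p-th powers, and these are the
  scalars under which \<open>U\<close> is stable.\<close>

lemma Uev_mult:
  assumes U: "tws U" and g: "g \<in> ideal_pow R I a" and u: "u \<in> Uev U n"
  shows "g [^] p \<otimes> u \<in> Uev U (a + n)"
proof -
  obtain c where c: "g = ev y d a c" "c \<in> UNIV \<rightarrow> carrier R"
    using g unfolding ideal_pow_eq_evs[of y, OF yc, where J = "carrier R"] evs_def[of y, OF yc] by blast
  obtain w where w: "u = ev yp d n w" "\<And>\<alpha>. w \<alpha> \<in> U" using u unfolding Uev_def by blast
  have cc: "c \<alpha> \<in> carrier R" for \<alpha> using c(2) by auto
  show ?thesis unfolding c(1) ev_p[OF c(2)] w(1)
  proof (rule ev_mult_in[of yp, OF zc Uev_zero[OF U] Uev_add[OF U] Uev_carrier[OF U]])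
    fix \<beta> \<alpha> assume "\<beta> \<in> Mon d a" "\<alpha> \<in> Mon d n"
    then show "(c \<beta> [^] p \<otimes> w \<alpha>) \<otimes> mon yp (\<beta> + \<alpha>) \<in> Uev U (a + n)"
      by (intro Uev_term[OF U] tws_D(4)[OF U] cc w Mon_add)
  qed (use cc w tws_D(6)[OF U] in auto)
qed

lemma coeff_mem_if_mod_B:
  assumes U: "tws U" and u: "u \<in> U" and c: "c \<in> carrier R" "c \<ominus> u \<in> B"
  shows "c \<in> U"
proof -
  have "c = (c \<ominus> u) \<oplus> u" using c(1) tws_D(6)[OF U u] by (simp add: a_minus_def a_assoc l_neg)
  then show ?thesis using tws_D(3)[OF U _ u, of "c \<ominus> u"] tws_D(2)[OF U] c(2) by auto
qed

text \<open>A value determines the coefficients only modulo \<open>B\<close>; this is why twisted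
  submodules contain \<open>B\<close>.\<close>

lemma ev_eq_coeff:
  assumes c: "\<And>\<alpha>. c \<alpha> \<in> carrier R" "\<And>\<alpha>. c' \<alpha> \<in> carrier R" and eq: "ev yp d n c = ev yp d n c'" and a: "\<alpha> \<in> Mon d n"
  shows "c \<alpha> \<ominus> c' \<alpha> \<in> B"
proof -
  have cf: "c \<in> UNIV \<rightarrow> carrier R" "c' \<in> UNIV \<rightarrow> carrier R" "(\<lambda>\<alpha>. c \<alpha> \<ominus> c' \<alpha>) \<in> UNIV \<rightarrow> carrier R" using c by auto
  have "ev yp d n (\<lambda>\<alpha>. c \<alpha> \<ominus> c' \<alpha>) = \<zero>"
    using ev_minus[of yp, OF zc cf(1,2)] eq ev_closed[of yp, OF zc cf(2)] by (simp add: a_minus_def r_neg)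
  then show ?thesis using quasi_regular_zero[of yp, OF zc regz cf(3)] a by blast
qed

text \<open>Gauss's lemma. The induction runs over the submodules of elements \<open>u\<close> with \<open>r\<^sup>p u \<in> U\<close> for all
  \<open>r \<in> \<mm>\<^sup>i\<close>; each step compares the coefficients of the product of the leading terms.\<close>

lemma gauss_Uev:
  assumes U: "tws U" and g: "g \<in> ideal_pow R I a" "g \<notin> \<mm> \<cdot> ideal_pow R I a"
    and w: "w \<in> ideal_pow R B n" and gw: "g [^] p \<otimes> w \<in> Uev U (a + n)"
  shows "w \<in> Uev U n"
proof -
  obtain c where c: "g = ev y d a c" "c \<in> UNIV \<rightarrow> carrier R"
    using g(1) unfolding ideal_pow_eq_evs[of y, OF yc, where J = "carrier R"] evs_def[of y, OF yc] by blast
  have cc: "c \<beta> \<in> carrier R" for \<beta> using c(2) by auto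
  obtain v where v: "w = ev yp d n v" "v \<in> UNIV \<rightarrow> carrier R"
    using w unfolding ideal_pow_eq_evs[of yp, OF zc, where J = "carrier R"] evs_def[of yp, OF zc] by blast
  have vc: "v \<alpha> \<in> carrier R" for \<alpha> using v(2) by auto
  define S where "S = {\<beta> \<in> Mon d a. c \<beta> \<notin> \<mm>}"
  have finS: "finite S" unfolding S_def by simp
  have "S \<noteq> {}"
  proof
    assume "S = {}"
    then have "\<forall>\<beta>\<in>Mon d a. c \<beta> \<in> \<mm>" unfolding S_def by blast
    then have "g \<in> \<mm> \<cdot> ideal_pow R I a"
      unfolding ideal_prod_pow_eq_evs[of y, OF yc mm_ideal] evs_def[of y, OF yc] using c by blast
    then show False using g(2) by blast
  qed
  \<comment> \<open>The leading monomial of \<open>g\<close> modulo \<open>\<mm>\<close>.\<close>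
  define \<beta>0 where "\<beta>0 = Max S"
  have b0: "\<beta>0 \<in> Mon d a" "c \<beta>0 \<notin> \<mm>" using Max_in[OF finS \<open>S \<noteq> {}\<close>] unfolding \<beta>0_def[symmetric] by (auto simp: S_def)
  have b0_max: "\<beta> \<le> \<beta>0" if "\<beta> \<in> Mon d a" "c \<beta> \<notin> \<mm>" for \<beta>
    unfolding \<beta>0_def by (rule Max_ge[OF finS]) (use that in \<open>simp add: S_def\<close>)
  obtain N where N: "ideal_pow R \<mm> N \<subseteq> I" using mm_pow_subset_I by blast
  \<comment> \<open>\<open>V 0\<close> is U, and \<open>V N\<close> is all of R, since r^p lies in
    \<open>B\<close> for r in \<mm>^N \<subseteq> I. The coefficients of \<open>w\<close> are moved
    from \<open>V N\<close> down to \<open>V 0\<close>, one index at a time.\<close>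
  define V where "V i = {u \<in> carrier R. \<forall>r\<in>ideal_pow R \<mm> i. r [^] p \<otimes> u \<in> U}" for i
  have mc: "r \<in> carrier R" if "r \<in> ideal_pow R \<mm> i" for r i using ideal_D(8)[OF ideal_pow_ideal[OF mm_ideal] that] .
  have UV: "U \<subseteq> V i" for i using tws_D(4)[OF U] tws_D(6)[OF U] mc by (auto simp: V_def)
  have V: "tws (V i)" for i unfolding tws_def
  proof (intro conjI ballI)
    show "V i \<subseteq> carrier R" by (auto simp: V_def)
    show "B \<subseteq> V i" using UV tws_D(2)[OF U] by blast
    fix u assume u: "u \<in> V i"
    {
      fix u' assume "u' \<in> V i"
      then show "u \<oplus> u' \<in> V i" using u tws_D(3)[OF U] mc by (auto simp: V_def r_distr)
    }
    fix s assume s: "s \<in> carrier R"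
    have "r [^] p \<otimes> (s [^] p \<otimes> u) \<in> U" if r: "r \<in> ideal_pow R \<mm> i" for r
    proof -
      have "r [^] p \<otimes> (s [^] p \<otimes> u) = s [^] p \<otimes> (r [^] p \<otimes> u)"
        using s mc[OF r] u by (simp add: V_def m_lcomm)
      then show ?thesis using tws_D(4)[OF U s, of "r [^] p \<otimes> u"] u r by (simp add: V_def)
    qed
    then show "s [^] p \<otimes> u \<in> V i" using u s by (simp add: V_def)
  qed
  have V_step: "r [^] p \<otimes> u \<in> V i" if r: "r \<in> \<mm>" and u: "u \<in> V (Suc i)" for r u i
  proof -
    have rc: "r \<in> carrier R" "u \<in> carrier R" using r mm_carrier u by (auto simp: V_def)
    have "s [^] p \<otimes> (r [^] p \<otimes> u) \<in> U" if s: "s \<in> ideal_pow R \<mm> i" for s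
    proof -
      have "s \<otimes> r \<in> ideal_pow R \<mm> (Suc i)" using ideal_prod.prod[OF s r, where R = R] by simp
      then have "(s \<otimes> r) [^] p \<otimes> u \<in> U" using u unfolding V_def by blast
      then show ?thesis using rc mc[OF s] by (simp add: nat_pow_distrib m_assoc)
    qed
    then show ?thesis using rc by (simp add: V_def)
  qed
  have V_N: "u \<in> V N" if "u \<in> carrier R" for u
  proof -
    have "r [^] p \<otimes> u \<in> U" if r: "r \<in> ideal_pow R \<mm> N" for r
    proof -
      have "r \<in> ideal_pow R I (Suc 0)" using N r unfolding ideal_pow_1[OF I_ideal] by blast
      then have "r \<in> M (Suc 0)" using I_pow_subset_M by blast
      then have "r [^] p \<in> B" unfolding M_def ideal_pow_1[OF B_ideal] by blast
      then show ?thesis using ideal_D(7)[OF B_ideal _ \<open>u \<in> carrier R\<close>] tws_D(2)[OF U] by blast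
    qed
    then show ?thesis using that by (simp add: V_def)
  qed
  have step: "\<forall>\<alpha>\<in>Mon d n. v \<alpha> \<in> V i" if IH: "\<forall>\<alpha>\<in>Mon d n. v \<alpha> \<in> V (Suc i)" for i
  proof (rule ccontr)
    assume nall: "\<not> ?thesis"
    define T where "T = {\<alpha> \<in> Mon d n. v \<alpha> \<notin> V i}"
    have finT: "finite T" "T \<noteq> {}" using nall unfolding T_def by auto
    define \<alpha>0 where "\<alpha>0 = Max T"
    have a0: "\<alpha>0 \<in> Mon d n" "v \<alpha>0 \<notin> V i" using Max_in[OF finT] unfolding \<alpha>0_def[symmetric] by (auto simp: T_def)
    have a0_max: "\<alpha> \<le> \<alpha>0" if "\<alpha> \<in> Mon d n" "v \<alpha> \<notin> V i" for \<alpha>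
      unfolding \<alpha>0_def by (rule Max_ge[OF finT(1)]) (use that in \<open>simp add: T_def\<close>)
    let ?\<gamma>0 = "\<beta>0 + \<alpha>0"
    have g0: "?\<gamma>0 \<in> Mon d (a + n)" using Mon_add[OF b0(1) a0(1)] .
    \<comment> \<open>No condition is put on coefficients below \<gamma>0, the product of the two
      leading monomials. All terms of g^p w other than the product of the leading ones belong
      here.\<close>
    define W where "W = {ev yp d (a + n) h | h. h \<in> UNIV \<rightarrow> carrier R \<and> (\<forall>\<gamma>\<ge>?\<gamma>0. h \<gamma> \<in> V i)}"
    have WI: "ev yp d (a + n) h \<in> W" if "\<And>\<gamma>. h \<gamma> \<in> carrier R" "\<And>\<gamma>. \<gamma> \<ge> ?\<gamma>0 \<Longrightarrow> h \<gamma> \<in> V i" for h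
      unfolding W_def using that by blast
    have W_carrier: "W \<subseteq> carrier R" unfolding W_def using ev_closed[of yp, OF zc] by blast
    have W_zero: "\<zero> \<in> W"
      using WI[of "\<lambda>_. \<zero>"] ev_zero[of yp d "a + n" "\<lambda>_. \<zero>", OF zc] tws_D(5)[OF V] by simp
    have W_add: "x \<oplus> z \<in> W" if "x \<in> W" "z \<in> W" for x z
    proof -
      obtain h k where h: "x = ev yp d (a + n) h" "h \<in> UNIV \<rightarrow> carrier R" "\<forall>\<gamma>\<ge>?\<gamma>0. h \<gamma> \<in> V i"
        and k: "z = ev yp d (a + n) k" "k \<in> UNIV \<rightarrow> carrier R" "\<forall>\<gamma>\<ge>?\<gamma>0. k \<gamma> \<in> V i"
        using \<open>x \<in> W\<close> \<open>z \<in> W\<close> unfolding W_def by blast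
      have "x \<oplus> z = ev yp d (a + n) (\<lambda>\<gamma>. h \<gamma> \<oplus> k \<gamma>)" using ev_add[of yp, OF zc h(2) k(2)] h(1) k(1) by simp
      also have "\<dots> \<in> W" by (rule WI) (use h k tws_D(3)[OF V] in auto)
      finally show ?thesis .
    qed
    have W_term: "u \<otimes> mon yp \<gamma> \<in> W"
      if "u \<in> carrier R" "\<gamma> \<in> Mon d (a + n)" "\<gamma> < ?\<gamma>0 \<or> u \<in> V i" for u \<gamma>
    proof -
      have "u \<otimes> mon yp \<gamma> = ev yp d (a + n) (\<lambda>\<delta>. if \<delta> = \<gamma> then u else \<zero>)"
        using ev_single[of yp, OF zc that(2,1)] by simp
      also have "\<dots> \<in> W" by (rule WI) (use that tws_D(5)[OF V] in auto)
      finally show ?thesis .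
    qed
    have prod_term: "(c \<beta> [^] p \<otimes> v \<alpha>) \<otimes> mon yp (\<beta> + \<alpha>) \<in> W"
      if b: "\<beta> \<in> Mon d a" and al: "\<alpha> \<in> Mon d n" and ne: "\<beta> \<noteq> \<beta>0 \<or> \<alpha> \<noteq> \<alpha>0" for \<beta> \<alpha>
    proof (rule W_term)
      show "c \<beta> [^] p \<otimes> v \<alpha> \<in> carrier R" using cc vc by simp
      show "\<beta> + \<alpha> \<in> Mon d (a + n)" using Mon_add[OF b al] .
      \<comment> \<open>A coefficient of \<open>g\<close> in \<open>\<mm>\<close> carries
        \<open>V (Suc i)\<close> into \<open>V i\<close>, and \<open>V i\<close> is stable under the
        others. If neither effect applies, both monomials are at most the leading ones, one of them
        strictly.\<close>
      show "\<beta> + \<alpha> < ?\<gamma>0 \<or> c \<beta> [^] p \<otimes> v \<alpha> \<in> V i"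
      proof (cases "c \<beta> \<in> \<mm> \<or> v \<alpha> \<in> V i")
        case True
        then show ?thesis using V_step[of "c \<beta>" "v \<alpha>"] IH al tws_D(4)[OF V cc] by blast
      next
        case False
        then have le: "\<beta> \<le> \<beta>0" "\<alpha> \<le> \<alpha>0" using b0_max[OF b] a0_max[OF al] by auto
        show ?thesis
        proof (cases "\<beta> = \<beta>0")
          case True
          then have "\<alpha> < \<alpha>0" using le(2) ne by auto
          then show ?thesis using True by simp
        next
          case False
          then have "\<beta> < \<beta>0" using le(1) by auto
          then show ?thesis using add_less_le_mono[OF _ le(2)] by blast
        qed
      qed
    qed
    let ?e = "\<lambda>\<beta>. c \<beta> [^] p"
    have ec: "?e \<in> UNIV \<rightarrow> carrier R" using cc by auto
    define X0 where "X0 = c \<beta>0 [^] p \<otimes> mon yp \<beta>0"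
    define X1 where "X1 = ev yp d a (?e(\<beta>0 := \<zero>))"
    define Y0 where "Y0 = v \<alpha>0 \<otimes> mon yp \<alpha>0"
    define Y1 where "Y1 = ev yp d n (v(\<alpha>0 := \<zero>))"
    note mcl = mon_closed[of yp, OF zc]
    have X: "g [^] p = X0 \<oplus> X1" unfolding c(1) ev_p[OF c(2)] X0_def X1_def
      using ev_remove[of yp, OF zc b0(1) ec] by simp
    have Y: "w = Y0 \<oplus> Y1" unfolding v(1) Y0_def Y1_def using ev_remove[of yp, OF zc a0(1) v(2)] .
    have e1c: "?e(\<beta>0 := \<zero>) \<in> UNIV \<rightarrow> carrier R" "v(\<alpha>0 := \<zero>) \<in> UNIV \<rightarrow> carrier R" using cc vc by auto
    have XYc: "X0 \<in> carrier R" "X1 \<in> carrier R" "Y0 \<in> carrier R" "Y1 \<in> carrier R"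
      unfolding X0_def X1_def Y0_def Y1_def using cc vc mcl ev_closed[of yp, OF zc] e1c by auto
    have zW: "\<zero> \<otimes> mon yp \<gamma> \<in> W" for \<gamma>
      using W_zero mcl by simp
    have XY1: "X1 \<otimes> w \<in> W" unfolding X1_def v(1)
      by (rule ev_mult_in[of yp, OF zc W_zero W_add W_carrier])
        (use cc vc prod_term zW in \<open>auto split: if_splits\<close>)
    have "X0 = ev yp d a (\<lambda>\<beta>. if \<beta> = \<beta>0 then c \<beta>0 [^] p else \<zero>)"
      unfolding X0_def using ev_single[of yp, OF zc b0(1)] cc by simp
    then have X0Y1: "X0 \<otimes> Y1 \<in> W" unfolding Y1_def
      by (simp only:) (rule ev_mult_in[of yp, OF zc W_zero W_add W_carrier],
        use cc vc prod_term zW b0(1) in \<open>auto split: if_splits\<close>)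
    have neg: "\<ominus> x \<in> W" if "x \<in> W" for x
    proof -
      obtain h where h: "x = ev yp d (a + n) h" "h \<in> UNIV \<rightarrow> carrier R" "\<forall>\<gamma>\<ge>?\<gamma>0. h \<gamma> \<in> V i"
        using \<open>x \<in> W\<close> unfolding W_def by blast
      have m1: "(\<ominus> \<one>) [^] p = \<ominus> \<one>"
        using frob_minus[of \<zero> \<one> 1] zero_pow_p by (simp add: a_minus_def)
      have hc: "h \<gamma> \<in> carrier R" for \<gamma> using h(2) by auto
      have "\<ominus> x = ev yp d (a + n) (\<lambda>\<gamma>. (\<ominus> \<one>) \<otimes> h \<gamma>)"
        using ev_smult[of yp, OF zc h(2), of "\<ominus> \<one>"] ev_closed[of yp, OF zc h(2)] h(1) by (simp add: l_minus)
      also have "\<dots> \<in> W"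
      proof (rule WI)
        show "(\<ominus> \<one>) \<otimes> h \<gamma> \<in> V i" if "\<gamma> \<ge> ?\<gamma>0" for \<gamma>
          using tws_D(4)[OF V, of "\<ominus> \<one>" "h \<gamma>" i] h(3) that unfolding m1 by simp
      qed (use hc in simp)
      finally show ?thesis .
    qed
    have gwW: "g [^] p \<otimes> w \<in> W"
    proof -
      obtain h where h: "g [^] p \<otimes> w = ev yp d (a + n) h" "\<And>\<gamma>. h \<gamma> \<in> U" using gw unfolding Uev_def by blast
      show ?thesis unfolding h(1) by (rule WI) (use h(2) UV tws_D(6)[OF U] in auto)
    qed
    \<comment> \<open>The product of the leading terms is g^p w minus elements of \<open>W\<close>,
      and g^p w has coefficients in U. So its coefficient lies in \<open>V i\<close>, and the unit
      \<open>c \<beta>0\<close> can be removed from it.\<close>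
    have "X0 \<otimes> Y0 = (g [^] p \<otimes> w \<oplus> (\<ominus> (X1 \<otimes> w))) \<oplus> (\<ominus> (X0 \<otimes> Y1))"
    proof -
      have wc: "w \<in> carrier R" using Y XYc by simp
      have "g [^] p \<otimes> w = X0 \<otimes> Y0 \<oplus> X0 \<otimes> Y1 \<oplus> X1 \<otimes> w"
        unfolding X using XYc wc by (simp add: l_distr) (simp add: Y r_distr)
      then show ?thesis using XYc wc by (simp add: a_assoc r_neg)
    qed
    then have "X0 \<otimes> Y0 \<in> W" using W_add[OF W_add[OF gwW neg[OF XY1]] neg[OF X0Y1]] by simp
    moreover have "X0 \<otimes> Y0 = (c \<beta>0 [^] p \<otimes> v \<alpha>0) \<otimes> mon yp ?\<gamma>0"
      unfolding X0_def Y0_def using cc vc mcl by (simp add: mon_add[of yp, OF zc] m_ac)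
    ultimately obtain h where h: "(c \<beta>0 [^] p \<otimes> v \<alpha>0) \<otimes> mon yp ?\<gamma>0 = ev yp d (a + n) h"
      "h \<in> UNIV \<rightarrow> carrier R" "\<forall>\<gamma>\<ge>?\<gamma>0. h \<gamma> \<in> V i" unfolding W_def by auto
    define u where "u = c \<beta>0 [^] p \<otimes> v \<alpha>0"
    have uc: "u \<in> carrier R" unfolding u_def using cc vc by simp
    have hc: "h \<gamma> \<in> carrier R" for \<gamma> using h(2) by auto
    have "ev yp d (a + n) (\<lambda>\<gamma>. if \<gamma> = ?\<gamma>0 then u else \<zero>) = ev yp d (a + n) h"
      using ev_single[of yp, OF zc g0 uc] h(1) unfolding u_def by simp
    then have "u \<ominus> h ?\<gamma>0 \<in> B"
      using ev_eq_coeff[of "\<lambda>\<gamma>. if \<gamma> = ?\<gamma>0 then u else \<zero>" h, OF _ hc _ g0] uc by simp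
    then have uV: "u \<in> V i" using coeff_mem_if_mod_B[OF V _ uc] h(3) by blast
    obtain e where e: "e \<in> carrier R" "e \<otimes> c \<beta>0 = \<one>" using unit_if_not_mem_mm[OF cc b0(2)] by blast
    have "e [^] p \<otimes> u = (e \<otimes> c \<beta>0) [^] p \<otimes> v \<alpha>0"
      unfolding u_def using e(1) cc vc by (simp add: nat_pow_distrib m_assoc)
    also have "\<dots> = v \<alpha>0" unfolding e(2) using vc by simp
    finally show False using tws_D(4)[OF V e(1) uV] a0(2) by simp
  qed
  have "\<forall>\<alpha>\<in>Mon d n. v \<alpha> \<in> V (N - i)" for i
  proof (induction i)
    case 0
    then show ?case using V_N vc by simp
  next
    case (Suc i)
    show ?case
    proof (cases "N - i")
      case 0
      then show ?thesis using Suc by simp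
    next
      case (Suc j)
      then have "N - Suc i = j" by simp
      then show ?thesis using step[of j] Suc.IH Suc by simp
    qed
  qed
  from this[of N] have v0: "v \<alpha> \<in> V 0" if "\<alpha> \<in> Mon d n" for \<alpha> using that by simp
  have "v \<alpha> \<in> U" if "\<alpha> \<in> Mon d n" for \<alpha>
  proof -
    have "\<forall>r\<in>carrier R. r [^] p \<otimes> v \<alpha> \<in> U" using v0[OF that] unfolding V_def by simp
    then have "\<one> [^] p \<otimes> v \<alpha> \<in> U" using one_closed by blast
    then show ?thesis using vc by simp
  qed
  then show ?thesis unfolding v(1) by (rule UevI[OF U v(2)])
qed

end

section \<open>Powers of I compared with powers of its Frobenius powers\<close>

context cring
begin
lemma add_minus_add:
  assumes "a \<in> carrier R" "b \<in> carrier R" "c \<in> carrier R" "e \<in> carrier R"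
  shows "(a \<oplus> b) \<ominus> (c \<oplus> e) = (a \<ominus> c) \<oplus> (b \<ominus> e)"
  using assms by (simp add: a_minus_def minus_add a_ac)

text \<open>Pigeonhole: a monomial of degree above q d has some exponent at least q. Split off y_i^q
  and repeat; the slack q d keeps the degree large enough for all \<open>N\<close> factors.\<close>

lemma mon_mem_pow_gid_pow:
  assumes yc: "\<And>i. y i \<in> carrier R" and q: "q > 0"
  shows "\<alpha> \<in> Mon d m \<Longrightarrow> q * N + q * d \<le> m \<Longrightarrow> mon y \<alpha> \<in> ideal_pow R (gid (\<lambda>i. y i [^] (q::nat)) d) N"
proof (induction N arbitrary: \<alpha> m)
  case 0
  then show ?case using mon_closed[of y, OF yc] by simp
next
  case (Suc N)
  have zc: "y i [^] q \<in> carrier R" for i using yc by simp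
  have "\<exists>i<d. q \<le> count \<alpha> i"
  proof (rule ccontr)
    assume n: "\<not> ?thesis"
    have "m = (\<Sum>i\<in>set_mset \<alpha>. count \<alpha> i)" using Suc.prems(1) by (simp add: Mon_iff size_multiset_overloaded_eq)
    also have "\<dots> \<le> (\<Sum>i<d. count \<alpha> i)" using Suc.prems(1) by (intro sum_mono2) (auto simp: Mon_iff)
    also have "\<dots> \<le> (\<Sum>i<d. q)" by (rule sum_mono) (use n in \<open>auto simp: not_le less_imp_le\<close>)
    finally show False using Suc.prems(2) q by (simp add: mult.commute)
  qed
  then obtain i where i: "i < d" "q \<le> count \<alpha> i" by blast
  define \<beta> where "\<beta> = \<alpha> - replicate_mset q i"
  have ab: "\<alpha> = \<beta> + replicate_mset q i"
    unfolding \<beta>_def using i(2) by (simp add: count_le_replicate_mset_subset_eq subset_mset.diff_add)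
  have b: "\<beta> \<in> Mon d (m - q)"
    using Suc.prems(1) unfolding ab Mon_iff by auto
  have "q * N + q * d \<le> m - q" using Suc.prems(2) by simp
  then have 1: "mon y \<beta> \<in> ideal_pow R (gid (\<lambda>i. y i [^] q) d) N" using Suc.IH[OF b] by blast
  have "mon y (replicate_mset q i) = y i [^] q" for q
    by (induction q) (use yc in \<open>auto simp: mon_empty[of y, OF yc] mon_add_mset[of y, OF yc] m_comm\<close>)
  then have "mon y \<alpha> = mon y \<beta> \<otimes> y i [^] q" unfolding ab mon_add[of y, OF yc] by simp
  then show ?case unfolding ideal_pow_Suc
    using ideal_prod.prod[OF 1 gid_mem[of "\<lambda>i. y i [^] q", OF zc i(1)], where R = R] by simp
qed

lemma gid_pow_subset:
  assumes yc: "\<And>i. y i \<in> carrier R" and q: "q > 0"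
  shows "ideal_pow R (gid y d) (q * (N + d)) \<subseteq> ideal_pow R (gid (\<lambda>i. y i [^] (q::nat)) d) N"
proof
  have zc: "y i [^] q \<in> carrier R" for i using yc by simp
  note P = ideal_pow_ideal[OF gid_ideal[of "\<lambda>i. y i [^] q", OF zc], of d N]
  fix x assume "x \<in> ideal_pow R (gid y d) (q * (N + d))"
  then obtain c where c: "x = ev y d (q * (N + d)) c" "c \<in> UNIV \<rightarrow> carrier R"
    unfolding ideal_pow_eq_evs[of y, OF yc, where J = "carrier R"] evs_def[of y, OF yc] by blast
  show "x \<in> ideal_pow R (gid (\<lambda>i. y i [^] q) d) N" unfolding c(1) ev_def
  proof (rule finsum_in_subgroup[OF ideal_D(2,3,1)[OF P] finite_Mon])
    fix \<alpha> assume a: "\<alpha> \<in> Mon d (q * (N + d))"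
    have "mon y \<alpha> \<in> ideal_pow R (gid (\<lambda>i. y i [^] q) d) N"
      by (rule mon_mem_pow_gid_pow[of y, OF yc q a]) (simp add: algebra_simps)
    then show "c \<alpha> \<otimes> mon y \<alpha> \<in> ideal_pow R (gid (\<lambda>i. y i [^] q) d) N"
      using ideal_D(6)[OF P] c(2) by auto
  qed
qed

end

section \<open>Finite generation of the graded ring of M and the linear bound\<close>

context unramified_sop
begin

text \<open>A linear combination of \<open>vs\<close> for the action of R through p-th powers;
  \<open>twspan vs\<close> is then the smallest twisted submodule containing
  \<open>vs\<close>.\<close>

definition twc :: "'a list \<Rightarrow> (nat \<Rightarrow> 'a) \<Rightarrow> 'a" where
  "twc vs r = (\<Oplus>j\<in>{..<length vs}. r j [^] p \<otimes> nth0 vs j)"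

definition twspan :: "'a list \<Rightarrow> 'a set" where
  "twspan vs = {twc vs r \<oplus> b | r b. r \<in> UNIV \<rightarrow> carrier R \<and> b \<in> B}"

lemma twc_closed: "set vs \<subseteq> carrier R \<Longrightarrow> (\<And>j. r j \<in> carrier R) \<Longrightarrow> twc vs r \<in> carrier R"
  unfolding twc_def using nth0_closed[of vs] by (intro finsum_closed) auto

lemma twc_add:
  assumes vs: "set vs \<subseteq> carrier R" and r: "\<And>j. r j \<in> carrier R" "\<And>j. s j \<in> carrier R"
  shows "twc vs (\<lambda>j. r j \<oplus> s j) = twc vs r \<oplus> twc vs s"
proof -
  note v = nth0_closed[OF vs]
  have "twc vs (\<lambda>j. r j \<oplus> s j) = (\<Oplus>j\<in>{..<length vs}. r j [^] p \<otimes> nth0 vs j \<oplus> s j [^] p \<otimes> nth0 vs j)"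
    unfolding twc_def using r v frob_add[of _ _ 1] by (intro finsum_cong') (auto simp: l_distr)
  also have "\<dots> = twc vs r \<oplus> twc vs s" unfolding twc_def using r v by (intro finsum_addf) auto
  finally show ?thesis .
qed

lemma twc_smult:
  assumes vs: "set vs \<subseteq> carrier R" and r: "\<And>j. r j \<in> carrier R" "s \<in> carrier R"
  shows "twc vs (\<lambda>j. s \<otimes> r j) = s [^] p \<otimes> twc vs r"
proof -
  note v = nth0_closed[OF vs]
  have "s [^] p \<otimes> twc vs r = (\<Oplus>j\<in>{..<length vs}. s [^] p \<otimes> (r j [^] p \<otimes> nth0 vs j))"
    unfolding twc_def using r v by (intro finsum_rdistr) auto
  also have "\<dots> = twc vs (\<lambda>j. s \<otimes> r j)"
    unfolding twc_def using r v by (intro finsum_cong') (auto simp: nat_pow_distrib m_assoc)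
  finally show ?thesis by simp
qed

lemma twc_zero: "set vs \<subseteq> carrier R \<Longrightarrow> twc vs (\<lambda>_. \<zero>) = \<zero>"
proof -
  assume vs: "set vs \<subseteq> carrier R"
  have "twc vs (\<lambda>_. \<zero>) = (\<Oplus>j\<in>{..<length vs}. \<zero>)"
    unfolding twc_def using nth0_closed[OF vs] zero_pow_p by (intro finsum_cong') auto
  then show ?thesis by simp
qed

lemma twspan_tws:
  assumes vs: "set vs \<subseteq> carrier R"
  shows "tws (twspan vs)"
  unfolding tws_def
proof (intro conjI ballI)
  note v = nth0_closed[OF vs]
  have tc: "twc vs r \<in> carrier R" if "r \<in> UNIV \<rightarrow> carrier R" for r using twc_closed[OF vs] that by auto
  note Bc = ideal_D(8)[OF B_ideal]
  show "twspan vs \<subseteq> carrier R" unfolding twspan_def using tc Bc by auto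
  show "B \<subseteq> twspan vs"
  proof
    fix b assume b: "b \<in> B"
    have "b = twc vs (\<lambda>_. \<zero>) \<oplus> b" using twc_zero[OF vs] Bc[OF b] by simp
    moreover have "(\<lambda>_. \<zero>) \<in> UNIV \<rightarrow> carrier R" by simp
    ultimately show "b \<in> twspan vs" unfolding twspan_def using b by blast
  qed
  fix u assume "u \<in> twspan vs"
  then obtain r b where u: "u = twc vs r \<oplus> b" "r \<in> UNIV \<rightarrow> carrier R" "b \<in> B" unfolding twspan_def by blast
  have rc: "r j \<in> carrier R" for j using u(2) by auto
  {
    fix w assume "w \<in> twspan vs"
    then obtain s c where w: "w = twc vs s \<oplus> c" "s \<in> UNIV \<rightarrow> carrier R" "c \<in> B" unfolding twspan_def by blast
    have sc: "s j \<in> carrier R" for j using w(2) by auto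
    have "u \<oplus> w = twc vs (\<lambda>j. r j \<oplus> s j) \<oplus> (b \<oplus> c)"
      using twc_add[OF vs rc sc] u(1) w(1) tc[OF u(2)] tc[OF w(2)] Bc[OF u(3)] Bc[OF w(3)] by (simp add: a_ac)
    moreover have "(\<lambda>j. r j \<oplus> s j) \<in> UNIV \<rightarrow> carrier R" using rc sc by auto
    ultimately show "u \<oplus> w \<in> twspan vs" unfolding twspan_def using ideal_D(3)[OF B_ideal u(3) w(3)] by blast
  }
  fix s assume s: "s \<in> carrier R"
  have "s [^] p \<otimes> u = twc vs (\<lambda>j. s \<otimes> r j) \<oplus> s [^] p \<otimes> b"
    using twc_smult[OF vs rc s] u(1) tc[OF u(2)] Bc[OF u(3)] s by (simp add: r_distr)
  moreover have "(\<lambda>j. s \<otimes> r j) \<in> UNIV \<rightarrow> carrier R" using rc s by auto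
  moreover have "s [^] p \<otimes> b \<in> B" using ideal_D(6)[OF B_ideal u(3)] s by simp
  ultimately show "s [^] p \<otimes> u \<in> twspan vs" unfolding twspan_def by blast
qed

lemma set_subset_twspan:
  assumes vs: "set vs \<subseteq> carrier R"
  shows "set vs \<subseteq> twspan vs"
proof
  note v = nth0_closed[OF vs]
  fix u assume "u \<in> set vs"
  then obtain j where j: "j < length vs" "u = vs ! j" by (metis in_set_conv_nth)
  define r where "r = (\<lambda>i. if i = j then \<one> else \<zero>)"
  have "twc vs r = (\<Oplus>i\<in>{..<length vs}. if j = i then nth0 vs i else \<zero>)"
    unfolding twc_def using v zero_pow_p by (intro finsum_cong') (auto simp: r_def)
  also have "\<dots> = nth0 vs j" by (rule finsum_singleton) (use j v in auto)
  also have "\<dots> = u" using j by (simp add: nth0_def)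
  finally have "u = twc vs r \<oplus> \<zero>" using v[of j] j by (simp add: nth0_def)
  moreover have "r \<in> UNIV \<rightarrow> carrier R" by (simp add: r_def)
  ultimately show "u \<in> twspan vs" unfolding twspan_def using ideal_D(2)[OF B_ideal] by blast
qed

text \<open>\<open>vs\<close> collects the coefficients of all f^p, written as forms in y^p.\<close>

lemma exists_coeffs:
  "(\<And>k f. (k, f) \<in> set fs \<Longrightarrow> f \<in> M k) \<Longrightarrow>
    \<exists>vs. set vs \<subseteq> carrier R \<and> (\<forall>U. tws U \<longrightarrow> set vs \<subseteq> U \<longrightarrow> (\<forall>(k, f)\<in>set fs. f [^] p \<in> Uev U k))"
proof (induction fs)
  case Nil
  show ?case by (intro exI[of _ "[]"]) auto
next
  case (Cons kf fs)
  obtain k f where kf: "kf = (k, f)" by (cases kf) auto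
  obtain vs where vs: "set vs \<subseteq> carrier R"
    "\<And>U. tws U \<Longrightarrow> set vs \<subseteq> U \<Longrightarrow> \<forall>(k, f)\<in>set fs. f [^] p \<in> Uev U k"
    using Cons by auto
  have "f [^] p \<in> ideal_pow R B k" using Cons.prems[of k f] kf by (simp add: M_def)
  then obtain w where w: "f [^] p = ev yp d k w" "w \<in> UNIV \<rightarrow> carrier R"
    unfolding ideal_pow_eq_evs[of yp, OF zc, where J = "carrier R"] evs_def[of yp, OF zc] by blast
  obtain l where l: "set l = Mon d k" using finite_list[OF finite_Mon] by blast
  have "f [^] p \<in> Uev U k" if "tws U" "set (map w l) \<subseteq> U" for U
    unfolding w(1) by (rule UevI[OF that(1) w(2)]) (use that(2) l in auto)
  then have "\<forall>(k, f)\<in>set (kf # fs). f [^] p \<in> Uev U k" if "tws U" "set (vs @ map w l) \<subseteq> U" for U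
    using vs(2)[OF that(1)] that kf by auto
  moreover have "set (vs @ map w l) \<subseteq> carrier R" using vs(1) w(2) by auto
  ultimately show ?case by blast
qed

text \<open>Taking p-th powers turns g f into g^p f^p, where g^p preserves forms over
  \<open>U\<close>, and sends M_(n+1) into B^(n+1), which lies in every
  \<open>Uev U n\<close>.\<close>

lemma Sp_pow:
  assumes U: "tws U"
  shows "ind fs \<Longrightarrow> (\<forall>(k, f)\<in>set fs. f [^] p \<in> Uev U k) \<Longrightarrow> x \<in> Sp fs n \<Longrightarrow> x [^] p \<in> Uev U n"
proof (induction fs arbitrary: x rule: ind.induct)
  case 1
  then show ?case using B_pow_subset_Uev[OF U, of n] by (auto simp: M_def)
next
  case (2 k f fs)
  have f: "f \<in> carrier R" using 2(2) ideal_D(8)[OF M_ideal] by auto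
  have ind: "ind fs" using 2(2) by simp
  obtain s g where x: "x = s \<oplus> g \<otimes> f" "s \<in> Sp fs n"
    "g \<in> (if k \<le> n then ideal_pow R I (n - k) else {\<zero>})" using 2(4) by (auto simp: lin_def)
  have sc: "s \<in> carrier R" using ideal_D(8)[OF Sp_ideal[OF ind] x(2)] .
  have s: "s [^] p \<in> Uev U n" using 2(1)[OF ind _ x(2)] 2(3) by auto
  show ?case
  proof (cases "k \<le> n")
    case True
    then have g: "g \<in> ideal_pow R I (n - k)" using x(3) by simp
    have gc: "g \<in> carrier R" using ideal_D(8)[OF In_ideal g] .
    have "f [^] p \<in> Uev U k" using 2(3) by simp
    then have "g [^] p \<otimes> f [^] p \<in> Uev U (n - k + k)" by (rule Uev_mult[OF U g])
    then have "s [^] p \<oplus> g [^] p \<otimes> f [^] p \<in> Uev U n" using Uev_add[OF U s] True by simp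
    then show ?thesis using frob_add[of s "g \<otimes> f" 1] sc gc f x(1) by (simp add: nat_pow_distrib)
  next
    case False
    then have "x = s" using x sc f by simp
    then show ?thesis using s by simp
  qed
qed

text \<open>A multiplier g from \<open>exists_maximal_ind\<close> makes (g x)^p a form over the
  twisted span of finitely many coefficients, and Gauss's lemma cancels g^p.\<close>

lemma M_pow_subset_Uev:
  "\<exists>vs. set vs \<subseteq> carrier R \<and> (\<forall>n. \<forall>x\<in>M n. x [^] p \<in> Uev (twspan vs) n)"
proof -
  obtain fs where fs: "ind fs"
    "\<And>n x. x \<in> M n \<Longrightarrow> \<exists>a g. g \<in> ideal_pow R I a \<and> g \<notin> \<mm> \<cdot> ideal_pow R I a \<and> g \<otimes> x \<in> Sp fs (n + a)"
    using exists_maximal_ind by blast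
  obtain vs where vs: "set vs \<subseteq> carrier R"
    "\<And>U. tws U \<Longrightarrow> set vs \<subseteq> U \<Longrightarrow> \<forall>(k, f)\<in>set fs. f [^] p \<in> Uev U k"
    using exists_coeffs[of fs] ind_M[OF fs(1)] by blast
  have U: "tws (twspan vs)" using twspan_tws[OF vs(1)] .
  have fU: "\<forall>(k, f)\<in>set fs. f [^] p \<in> Uev (twspan vs) k" using vs(2)[OF U set_subset_twspan[OF vs(1)]] .
  have "x [^] p \<in> Uev (twspan vs) n" if x: "x \<in> M n" for x n
  proof -
    obtain a g where g: "g \<in> ideal_pow R I a" "g \<notin> \<mm> \<cdot> ideal_pow R I a" "g \<otimes> x \<in> Sp fs (n + a)"
      using fs(2)[OF x] by blast
    have xc: "x \<in> carrier R" "g \<in> carrier R" using x ideal_D(8)[OF In_ideal g(1)] by (auto simp: M_def)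
    have "(g \<otimes> x) [^] p \<in> Uev (twspan vs) (n + a)" using Sp_pow[OF U fs(1) fU g(3)] .
    then have "g [^] p \<otimes> x [^] p \<in> Uev (twspan vs) (a + n)" using xc by (simp add: nat_pow_distrib add.commute)
    then show ?thesis using gauss_Uev[OF U g(1,2)] x by (simp add: M_def)
  qed
  then show ?thesis using vs(1) by blast
qed

text \<open>The graded ring of M is lifted to the free module of rank t = \<open>length vs\<close>
  over R[Y]: a family r stands for the form with coefficients \<Sum> r_j^p v_j. The families that
  represent p-th powers of elements of M_n form a graded submodule over R itself, since r enters
  through its p-th power. Finite generation of that submodule is translated back.\<close>

lemma M_fg: "\<exists>n0. \<forall>n\<ge>n0. M (Suc n) \<subseteq> Idl (I \<cdot> M n \<union> M (Suc (Suc n)))"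
proof -
  obtain vs where vs: "set vs \<subseteq> carrier R" and MU: "\<And>n x. x \<in> M n \<Longrightarrow> x [^] p \<in> Uev (twspan vs) n"
    using M_pow_subset_Uev by blast
  let ?t = "length vs"
  define cf where "cf r \<alpha> = twc vs (\<lambda>j. r (j, \<alpha>))" for r :: "nat \<times> nat multiset \<Rightarrow> 'a" and \<alpha>
  define E where "E n r = ev yp d n (cf r)" for n r
  have cf_c: "cf r \<in> UNIV \<rightarrow> carrier R" if "\<And>\<omega>. r \<omega> \<in> carrier R" for r
    unfolding cf_def using twc_closed[OF vs] that by auto
  have E_c: "E n r \<in> carrier R" if "\<And>\<omega>. r \<omega> \<in> carrier R" for n r
    unfolding E_def using ev_closed[of yp, OF zc cf_c[OF that]] .
  have E_add: "E n (\<lambda>\<omega>. r \<omega> \<oplus> s \<omega>) = E n r \<oplus> E n s"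
    if "\<And>\<omega>. r \<omega> \<in> carrier R" "\<And>\<omega>. s \<omega> \<in> carrier R" for n r s
  proof -
    have "cf (\<lambda>\<omega>. r \<omega> \<oplus> s \<omega>) = (\<lambda>\<alpha>. cf r \<alpha> \<oplus> cf s \<alpha>)"
      unfolding cf_def using twc_add[OF vs, of "\<lambda>j. r (j, _)" "\<lambda>j. s (j, _)"] that by auto
    then show ?thesis unfolding E_def using ev_add[of yp, OF zc cf_c cf_c, of r s] that by simp
  qed
  have E_smult: "E n (\<lambda>\<omega>. s \<otimes> r \<omega>) = s [^] p \<otimes> E n r"
    if "\<And>\<omega>. r \<omega> \<in> carrier R" "s \<in> carrier R" for n r s
  proof -
    have "cf (\<lambda>\<omega>. s \<otimes> r \<omega>) = (\<lambda>\<alpha>. s [^] p \<otimes> cf r \<alpha>)"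
      unfolding cf_def using twc_smult[OF vs, of "\<lambda>j. r (j, _)" s] that by auto
    then show ?thesis unfolding E_def using ev_smult[of yp, OF zc cf_c, of r "s [^] p"] that by simp
  qed
  have E_shift: "E (Suc n) (shift i r) = yp i \<otimes> E n r"
    if "\<And>\<omega>. r \<omega> \<in> carrier R" "i < d" for n r i
  proof -
    have "cf (shift i r) = (\<lambda>\<gamma>. if i \<in># \<gamma> then cf r (\<gamma> - {#i#}) else \<zero>)"
      unfolding cf_def shift_def using twc_zero[OF vs] by auto
    then show ?thesis unfolding E_def using ev_shift[of yp, OF zc cf_c that(2), of r n] that(1) by simp
  qed
  have E_zero: "E n (\<lambda>_. \<zero>) = \<zero>" for n
    unfolding E_def cf_def using ev_zero[of yp d n, OF zc] twc_zero[OF vs] by simp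
  have shc: "shift i r \<omega> \<in> carrier R" if "\<And>\<omega>. r \<omega> \<in> carrier R" for i r \<omega>
    using that by (cases \<omega>) (auto simp: shift_def)
  \<comment> \<open>A congruence modulo B^(n+1) instead of an equality: only initial forms matter,
    and x is then determined modulo M_(n+1).\<close>
  define H where "H n = {r :: nat \<times> nat multiset \<Rightarrow> 'a. (\<forall>\<omega>. r \<omega> \<in> carrier R) \<and>
    (\<forall>j \<alpha>. r (j, \<alpha>) \<noteq> \<zero> \<longrightarrow> j < ?t \<and> \<alpha> \<in> Mon d n) \<and> (\<exists>x\<in>M n. x [^] p \<ominus> E n r \<in> ideal_pow R B (Suc n))}" for n
  have HD: "\<And>\<omega>. r \<omega> \<in> carrier R" "\<And>j \<alpha>. r (j, \<alpha>) \<noteq> \<zero> \<Longrightarrow> j < ?t \<and> \<alpha> \<in> Mon d n"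
    "\<exists>x\<in>M n. x [^] p \<ominus> E n r \<in> ideal_pow R B (Suc n)" if "r \<in> H n" for r n
    using that unfolding H_def by blast+
  have HI: "r \<in> H n" if "\<And>\<omega>. r \<omega> \<in> carrier R" "\<And>j \<alpha>. r (j, \<alpha>) \<noteq> \<zero> \<Longrightarrow> j < ?t \<and> \<alpha> \<in> Mon d n"
    "x \<in> M n" "x [^] p \<ominus> E n r \<in> ideal_pow R B (Suc n)" for r n x
    using that unfolding H_def by blast
  note Mc = ideal_D(8)[OF M_ideal]
  have padd: "(a \<oplus> b) [^] p = a [^] p \<oplus> b [^] p" if "a \<in> carrier R" "b \<in> carrier R" for a b
    using frob_add[OF that, of 1] by simp
  have "\<exists>n0. \<forall>n\<ge>n0. H (Suc n) \<subseteq> shift_span d (H n)"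
  proof (rule graded_submodule_fg[where t = ?t])
    show "f \<omega> \<in> carrier R" if "f \<in> H n" for n f \<omega> using HD(1)[OF that] .
    show "j < ?t \<and> \<alpha> \<in> Mon d n" if "f \<in> H n" "f (j, \<alpha>) \<noteq> \<zero>" for n f j \<alpha> using HD(2)[OF that] .
    show "(\<lambda>_. \<zero>) \<in> H n" for n
    proof (rule HI)
      show "\<zero> \<in> M n" using ideal_D(2)[OF M_ideal] .
      have "\<zero> [^] p \<ominus> E n (\<lambda>_. \<zero>) = \<zero>" using E_zero zero_pow_p by (simp add: a_minus_def)
      then show "\<zero> [^] p \<ominus> E n (\<lambda>_. \<zero>) \<in> ideal_pow R B (Suc n)"
        using ideal_D(2)[OF Bn_ideal] by metis
    qed auto
    show "(\<lambda>\<omega>. f \<omega> \<oplus> g \<omega>) \<in> H n" if f: "f \<in> H n" and g: "g \<in> H n" for n f g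
    proof -
      obtain x where x: "x \<in> M n" "x [^] p \<ominus> E n f \<in> ideal_pow R B (Suc n)" using HD(3)[OF f] by blast
      obtain z where z: "z \<in> M n" "z [^] p \<ominus> E n g \<in> ideal_pow R B (Suc n)" using HD(3)[OF g] by blast
      have "(x \<oplus> z) [^] p \<ominus> E n (\<lambda>\<omega>. f \<omega> \<oplus> g \<omega>) = (x [^] p \<ominus> E n f) \<oplus> (z [^] p \<ominus> E n g)"
        unfolding E_add[OF HD(1)[OF f] HD(1)[OF g]] padd[OF Mc[OF x(1)] Mc[OF z(1)]]
        using Mc[OF x(1)] Mc[OF z(1)] E_c HD(1)[OF f] HD(1)[OF g] by (intro add_minus_add) auto
      then have mem: "(x \<oplus> z) [^] p \<ominus> E n (\<lambda>\<omega>. f \<omega> \<oplus> g \<omega>) \<in> ideal_pow R B (Suc n)"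
        using ideal_D(3)[OF Bn_ideal x(2) z(2)] by simp
      show ?thesis
      proof (rule HI[OF _ _ ideal_D(3)[OF M_ideal x(1) z(1)] mem])
        show "f \<omega> \<oplus> g \<omega> \<in> carrier R" for \<omega> using HD(1)[OF f] HD(1)[OF g] by simp
        show "j < ?t \<and> \<alpha> \<in> Mon d n" if "f (j, \<alpha>) \<oplus> g (j, \<alpha>) \<noteq> \<zero>" for j \<alpha>
        proof -
          have "f (j, \<alpha>) \<noteq> \<zero> \<or> g (j, \<alpha>) \<noteq> \<zero>" using that by auto
          then show ?thesis using HD(2)[OF f] HD(2)[OF g] by blast
        qed
      qed
    qed
    show "(\<lambda>\<omega>. r \<otimes> f \<omega>) \<in> H n" if f: "f \<in> H n" and r: "r \<in> carrier R" for n f r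
    proof -
      obtain x where x: "x \<in> M n" "x [^] p \<ominus> E n f \<in> ideal_pow R B (Suc n)" using HD(3)[OF f] by blast
      have "(r \<otimes> x) [^] p \<ominus> E n (\<lambda>\<omega>. r \<otimes> f \<omega>) = r [^] p \<otimes> (x [^] p \<ominus> E n f)"
        unfolding E_smult[OF HD(1)[OF f] r] using Mc[OF x(1)] r E_c[OF HD(1)[OF f]]
        by (simp add: nat_pow_distrib a_minus_def r_distr r_minus)
      then have mem: "(r \<otimes> x) [^] p \<ominus> E n (\<lambda>\<omega>. r \<otimes> f \<omega>) \<in> ideal_pow R B (Suc n)"
        using ideal_D(6)[OF Bn_ideal x(2)] r by simp
      show ?thesis
      proof (rule HI[OF _ _ ideal_D(6)[OF M_ideal x(1) r] mem])
        show "r \<otimes> f \<omega> \<in> carrier R" for \<omega> using HD(1)[OF f] r by simp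
        show "j < ?t \<and> \<alpha> \<in> Mon d n" if "r \<otimes> f (j, \<alpha>) \<noteq> \<zero>" for j \<alpha>
        proof -
          have "f (j, \<alpha>) \<noteq> \<zero>" using that r by auto
          then show ?thesis using HD(2)[OF f] by blast
        qed
      qed
    qed
    show "shift i f \<in> H (Suc n)" if f: "f \<in> H n" and i: "i < d" for n f i
    proof -
      obtain x where x: "x \<in> M n" "x [^] p \<ominus> E n f \<in> ideal_pow R B (Suc n)" using HD(3)[OF f] by blast
      have "(y i \<otimes> x) [^] p \<ominus> E (Suc n) (shift i f) = yp i \<otimes> (x [^] p \<ominus> E n f)"
        unfolding E_shift[OF HD(1)[OF f] i] using Mc[OF x(1)] yc[of i] E_c[OF HD(1)[OF f]]
        by (simp add: nat_pow_distrib a_minus_def r_distr r_minus)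
      then have mem: "(y i \<otimes> x) [^] p \<ominus> E (Suc n) (shift i f) \<in> ideal_pow R B (Suc (Suc n))"
        unfolding gid_pow_Suc[of yp, OF zc, where d = d and n = "Suc n"]
        using ideal_prod.prod[OF gid_mem[of yp, OF zc i] x(2), where R = R] by metis
      have "y i \<in> M (Suc 0)"
        using I_pow_subset_M[of "Suc 0"] gid_mem[of y, OF yc i] ideal_pow_1[OF I_ideal] by auto
      then have yx: "y i \<otimes> x \<in> M (Suc n)" using M_mult[OF _ x(1), of "y i" "Suc 0"] by simp
      show ?thesis
      proof (rule HI[OF _ _ yx mem])
        show "shift i f \<omega> \<in> carrier R" for \<omega> using shc[OF HD(1)[OF f]] .
        show "j < ?t \<and> \<alpha> \<in> Mon d (Suc n)" if nz: "shift i f (j, \<alpha>) \<noteq> \<zero>" for j \<alpha>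
        proof -
          have ia: "i \<in># \<alpha>" "f (j, \<alpha> - {#i#}) \<noteq> \<zero>" using nz by (auto simp: shift_def split: if_splits)
          then have j: "j < ?t" "\<alpha> - {#i#} \<in> Mon d n" using HD(2)[OF f] by blast+
          have "add_mset i (\<alpha> - {#i#}) \<in> Mon d (Suc n)" using j(2) i by (auto simp: Mon_iff)
          then show ?thesis using ia(1) j(1) by simp
        qed
      qed
    qed
  qed
  then obtain n0 where n0: "\<And>n. n \<ge> n0 \<Longrightarrow> H (Suc n) \<subseteq> shift_span d (H n)" by blast
  have IM: "ideal (I \<cdot> M n) R" for n using ideal_prod_is_ideal[OF I_ideal M_ideal] .
  note IMc = ideal_D(8)[OF IM]
  have span: "(\<forall>\<omega>. f \<omega> \<in> carrier R) \<and> (\<exists>x\<in>I \<cdot> M n. x [^] p \<ominus> E (Suc n) f \<in> ideal_pow R B (Suc (Suc n)))"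
    if "f \<in> shift_span d (H n)" for f n
    using that
  proof (induction rule: shift_span.induct)
    case zero
    have "\<zero> [^] p \<ominus> E (Suc n) (\<lambda>_. \<zero>) = \<zero>" using E_zero zero_pow_p by (simp add: a_minus_def)
    then have "\<zero> [^] p \<ominus> E (Suc n) (\<lambda>_. \<zero>) \<in> ideal_pow R B (Suc (Suc n))"
      using ideal_D(2)[OF Bn_ideal] by metis
    then show ?case using ideal_D(2)[OF IM] zero_closed by blast
  next
    case (step f h i)
    obtain x where x: "x \<in> I \<cdot> M n" "x [^] p \<ominus> E (Suc n) f \<in> ideal_pow R B (Suc (Suc n))" using step.IH by blast
    have fc: "f \<omega> \<in> carrier R" for \<omega> using step.IH by blast
    obtain z where z: "z \<in> M n" "z [^] p \<ominus> E n h \<in> ideal_pow R B (Suc n)" using HD(3)[OF step.hyps(2)] by blast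
    have hc: "h \<omega> \<in> carrier R" for \<omega> using HD(1)[OF step.hyps(2)] .
    have "(y i \<otimes> z) [^] p \<ominus> E (Suc n) (shift i h) = yp i \<otimes> (z [^] p \<ominus> E n h)"
      unfolding E_shift[OF hc step.hyps(3)] using Mc[OF z(1)] yc[of i] E_c[OF hc]
      by (simp add: nat_pow_distrib a_minus_def r_distr r_minus)
    then have mem: "(y i \<otimes> z) [^] p \<ominus> E (Suc n) (shift i h) \<in> ideal_pow R B (Suc (Suc n))"
      unfolding gid_pow_Suc[of yp, OF zc, where d = d and n = "Suc n"]
        using ideal_prod.prod[OF gid_mem[of yp, OF zc step.hyps(3)] z(2), where R = R] by metis
    have yz: "y i \<otimes> z \<in> I \<cdot> M n" using ideal_prod.prod[OF gid_mem[of y, OF yc step.hyps(3)] z(1), where R = R] .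
    have "(x \<oplus> y i \<otimes> z) [^] p \<ominus> E (Suc n) (\<lambda>\<omega>. f \<omega> \<oplus> shift i h \<omega>)
        = (x [^] p \<ominus> E (Suc n) f) \<oplus> ((y i \<otimes> z) [^] p \<ominus> E (Suc n) (shift i h))"
      unfolding E_add[OF fc shc[OF hc]] padd[OF IMc[OF x(1)] IMc[OF yz]]
      using IMc[OF x(1)] IMc[OF yz] E_c[OF fc] E_c[OF shc[OF hc]] by (intro add_minus_add) auto
    then have "(x \<oplus> y i \<otimes> z) [^] p \<ominus> E (Suc n) (\<lambda>\<omega>. f \<omega> \<oplus> shift i h \<omega>) \<in> ideal_pow R B (Suc (Suc n))"
      using ideal_D(3)[OF Bn_ideal x(2) mem] by simp
    moreover have "x \<oplus> y i \<otimes> z \<in> I \<cdot> M n" using ideal_D(3)[OF IM x(1) yz] .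
    moreover have "\<forall>\<omega>. f \<omega> \<oplus> shift i h \<omega> \<in> carrier R" using fc shc[of h, OF hc] by simp
    ultimately show ?case by blast
  qed
  have "M (Suc n) \<subseteq> Idl (I \<cdot> M n \<union> M (Suc (Suc n)))" if n: "n \<ge> n0" for n
  proof
    fix x assume x: "x \<in> M (Suc n)"
    have xc: "x \<in> carrier R" using Mc[OF x] .
    have U: "tws (twspan vs)" using twspan_tws[OF vs] .
    obtain w where w: "x [^] p = ev yp d (Suc n) w" "\<And>\<alpha>. w \<alpha> \<in> twspan vs"
      using MU[OF x] unfolding Uev_def by blast
    have wc: "w \<in> UNIV \<rightarrow> carrier R" using w(2) tws_D(6)[OF U] by auto
    have "\<forall>\<alpha>. \<exists>r b. w \<alpha> = twc vs r \<oplus> b \<and> r \<in> UNIV \<rightarrow> carrier R \<and> b \<in> B"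
      using w(2) unfolding twspan_def by blast
    then obtain rr b where rb: "\<And>\<alpha>. w \<alpha> = twc vs (rr \<alpha>) \<oplus> b \<alpha>" "\<And>\<alpha>. rr \<alpha> \<in> UNIV \<rightarrow> carrier R" "\<And>\<alpha>. b \<alpha> \<in> B"
      by metis
    define r where "r = (\<lambda>(j, \<alpha>). if j < ?t \<and> \<alpha> \<in> Mon d (Suc n) then rr \<alpha> j else \<zero>)"
    have rrc: "rr \<alpha> j \<in> carrier R" for \<alpha> j using rb(2)[of \<alpha>] by auto
    have rc: "r \<omega> \<in> carrier R" for \<omega> using rrc by (cases \<omega>) (auto simp: r_def)
    have cfr: "cf r \<alpha> = twc vs (rr \<alpha>)" if "\<alpha> \<in> Mon d (Suc n)" for \<alpha>
      unfolding cf_def twc_def r_def using that rrc nth0_closed[OF vs] by (intro finsum_cong') auto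
    have wcf: "w \<alpha> \<ominus> cf r \<alpha> \<in> B" if "\<alpha> \<in> Mon d (Suc n)" for \<alpha>
    proof -
      have c: "twc vs (rr \<alpha>) \<in> carrier R" "b \<alpha> \<in> carrier R" using twc_closed[OF vs rrc] ideal_D(8)[OF B_ideal rb(3)] by auto
      have "w \<alpha> \<ominus> cf r \<alpha> = b \<alpha>" unfolding cfr[OF that] rb(1)[of \<alpha>] using c
        by (simp add: a_minus_def a_comm[of "twc vs (rr \<alpha>)"] a_assoc r_neg)
      then show ?thesis using rb(3) by simp
    qed
    have wmc: "(\<lambda>\<alpha>. w \<alpha> \<ominus> cf r \<alpha>) \<in> UNIV \<rightarrow> carrier R" using wc cf_c[OF rc] by auto
    have "x [^] p \<ominus> E (Suc n) r = ev yp d (Suc n) (\<lambda>\<alpha>. w \<alpha> \<ominus> cf r \<alpha>)"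
      unfolding w(1) E_def using ev_minus[of yp, OF zc wc cf_c[OF rc]] by simp
    also have "\<dots> \<in> ideal_pow R B (Suc (Suc n))"
      unfolding gid_pow_Suc[of yp, OF zc, where d = d and n = "Suc n"]
        ideal_prod_pow_eq_evs[of yp, OF zc B_ideal, of d "Suc n"] evs_def[of yp, OF zc]
      using wmc wcf by blast
    finally have xE: "x [^] p \<ominus> E (Suc n) r \<in> ideal_pow R B (Suc (Suc n))" .
    have "r \<in> H (Suc n)" by (rule HI[OF rc _ x xE]) (auto simp: r_def split: if_splits)
    then obtain x' where x': "x' \<in> I \<cdot> M n" "x' [^] p \<ominus> E (Suc n) r \<in> ideal_pow R B (Suc (Suc n))"
      using n0[OF n] span by blast
    have x'c: "x' \<in> carrier R" using IMc[OF x'(1)] .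
    \<comment> \<open>The p-th powers of x and x' are congruent to the same form modulo B^(n+2), so
      x - x' falls into M_(n+2).\<close>
    have "(x \<ominus> x') [^] p = (x [^] p \<ominus> E (Suc n) r) \<ominus> (x' [^] p \<ominus> E (Suc n) r)"
      using frob_minus[OF xc x'c, of 1] xc x'c E_c[OF rc, of "Suc n"] by (simp add: a_minus_def minus_add a_ac r_neg1 r_neg2 r_neg l_neg)
    then have "x \<ominus> x' \<in> M (Suc (Suc n))"
      using ideal_D(4)[OF Bn_ideal xE x'(2)] xc x'c by (simp add: M_def)
    moreover have "x = x' \<oplus> (x \<ominus> x')" using xc x'c by (simp add: a_minus_def a_comm[of x' "x \<oplus> \<ominus> x'"] a_assoc l_neg)
    ultimately show "x \<in> Idl (I \<cdot> M n \<union> M (Suc (Suc n)))"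
      using mem_genideal_Un[OF IM M_ideal] x'(1) by blast
  qed
  then show ?thesis by blast
qed

text \<open>Iterating M_(n+1) \<subseteq> I M_n + M_(n+2) pushes the error term arbitrarily deep,
  and \<open>M_chevalley\<close> places it in I^(n+1) \<subseteq> I M_n. From \<open>n0\<close> on,
  every degree therefore contributes a factor I.\<close>

lemma M_linear: "\<exists>n0. \<forall>k. M (n0 + k) \<subseteq> ideal_pow R I k"
proof -
  obtain n0 where n0: "\<And>n. n \<ge> n0 \<Longrightarrow> M (Suc n) \<subseteq> Idl (I \<cdot> M n \<union> M (Suc (Suc n)))" using M_fg by blast
  have IM: "ideal (I \<cdot> M n) R" for n using ideal_prod_is_ideal[OF I_ideal M_ideal] .
  have un: "I \<cdot> M n \<union> M m \<subseteq> carrier R" for n m using ideal_D(1)[OF IM] ideal_D(1)[OF M_ideal] by blast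
  have step: "M (Suc n) \<subseteq> I \<cdot> M n" if n: "n \<ge> n0" for n
  proof -
    have it: "M (Suc n) \<subseteq> Idl (I \<cdot> M n \<union> M (Suc n + k))" for k
    proof (induction k)
      case 0
      then show ?case using genideal_self[OF un[of n "Suc n"]] by simp
    next
      case (Suc k)
      have J: "ideal (Idl (I \<cdot> M n \<union> M (Suc n + Suc k))) R" using genideal_ideal[OF un] .
      have s: "I \<cdot> M n \<union> M (Suc n + Suc k) \<subseteq> Idl (I \<cdot> M n \<union> M (Suc n + Suc k))" using genideal_self[OF un] .
      have "I \<cdot> M (n + k) \<subseteq> I \<cdot> M n" by (rule ideal_prod_mono[OF order_refl M_antimono]) simp
      then have "Idl (I \<cdot> M (n + k) \<union> M (Suc (Suc (n + k)))) \<subseteq> Idl (I \<cdot> M n \<union> M (Suc n + Suc k))"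
        using s by (intro genideal_minimal[OF J]) auto
      then have "M (Suc n + k) \<subseteq> Idl (I \<cdot> M n \<union> M (Suc n + Suc k))" using n0[of "n + k"] n by auto
      then have "Idl (I \<cdot> M n \<union> M (Suc n + k)) \<subseteq> Idl (I \<cdot> M n \<union> M (Suc n + Suc k))"
        using s by (intro genideal_minimal[OF J]) auto
      then show ?case using Suc by blast
    qed
    obtain N where N: "M N \<subseteq> ideal_pow R I (Suc n)" using M_chevalley by blast
    have "ideal_pow R I (Suc n) \<subseteq> I \<cdot> M n"
      unfolding gid_pow_Suc[of y, OF yc] by (rule ideal_prod_mono[OF order_refl I_pow_subset_M])
    then have "M (Suc n + N) \<subseteq> I \<cdot> M n" using N M_antimono[of N "Suc n + N"] by auto
    then have "Idl (I \<cdot> M n \<union> M (Suc n + N)) \<subseteq> I \<cdot> M n" by (intro genideal_minimal[OF IM]) auto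
    then show ?thesis using it[of N] by blast
  qed
  have "M (n0 + k) \<subseteq> ideal_pow R I k" for k
  proof (induction k)
    case 0
    then show ?case using ideal_D(1)[OF M_ideal] by simp
  next
    case (Suc k)
    have "M (n0 + Suc k) \<subseteq> I \<cdot> M (n0 + k)" using step[of "n0 + k"] by simp
    also have "\<dots> \<subseteq> I \<cdot> ideal_pow R I k" by (rule ideal_prod_mono[OF order_refl Suc])
    finally show ?case unfolding gid_pow_Suc[of y, OF yc] .
  qed
  then show ?thesis by blast
qed

text \<open>One root loses a constant: I^(p N) lies in the (N-d)-th power of \<open>B\<close>, so z
  is in M_(N-d) and then in I^(N-d-n0). With h = d + n0 the accumulated loss 2h reproduces itself at
  each further root, since p (N - h) \<le> p N - 2h for p \<ge> 2.\<close>

lemma frob_root_bound: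
  "\<exists>h. \<forall>e N. \<forall>z\<in>carrier R. z [^] (p ^ e) \<in> ideal_pow R I (p ^ e * N) \<longrightarrow> z \<in> ideal_pow R I (N - h)"
proof -
  obtain n0 where n0: "\<And>k. M (n0 + k) \<subseteq> ideal_pow R I k" using M_linear by blast
  define h where "h = d + n0"
  have p2: "p \<ge> 2" using prime_ge_2_nat[OF prime_char] .
  have root: "z \<in> ideal_pow R I (N - h)" if z: "z \<in> carrier R" "z [^] p \<in> ideal_pow R I (p * N)" for z N
  proof (cases "N \<ge> h")
    case True
    have "z [^] p \<in> ideal_pow R I (p * ((N - d) + d))" using z(2) True by (simp add: h_def)
    then have "z [^] p \<in> ideal_pow R B (N - d)" using gid_pow_subset[of y p, OF yc] p2 by auto
    then have "z \<in> M (n0 + (N - h))" using z(1) True by (simp add: M_def h_def)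
    then show ?thesis using n0 by blast
  qed (use z in simp)
  have "\<forall>N. \<forall>z\<in>carrier R. z [^] (p ^ e) \<in> ideal_pow R I (p ^ e * N) \<longrightarrow> z \<in> ideal_pow R I (N - 2 * h)" for e
  proof (induction e)
    case 0
    show ?case
    proof (intro allI ballI impI)
      fix N z assume z: "z \<in> carrier R" "z [^] (p ^ 0) \<in> ideal_pow R I (p ^ 0 * N)"
      then have "z \<in> ideal_pow R I N" by simp
      then show "z \<in> ideal_pow R I (N - 2 * h)" using ideal_pow_antimono[OF I_ideal, of "N - 2 * h" N] by auto
    qed
  next
    case (Suc e)
    show ?case
    proof (intro allI ballI impI)
      fix N z assume z: "z \<in> carrier R" "z [^] (p ^ Suc e) \<in> ideal_pow R I (p ^ Suc e * N)"
      have "p ^ Suc e * N = p ^ e * (p * N)" by (simp add: ac_simps)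
      moreover have "z [^] (p ^ Suc e) = (z [^] p) [^] (p ^ e)" using z(1) by (simp add: nat_pow_pow)
      ultimately have "(z [^] p) [^] (p ^ e) \<in> ideal_pow R I (p ^ e * (p * N))" using z(2) by metis
      then have 1: "z [^] p \<in> ideal_pow R I (p * N - 2 * h)" using Suc z(1) by simp
      have "p * (N - h) \<le> p * N - 2 * h"
        using p2 by (simp add: diff_mult_distrib2 diff_le_mono2)
      then have "z [^] p \<in> ideal_pow R I (p * (N - h))" using 1 ideal_pow_antimono[OF I_ideal] by blast
      then have "z \<in> ideal_pow R I (N - h - h)" using root[OF z(1)] by blast
      then show "z \<in> ideal_pow R I (N - 2 * h)" by (simp add: mult_2)
    qed
  qed
  then show ?thesis by blast
qed

text \<open>From c x^q in I^(n q), Artin-Rees removes \<open>c\<close> at the price of a constant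
  depending on \<open>c\<close>. A single q exceeding this constant suffices: then x^q lies in I^(q
  (n-1)), and the q-th root costs a constant that depends on neither q nor \<open>c\<close>.\<close>

lemma tight_closure_pow_bound: "\<exists>h. \<forall>n. tight_closure R (ideal_pow R I n) \<subseteq> ideal_pow R I (n - h)"
proof -
  obtain h where h: "\<And>e N z. z \<in> carrier R \<Longrightarrow> z [^] (p ^ e) \<in> ideal_pow R I (p ^ e * N) \<Longrightarrow> z \<in> ideal_pow R I (N - h)"
    using frob_root_bound by blast
  have "x \<in> ideal_pow R I (n - Suc h)" if x: "x \<in> tight_closure R (ideal_pow R I n)" for x n
  proof (cases "n = 0")
    case True
    then show ?thesis using x tight_closure_carrier by auto
  next
    case False
    obtain c e0 where c: "x \<in> carrier R" "c \<in> ring_circ R"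
      "\<And>e. e \<ge> e0 \<Longrightarrow> c \<otimes> x [^] (p ^ e) \<in> frobenius_power R (ideal_pow R I n) (p ^ e)"
      using x unfolding mem_tight_closure_iff by blast
    have cc: "c \<in> carrier R" using ring_circ_carrier[OF c(2)] .
    have "nzd {\<zero>} c"
      by (rule ring_circ_nzd[OF _ c(2)]) (rule reduced_if_completion_reduced[OF unramified])
    then obtain k where k: "\<And>m z. z \<in> carrier R \<Longrightarrow> c \<otimes> z \<in> ideal_pow R I (k + m) \<Longrightarrow> z \<in> ideal_pow R I m"
      using artin_rees_nzd[of y, OF yc cc] by blast
    define e where "e = max e0 k"
    have pe: "p ^ e \<ge> k"
    proof -
      have "k \<le> 2 ^ k" using less_exp[of k] by simp
      also have "\<dots> \<le> p ^ k" by (rule power_mono) (use prime_ge_2_nat[OF prime_char] in auto)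
      also have "\<dots> \<le> p ^ e" by (rule power_increasing) (use prime_ge_2_nat[OF prime_char] in \<open>auto simp: e_def\<close>)
      finally show ?thesis .
    qed
    have "frobenius_power R (ideal_pow R I n) (p ^ e) \<subseteq> ideal_pow R I (n * p ^ e)"
      by (rule frobenius_power_least[OF In_ideal]) (rule pow_mem_ideal_pow_mult[OF I_ideal])
    then have "c \<otimes> x [^] (p ^ e) \<in> ideal_pow R I (n * p ^ e)" using c(3)[of e] by (auto simp: e_def)
    moreover have "k + p ^ e * (n - 1) \<le> n * p ^ e"
    proof -
      have "n * p ^ e = p ^ e + p ^ e * (n - 1)" using False by (cases n) auto
      then show ?thesis using pe by simp
    qed
    ultimately have "c \<otimes> x [^] (p ^ e) \<in> ideal_pow R I (k + p ^ e * (n - 1))"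
      using ideal_pow_antimono[OF I_ideal] by blast
    then have "x [^] (p ^ e) \<in> ideal_pow R I (p ^ e * (n - 1))" using k c(1) by simp
    then have "x \<in> ideal_pow R I (n - 1 - h)" using h[OF c(1)] by blast
    then show ?thesis by simp
  qed
  then show ?thesis by blast
qed

end

section \<open>The tight Hilbert polynomial\<close>

text \<open>The lower bound forces c \<le> e 0. With e 1 = 0 the polynomial differs from e 0
  binom(n+d-1, d) by a remainder \<open>Q\<close> of degree at most d - 2, while the upper bound
  puts it below c binom(n+d-1, d) by a term of exact degree d - 1. Division by n^(d-1) leaves
  1/(d-1)! \<le> 0 in the limit.\<close>

lemma hilbert_arith:
  fixes e :: "nat \<Rightarrow> int" and l :: "nat \<Rightarrow> nat" and c h d :: nat
  assumes d: "d \<ge> 1" and e1: "e 1 = 0"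
    and poly: "\<forall>\<^sub>F n in sequentially. int (l n) = (\<Sum>i\<le>d. (-1) ^ i * e i * int ((n + d - 1 - i) choose (d - i)))"
    and lower: "\<And>n. c * ((n - h + d - 1) choose d) \<le> l n"
    and upper: "\<And>n. n \<ge> 1 \<Longrightarrow> l n + ((n + d - 2) choose (d - 1)) \<le> c * ((n + d - 1) choose d)"
  shows False
proof -
  define a where "a i n = real ((n + d - 1 - i) choose (d - i))" for i n
  have a_lim: "(\<lambda>n. a i n / real n ^ (d - i)) \<longlonglongrightarrow> 1 / fact (d - i)" for i
    using binomial_asymp_shift[of "d - 1" i "d - i"] d by (simp add: a_def)
  have inv: "(\<lambda>n. 1 / real n) \<longlonglongrightarrow> 0" by (rule lim_const_over_n)
  have a_null: "(\<lambda>n. a i n / real n ^ m) \<longlonglongrightarrow> 0" if i: "i \<le> d" "d - i < m" for i m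
  proof -
    have "(\<lambda>n. a i n / real n ^ (d - i) * (1 / real n) ^ (m - (d - i))) \<longlonglongrightarrow> 1 / fact (d - i) * 0 ^ (m - (d - i))"
      by (intro tendsto_mult tendsto_power a_lim inv)
    moreover have "a i n / real n ^ (d - i) * (1 / real n) ^ (m - (d - i)) = a i n / real n ^ m" for n
    proof -
      have "real n ^ m = real n ^ (d - i) * real n ^ (m - (d - i))" using i(2) by (simp flip: power_add)
      then show ?thesis by (simp add: power_one_over)
    qed
    ultimately show ?thesis using i(2) by (simp add: power_0_left)
  qed
  \<comment> \<open>An empty sum for d = 1, where the contradiction is one between
    constants.\<close>
  define Q where "Q n = (\<Sum>i\<in>{2..d}. (-1) ^ i * real_of_int (e i) * a i n)" for n
  have Q_null: "(\<lambda>n. Q n / real n ^ m) \<longlonglongrightarrow> 0" if m: "m \<ge> d - 1" "m \<ge> 1 \<or> d = 1" for m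
  proof -
    have "(\<lambda>n. \<Sum>i\<in>{2..d}. (-1) ^ i * real_of_int (e i) * (a i n / real n ^ m)) \<longlonglongrightarrow> (\<Sum>i\<in>{2..d}. (-1) ^ i * real_of_int (e i) * 0)"
      by (intro tendsto_sum tendsto_mult tendsto_const a_null) (use m in auto)
    then show ?thesis by (simp add: Q_def sum_divide_distrib)
  qed
  have P: "\<forall>\<^sub>F n in sequentially. real (l n) = real_of_int (e 0) * a 0 n + Q n"
    using poly
  proof eventually_elim
    case (elim n)
    have "{..d} = insert 0 (insert 1 {2..d})" using d by auto
    then have "int (l n) = e 0 * int ((n + d - 1) choose d) + (\<Sum>i\<in>{2..d}. (-1) ^ i * e i * int ((n + d - 1 - i) choose (d - i)))"
      unfolding elim using e1 by simp
    then have "real_of_int (int (l n)) = real_of_int (e 0 * int ((n + d - 1) choose d) + (\<Sum>i\<in>{2..d}. (-1) ^ i * e i * int ((n + d - 1 - i) choose (d - i))))"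
      by (rule arg_cong)
    then show ?case by (simp add: a_def Q_def)
  qed
  have "real c \<le> real_of_int (e 0)"
  proof -
    have L: "(\<lambda>n. real c * (real ((n - h + d - 1) choose d) / real n ^ d)) \<longlonglongrightarrow> real c * (1 / fact d)"
    proof (intro tendsto_mult tendsto_const)
      have "\<forall>\<^sub>F n in sequentially. real ((n + (d - 1) - h) choose d) / real n ^ d
          = real ((n - h + d - 1) choose d) / real n ^ d"
        using eventually_ge_at_top[of h] by eventually_elim (use d in simp)
      then show "(\<lambda>n. real ((n - h + d - 1) choose d) / real n ^ d) \<longlonglongrightarrow> 1 / fact d"
        using binomial_asymp_shift[of "d - 1" h d] tendsto_cong by fast
    qed
    have "(\<lambda>n. real_of_int (e 0) * (a 0 n / real n ^ d) + Q n / real n ^ d) \<longlonglongrightarrow> real_of_int (e 0) * (1 / fact d) + 0"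
      using a_lim[of 0] by (intro tendsto_add tendsto_mult tendsto_const Q_null) (use d in auto)
    moreover have "\<forall>\<^sub>F n in sequentially. real c * (real ((n - h + d - 1) choose d) / real n ^ d)
        \<le> real_of_int (e 0) * (a 0 n / real n ^ d) + Q n / real n ^ d"
      using P
    proof eventually_elim
      case (elim n)
      have "real (c * ((n - h + d - 1) choose d)) \<le> real (l n)" using lower[of n] by (simp only: of_nat_le_iff)
      then have "real (c * ((n - h + d - 1) choose d)) / real n ^ d \<le> real (l n) / real n ^ d"
        by (rule divide_right_mono) simp
      then show ?case unfolding elim by (simp add: add_divide_distrib)
    qed
    ultimately have "real c * (1 / fact d) \<le> real_of_int (e 0) * (1 / fact d) + 0"
      using L by (intro tendsto_le[OF trivial_limit_sequentially]) auto
    then have "real c / fact d \<le> real_of_int (e 0) / fact d" by simp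
    then show ?thesis by (simp add: divide_le_cancel)
  qed
  then have le: "real c * a 0 n \<le> real_of_int (e 0) * a 0 n" for n by (rule mult_right_mono) (simp add: a_def)
  let ?b = "\<lambda>n. real ((n + d - 2) choose (d - 1))"
  have "(\<lambda>n. Q n / real n ^ (d - 1) + ?b n / real n ^ (d - 1)) \<longlonglongrightarrow> 0 + 1 / fact (d - 1)"
    using binomial_asymp_shift[of d 2 "d - 1"] d by (intro tendsto_add Q_null) auto
  moreover have "\<forall>\<^sub>F n in sequentially. Q n / real n ^ (d - 1) + ?b n / real n ^ (d - 1) \<le> 0"
    using P eventually_ge_at_top[of 1]
  proof eventually_elim
    case (elim n)
    have "real (l n + ((n + d - 2) choose (d - 1))) \<le> real (c * ((n + d - 1) choose d))"
      using upper[OF elim(2)] by (simp only: of_nat_le_iff)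
    then have "real_of_int (e 0) * a 0 n + Q n + ?b n \<le> real c * a 0 n" using elim(1) by (simp add: a_def)
    then have "Q n + ?b n \<le> 0" using le[of n] by linarith
    then have "(Q n + ?b n) / real n ^ (d - 1) \<le> 0" by (simp add: divide_nonpos_nonneg)
    then show ?case by (simp add: add_divide_distrib)
  qed
  ultimately have "0 + 1 / fact (d - 1) \<le> (0::real)" by (intro tendsto_upperbound) auto
  moreover have "0 < 1 / (fact (d - 1) :: real)" by (intro divide_pos_pos) auto
  ultimately show False by linarith
qed

context unramified_sop
begin

lemma tight_closure_In_ideal: "ideal (tight_closure R (ideal_pow R I n)) R"
  using tight_closure_ideal[OF ideal_D(1)[OF In_ideal]] ideal_D(2)[OF In_ideal] by blast

text \<open>All powers of I are tightly closed, so the tight Hilbert function is the ordinary one, a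
  single binomial coefficient times \<open>lam\<close> for every n.\<close>

lemma tight_hilbert_coeffs_if_tc_closed:
  assumes "tight_closure R I = I"
  shows "tight_hilbert_coeffs R d I (\<lambda>i. if i = 0 then int lam else 0)"
  unfolding tight_hilbert_coeffs_def
proof (rule eventuallyI)
  fix n
  have "module_length R (quotient_module R (tight_closure R (ideal_pow R I n))) = enat (((n + d - 1) choose d) * lam)"
    unfolding tight_closure_pow_eq[of y, OF yc reg_pow assms]
    using module_length_quotient[OF In_ideal] ilen_In by simp
  moreover have "int (((n + d - 1) choose d) * lam)
      = (\<Sum>i\<le>d. (-1) ^ i * (if i = 0 then int lam else 0) * int ((n + d - 1 - i) choose (d - i)))"
  proof -
    have "(\<Sum>i\<le>d. (-1) ^ i * (if i = 0 then int lam else 0) * int ((n + d - 1 - i) choose (d - i)))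
        = (\<Sum>i\<in>{0}. (-1) ^ i * (if i = 0 then int lam else 0) * int ((n + d - 1 - i) choose (d - i)))"
      by (rule sum.mono_neutral_right) auto
    then show ?thesis by simp
  qed
  ultimately show "\<exists>l. module_length R (quotient_module R (tight_closure R (ideal_pow R I n))) = enat l \<and>
      int l = (\<Sum>i\<le>d. (-1) ^ i * (if i = 0 then int lam else 0) * int ((n + d - 1 - i) choose (d - i)))" by blast
qed

text \<open>If J = I^* were larger than I, the inclusion of J I^m in the tight closure of I^(m+1)
  would lower the length at n = m + 1 by at least one for every monomial of degree m, that is by
  binom(n+d-2, d-1), while the linear bound on tight closures keeps the leading coefficient at least
  \<open>lam\<close>.\<close>

lemma tc_closed_if_tight_hilbert_coeff_zero:
  assumes e: "tight_hilbert_coeffs R d I e" "e 1 = 0"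
  shows "tight_closure R I = I"
proof (rule ccontr)
  assume ne: "tight_closure R I \<noteq> I"
  define J where "J = tight_closure R I"
  define T where "T n = tight_closure R (ideal_pow R I n)" for n
  have JI: "ideal J R" unfolding J_def using tight_closure_ideal[OF ideal_D(1)[OF I_ideal]] ideal_D(2)[OF I_ideal] by blast
  have IJ: "I \<subset> J" using subset_tight_closure[OF ideal_D(1)[OF I_ideal]] ne unfolding J_def by blast
  have TI: "ideal (T n) R" for n unfolding T_def by (rule tight_closure_In_ideal)
  have "1 + ilen J (carrier R) \<le> ilen I (carrier R)"
    using ilen_add[OF I_ideal JI oneideal, OF psubset_imp_subset[OF IJ] ideal_D(1)[OF JI]] one_le_ilen[OF I_ideal IJ]
    by (simp add: add_right_mono)
  then obtain lj where lj: "ilen J (carrier R) = enat lj" "lj + 1 \<le> lam"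
    unfolding ilen_I_eq by (cases "ilen J (carrier R)") (auto simp: one_enat_def)
  have In_T: "ideal_pow R I n \<subseteq> T n" for n unfolding T_def using subset_tight_closure[OF ideal_D(1)[OF In_ideal]] .
  have le: "ilen (T n) (carrier R) \<le> enat (((n + d - 1) choose d) * lam)" for n
    using ilen_mono[OF In_T order_refl, of n "carrier R"] unfolding ilen_In .
  have "\<exists>l. ilen (T n) (carrier R) = enat l" for n using le[of n] by (cases "ilen (T n) (carrier R)") auto
  then obtain l where l: "\<And>n. ilen (T n) (carrier R) = enat (l n)" by metis
  obtain h where h: "\<And>n. T n \<subseteq> ideal_pow R I (n - h)" using tight_closure_pow_bound unfolding T_def by blast
  show False
  proof (rule hilbert_arith[where e = e and d = d and l = l and h = h and c = lam, OF dim_pos e(2)])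
    show "\<forall>\<^sub>F n in sequentially. int (l n) = (\<Sum>i\<le>d. (-1) ^ i * e i * int ((n + d - 1 - i) choose (d - i)))"
      using e(1)[unfolded tight_hilbert_coeffs_def]
    proof eventually_elim
      case (elim n)
      then show ?case using l[of n] module_length_quotient[OF TI, of n] unfolding T_def by auto
    qed
    show "lam * ((n - h + d - 1) choose d) \<le> l n" for n
      using ilen_mono[OF h order_refl, of n "carrier R"] unfolding ilen_In l by (simp add: mult.commute)
    show "l n + ((n + d - 2) choose (d - 1)) \<le> lam * ((n + d - 1) choose d)" if n: "n \<ge> 1" for n
    proof -
      obtain m where m: "n = Suc m" using n by (cases n) auto
      have JIm: "ideal (J \<cdot> ideal_pow R I m) R" using ideal_prod_is_ideal[OF JI In_ideal] .
      have sub: "J \<cdot> ideal_pow R I m \<subseteq> ideal_pow R I m" using ideal_prod_inter[OF JI In_ideal] by blast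
      have "J \<cdot> ideal_pow R I m \<subseteq> T n"
        unfolding m T_def J_def using pow_mult_tight_closure[of y, OF yc] by blast
      then have "enat (l n) \<le> ilen (J \<cdot> ideal_pow R I m) (carrier R)"
        unfolding l[symmetric] by (rule ilen_mono) simp
      also have "\<dots> = ilen (J \<cdot> ideal_pow R I m) (ideal_pow R I m) + ilen (ideal_pow R I m) (carrier R)"
        by (rule ilen_add[OF JIm In_ideal oneideal sub ideal_D(1)[OF In_ideal]])
      also have "\<dots> = enat (card (Mon d m) * lj + ((m + d - 1) choose d) * lam)"
        unfolding ilen_prod_pow[of y, OF yc regy JI psubset_imp_subset[OF IJ]] ilen_In lj(1)
        by (simp add: of_nat_eq_enat)
      finally have 1: "l n \<le> card (Mon d m) * lj + ((m + d - 1) choose d) * lam" by simp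
      have cM: "card (Mon d m) = (n + d - 2) choose (d - 1)"
      proof -
        have "card (Mon d m) = (d + m - 1) choose m" using card_multisets_of_size[of "{..<d}" m] by simp
        also have "\<dots> = (d + m - 1) choose (d - 1)"
          using binomial_symmetric[of m "d + m - 1"] dim_pos by simp
        finally show ?thesis using m by (simp add: add.commute)
      qed
      have "card (Mon d m) * lj + card (Mon d m) \<le> card (Mon d m) * lam"
        using mult_le_mono2[OF lj(2), of "card (Mon d m)"] by (simp add: algebra_simps)
      moreover have "((n + d - 1) choose d) = card (Mon d m) + ((m + d - 1) choose d)"
        unfolding sum_card_Mon[OF dim_pos, symmetric] m by simp
      ultimately show ?thesis using 1 unfolding cM by (simp add: algebra_simps)
    qed
  qed
qed

end

theorem theorem1p3:
  fixes R :: "('a, 'b) ring_scheme" and \<mm> :: "'a set" and d p :: nat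
  assumes "local_ring \<mm> R"
    and "noetherian_ring R"
    and "krull_dim R = enat d"
    and "d \<ge> 1"
    and "prime p"
    and "ring_char R = p"
    and "analytically_unramified R \<mm>"
    and "cohen_macaulay_local R \<mm>"
  shows "F_rational R \<longleftrightarrow>
    (\<exists>I e. parameter_ideal R \<mm> I \<and> tight_hilbert_coeffs R d I e \<and> e 1 = 0)"
proof -
  interpret local_ring \<mm> R by fact
  interpret noetherian_ring R by fact
  interpret noetherian_local \<mm> R ..
  have "enat d \<le> depth R \<mm>" using assms(3,8) by (simp add: cohen_macaulay_local_def)
  \<comment> \<open>\<open>depth\<close> is a supremum; the strict inequality, which uses d \<ge> 1,
    yields an actual regular sequence of length at least \<open>d\<close>, to be cut to length
    \<open>d\<close>.\<close>
  then have "enat (d - 1) < depth R \<mm>" using assms(4) by (cases "depth R \<mm>") auto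
  then obtain ws where ws: "d - 1 < length ws" "regular_sequence R ws" "set ws \<subseteq> \<mm>"
    unfolding depth_def less_Sup_iff by auto
  define x0 where "x0 = take d ws"
  have "reg {} (x0 @ drop d ws)" using reg_if_regular_sequence[OF ws(2)] by (simp add: x0_def)
  then have x0: "reg {} x0" "set x0 \<subseteq> \<mm>" "length x0 = d"
    using ws set_take_subset[of d ws] unfolding reg_append x0_def by auto
  interpret cm_local_char_p \<mm> R d x0
    by unfold_locales (use assms x0 in auto)
  have unram: "unramified_sop \<mm> R d x0 xs" if "sop xs" for xs
    by unfold_locales (use that assms in \<open>auto simp: analytically_unramified_def\<close>)
  have sop_iff: "system_of_parameters R \<mm> xs \<longleftrightarrow> sop xs" for xs
  proof (cases "set xs \<subseteq> \<mm>")
    case True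
    then have "Idl\<^bsub>R\<^esub> (set xs) \<subseteq> \<mm>" using mm_ideal by (intro genideal_minimal)
    then show ?thesis using radical_eq_mm_iff[OF genideal_ideal] True mm_carrier dim
      by (auto simp: system_of_parameters_def sop_def)
  qed (simp add: system_of_parameters_def sop_def)
  show ?thesis
  proof
    assume F: "F_rational R"
    \<comment> \<open>The regular sequence taken from the depth is itself a system of parameters and
      supplies the ideal for this direction.\<close>
    have s: "sop x0" using reg_sop[OF x0] .
    interpret unramified_sop \<mm> R d x0 x0 using unram[OF s] .
    have "tight_closure R I = I" unfolding gid_xs using tc_closed_if_F_rational[OF F s] .
    then have "tight_hilbert_coeffs R d I (\<lambda>i. if i = 0 then int lam else 0)"
      by (rule tight_hilbert_coeffs_if_tc_closed)
    moreover have "parameter_ideal R \<mm> I" unfolding parameter_ideal_def gid_xs using s sop_iff by blast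
    ultimately show "\<exists>I e. parameter_ideal R \<mm> I \<and> tight_hilbert_coeffs R d I e \<and> e 1 = 0" by fastforce
  next
    assume "\<exists>I e. parameter_ideal R \<mm> I \<and> tight_hilbert_coeffs R d I e \<and> e 1 = 0"
    then obtain xs e where xs: "sop xs" "tight_hilbert_coeffs R d (Idl\<^bsub>R\<^esub> (set xs)) e" "e 1 = 0"
      unfolding parameter_ideal_def sop_iff by blast
    interpret unramified_sop \<mm> R d x0 xs using unram[OF xs(1)] .
    have "tight_closure R I = I"
      using tc_closed_if_tight_hilbert_coeff_zero[of e] xs(2,3) unfolding gid_xs by blast
    then show "F_rational R" using F_rational_if_tc_closed_sop[OF xs(1)] unfolding gid_xs by blast
  qed
qed

end
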